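(* Let $\mathbb K$ be a field and let $\boldsymbol f=\{f_0,\dots,f_n\}$ be multihomogeneous polynomials of degrees $\boldsymbol d_0,\dots,\boldsymbol d_n$ in $R=\mathbb K[\boldsymbol x_1,\dots,\boldsymbol x_r]$. Assume that $\boldsymbol f$ defines a finite subscheme of $\mathbb P^{n_1}_{\overline{\mathbb K}}\times\cdots\times\mathbb P^{n_r}_{\overline{\mathbb K}}$ of degree $\kappa$. If $$\boldsymbol\nu\in\boldsymbol\delta-\big(\min_id_{i,1}-1,\dots,\min_id_{i,r}-1\big)+\mathbb N^r,$$ then the corank of the elimination matrix of degree $\boldsymbol\nu$ — namely $\mathbb H_{\boldsymbol\nu}(\boldsymbol f)$ if $\boldsymbol\nu\in\boldsymbol\delta-\mathbb N^r$, and $\mathbb M_{\boldsymbol\nu}(\boldsymbol f)$ otherwise — is equal to $\kappa$.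
   Context: Setting. Let $r\ge 1$ and $n_1,\dots,n_r\ge 1$ be integers and $n=n_1+\cdots+n_r$. For $j=1,\dots,r$ let $\boldsymbol x_j=(x_{j,0},\dots,x_{j,n_j})$. For $i=0,\dots,n$ fix $\boldsymbol d_i=(d_{i,1},\dots,d_{i,r})$ with all $d_{i,j}\ge 1$. Let $A=A_{\mathbb Z}$ be the polynomial ring over $\mathbb Z$ in the indeterminates $U_{i,\alpha_1,\dots,\alpha_r}$, where $0\le i\le n$ and $\alpha_j\in\mathbb N^{n_j+1}$ with $|\alpha_j|=d_{i,j}$. Let $C=A[\boldsymbol x_1,\dots,\boldsymbol x_r]$, $\mathbb Z^r$-graded by giving each $x_{j,l}$ the degree $\boldsymbol e_j$ and elements of $A$ degree $0$. The generic multihomogeneous polynomials are $F_i=\sum U_{i,\alpha_1,\dots,\alpha_r}\boldsymbol x_1^{\alpha_1}\cdots\boldsymbol x_r^{\alpha_r}\in C$, the sum being over all $(\alpha_1,\dots,\alpha_r)$ with $|\alpha_j|=d_{i,j}$. Put $\boldsymbol\delta=(\delta_1,\dots,\delta_r)=\sum_{i=0}^n\boldsymbol d_i-(n_1+1,\dots,n_r+1)$. Multigraded Sylvester forms. Let $\alpha_j=(\alpha^{(j)}_0,\dots,\alpha^{(j)}_{n_j})\in\mathbb N^{n_j+1}$ with $|\alpha_j|<\min_i d_{i,j}$ for $j=1,\dots,r$. Fix an ordering of the polynomials, of the groups of variables and of the variables in each group (here, the one given by the indexing). Choose for each $i$ a decomposition, with multihomogeneous $F^{(l)}_{i,j}\in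 C$, $$F_i=\sum_{j=0}^{n_1-1}x_{1,j}^{\alpha^{(1)}_j+1}F^{(1)}_{i,j}+x_{1,n_1}^{\alpha^{(1)}_{n_1}+1}\Big(\sum_{j=0}^{n_2-1}x_{2,j}^{\alpha^{(2)}_j+1}F^{(2)}_{i,j}+x_{2,n_2}^{\alpha^{(2)}_{n_2}+1}\Big(\cdots+x_{r-1,n_{r-1}}^{\alpha^{(r-1)}_{n_{r-1}}+1}\Big(\sum_{j=0}^{n_r}x_{r,j}^{\alpha^{(r)}_j+1}F^{(r)}_{i,j}\Big)\Big)\Big)$$ (first decompose $F_i$ over the $x_{1,j}^{\alpha_j^{(1)}+1}$, $0\le j\le n_1$, then the coefficient of $x_{1,n_1}^{\alpha^{(1)}_{n_1}+1}$ over the $x_{2,j}^{\alpha^{(2)}_j+1}$, and so on). Let $\mathcal D_{\alpha_1,\dots,\alpha_r}$ be the determinant of the $(n+1)\times(n+1)$ matrix with $i$-th row $\big(F^{(1)}_{i,0},\dots,F^{(1)}_{i,n_1-1},F^{(2)}_{i,0},\dots,F^{(2)}_{i,n_2-1},\dots,F^{(r-1)}_{i,n_{r-1}-1},F^{(r)}_{i,0},\dots,F^{(r)}_{i,n_r}\big)$, $i=0,\dots,n$. With $v_i=\sum_{j=i+1}^rn_j$, put $\mathrm{Sylv}_{\alpha_1,\dots,\alpha_r}=\big(\prod_{i=1}^{r-1}x_{i,n_i}^{(\alpha^{(i)}_{n_i}+1)v_i}\big)\mathcal D_{\alpha_1,\dots,\alpha_r}$, which is multihomogeneous of degree $(\delta_1-|\alpha_1|,\dots,\delta_r-|\alpha_r|)$.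 Matrices. $\mathbb M_{\boldsymbol\nu}$ is the matrix, in monomial bases, of the $A$-linear map $\bigoplus_{i=0}^nC_{\boldsymbol\nu-\boldsymbol d_i}\to C_{\boldsymbol\nu}$, $(G_0,\dots,G_n)\mapsto\sum_iG_iF_i$. For $\boldsymbol\nu=\boldsymbol\delta-(\mu_1,\dots,\mu_r)$ with $0\le\mu_j<\min_id_{i,j}$ for all $j$, $\mathbb H_{\boldsymbol\nu}$ is the matrix, in canonical bases, of the $A$-linear map $$\bigoplus_{i=0}^nC_{\boldsymbol\nu-\boldsymbol d_i}\ \oplus\bigoplus_{\alpha=(\alpha_1,\dots,\alpha_r):\,|\alpha_j|=\delta_j-\nu_j}A\ \to\ C_{\boldsymbol\nu},\qquad(G_0,\dots,G_n,(\ell_\alpha)_\alpha)\mapsto\sum_iG_iF_i+\sum_\alpha\ell_\alpha\,\mathrm{Sylv}_\alpha .$$ Specialization. Let $A\to\mathbb K$ be the ring map sending each coefficient of $F_i$ to the corresponding coefficient of $f_i$; $\mathbb M_{\boldsymbol\nu}(\boldsymbol f)$ and $\mathbb H_{\boldsymbol\nu}(\boldsymbol f)$ are the images of the matrices under this map, viewed as $\mathbb K$-linear maps to $R_{\boldsymbol\nu}$. The corank is the dimension of the cokernel. The degree of a finite subscheme is the sum of the lengths of the local rings at its points ($0$ if it is empty); $\overline{\mathbb K}$ is the algebraic closure of $\mathbb K$. *)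

theory Defs
  imports
    "HOL-Library.Poly_Mapping"
    "HOL-Library.Product_Lexorder"
    "HOL-Library.Extended_Nat"
    "HOL-Computational_Algebra.Fraction_Field"
    "HOL-Algebra.QuotRing"
    "HOL-Algebra.Algebraic_Closure_Type"
    "Jordan_Normal_Form.Determinant"
    "Jordan_Normal_Form.VS_Connect"
begin

section \<open>Multigraded polynomials\<close>

text \<open>
  The indeterminate \<open>x\<^sub>j\<^sub>,\<^sub>l\<close> is the pair \<open>(j, l)\<close> with \<open>1 \<le> j \<le> r\<close> and \<open>0 \<le> l \<le> n j\<close>. A tuple of
  exponent vectors \<open>(\<alpha>\<^sub>1, \<dots>, \<alpha>\<^sub>r)\<close> is one finitely supported function on these pairs. The types contain
  further indeterminates; every set of polynomials or monomials below is cut down to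
  the indeterminates that exist for the given \<open>r\<close> and \<open>n\<close>.
  Multidegrees are functions on \<open>nat\<close> of which only the values on \<open>{1..r}\<close> matter.
\<close>

type_synonym expo = "(nat \<times> nat) \<Rightarrow>\<^sub>0 nat"
type_synonym 'a mpol = "expo \<Rightarrow>\<^sub>0 'a"

definition indets :: "nat \<Rightarrow> (nat \<Rightarrow> nat) \<Rightarrow> (nat \<times> nat) set" where
  "indets r n = (SIGMA j:{1..r}. {..n j})"

definition group_degree :: "(nat \<Rightarrow> nat) \<Rightarrow> expo \<Rightarrow> nat \<Rightarrow> nat" where
  "group_degree n m j = (\<Sum>l\<le>n j. Poly_Mapping.lookup m (j, l))"

definition monomials :: "nat \<Rightarrow> (nat \<Rightarrow> nat) \<Rightarrow> (nat \<Rightarrow> int) \<Rightarrow> expo set" where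
  "monomials r n \<nu> =
     {m. Poly_Mapping.keys m \<subseteq> indets r n \<and> (\<forall>j\<in>{1..r}. int (group_degree n m j) = \<nu> j)}"

definition graded_part :: "nat \<Rightarrow> (nat \<Rightarrow> nat) \<Rightarrow> (nat \<Rightarrow> int) \<Rightarrow> 'a::zero mpol set" where
  "graded_part r n \<nu> = {P. Poly_Mapping.keys P \<subseteq> monomials r n \<nu>}"

definition sum_dims :: "nat \<Rightarrow> (nat \<Rightarrow> nat) \<Rightarrow> nat" where
  "sum_dims r n = (\<Sum>j\<in>{1..r}. n j)"

definition idegree :: "(nat \<Rightarrow> nat \<Rightarrow> nat) \<Rightarrow> nat \<Rightarrow> nat \<Rightarrow> int" where
  "idegree d i = (\<lambda>j. int (d i j))"

definition min_degree :: "nat \<Rightarrow> (nat \<Rightarrow> nat) \<Rightarrow> (nat \<Rightarrow> nat \<Rightarrow> nat) \<Rightarrow> nat \<Rightarrow> int" where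
  "min_degree r n d j = Min ((\<lambda>i. idegree d i j) ` {..sum_dims r n})"

definition crit_degree :: "nat \<Rightarrow> (nat \<Rightarrow> nat) \<Rightarrow> (nat \<Rightarrow> nat \<Rightarrow> nat) \<Rightarrow> nat \<Rightarrow> int" where
  "crit_degree r n d = (\<lambda>j. (\<Sum>i\<le>sum_dims r n. idegree d i j) - (int (n j) + 1))"

definition indet :: "nat \<times> nat \<Rightarrow> 'a::zero_neq_one mpol" where
  "indet v = Poly_Mapping.single (Poly_Mapping.single v 1) 1"

definition evaluate ::
  "('a::zero \<Rightarrow> 'b::comm_ring_1) \<Rightarrow> ('v \<Rightarrow> 'b) \<Rightarrow> (('v \<Rightarrow>\<^sub>0 nat) \<Rightarrow>\<^sub>0 'a) \<Rightarrow> 'b" where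
  "evaluate h \<phi> P = (\<Sum>m\<in>Poly_Mapping.keys P. h (Poly_Mapping.lookup P m) * (\<Prod>v\<in>Poly_Mapping.keys m. \<phi> v ^ Poly_Mapping.lookup m v))"


section \<open>Generic polynomials and Sylvester forms\<close>

text \<open>The indeterminate \<open>U\<^sub>i\<^sub>,\<^sub>\<alpha>\<close> is the pair \<open>(i, \<alpha>)\<close>.\<close>

type_synonym coeff_poly = "((nat \<times> expo) \<Rightarrow>\<^sub>0 nat) \<Rightarrow>\<^sub>0 int"

definition coeff_ring :: "nat \<Rightarrow> (nat \<Rightarrow> nat) \<Rightarrow> (nat \<Rightarrow> nat \<Rightarrow> nat) \<Rightarrow> coeff_poly set" where
  "coeff_ring r n d =
     {a. \<forall>t\<in>Poly_Mapping.keys a. Poly_Mapping.keys t \<subseteq> (SIGMA i:{..sum_dims r n}. monomials r n (idegree d i))}"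

definition generic_ring :: "nat \<Rightarrow> (nat \<Rightarrow> nat) \<Rightarrow> (nat \<Rightarrow> nat \<Rightarrow> nat) \<Rightarrow> coeff_poly mpol set" where
  "generic_ring r n d =
     {P. \<forall>m\<in>Poly_Mapping.keys P. Poly_Mapping.keys m \<subseteq> indets r n \<and> Poly_Mapping.lookup P m \<in> coeff_ring r n d}"

definition generic_poly ::
  "nat \<Rightarrow> (nat \<Rightarrow> nat) \<Rightarrow> (nat \<Rightarrow> nat \<Rightarrow> nat) \<Rightarrow> nat \<Rightarrow> coeff_poly mpol" where
  "generic_poly r n d i =
     (\<Sum>m\<in>monomials r n (idegree d i).
        Poly_Mapping.single m (Poly_Mapping.single (Poly_Mapping.single (i, m) 1) 1))"

text \<open>
  The right-hand side of the decomposition of a single polynomial, from the \<open>l\<close>-th group of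
  indeterminates on; \<open>G l j\<close> is the cofactor \<open>F\<^sup>(\<^sup>l\<^sup>)\<^sub>j\<close>, and the whole right-hand side is obtained for \<open>l = 1\<close>.
\<close>

function nested_sum ::
  "nat \<Rightarrow> (nat \<Rightarrow> nat) \<Rightarrow> expo \<Rightarrow> (nat \<Rightarrow> nat \<Rightarrow> 'a::comm_ring_1 mpol) \<Rightarrow> nat \<Rightarrow> 'a mpol" where
  "nested_sum r n \<alpha> G l =
     (if l < r
      then (\<Sum>j<n l. indet (l, j) ^ (Poly_Mapping.lookup \<alpha> (l, j) + 1) * G l j)
           + indet (l, n l) ^ (Poly_Mapping.lookup \<alpha> (l, n l) + 1) * nested_sum r n \<alpha> G (Suc l)
      else (\<Sum>j\<le>n l. indet (l, j) ^ (Poly_Mapping.lookup \<alpha> (l, j) + 1) * G l j))"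
  by auto
termination by (relation "measure (\<lambda>(r, n, \<alpha>, G, l). r - l)") auto

declare nested_sum.simps [simp del]

text \<open>
  The pairs \<open>(l, j)\<close> that index the cofactors \<open>F\<^sup>(\<^sup>l\<^sup>)\<^sub>j\<close>, in the order of the columns of the Sylvester
  matrix. There are \<open>sum_dims r n + 1\<close> of them, the last group contributing one more than \<open>n r\<close>.
\<close>

definition cofactor_indices :: "nat \<Rightarrow> (nat \<Rightarrow> nat) \<Rightarrow> (nat \<times> nat) list" where
  "cofactor_indices r n =
     concat (map (\<lambda>l. map (Pair l) [0..<(if l < r then n l else Suc (n l))]) [1..<Suc r])"

definition sylvester_decomposition ::
  "nat \<Rightarrow> (nat \<Rightarrow> nat) \<Rightarrow> (nat \<Rightarrow> nat \<Rightarrow> nat) \<Rightarrow> expo \<Rightarrow> nat \<Rightarrow> (nat \<Rightarrow> nat \<Rightarrow> coeff_poly mpol) \<Rightarrow> bool"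
where
  "sylvester_decomposition r n d \<alpha> i G \<longleftrightarrow>
     (\<forall>(l, j)\<in>set (cofactor_indices r n).
        G l j \<in> generic_ring r n d \<and> (\<exists>e. G l j \<in> graded_part r n e)) \<and>
     generic_poly r n d i = nested_sum r n \<alpha> G 1"

text \<open>In the following, \<open>G i l j\<close> is the cofactor \<open>F\<^sup>(\<^sup>l\<^sup>)\<^sub>i\<^sub>,\<^sub>j\<close>.\<close>

definition sylvester_matrix ::
  "nat \<Rightarrow> (nat \<Rightarrow> nat) \<Rightarrow> (nat \<Rightarrow> nat \<Rightarrow> nat \<Rightarrow> 'a mpol) \<Rightarrow> 'a::zero mpol mat" where
  "sylvester_matrix r n G =
     mat (sum_dims r n + 1) (sum_dims r n + 1)
       (\<lambda>(i, c). case cofactor_indices r n ! c of (l, j) \<Rightarrow> G i l j)"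

definition sylvester_form ::
  "nat \<Rightarrow> (nat \<Rightarrow> nat) \<Rightarrow> expo \<Rightarrow> (nat \<Rightarrow> nat \<Rightarrow> nat \<Rightarrow> 'a mpol) \<Rightarrow> 'a::comm_ring_1 mpol" where
  "sylvester_form r n \<alpha> G =
     (\<Prod>i\<in>{1..<r}. indet (i, n i) ^ ((Poly_Mapping.lookup \<alpha> (i, n i) + 1) * (\<Sum>j\<in>{i<..r}. n j)))
     * det (sylvester_matrix r n G)"


section \<open>Elimination matrices\<close>

text \<open>
  The columns of each matrix are the coordinate vectors of the images of the basis elements. The
  monomials of a given degree are listed in the lexicographic order of the exponents.
\<close>

definition monomial_list :: "nat \<Rightarrow> (nat \<Rightarrow> nat) \<Rightarrow> (nat \<Rightarrow> int) \<Rightarrow> expo list" where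
  "monomial_list r n \<nu> = sorted_list_of_set (monomials r n \<nu>)"

definition coordinates ::
  "nat \<Rightarrow> (nat \<Rightarrow> nat) \<Rightarrow> (nat \<Rightarrow> int) \<Rightarrow> 'a::zero mpol \<Rightarrow> 'a vec" where
  "coordinates r n \<nu> P = vec_of_list (map (Poly_Mapping.lookup P) (monomial_list r n \<nu>))"

definition macaulay_columns ::
  "nat \<Rightarrow> (nat \<Rightarrow> nat) \<Rightarrow> (nat \<Rightarrow> nat \<Rightarrow> nat) \<Rightarrow> (nat \<Rightarrow> int) \<Rightarrow> coeff_poly mpol list" where
  "macaulay_columns r n d \<nu> =
     concat (map (\<lambda>i. map (\<lambda>m. Poly_Mapping.single m 1 * generic_poly r n d i)
                       (monomial_list r n (\<lambda>j. \<nu> j - idegree d i j)))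
             [0..<sum_dims r n + 1])"

definition sylvester_columns ::
  "nat \<Rightarrow> (nat \<Rightarrow> nat) \<Rightarrow> (nat \<Rightarrow> nat \<Rightarrow> nat) \<Rightarrow> (expo \<Rightarrow> nat \<Rightarrow> nat \<Rightarrow> nat \<Rightarrow> coeff_poly mpol) \<Rightarrow>
   (nat \<Rightarrow> int) \<Rightarrow> coeff_poly mpol list" where
  "sylvester_columns r n d G \<nu> =
     map (\<lambda>\<alpha>. sylvester_form r n \<alpha> (G \<alpha>)) (monomial_list r n (\<lambda>j. crit_degree r n d j - \<nu> j))"

definition matrix_M ::
  "nat \<Rightarrow> (nat \<Rightarrow> nat) \<Rightarrow> (nat \<Rightarrow> nat \<Rightarrow> nat) \<Rightarrow> (nat \<Rightarrow> int) \<Rightarrow> coeff_poly mat" where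
  "matrix_M r n d \<nu> =
     mat_of_cols (length (monomial_list r n \<nu>))
       (map (coordinates r n \<nu>) (macaulay_columns r n d \<nu>))"

definition matrix_H ::
  "nat \<Rightarrow> (nat \<Rightarrow> nat) \<Rightarrow> (nat \<Rightarrow> nat \<Rightarrow> nat) \<Rightarrow> (expo \<Rightarrow> nat \<Rightarrow> nat \<Rightarrow> nat \<Rightarrow> coeff_poly mpol) \<Rightarrow>
   (nat \<Rightarrow> int) \<Rightarrow> coeff_poly mat" where
  "matrix_H r n d G \<nu> =
     mat_of_cols (length (monomial_list r n \<nu>))
       (map (coordinates r n \<nu>) (macaulay_columns r n d \<nu> @ sylvester_columns r n d G \<nu>))"

definition elimination_matrix ::
  "nat \<Rightarrow> (nat \<Rightarrow> nat) \<Rightarrow> (nat \<Rightarrow> nat \<Rightarrow> nat) \<Rightarrow> (expo \<Rightarrow> nat \<Rightarrow> nat \<Rightarrow> nat \<Rightarrow> coeff_poly mpol) \<Rightarrow>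
   (nat \<Rightarrow> int) \<Rightarrow> coeff_poly mat" where
  "elimination_matrix r n d G \<nu> =
     (if \<forall>j\<in>{1..r}. \<nu> j \<le> crit_degree r n d j then matrix_H r n d G \<nu> else matrix_M r n d \<nu>)"

definition specialize :: "(nat \<Rightarrow> 'k::comm_ring_1 mpol) \<Rightarrow> coeff_poly \<Rightarrow> 'k" where
  "specialize f = evaluate of_int (\<lambda>(i, m). Poly_Mapping.lookup (f i) m)"

text \<open>
  The multiplicative part of the record plays no role for a module; it is left unspecified, as in
  \<^const>\<open>module_vec\<close>.
\<close>

definition quotient_module ::
  "('a, 'v, 'm) module_scheme \<Rightarrow> 'v set \<Rightarrow> ('a, 'v set) module" where
  "quotient_module V W =
     \<lparr>carrier = a_rcosets\<^bsub>V\<^esub> W, monoid.mult = undefined, one = undefined, zero = W, add = set_add V,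
      module.smult = (\<lambda>a S. \<Union>x\<in>S. W +>\<^bsub>V\<^esub> (a \<odot>\<^bsub>V\<^esub> x))\<rparr>"

definition cokernel :: "'k::field mat \<Rightarrow> ('k, 'k vec set) module" where
  "cokernel A =
     quotient_module (module_vec TYPE('k) (dim_row A)) {A *\<^sub>v x | x. x \<in> carrier_vec (dim_col A)}"

definition corank :: "'k::field mat \<Rightarrow> nat" where
  "corank A = vectorspace.dim class_ring (cokernel A)"


section \<open>Subschemes of a product of projective spaces\<close>

text \<open>
  Over an algebraically closed field the closed points of \<open>\<P>\<^sup>n\<^sup>1 \<times> \<dots> \<times> \<P>\<^sup>n\<^sup>r\<close> are the classes of the tuples
  of nonzero coordinate vectors, modulo independent rescaling of the \<open>r\<close> vectors.
  A closed subscheme is finite iff it has finitely many closed points, and then all its points are closed,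
  so that only these points are needed below.
\<close>

definition homogeneous_coords ::
  "nat \<Rightarrow> (nat \<Rightarrow> nat) \<Rightarrow> (nat \<times> nat \<Rightarrow> 'k::field) set" where
  "homogeneous_coords r n =
     {p \<in> extensional (indets r n). \<forall>j\<in>{1..r}. \<exists>l\<le>n j. p (j, l) \<noteq> 0}"

definition rescaling ::
  "nat \<Rightarrow> (nat \<Rightarrow> nat) \<Rightarrow> ((nat \<times> nat \<Rightarrow> 'k::field) \<times> (nat \<times> nat \<Rightarrow> 'k)) set" where
  "rescaling r n =
     {(p, q). p \<in> homogeneous_coords r n \<and> q \<in> homogeneous_coords r n \<and>
        (\<exists>c. \<forall>j\<in>{1..r}. c j \<noteq> 0 \<and> (\<forall>l\<le>n j. q (j, l) = c j * p (j, l)))}"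

definition multiprojective_space ::
  "nat \<Rightarrow> (nat \<Rightarrow> nat) \<Rightarrow> (nat \<times> nat \<Rightarrow> 'k::field) set set" where
  "multiprojective_space r n = homogeneous_coords r n // rescaling r n"

definition zero_points ::
  "nat \<Rightarrow> (nat \<Rightarrow> nat) \<Rightarrow> (nat \<Rightarrow> 'k::field mpol) \<Rightarrow> (nat \<times> nat \<Rightarrow> 'k) set set" where
  "zero_points r n f =
     {p \<in> multiprojective_space r n. \<forall>i\<le>sum_dims r n. \<forall>q\<in>p. evaluate (\<lambda>c. c) q (f i) = 0}"

text \<open>
  The local ring of the multiprojective space at \<open>p\<close>: fractions of multihomogeneous polynomials of the same
  multidegree whose denominator does not vanish at \<open>p\<close>.
\<close>

definition multiprojective_local_ring ::
  "nat \<Rightarrow> (nat \<Rightarrow> nat) \<Rightarrow> (nat \<times> nat \<Rightarrow> 'k::field) set \<Rightarrow> 'k mpol fract ring" where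
  "multiprojective_local_ring r n p =
     \<lparr>carrier = {Fract g h | g h e. g \<in> graded_part r n e \<and> h \<in> graded_part r n e \<and>
                   (\<forall>q\<in>p. evaluate (\<lambda>c. c) q h \<noteq> 0)},
      monoid.mult = (*), one = 1, zero = 0, add = (+)\<rparr>"

definition subscheme_local_ring ::
  "nat \<Rightarrow> (nat \<Rightarrow> nat) \<Rightarrow> (nat \<Rightarrow> nat \<Rightarrow> nat) \<Rightarrow> (nat \<Rightarrow> 'k::field mpol) \<Rightarrow> (nat \<times> nat \<Rightarrow> 'k) set \<Rightarrow>
   'k mpol fract set ring" where
  "subscheme_local_ring r n d f p =
     multiprojective_local_ring r n p Quot
       genideal (multiprojective_local_ring r n p)
         {Fract (f i) h | i h. i \<le> sum_dims r n \<and> h \<in> graded_part r n (idegree d i) \<and>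
            (\<forall>q\<in>p. evaluate (\<lambda>c. c) q h \<noteq> 0)}"

text \<open>The submodules of a commutative ring, as a module over itself, are its ideals.\<close>

definition ring_length :: "('a, 'b) ring_scheme \<Rightarrow> enat" where
  "ring_length R =
     (SUP k\<in>{k. \<exists>J. (\<forall>i\<le>k. ideal (J i) R) \<and> (\<forall>i<k. J i \<subset> J (Suc i))}. enat k)"

definition defines_finite_subscheme_of_degree ::
  "nat \<Rightarrow> (nat \<Rightarrow> nat) \<Rightarrow> (nat \<Rightarrow> nat \<Rightarrow> nat) \<Rightarrow> (nat \<Rightarrow> 'k::field mpol) \<Rightarrow> nat \<Rightarrow> bool" where
  "defines_finite_subscheme_of_degree r n d f \<kappa> \<longleftrightarrow>
     finite (zero_points r n f) \<and>
     (\<Sum>p\<in>zero_points r n f. ring_length (subscheme_local_ring r n d f p)) = enat \<kappa>"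

definition extend_to_closure :: "'k::field mpol \<Rightarrow> 'k alg_closure mpol" where
  "extend_to_closure = Poly_Mapping.map to_ac"

end

theory Submission
  imports Defs
begin

text \<open>
  Let \<open>\<Lambda>\<close> be a form of large degree \<open>e\<close> that vanishes at no zero of \<open>f\<^sub>0, \<dots>, f\<^sub>n\<close>, and let \<open>I\<close> be the ideal of
  the \<open>f\<^sub>i\<close>. The \<open>n + 2\<close> forms \<open>f\<^sub>0, \<dots>, f\<^sub>n, \<Lambda>\<close> have no common zero, so by the Nullstellensatz their Koszul
  complexes over the Laurent coefficient modules of local cohomology are exact. Dividing a cocycle by one
  cofactor variable after the other, along the nested decomposition, leads from the monomial residuals
  \<open>\<alpha>\<close> to the Sylvester forms. Thus multiplication by \<open>\<Lambda>\<close> is an isomorphism from the cokernel in degree \<open>\<nu>\<close>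
  onto \<open>(R / I)\<close> in degree \<open>\<nu> + e\<close>; the Sylvester forms generate exactly the kernel of \<open>\<Lambda>\<close> modulo \<open>I\<close>.

  In large degrees \<open>I\<close> is the intersection of its primary components at the zeros, these are pairwise
  comaximal, and the quotient by the component at \<open>p\<close> is the local ring at \<open>p\<close>, whose length is its dimension
  because the residue field is algebraically closed. Finally the dimension of the cokernel does not
  change under extension of the field.
\<close>

section \<open>Polynomials and gradings\<close>

text \<open>The Laurent modules are indexed by two disjoint sets of variables: those of A are
  inverted and everything regular in one of them is divided out, those of B are only inverted. Exact
  sequences that move one variable at a time take the place of spectral sequences. They work because
  of the lower bound on \<nu>: in positive form degree no group can carry negative exponents only,
  so a module whose set A fills a group contributes nothing. With one group, dividing by the
  variables in turn would suffice. With several, the last variable of a finished group stands in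
  front of all later cofactors without being divided out itself. It has to be inverted, and this
  creates cocycles that are not combinations of residuals; they are carried along as the \<xi> of
  \<open>decomposed\<close> and disappear one group at a time on the way back. On the local side, a
  form may vanish at some zeros and not at others, and the Koszul argument is silent about it;
  comaximality and length therefore rest on linear dependence and on counting dimensions, not on an
  abstract primary decomposition.\<close>

lemma poly_mapping_sum_singles:
  fixes P :: "'a \<Rightarrow>\<^sub>0 'b::comm_monoid_add"
  shows "P = (\<Sum>m\<in>Poly_Mapping.keys P. Poly_Mapping.single m (Poly_Mapping.lookup P m))"
  by (rule poly_mapping_eqI)
     (auto simp: lookup_sum lookup_single when_def in_keys_iff sum.delta)

text \<open>Multiplicativity of evaluation, of the action on Laurent coefficients and of
  coefficientwise homomorphisms is shown by two nested applications, which reduce a product to two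
  monomials. Zero needs no case of its own, being a monomial with coefficient 0.\<close>

lemma poly_mapping_additive_induct [case_names single add]:
  fixes P :: "'a \<Rightarrow>\<^sub>0 'b::comm_monoid_add"
  assumes "\<And>m c. Q (Poly_Mapping.single m c)" and "\<And>P R. Q P \<Longrightarrow> Q R \<Longrightarrow> Q (P + R)"
  shows "Q P"
proof -
  have "Q (\<Sum>m\<in>S. Poly_Mapping.single m (Poly_Mapping.lookup P m))" if "finite S" for S
    using that
  proof induction
    case empty
    show ?case using assms(1)[of undefined 0] by simp
  next
    case (insert m S)
    then show ?case using assms by simp
  qed
  from this[of "Poly_Mapping.keys P"] show ?thesis
    by (simp flip: poly_mapping_sum_singles)
qed

definition evaluate_monomial :: "('v \<Rightarrow> 'b::comm_ring_1) \<Rightarrow> ('v \<Rightarrow>\<^sub>0 nat) \<Rightarrow> 'b" where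
  "evaluate_monomial \<phi> m = (\<Prod>v\<in>Poly_Mapping.keys m. \<phi> v ^ Poly_Mapping.lookup m v)"

lemma evaluate_monomial_superset:
  assumes "finite S" "Poly_Mapping.keys m \<subseteq> S"
  shows "evaluate_monomial \<phi> m = (\<Prod>v\<in>S. \<phi> v ^ Poly_Mapping.lookup m v)"
  unfolding evaluate_monomial_def
  by (rule prod.mono_neutral_left) (use assms in \<open>auto simp: in_keys_iff\<close>)

lemma evaluate_monomial_add:
  "evaluate_monomial \<phi> (m + m') = evaluate_monomial \<phi> m * evaluate_monomial \<phi> m'"
proof -
  let ?S = "Poly_Mapping.keys m \<union> Poly_Mapping.keys m'"
  have "Poly_Mapping.keys (m + m') \<subseteq> ?S" by (rule Poly_Mapping.keys_add)
  then show ?thesis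
    by (simp add: evaluate_monomial_superset[of ?S] lookup_add power_add prod.distrib)
qed

lemma evaluate_monomial_0 [simp]: "evaluate_monomial \<phi> 0 = 1"
  by (simp add: evaluate_monomial_def)

lemma evaluate_monomial_single [simp]: "evaluate_monomial \<phi> (Poly_Mapping.single v k) = \<phi> v ^ k"
  by (cases "k = 0") (simp_all add: evaluate_monomial_def)

text \<open>Terms may cancel in a sum, so the supports of P, Q and P + Q differ; a common finite
  index set makes the three evaluations comparable.\<close>

lemma evaluate_superset:
  assumes "finite S" "Poly_Mapping.keys P \<subseteq> S" "h 0 = 0"
  shows "evaluate h \<phi> P = (\<Sum>m\<in>S. h (Poly_Mapping.lookup P m) * evaluate_monomial \<phi> m)"
  unfolding evaluate_def evaluate_monomial_def
  by (rule sum.mono_neutral_left) (use assms in \<open>auto simp: in_keys_iff\<close>)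

lemma evaluate_single:
  assumes "h 0 = 0"
  shows "evaluate h \<phi> (Poly_Mapping.single m c) = h c * evaluate_monomial \<phi> m"
  using evaluate_superset[of "{m}" "Poly_Mapping.single m c" h \<phi>] assms by simp

lemma evaluate_add:
  assumes "h 0 = 0" "\<And>a b. h (a + b) = h a + h b"
  shows "evaluate h \<phi> (P + Q) = evaluate h \<phi> P + evaluate h \<phi> Q"
proof -
  let ?S = "Poly_Mapping.keys P \<union> Poly_Mapping.keys Q"
  have "Poly_Mapping.keys (P + Q) \<subseteq> ?S" by (rule Poly_Mapping.keys_add)
  then show ?thesis
    using assms by (simp add: evaluate_superset[of ?S] lookup_add distrib_right sum.distrib)
qed

lemma comm_ring_hom_evaluate:
  assumes "comm_ring_hom h"
  shows "comm_ring_hom (evaluate h \<phi>)"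
proof -
  interpret h: comm_ring_hom h by fact
  have add: "evaluate h \<phi> (P + Q) = evaluate h \<phi> P + evaluate h \<phi> Q" for P Q
    by (rule evaluate_add) (simp_all add: h.hom_add)
  have mult: "evaluate h \<phi> (P * Q) = evaluate h \<phi> P * evaluate h \<phi> Q" for P Q
  proof (induction P rule: poly_mapping_additive_induct)
    case (single m c)
    show ?case
    proof (induction Q rule: poly_mapping_additive_induct)
      case (single m' c')
      show ?case
        by (simp add: mult_single evaluate_single h.hom_mult evaluate_monomial_add)
    qed (simp add: distrib_left add)
  qed (simp add: distrib_right add)
  show ?thesis
  proof
    show "evaluate h \<phi> 1 = 1"
      using evaluate_single[of h \<phi> 0 1] by simp
    show "evaluate h \<phi> 0 = 0" by (simp add: evaluate_def)
  qed (use add mult in simp_all)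
qed

lemma comm_ring_hom_id: "comm_ring_hom (\<lambda>c::'a::comm_ring_1. c)"
  by unfold_locales auto

lemma comm_ring_hom_eval: "comm_ring_hom (evaluate (\<lambda>c::'a::comm_ring_1. c) \<phi>)"
  by (rule comm_ring_hom_evaluate[OF comm_ring_hom_id])

lemma evaluate_indet [simp]: "evaluate (\<lambda>c::'a::comm_ring_1. c) \<phi> (indet v) = \<phi> v"
  by (simp add: indet_def evaluate_single)

lemma evaluate_cong:
  assumes "\<And>m v. m \<in> Poly_Mapping.keys P \<Longrightarrow> v \<in> Poly_Mapping.keys m \<Longrightarrow> \<phi> v = \<psi> v"
  shows "evaluate h \<phi> P = evaluate h \<psi> P"
  unfolding evaluate_def using assms by (intro sum.cong refl) (auto intro!: prod.cong arg_cong2[of _ _ _ _ "(*)"])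

lemma graded_part_cong:
  "(\<And>j. j \<in> {1..r} \<Longrightarrow> a j = b j) \<Longrightarrow> graded_part r n a = graded_part r n b"
  unfolding graded_part_def monomials_def by auto

lemma group_degree_add: "group_degree n (m + m') j = group_degree n m j + group_degree n m' j"
  by (simp add: group_degree_def lookup_add sum.distrib)

lemma group_degree_0 [simp]: "group_degree n 0 j = 0"
  by (simp add: group_degree_def)

lemma monomials_add:
  "m \<in> monomials r n a \<Longrightarrow> m' \<in> monomials r n b \<Longrightarrow> m + m' \<in> monomials r n (\<lambda>j. a j + b j)"
  unfolding monomials_def using Poly_Mapping.keys_add[of m m'] by (auto simp: group_degree_add)

lemma finite_indets [simp]: "finite (indets r n)"
  by (simp add: indets_def)

lemma lookup_le_group_degree:
  "l \<le> n j \<Longrightarrow> Poly_Mapping.lookup m (j, l) \<le> group_degree n m j"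
  unfolding group_degree_def by (rule member_le_sum) auto

text \<open>Every exponent is bounded by the degree of its group and is zero off
  \<open>indets\<close>, so the exponent functions lie in a finite set of functions.\<close>

lemma finite_monomials [simp]: "finite (monomials r n a)"
proof -
  let ?N = "Max ((\<lambda>v. nat (a (fst v))) ` indets r n)"
  let ?B = "{f. \<forall>v. (v \<in> indets r n \<longrightarrow> f v \<in> {..?N}) \<and> (v \<notin> indets r n \<longrightarrow> f v = (0::nat))}"
  have "finite ?B" by (rule finite_set_of_finite_funs) auto
  moreover have "Poly_Mapping.lookup m \<in> ?B" if m: "m \<in> monomials r n a" for m
  proof -
    have "Poly_Mapping.lookup m v \<le> ?N" if v: "v \<in> indets r n" for v
    proof -
      obtain j l where jl: "v = (j, l)" "j \<in> {1..r}" "l \<le> n j" using v by (auto simp: indets_def)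
      have "int (group_degree n m j) = a j" using m jl(2) by (auto simp: monomials_def)
      then have "Poly_Mapping.lookup m v \<le> nat (a (fst v))"
        using lookup_le_group_degree[of l n j m] jl by auto
      also have "\<dots> \<le> ?N" using v by (intro Max_ge) auto
      finally show ?thesis .
    qed
    moreover have "Poly_Mapping.lookup m v = 0" if "v \<notin> indets r n" for v
      using that m by (auto simp: monomials_def in_keys_iff)
    ultimately show ?thesis by auto
  qed
  then have "Poly_Mapping.lookup ` monomials r n a \<subseteq> ?B" by (rule image_subsetI)
  ultimately have "finite (Poly_Mapping.lookup ` monomials r n a)" by (rule finite_subset[rotated])
  then show ?thesis by (rule finite_imageD) (simp add: inj_on_def poly_mapping.lookup_inject)
qed

lemma graded_part_0 [simp]: "0 \<in> graded_part r n a"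
  by (simp add: graded_part_def)

lemma graded_part_single: "m \<in> monomials r n a \<Longrightarrow> Poly_Mapping.single m c \<in> graded_part r n a"
  by (simp add: graded_part_def)

lemma graded_part_add:
  "P \<in> graded_part r n a \<Longrightarrow> Q \<in> graded_part r n a \<Longrightarrow> P + Q \<in> graded_part r n a"
  for P Q :: "'a::comm_monoid_add mpol"
  unfolding graded_part_def using Poly_Mapping.keys_add[of P Q] by auto

lemma graded_part_uminus: "P \<in> graded_part r n a \<Longrightarrow> - P \<in> graded_part r n a"
  for P :: "'a::ab_group_add mpol"
  by (simp add: graded_part_def)

lemma graded_part_diff:
  "P \<in> graded_part r n a \<Longrightarrow> Q \<in> graded_part r n a \<Longrightarrow> P - Q \<in> graded_part r n a"
  for P Q :: "'a::ab_group_add mpol"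
  using graded_part_add[OF _ graded_part_uminus, of P r n a Q] by simp

lemma graded_part_sum:
  "(\<And>i. i \<in> S \<Longrightarrow> P i \<in> graded_part r n a) \<Longrightarrow> (\<Sum>i\<in>S. P i) \<in> graded_part r n a"
  for P :: "'i \<Rightarrow> 'a::comm_monoid_add mpol"
  by (induction S rule: infinite_finite_induct) (auto intro: graded_part_add)

lemma graded_part_mult:
  assumes "P \<in> graded_part r n a" "Q \<in> graded_part r n b"
  shows "P * Q \<in> graded_part r n (\<lambda>j. a j + b j)"
proof -
  have "Poly_Mapping.keys (P * Q) \<subseteq> {x + y |x y. x \<in> Poly_Mapping.keys P \<and> y \<in> Poly_Mapping.keys Q}"
    by (rule Poly_Mapping.keys_mult)
  also have "\<dots> \<subseteq> monomials r n (\<lambda>j. a j + b j)"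
    using assms by (auto simp: graded_part_def intro: monomials_add)
  finally show ?thesis by (simp add: graded_part_def)
qed

lemma graded_part_1 [simp]: "1 \<in> graded_part r n (\<lambda>j. 0)"
  by (simp add: graded_part_def monomials_def)

lemma graded_part_power:
  "P \<in> graded_part r n a \<Longrightarrow> P ^ k \<in> graded_part r n (\<lambda>j. int k * a j)"
proof (induction k)
  case (Suc k)
  then have "P * P ^ k \<in> graded_part r n (\<lambda>j. a j + int k * a j)" by (intro graded_part_mult) auto
  then show ?case by (simp add: algebra_simps)
qed simp

lemma graded_part_prod:
  "(\<And>i. i \<in> S \<Longrightarrow> P i \<in> graded_part r n (a i)) \<Longrightarrow> (\<Prod>i\<in>S. P i) \<in> graded_part r n (\<lambda>j. \<Sum>i\<in>S. a i j)"
proof (induction S rule: infinite_finite_induct)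
  case (insert x F)
  then show ?case using graded_part_mult[of "P x" r n "a x" "\<Prod>i\<in>F. P i"] by simp
qed auto

lemma group_degree_single:
  "group_degree n (Poly_Mapping.single (j, l) k) i = (if i = j \<and> l \<le> n j then k else 0)"
proof -
  have "(\<Sum>x\<le>n j. if l = x then k else 0) = (if l \<le> n j then k else 0)" by (simp add: sum.delta)
  then show ?thesis by (auto simp: group_degree_def lookup_single when_def)
qed

lemma monomials_single:
  assumes "(j, l) \<in> indets r n"
  shows "Poly_Mapping.single (j, l) 1 \<in> monomials r n (\<lambda>i. if i = j then 1 else 0)"
  using assms by (auto simp: monomials_def group_degree_single indets_def)

lemma graded_part_indet:
  "(j, l) \<in> indets r n \<Longrightarrow> indet (j, l) \<in> graded_part r n (\<lambda>i. if i = j then 1 else 0)"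
  unfolding indet_def by (intro graded_part_single monomials_single)

text \<open>Natural exponents cannot cancel, so a factor of a monomial in the existing
  indeterminates has no others, and its degree is the difference.\<close>

lemma group_degree_diff:
  assumes "m + m' \<in> monomials r n (\<lambda>j. a j + b j)" "m \<in> monomials r n a"
  shows "m' \<in> monomials r n b"
proof -
  have "Poly_Mapping.keys m' \<subseteq> Poly_Mapping.keys (m + m')"
    by (auto simp: in_keys_iff lookup_add)
  moreover have "int (group_degree n m' j) = b j" if "j \<in> {1..r}" for j
  proof -
    have "int (group_degree n (m + m') j) = a j + b j" "int (group_degree n m j) = a j"
      using that assms unfolding monomials_def by blast+
    then show ?thesis by (simp add: group_degree_add)
  qed
  ultimately show ?thesis using assms(1) unfolding monomials_def by blast
qed

section \<open>Laurent coefficient functions\<close>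

text \<open>
  A function on integer exponents stands for a possibly infinite sum of Laurent monomials. Polynomials
  still act on these, which is all that is needed, and no finiteness has to be carried along.
\<close>

type_synonym 'a laurent = "(nat \<times> nat \<Rightarrow> int) \<Rightarrow> 'a"

definition int_expo :: "expo \<Rightarrow> nat \<times> nat \<Rightarrow> int" where
  "int_expo m v = int (Poly_Mapping.lookup m v)"

definition act :: "'a::comm_ring_1 mpol \<Rightarrow> 'a laurent \<Rightarrow> 'a laurent" where
  "act P \<phi> \<gamma> = (\<Sum>m\<in>Poly_Mapping.keys P. Poly_Mapping.lookup P m * \<phi> (\<lambda>v. \<gamma> v - int_expo m v))"

lemma int_expo_add: "int_expo (m + m') v = int_expo m v + int_expo m' v"
  by (simp add: int_expo_def lookup_add)

lemma int_expo_0 [simp]: "int_expo 0 v = 0"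
  by (simp add: int_expo_def)

lemma act_superset:
  assumes "finite S" "Poly_Mapping.keys P \<subseteq> S"
  shows "act P \<phi> \<gamma> = (\<Sum>m\<in>S. Poly_Mapping.lookup P m * \<phi> (\<lambda>v. \<gamma> v - int_expo m v))"
  unfolding act_def by (rule sum.mono_neutral_left) (use assms in \<open>auto simp: in_keys_iff\<close>)

lemma act_single: "act (Poly_Mapping.single m c) \<phi> \<gamma> = c * \<phi> (\<lambda>v. \<gamma> v - int_expo m v)"
  using act_superset[of "{m}" "Poly_Mapping.single m c"] by simp

lemma act_0_left [simp]: "act 0 \<phi> \<gamma> = 0"
  by (simp add: act_def)

lemma act_add_left: "act (P + Q) \<phi> \<gamma> = act P \<phi> \<gamma> + act Q \<phi> \<gamma>"
proof -
  let ?S = "Poly_Mapping.keys P \<union> Poly_Mapping.keys Q"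
  have "Poly_Mapping.keys (P + Q) \<subseteq> ?S" by (rule Poly_Mapping.keys_add)
  then show ?thesis
    by (simp add: act_superset[of ?S] lookup_add distrib_right sum.distrib)
qed

lemma act_uminus_left: "act (- P) \<phi> \<gamma> = - act P \<phi> \<gamma>"
  using act_add_left[of P "- P" \<phi> \<gamma>] by (simp add: eq_neg_iff_add_eq_0 add.commute)

lemma act_sum_left: "act (\<Sum>i\<in>S. P i) \<phi> \<gamma> = (\<Sum>i\<in>S. act (P i) \<phi> \<gamma>)"
  by (induction S rule: infinite_finite_induct) (simp_all add: act_add_left)

lemma act_add_right: "act P (\<lambda>\<gamma>. \<phi> \<gamma> + \<psi> \<gamma>) \<gamma> = act P \<phi> \<gamma> + act P \<psi> \<gamma>"
  by (simp add: act_def distrib_left sum.distrib)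

lemma act_uminus_right: "act P (\<lambda>\<gamma>. - \<phi> \<gamma>) \<gamma> = - act P \<phi> \<gamma>"
  by (simp add: act_def sum_negf)

lemma act_0_right [simp]: "act P (\<lambda>\<gamma>. 0) \<gamma> = 0"
  by (simp add: act_def)

lemma act_mult: "act (P * Q) \<phi> \<gamma> = act P (act Q \<phi>) \<gamma>"
proof (induction P arbitrary: \<gamma> rule: poly_mapping_additive_induct)
  case (single m c)
  show ?case
  proof (induction Q arbitrary: \<gamma> rule: poly_mapping_additive_induct)
    case (single m' c')
    show ?case
      by (simp add: mult_single act_single int_expo_add mult.assoc diff_diff_eq)
  next
    case (add P R)
    have "act (P + R) \<phi> = (\<lambda>\<gamma>. act P \<phi> \<gamma> + act R \<phi> \<gamma>)" by (rule ext) (rule act_add_left)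
    then show ?case by (simp only: distrib_left act_add_left act_add_right add)
  qed
qed (simp only: distrib_right act_add_left)

lemma act_1 [simp]: "act 1 \<phi> \<gamma> = \<phi> \<gamma>"
  using act_single[of 0 1 \<phi> \<gamma>] by simp

text \<open>Each exponent of a product is an exponent of \<phi> raised by a monomial of P. All
  support conditions on forms, for poles as well as for degrees, are propagated through this
  fact.\<close>

lemma act_nonzero:
  assumes "act P \<phi> \<gamma> \<noteq> 0"
  obtains m where "m \<in> Poly_Mapping.keys P" "\<phi> (\<lambda>v. \<gamma> v - int_expo m v) \<noteq> 0"
proof -
  have "\<exists>m\<in>Poly_Mapping.keys P. Poly_Mapping.lookup P m * \<phi> (\<lambda>v. \<gamma> v - int_expo m v) \<noteq> 0"
    using assms unfolding act_def by (rule contrapos_np) (simp add: sum.neutral)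
  then show ?thesis using that by (metis mult_zero_right)
qed

lemma inj_int_expo: "int_expo m = int_expo m' \<Longrightarrow> m = m'"
  by (rule poly_mapping_eqI) (auto simp: int_expo_def fun_eq_iff)

text \<open>Polynomials enter the Koszul complex and are recovered from it through this embedding;
  it is injective and compatible with the action of polynomials.\<close>

definition to_laurent :: "'a::comm_ring_1 mpol \<Rightarrow> 'a laurent" where
  "to_laurent P \<gamma> = (\<Sum>m\<in>Poly_Mapping.keys P. if \<gamma> = int_expo m then Poly_Mapping.lookup P m else 0)"

lemma to_laurent_int_expo [simp]: "to_laurent P (int_expo m) = Poly_Mapping.lookup P m"
proof -
  have "to_laurent P (int_expo m) =
      (\<Sum>m'\<in>Poly_Mapping.keys P. if m = m' then Poly_Mapping.lookup P m' else 0)"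
    unfolding to_laurent_def by (intro sum.cong) (auto dest: inj_int_expo)
  then show ?thesis by (simp add: in_keys_iff)
qed

lemma to_laurent_outside: "(\<And>m. \<gamma> \<noteq> int_expo m) \<Longrightarrow> to_laurent P \<gamma> = 0"
  by (simp add: to_laurent_def)

lemma to_laurent_inject: "(\<And>\<gamma>. to_laurent P \<gamma> = to_laurent Q \<gamma>) \<Longrightarrow> P = Q"
  by (rule poly_mapping_eqI) (simp flip: to_laurent_int_expo)

lemma to_laurent_add: "to_laurent (P + Q) \<gamma> = to_laurent P \<gamma> + to_laurent Q \<gamma>"
  by (cases "\<exists>m. \<gamma> = int_expo m") (auto simp: lookup_add to_laurent_outside)

lemma to_laurent_0 [simp]: "to_laurent 0 \<gamma> = 0"
  by (simp add: to_laurent_def)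

lemma to_laurent_uminus: "to_laurent (- P) \<gamma> = - to_laurent P \<gamma>"
  using to_laurent_add[of P "- P" \<gamma>] by (simp add: eq_neg_iff_add_eq_0 add.commute)

lemma to_laurent_sum: "to_laurent (\<Sum>i\<in>S. P i) \<gamma> = (\<Sum>i\<in>S. to_laurent (P i) \<gamma>)"
  by (induction S rule: infinite_finite_induct) (simp_all add: to_laurent_add)

lemma to_laurent_single:
  "to_laurent (Poly_Mapping.single m c) \<gamma> = (if \<gamma> = int_expo m then c else 0)"
  by (simp add: to_laurent_def)

lemma act_to_laurent: "act P (to_laurent Q) \<gamma> = to_laurent (P * Q) \<gamma>"
proof (induction P arbitrary: \<gamma> rule: poly_mapping_additive_induct)
  case (single m c)
  show ?case
  proof (induction Q arbitrary: \<gamma> rule: poly_mapping_additive_induct)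
    case (single m' c')
    have "(\<lambda>v. \<gamma> v - int_expo m v) = int_expo m' \<longleftrightarrow> \<gamma> = int_expo (m + m')"
      unfolding fun_eq_iff int_expo_add by (simp add: algebra_simps)
    then show ?case by (simp add: mult_single act_single to_laurent_single)
  next
    case (add P R)
    have "to_laurent (P + R) = (\<lambda>\<gamma>. to_laurent P \<gamma> + to_laurent R \<gamma>)"
      by (rule ext) (rule to_laurent_add)
    then show ?case by (simp only: distrib_left to_laurent_add act_add_right add)
  qed
qed (simp only: distrib_right act_add_left to_laurent_add)

section \<open>Exterior forms\<close>

text \<open>
  A form assigns to \<open>I = {i\<^sub>1 < \<dots> < i\<^sub>k}\<close> its coefficient at \<open>e\<^sub>i\<^sub>1 \<and> \<dots> \<and> e\<^sub>i\<^sub>k\<close>; \<open>cre i\<close> is exterior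
  multiplication by \<open>e\<^sub>i\<close> and \<open>ann i\<close> is contraction with the dual basis vector.
\<close>

typedef 'a form = "UNIV :: (nat set \<Rightarrow> 'a laurent) set"
  morphisms coef Form by auto

lemma coef_Form [simp]: "coef (Form w) = w"
  by (simp add: Form_inverse)

lemma form_eqI: "(\<And>I \<gamma>. coef \<omega> I \<gamma> = coef \<omega>' I \<gamma>) \<Longrightarrow> \<omega> = \<omega>'"
  by (metis coef_inject ext)

instantiation form :: (ab_group_add) ab_group_add
begin

definition "0 = Form (\<lambda>I \<gamma>. 0)"
definition "\<omega> + \<omega>' = Form (\<lambda>I \<gamma>. coef \<omega> I \<gamma> + coef \<omega>' I \<gamma>)"
definition "- \<omega> = Form (\<lambda>I \<gamma>. - coef \<omega> I \<gamma>)"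
definition "\<omega> - \<omega>' = Form (\<lambda>I \<gamma>. coef \<omega> I \<gamma> - coef \<omega>' I \<gamma>)"

instance
  by standard
    (auto simp: zero_form_def plus_form_def uminus_form_def minus_form_def intro!: form_eqI)

end

lemma coef_simps [simp]:
  "coef 0 I \<gamma> = 0"
  "coef (\<omega> + \<omega>') I \<gamma> = coef \<omega> I \<gamma> + coef \<omega>' I \<gamma>"
  "coef (- \<omega>) I \<gamma> = - coef \<omega> I \<gamma>"
  "coef (\<omega> - \<omega>') I \<gamma> = coef \<omega> I \<gamma> - coef \<omega>' I \<gamma>"
  by (simp_all add: zero_form_def plus_form_def uminus_form_def minus_form_def)

lemma coef_sum: "coef (\<Sum>i\<in>S. \<omega> i) I \<gamma> = (\<Sum>i\<in>S. coef (\<omega> i) I \<gamma>)"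
  by (induction S rule: infinite_finite_induct) simp_all

definition scale_form :: "'a::comm_ring_1 mpol \<Rightarrow> 'a form \<Rightarrow> 'a form" where
  "scale_form P \<omega> = Form (\<lambda>I. act P (coef \<omega> I))"

lemma coef_scale [simp]: "coef (scale_form P \<omega>) I \<gamma> = act P (coef \<omega> I) \<gamma>"
  by (simp add: scale_form_def)

lemma coef_scale_fun: "coef (scale_form P \<omega>) I = act P (coef \<omega> I)"
  by (simp add: scale_form_def)

lemma coef_fun:
  "coef 0 I = (\<lambda>\<gamma>. 0)"
  "coef (\<omega> + \<omega>') I = (\<lambda>\<gamma>. coef \<omega> I \<gamma> + coef \<omega>' I \<gamma>)"
  "coef (- \<omega>) I = (\<lambda>\<gamma>. - coef \<omega> I \<gamma>)"
  by (rule ext, simp)+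

interpretation scale_form: Modules.module scale_form
  by unfold_locales
    (rule form_eqI, simp add: act_add_left act_add_right act_mult coef_fun coef_scale_fun)+

text \<open>The sign is that of moving the new basis vector past all smaller ones. Only indices
  below i are counted, so the sign makes sense for infinite I too and the operators are
  total.\<close>

definition cre :: "nat \<Rightarrow> 'a::comm_ring_1 form \<Rightarrow> 'a form" where
  "cre i \<omega> = Form (\<lambda>I \<gamma>. if i \<in> I then if odd (card {j\<in>I. j < i}) then - coef \<omega> (I - {i}) \<gamma>
     else coef \<omega> (I - {i}) \<gamma> else 0)"

definition ann :: "nat \<Rightarrow> 'a::comm_ring_1 form \<Rightarrow> 'a form" where
  "ann i \<omega> = Form (\<lambda>I \<gamma>. if i \<in> I then 0 else if odd (card {j\<in>I. j < i}) then - coef \<omega> (insert i I) \<gamma>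
     else coef \<omega> (insert i I) \<gamma>)"

lemma coef_cre: "coef (cre i \<omega>) I \<gamma> = (if i \<in> I then if odd (card {j\<in>I. j < i})
    then - coef \<omega> (I - {i}) \<gamma> else coef \<omega> (I - {i}) \<gamma> else 0)"
  by (simp add: cre_def)

lemma coef_ann: "coef (ann i \<omega>) I \<gamma> = (if i \<in> I then 0 else if odd (card {j\<in>I. j < i})
    then - coef \<omega> (insert i I) \<gamma> else coef \<omega> (insert i I) \<gamma>)"
  by (simp add: ann_def)

lemma cre_0 [simp]: "cre i 0 = 0" and ann_0 [simp]: "ann i 0 = 0"
  by (rule form_eqI, simp add: coef_cre coef_ann)+

lemma cre_add: "cre i (\<omega> + \<omega>') = cre i \<omega> + cre i \<omega>'"
  and ann_add: "ann i (\<omega> + \<omega>') = ann i \<omega> + ann i \<omega>'"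
  by (rule form_eqI, simp add: coef_cre coef_ann)+

lemma cre_sum: "cre i (\<Sum>x\<in>S. \<omega> x) = (\<Sum>x\<in>S. cre i (\<omega> x))"
  by (induction S rule: infinite_finite_induct) (simp_all add: cre_add)

lemma ann_sum: "ann i (\<Sum>x\<in>S. \<omega> x) = (\<Sum>x\<in>S. ann i (\<omega> x))"
  by (induction S rule: infinite_finite_induct) (simp_all add: ann_add)

lemma cre_scale: "cre i (scale_form P \<omega>) = scale_form P (cre i \<omega>)"
  and ann_scale: "ann i (scale_form P \<omega>) = scale_form P (ann i \<omega>)"
proof -
  have neg: "act P (\<lambda>\<gamma>. - \<phi> \<gamma>) = (\<lambda>\<gamma>. - act P \<phi> \<gamma>)" for \<phi>
    by (rule ext) (rule act_uminus_right)
  have zero: "act P (\<lambda>\<gamma>. 0) = (\<lambda>\<gamma>. 0)" by (rule ext) simp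
  have "coef (cre i \<omega>) I = (if i \<in> I then if odd (card {j\<in>I. j < i})
    then (\<lambda>\<gamma>. - coef \<omega> (I - {i}) \<gamma>) else coef \<omega> (I - {i}) else (\<lambda>\<gamma>. 0))" for I
    by (rule ext) (simp add: coef_cre)
  then show "cre i (scale_form P \<omega>) = scale_form P (cre i \<omega>)"
    by (intro form_eqI) (simp add: coef_cre neg zero)
  have "coef (ann i \<omega>) I = (if i \<in> I then (\<lambda>\<gamma>. 0) else if odd (card {j\<in>I. j < i})
    then (\<lambda>\<gamma>. - coef \<omega> (insert i I) \<gamma>) else coef \<omega> (insert i I))" for I
    by (rule ext) (simp add: coef_ann)
  then show "ann i (scale_form P \<omega>) = scale_form P (ann i \<omega>)"
    by (intro form_eqI) (simp add: coef_ann neg zero)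
qed

lemma card_below_remove:
  fixes i j :: nat
  assumes "j \<in> I"
  shows "card {x\<in>I. x < i} = card {x\<in>I - {j}. x < i} + (if j < i then 1 else 0)"
proof (cases "j < i")
  case True
  then have "{x\<in>I. x < i} = insert j {x\<in>I - {j}. x < i}" using assms by auto
  moreover have "finite {x\<in>I - {j}. x < i}" by (rule finite_subset[of _ "{..<i}"]) auto
  ultimately show ?thesis using True by simp
next
  case False
  then have "{x\<in>I. x < i} = {x\<in>I - {j}. x < i}" by auto
  then show ?thesis using False by simp
qed

lemma card_below_insert:
  fixes i j :: nat
  assumes "j \<notin> I"
  shows "card {x\<in>insert j I. x < i} = card {x\<in>I. x < i} + (if j < i then 1 else 0)"
  using card_below_remove[of j "insert j I" i] assms by simp

lemma cre_cre_self [simp]: "cre i (cre i \<omega>) = 0"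
  by (rule form_eqI) (simp add: coef_cre)

lemma cre_anticommute: "cre i (cre j \<omega>) = - cre j (cre i \<omega>)"
proof (cases "i = j")
  case False
  have 1: "I - {i} - {j} = I - {j} - {i}" for I :: "nat set" by auto
  show ?thesis
  proof (rule form_eqI)
    fix I \<gamma>
    show "coef (cre i (cre j \<omega>)) I \<gamma> = coef (- cre j (cre i \<omega>)) I \<gamma>"
      using False card_below_remove[of i I j] card_below_remove[of j I i]
      by (cases "i \<in> I"; cases "j \<in> I"; cases "i < j") (auto simp: coef_cre 1 not_less)
  qed
qed simp

lemma cre_ann_anticommute:
  assumes "i \<noteq> j"
  shows "cre i (ann j \<omega>) = - ann j (cre i \<omega>)"
proof (rule form_eqI)
  fix I \<gamma>
  have 1: "insert j (I - {i}) = insert j I - {i}" using assms by auto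
  show "coef (cre i (ann j \<omega>)) I \<gamma> = coef (- ann j (cre i \<omega>)) I \<gamma>"
    using assms card_below_remove[of i I j] card_below_insert[of j I i]
    by (cases "i \<in> I"; cases "j \<in> I"; cases "i < j") (auto simp: coef_cre coef_ann 1 not_less)
qed

lemma cre_ann_self: "cre i (ann i \<omega>) + ann i (cre i \<omega>) = \<omega>"
proof (rule form_eqI)
  fix I \<gamma>
  have "{j \<in> I - {i}. j < i} = {j \<in> I. j < i}" and "{j \<in> insert i I. j < i} = {j \<in> I. j < i}"
    by auto
  then show "coef (cre i (ann i \<omega>) + ann i (cre i \<omega>)) I \<gamma> = coef \<omega> I \<gamma>"
    by (auto simp: coef_cre coef_ann insert_absorb)
qed

text \<open>For the forms f this is the Koszul differential; for a column of cofactors it adds one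
  more column to a determinant.\<close>

definition wedge :: "nat \<Rightarrow> (nat \<Rightarrow> 'a::comm_ring_1 mpol) \<Rightarrow> 'a form \<Rightarrow> 'a form" where
  "wedge m F \<omega> = (\<Sum>i<m. scale_form (F i) (cre i \<omega>))"

definition contract :: "nat \<Rightarrow> (nat \<Rightarrow> 'a::comm_ring_1 mpol) \<Rightarrow> 'a form \<Rightarrow> 'a form" where
  "contract m F \<omega> = (\<Sum>i<m. scale_form (F i) (ann i \<omega>))"

lemma wedge_0 [simp]: "wedge m F 0 = 0"
  by (simp add: wedge_def)

lemma wedge_add: "wedge m F (\<omega> + \<omega>') = wedge m F \<omega> + wedge m F \<omega>'"
  by (simp add: wedge_def cre_add scale_form.scale_right_distrib sum.distrib)

lemma wedge_diff: "wedge m F (\<omega> - \<omega>') = wedge m F \<omega> - wedge m F \<omega>'"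
  using wedge_add[of m F "\<omega> - \<omega>'" \<omega>'] by (simp add: algebra_simps)

lemma wedge_sum: "wedge m F (\<Sum>x\<in>S. \<omega> x) = (\<Sum>x\<in>S. wedge m F (\<omega> x))"
  by (induction S rule: infinite_finite_induct) (simp_all add: wedge_add)

lemma wedge_scale: "wedge m F (scale_form P \<omega>) = scale_form P (wedge m F \<omega>)"
  by (simp add: wedge_def cre_scale scale_form.scale_sum_right mult.commute)

text \<open>Linearity in the one-form. It splits the differential along the nested decomposition of
  the f_i into multiplications by the columns of cofactors.\<close>

lemma wedge_lincomb:
  assumes "\<And>i. i < m \<Longrightarrow> F i = (\<Sum>c\<in>S. P c * G c i)"
  shows "wedge m F \<omega> = (\<Sum>c\<in>S. scale_form (P c) (wedge m (G c) \<omega>))"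
proof -
  have "wedge m F \<omega> = (\<Sum>i<m. \<Sum>c\<in>S. scale_form (P c * G c i) (cre i \<omega>))"
    unfolding wedge_def using assms by (intro sum.cong refl) (simp add: scale_form.scale_sum_left)
  also have "\<dots> = (\<Sum>c\<in>S. \<Sum>i<m. scale_form (P c * G c i) (cre i \<omega>))" by (rule sum.swap)
  finally show ?thesis by (simp add: wedge_def scale_form.scale_sum_right)
qed

lemma wedge_wedge_expand:
  "wedge m F (wedge m G \<omega>) = (\<Sum>i<m. \<Sum>j<m. scale_form (F i * G j) (cre i (cre j \<omega>)))"
  by (simp add: wedge_def cre_sum cre_scale scale_form.scale_sum_right)

lemma wedge_anticommute: "wedge m F (wedge m G \<omega>) = - wedge m G (wedge m F \<omega>)"
proof -
  have "wedge m F (wedge m G \<omega>) = (\<Sum>i<m. \<Sum>j<m. - scale_form (G j * F i) (cre j (cre i \<omega>)))"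
    unfolding wedge_wedge_expand
  proof (intro sum.cong refl)
    show "scale_form (F i * G j) (cre i (cre j \<omega>)) = - scale_form (G j * F i) (cre j (cre i \<omega>))" for i j
      unfolding cre_anticommute[of i j] mult.commute[of "F i"] by simp
  qed
  then show ?thesis
    unfolding wedge_wedge_expand[of m G] by (subst (asm) sum.swap) (simp add: sum_negf)
qed

lemma sum_antisymmetric:
  fixes t :: "'i \<Rightarrow> 'i \<Rightarrow> 'b::ab_group_add"
  assumes "finite S" "\<And>i. t i i = 0" "\<And>i j. t i j = - t j i"
  shows "(\<Sum>i\<in>S. \<Sum>j\<in>S. t i j) = 0"
  using assms(1)
proof induction
  case (insert x S)
  have "(\<Sum>i\<in>S. t i x) = - (\<Sum>j\<in>S. t x j)"
    unfolding sum_negf[symmetric] by (rule sum.cong[OF refl assms(3)])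
  then show ?case using insert by (simp add: assms(2) sum.distrib)
qed simp

lemma wedge_wedge_self [simp]: "wedge m F (wedge m F \<omega>) = 0"
  unfolding wedge_wedge_expand
proof (rule sum_antisymmetric)
  show "scale_form (F i * F j) (cre i (cre j \<omega>)) = - scale_form (F j * F i) (cre j (cre i \<omega>))" for i j
    unfolding cre_anticommute[of i j] mult.commute[of "F i"] by simp
qed simp_all

text \<open>The homotopy formula of the Koszul complex: contraction with G is a homotopy for
  multiplication by the scalar on the right. Where this scalar becomes invertible, the complex is
  exact.\<close>

lemma wedge_contract:
  "wedge m F (contract m G \<omega>) + contract m G (wedge m F \<omega>) = scale_form (\<Sum>i<m. F i * G i) \<omega>"
proof -
  have "contract m G (wedge m F \<omega>) = (\<Sum>j<m. \<Sum>i<m. scale_form (F i * G j) (ann j (cre i \<omega>)))"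
    by (simp add: wedge_def contract_def ann_sum ann_scale scale_form.scale_sum_right mult.commute)
  also have "\<dots> = (\<Sum>i<m. \<Sum>j<m. scale_form (F i * G j) (ann j (cre i \<omega>)))" by (rule sum.swap)
  finally have "wedge m F (contract m G \<omega>) + contract m G (wedge m F \<omega>) =
      (\<Sum>i<m. \<Sum>j<m. scale_form (F i * G j) (cre i (ann j \<omega>) + ann j (cre i \<omega>)))"
    by (simp add: wedge_def contract_def cre_sum cre_scale scale_form.scale_sum_right
        sum.distrib scale_form.scale_right_distrib)
  also have "\<dots> = (\<Sum>i<m. \<Sum>j<m. if j = i then scale_form (F i * G i) \<omega> else 0)"
    by (intro sum.cong refl) (auto simp: cre_ann_self cre_ann_anticommute)
  finally show ?thesis by (simp add: scale_form.scale_sum_left)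
qed

lemma coef_wedge:
  assumes "I \<subseteq> {..<m}"
  shows "coef (wedge m F \<omega>) I \<gamma> = (\<Sum>i\<in>I. (if odd (card {j\<in>I. j < i})
    then - act (F i) (coef \<omega> (I - {i})) \<gamma> else act (F i) (coef \<omega> (I - {i})) \<gamma>))"
proof -
  have "coef (wedge m F \<omega>) I \<gamma> = (\<Sum>i<m. coef (cre i (scale_form (F i) \<omega>)) I \<gamma>)"
    unfolding wedge_def coef_sum cre_scale ..
  also have "\<dots> = (\<Sum>i\<in>I. coef (cre i (scale_form (F i) \<omega>)) I \<gamma>)"
    using assms by (intro sum.mono_neutral_right) (auto simp: coef_cre)
  finally show ?thesis by (simp add: coef_cre cong: if_cong)
qed

fun wedges :: "nat \<Rightarrow> (nat \<Rightarrow> 'a::comm_ring_1 mpol) list \<Rightarrow> 'a laurent \<Rightarrow> 'a form" where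
  "wedges m [] \<psi> = Form (\<lambda>I \<gamma>. if I = {} then \<psi> \<gamma> else 0)"
| "wedges m (F # Fs) \<psi> = wedge m F (wedges m Fs \<psi>)"

lemma scale_wedges: "scale_form P (wedges m Fs \<psi>) = wedges m Fs (act P \<psi>)"
proof (induction Fs)
  case Nil
  show ?case by (rule form_eqI) (simp add: scale_form_def)
qed (simp flip: wedge_scale)

lemma wedge_wedges_member: "F \<in> set Fs \<Longrightarrow> wedge m F (wedges m Fs \<psi>) = 0"
proof (induction Fs)
  case (Cons F' Fs)
  then show ?case by (cases "F = F'") (simp_all add: wedge_anticommute[of m F F'])
qed simp

text \<open>Identifies \<open>mat_delete\<close> in the Laplace expansion with the minor whose row
  set lacks one element.\<close>

lemma sorted_list_of_set_remove_nth:
  fixes I :: "nat set"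
  assumes "finite I" "s < card I" "t < card I - 1"
  shows "sorted_list_of_set (I - {sorted_list_of_set I ! s}) ! t =
    sorted_list_of_set I ! (if t < s then t else Suc t)"
proof -
  let ?xs = "sorted_list_of_set I"
  have len: "length ?xs = card I" by simp
  have s: "s < length ?xs" using assms by simp
  let ?ys = "take s ?xs @ drop (Suc s) ?xs"
  have xs: "?xs = take s ?xs @ ?xs ! s # drop (Suc s) ?xs" using s by (rule id_take_nth_drop)
  have d: "distinct ?xs" "sorted ?xs" by simp_all
  have "distinct (take s ?xs @ ?xs ! s # drop (Suc s) ?xs)" using d(1) xs by simp
  then have sys: "set ?ys = set ?xs - {?xs ! s}" and dy: "distinct ?ys"
    using arg_cong[OF xs, of set] by auto
  have "sorted (take s ?xs @ ?xs ! s # drop (Suc s) ?xs)" using d(2) xs by simp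
  then have "sorted ?ys" by (auto simp: sorted_append)
  then have "?ys = sorted_list_of_set (set ?ys)" using dy
    by (intro sorted_list_of_set.idem_if_sorted_distinct[symmetric])
  then have "sorted_list_of_set (I - {?xs ! s}) = ?ys" using sys assms(1) by simp
  then show ?thesis using s assms by (auto simp: nth_append min_def)
qed

lemma card_below_nth:
  fixes I :: "nat set"
  assumes "finite I" "s < card I"
  shows "card {j\<in>I. j < sorted_list_of_set I ! s} = s"
proof -
  let ?xs = "sorted_list_of_set I"
  have st: "sorted_wrt (<) ?xs" by (rule strict_sorted_list_of_set)
  have mono: "?xs ! t < ?xs ! s \<longleftrightarrow> t < s" if "t < card I" for t
    using sorted_wrt_nth_less[OF st, of t s] sorted_wrt_nth_less[OF st, of s t] that assms
    by (cases t s rule: linorder_cases) auto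
  have I: "I = (!) ?xs ` {..<card I}"
    using nth_image[of "card I" ?xs] assms by (simp add: atLeast0LessThan)
  have "{j\<in>I. j < ?xs ! s} = (!) ?xs ` {..<s}"
  proof (intro equalityI subsetI)
    fix j assume j: "j \<in> {j\<in>I. j < ?xs ! s}"
    then have "j \<in> (!) ?xs ` {..<card I}" using I by blast
    then obtain t where "t < card I" "j = ?xs ! t" by auto
    with j mono show "j \<in> (!) ?xs ` {..<s}" by auto
  next
    fix j assume "j \<in> (!) ?xs ` {..<s}"
    then obtain t where t: "t < s" "j = ?xs ! t" by auto
    then have "j \<in> (!) ?xs ` {..<card I}" using assms by auto
    then have "j \<in> I" using I by blast
    with t mono[of t] assms show "j \<in> {j\<in>I. j < ?xs ! s}" by auto
  qed
  moreover have "inj_on ((!) ?xs) {..<s}"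
    by (rule inj_on_nth) (use assms in auto)
  ultimately show ?thesis by (simp add: card_image)
qed

text \<open>Coefficients of a product of one-forms are the minors of the matrix of its columns. The
  induction is Laplace expansion along the first column: the s-th element of I has exactly s
  elements below it, so the sign of \<open>wedge\<close> is the cofactor sign.\<close>

lemma wedges_eq_det:
  assumes "I \<subseteq> {..<m}" "card I = length Fs"
  shows "coef (wedges m Fs \<psi>) I \<gamma> =
    act (det (mat (card I) (card I) (\<lambda>(s, t). (Fs ! t) (sorted_list_of_set I ! s)))) \<psi> \<gamma>"
  using assms
proof (induction Fs arbitrary: I \<gamma>)
  case Nil
  then have "I = {}" using finite_subset[OF Nil(1)] by simp
  then show ?case by simp
next
  case (Cons F Fs)
  have fin: "finite I" using finite_subset[OF Cons.prems(1)] by simp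
  let ?k = "length Fs" let ?xs = "sorted_list_of_set I"
  let ?A = "mat (Suc ?k) (Suc ?k) (\<lambda>(s, t). ((F # Fs) ! t) (?xs ! s))"
  have cI: "card I = Suc ?k" using Cons.prems by simp
  have sub: "act (F (?xs ! s)) (coef (wedges m Fs \<psi>) (I - {?xs ! s})) \<gamma> =
      act (?A $$ (s, 0) * det (mat_delete ?A s 0)) \<psi> \<gamma>" if s: "s < Suc ?k" for s
  proof -
    have mem: "?xs ! s \<in> I" using s cI fin by (metis length_sorted_list_of_set nth_mem set_sorted_list_of_set)
    have c: "card (I - {?xs ! s}) = ?k" using mem cI fin by simp
    have "mat_delete ?A s 0 = mat ?k ?k (\<lambda>(s', t). (Fs ! t) (sorted_list_of_set (I - {?xs ! s}) ! s'))"
      using s by (intro eq_matI) (auto simp: mat_delete_def sorted_list_of_set_remove_nth[OF fin] cI)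
    moreover have "I - {?xs ! s} \<subseteq> {..<m}" using Cons.prems(1) by auto
    ultimately have "coef (wedges m Fs \<psi>) (I - {?xs ! s}) = act (det (mat_delete ?A s 0)) \<psi>"
      using Cons.IH[of "I - {?xs ! s}"] c by (intro ext) simp
    then show ?thesis using s by (simp add: act_mult)
  qed
  have bij: "bij_betw ((!) ?xs) {..<Suc ?k} I"
    by (rule bij_betw_nth) (use fin cI in auto)
  have "coef (wedges m (F # Fs) \<psi>) I \<gamma> = (\<Sum>i\<in>I. (if odd (card {j\<in>I. j < i})
      then - act (F i) (coef (wedges m Fs \<psi>) (I - {i})) \<gamma>
      else act (F i) (coef (wedges m Fs \<psi>) (I - {i})) \<gamma>))"
    by (simp add: coef_wedge[OF Cons.prems(1)])
  also have "\<dots> = (\<Sum>s<Suc ?k. (if odd s then - act (?A $$ (s, 0) * det (mat_delete ?A s 0)) \<psi> \<gamma>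
      else act (?A $$ (s, 0) * det (mat_delete ?A s 0)) \<psi> \<gamma>))"
    unfolding sum.reindex_bij_betw[OF bij, symmetric]
    by (intro sum.cong refl) (simp add: card_below_nth[OF fin] cI sub del: index_mat)
  also have "\<dots> = act (\<Sum>s<Suc ?k. ?A $$ (s, 0) * cofactor ?A s 0) \<psi> \<gamma>"
    unfolding act_sum_left
    by (intro sum.cong refl) (auto simp: cofactor_def act_uminus_left simp del: index_mat)
  also have "(\<Sum>s<Suc ?k. ?A $$ (s, 0) * cofactor ?A s 0) = det ?A"
    by (rule laplace_expansion_column[symmetric]) auto
  finally show ?case by (simp add: cI)
qed

section \<open>Vanishing of Koszul cohomology\<close>

definition all_expo :: "((nat \<times> nat \<Rightarrow> int) \<Rightarrow> bool) \<Rightarrow> 'a::comm_ring_1 form \<Rightarrow> bool" where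
  "all_expo p \<omega> \<longleftrightarrow> (\<forall>I \<gamma>. coef \<omega> I \<gamma> \<noteq> 0 \<longrightarrow> p \<gamma>)"

text \<open>Multiplication by a polynomial only raises exponents, so such a condition on the support
  cuts out a subcomplex.\<close>

definition up_closed :: "((nat \<times> nat \<Rightarrow> int) \<Rightarrow> bool) \<Rightarrow> bool" where
  "up_closed p \<longleftrightarrow> (\<forall>\<gamma> \<gamma>'. p \<gamma> \<longrightarrow> (\<forall>v. \<gamma> v \<le> \<gamma>' v) \<longrightarrow> p \<gamma>')"

text \<open>\<open>all_expo (nonneg_on A) \<omega>\<close> says that \<omega> is zero in the
  quotient in which only exponents negative on all of A survive, as in the top local cohomology
  along A. For empty A it says \<omega> = 0.\<close>

definition nonneg_on :: "(nat \<times> nat) set \<Rightarrow> (nat \<times> nat \<Rightarrow> int) \<Rightarrow> bool" where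
  "nonneg_on A \<gamma> \<longleftrightarrow> (\<exists>v\<in>A. 0 \<le> \<gamma> v)"

text \<open>This projection does not commute with multiplication by polynomials, so the parts of a
  cocycle are in general no cocycles; wherever a form is split, the differential of the discarded
  part is controlled separately.\<close>

definition restrict_expo :: "((nat \<times> nat \<Rightarrow> int) \<Rightarrow> bool) \<Rightarrow> 'a::comm_ring_1 form \<Rightarrow> 'a form" where
  "restrict_expo p \<omega> = Form (\<lambda>I \<gamma>. if p \<gamma> then coef \<omega> I \<gamma> else 0)"

lemma coef_restrict: "coef (restrict_expo p \<omega>) I \<gamma> = (if p \<gamma> then coef \<omega> I \<gamma> else 0)"
  by (simp add: restrict_expo_def)

lemma up_closed_nonneg_on [simp]: "up_closed (nonneg_on A)"
  unfolding up_closed_def nonneg_on_def by (meson order.trans)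

lemma up_closed_nonneg_at [simp]: "up_closed (\<lambda>\<gamma>. 0 \<le> \<gamma> v)"
  unfolding up_closed_def by (meson order.trans)

lemma scale_form_nonzero:
  assumes "coef (scale_form P \<omega>) I \<gamma> \<noteq> 0"
  obtains t where "t \<in> Poly_Mapping.keys P" "coef \<omega> I (\<lambda>v. \<gamma> v - int_expo t v) \<noteq> 0"
  using assms by (auto elim: act_nonzero)

lemma wedge_nonzero:
  assumes "coef (wedge m F \<omega>) I \<gamma> \<noteq> 0"
  obtains i t where "i < m" "i \<in> I" "t \<in> Poly_Mapping.keys (F i)"
    "coef \<omega> (I - {i}) (\<lambda>v. \<gamma> v - int_expo t v) \<noteq> 0"
proof -
  have "(\<Sum>i<m. coef (cre i (scale_form (F i) \<omega>)) I \<gamma>) \<noteq> 0"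
    using assms by (simp add: wedge_def coef_sum cre_scale)
  then obtain i where i: "i < m" "coef (cre i (scale_form (F i) \<omega>)) I \<gamma> \<noteq> 0"
    by (meson lessThan_iff sum.not_neutral_contains_not_neutral)
  then have "i \<in> I" "act (F i) (coef \<omega> (I - {i})) \<gamma> \<noteq> 0"
    by (auto simp: coef_cre split: if_splits)
  then show ?thesis using i(1) that by (auto elim: act_nonzero)
qed

lemma contract_nonzero:
  assumes "coef (contract m F \<omega>) I \<gamma> \<noteq> 0"
  obtains i t where "i < m" "i \<notin> I" "t \<in> Poly_Mapping.keys (F i)"
    "coef \<omega> (insert i I) (\<lambda>v. \<gamma> v - int_expo t v) \<noteq> 0"
proof -
  have "(\<Sum>i<m. coef (ann i (scale_form (F i) \<omega>)) I \<gamma>) \<noteq> 0"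
    using assms by (simp add: contract_def coef_sum ann_scale)
  then obtain i where i: "i < m" "coef (ann i (scale_form (F i) \<omega>)) I \<gamma> \<noteq> 0"
    by (meson lessThan_iff sum.not_neutral_contains_not_neutral)
  then have "i \<notin> I" "act (F i) (coef \<omega> (insert i I)) \<gamma> \<noteq> 0"
    by (auto simp: coef_ann split: if_splits)
  then show ?thesis using i(1) that by (auto elim: act_nonzero)
qed

lemma all_expo_0 [simp]: "all_expo p 0"
  by (simp add: all_expo_def)

lemma all_expo_add:
  assumes "all_expo p \<omega>" "all_expo p \<omega>'"
  shows "all_expo p (\<omega> + \<omega>')"
  unfolding all_expo_def
proof (intro allI impI)
  fix I \<gamma> assume "coef (\<omega> + \<omega>') I \<gamma> \<noteq> 0"
  then have "coef \<omega> I \<gamma> \<noteq> 0 \<or> coef \<omega>' I \<gamma> \<noteq> 0" by auto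
  then show "p \<gamma>" using assms unfolding all_expo_def by blast
qed

lemma all_expo_uminus: "all_expo p \<omega> \<Longrightarrow> all_expo p (- \<omega>)"
  by (simp add: all_expo_def)

lemma all_expo_diff: "all_expo p \<omega> \<Longrightarrow> all_expo p \<omega>' \<Longrightarrow> all_expo p (\<omega> - \<omega>')"
  using all_expo_add[OF _ all_expo_uminus, of p \<omega> \<omega>'] by simp

lemma all_expo_sum: "(\<And>i. i \<in> S \<Longrightarrow> all_expo p (\<omega> i)) \<Longrightarrow> all_expo p (\<Sum>i\<in>S. \<omega> i)"
  by (induction S rule: infinite_finite_induct) (auto intro: all_expo_add)

lemma up_closed_diffD: "up_closed p \<Longrightarrow> p (\<lambda>v. \<gamma> v - int_expo t v) \<Longrightarrow> p \<gamma>"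
  unfolding up_closed_def by (rule allE, assumption) (auto simp: int_expo_def)

lemma all_expo_wedge: "up_closed p \<Longrightarrow> all_expo p \<omega> \<Longrightarrow> all_expo p (wedge m F \<omega>)"
  unfolding all_expo_def by (blast elim: wedge_nonzero dest: up_closed_diffD)

lemma all_expo_contract: "up_closed p \<Longrightarrow> all_expo p \<omega> \<Longrightarrow> all_expo p (contract m F \<omega>)"
  unfolding all_expo_def by (blast elim: contract_nonzero dest: up_closed_diffD)

lemma all_expo_scale: "up_closed p \<Longrightarrow> all_expo p \<omega> \<Longrightarrow> all_expo p (scale_form P \<omega>)"
  unfolding all_expo_def by (blast elim: scale_form_nonzero dest: up_closed_diffD)

lemma all_expo_mono: "all_expo p \<omega> \<Longrightarrow> (\<And>\<gamma>. p \<gamma> \<Longrightarrow> q \<gamma>) \<Longrightarrow> all_expo q \<omega>"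
  unfolding all_expo_def by blast

lemma nonneg_on_mono: "nonneg_on A \<gamma> \<Longrightarrow> A \<subseteq> A' \<Longrightarrow> nonneg_on A' \<gamma>"
  unfolding nonneg_on_def by blast

section \<open>Multihomogeneous forms with poles along given variables\<close>

locale multigraded =
  fixes r :: nat and n :: "nat \<Rightarrow> nat" and m :: nat and D :: "nat \<Rightarrow> nat \<Rightarrow> int"
begin

definition group :: "nat \<Rightarrow> (nat \<times> nat) set" where
  "group j = Pair j ` {..n j}"

lemma finite_group [simp]: "finite (group j)"
  and card_group: "card (group j) = n j + 1"
  by (simp_all add: group_def card_image inj_on_def)

lemma mem_group: "v \<in> group j \<longleftrightarrow> fst v = j \<and> snd v \<le> n j"
  by (cases v) (auto simp: group_def)

text \<open>C is the set of inverted variables, that is A together with B in the modules of the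
  Koszul complex.\<close>

definition expos :: "(nat \<times> nat) set \<Rightarrow> (nat \<Rightarrow> int) \<Rightarrow> (nat \<times> nat \<Rightarrow> int) set" where
  "expos C b = {\<gamma>. (\<forall>v. v \<notin> indets r n \<longrightarrow> \<gamma> v = 0) \<and> (\<forall>v. v \<notin> C \<longrightarrow> 0 \<le> \<gamma> v) \<and>
     (\<forall>j\<in>{1..r}. (\<Sum>l\<le>n j. \<gamma> (j, l)) = b j)}"

text \<open>Shifting by the degrees of the forms indexed by I makes the Koszul differential
  homogeneous of degree zero, so b is constant along the complex. The bound on I makes all forms of
  degree above m vanish.\<close>

definition homog :: "(nat \<Rightarrow> int) \<Rightarrow> nat \<Rightarrow> (nat \<times> nat) set \<Rightarrow> 'a::comm_ring_1 form \<Rightarrow> bool" where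
  "homog b k C \<omega> \<longleftrightarrow> (\<forall>I \<gamma>. coef \<omega> I \<gamma> \<noteq> 0 \<longrightarrow>
     I \<subseteq> {..<m} \<and> card I = k \<and> \<gamma> \<in> expos C (\<lambda>j. b j + (\<Sum>i\<in>I. D i j)))"

lemma homog_0 [simp]: "homog b k C 0"
  by (simp add: homog_def)

lemma homog_add:
  assumes "homog b k C \<omega>" "homog b k C \<omega>'"
  shows "homog b k C (\<omega> + \<omega>')"
  unfolding homog_def
proof (intro allI impI)
  fix I \<gamma> assume "coef (\<omega> + \<omega>') I \<gamma> \<noteq> 0"
  then have "coef \<omega> I \<gamma> \<noteq> 0 \<or> coef \<omega>' I \<gamma> \<noteq> 0" by auto
  then show "I \<subseteq> {..<m} \<and> card I = k \<and> \<gamma> \<in> expos C (\<lambda>j. b j + (\<Sum>i\<in>I. D i j))"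
    using assms unfolding homog_def by blast
qed

lemma homog_uminus: "homog b k C \<omega> \<Longrightarrow> homog b k C (- \<omega>)"
  by (simp add: homog_def)

lemma homog_diff: "homog b k C \<omega> \<Longrightarrow> homog b k C \<omega>' \<Longrightarrow> homog b k C (\<omega> - \<omega>')"
  using homog_add[OF _ homog_uminus, of b k C \<omega> \<omega>'] by simp

lemma homog_sum: "(\<And>i. i \<in> S \<Longrightarrow> homog b k C (\<omega> i)) \<Longrightarrow> homog b k C (\<Sum>i\<in>S. \<omega> i)"
  by (induction S rule: infinite_finite_induct) (auto intro: homog_add)

lemma expos_mono: "C \<subseteq> C' \<Longrightarrow> expos C b \<subseteq> expos C' b"
  unfolding expos_def by blast

lemma homog_mono: "homog b k C \<omega> \<Longrightarrow> C \<subseteq> C' \<Longrightarrow> homog b k C' \<omega>"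
  unfolding homog_def using expos_mono by blast

lemma homog_restrict: "homog b k C \<omega> \<Longrightarrow> homog b k C (restrict_expo p \<omega>)"
  by (simp add: homog_def coef_restrict)

lemma homog_restrict_nonneg:
  assumes "homog b k C' \<omega>" "\<And>\<gamma> v. p \<gamma> \<Longrightarrow> v \<in> C' - C \<Longrightarrow> 0 \<le> \<gamma> v"
  shows "homog b k C (restrict_expo p \<omega>)"
  unfolding homog_def
proof (intro allI impI)
  fix I \<gamma> assume "coef (restrict_expo p \<omega>) I \<gamma> \<noteq> 0"
  then have p: "p \<gamma>" and "coef \<omega> I \<gamma> \<noteq> 0" by (auto simp: coef_restrict split: if_splits)
  then have h: "I \<subseteq> {..<m} \<and> card I = k \<and> \<gamma> \<in> expos C' (\<lambda>j. b j + (\<Sum>i\<in>I. D i j))"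
    using assms(1) unfolding homog_def by blast
  have "0 \<le> \<gamma> v" if "v \<notin> C" for v
    using h assms(2)[OF p, of v] that unfolding expos_def by blast
  with h show "I \<subseteq> {..<m} \<and> card I = k \<and> \<gamma> \<in> expos C (\<lambda>j. b j + (\<Sum>i\<in>I. D i j))"
    by (simp add: expos_def)
qed

lemma expos_shift:
  assumes "(\<lambda>v. \<gamma> v - int_expo t v) \<in> expos C b" "t \<in> monomials r n e"
  shows "\<gamma> \<in> expos C (\<lambda>j. b j + e j)"
proof -
  have out: "int_expo t v = 0" if "v \<notin> indets r n" for v
    using that assms(2) by (auto simp: int_expo_def monomials_def in_keys_iff)
  have deg: "(\<Sum>l\<le>n j. int_expo t (j, l)) = e j" if "j \<in> {1..r}" for j
    using that assms(2) unfolding monomials_def group_degree_def int_expo_def by auto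
  have nn: "0 \<le> int_expo t v" for v by (simp add: int_expo_def)
  show ?thesis
    unfolding expos_def
  proof (intro CollectI conjI allI impI ballI)
    fix v assume v: "v \<notin> indets r n"
    then have "\<gamma> v - int_expo t v = 0" using assms(1) unfolding expos_def by blast
    then show "\<gamma> v = 0" using out[OF v] by simp
  next
    fix v assume "v \<notin> C"
    then have "0 \<le> \<gamma> v - int_expo t v" using assms(1) unfolding expos_def by blast
    with nn[of v] show "0 \<le> \<gamma> v" by simp
  next
    fix j assume j: "j \<in> {1..r}"
    have "(\<Sum>l\<le>n j. \<gamma> (j, l) - int_expo t (j, l)) = b j"
      using assms(1) j unfolding expos_def by blast
    then show "(\<Sum>l\<le>n j. \<gamma> (j, l)) = b j + e j" using deg[OF j] by (simp add: sum_subtractf)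
  qed
qed

lemma expos_cong: "\<gamma> \<in> expos C b \<Longrightarrow> (\<And>j. j \<in> {1..r} \<Longrightarrow> b j = b' j) \<Longrightarrow> \<gamma> \<in> expos C b'"
  by (auto simp: expos_def)

text \<open>The defect e is zero for the f_i. For a column of cofactors it is the degree of the
  monomial in front of that column.\<close>

lemma homog_wedge:
  assumes "\<And>i. i < m \<Longrightarrow> F i \<in> graded_part r n (\<lambda>j. D i j - e j)" "homog b k C \<omega>"
  shows "homog (\<lambda>j. b j - e j) (Suc k) C (wedge m F \<omega>)"
  unfolding homog_def
proof (intro allI impI)
  fix I \<gamma> assume "coef (wedge m F \<omega>) I \<gamma> \<noteq> 0"
  then obtain i t where *: "i < m" "i \<in> I" "t \<in> Poly_Mapping.keys (F i)"
    "coef \<omega> (I - {i}) (\<lambda>v. \<gamma> v - int_expo t v) \<noteq> 0" by (rule wedge_nonzero)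
  from *(4) assms(2) have h: "I - {i} \<subseteq> {..<m}" "card (I - {i}) = k"
    "(\<lambda>v. \<gamma> v - int_expo t v) \<in> expos C (\<lambda>j. b j + (\<Sum>i\<in>I - {i}. D i j))"
    unfolding homog_def by blast+
  have sub: "I \<subseteq> {..<m}" using h(1) *(1) by auto
  then have fin: "finite I" using finite_subset by blast
  then have s: "(\<Sum>i\<in>I. D i j) = D i j + (\<Sum>i\<in>I - {i}. D i j)" for j
    using *(2) by (rule sum.remove)
  have "t \<in> monomials r n (\<lambda>j. D i j - e j)" using assms(1)[OF *(1)] *(3) by (auto simp: graded_part_def)
  then have "\<gamma> \<in> expos C (\<lambda>j. b j + (\<Sum>i\<in>I - {i}. D i j) + (D i j - e j))"
    using expos_shift[OF h(3)] by simp
  then have "\<gamma> \<in> expos C (\<lambda>j. b j - e j + (\<Sum>i\<in>I. D i j))"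
    by (rule expos_cong) (simp add: s)
  moreover have "card I = Suc k" using h(2) fin *(2) by (metis card_Suc_Diff1)
  ultimately show "I \<subseteq> {..<m} \<and> card I = Suc k \<and> \<gamma> \<in> expos C (\<lambda>j. b j - e j + (\<Sum>i\<in>I. D i j))"
    using sub by simp
qed

end

text \<open>\<open>no_zeros\<close> is the conclusion of the multiprojective Nullstellensatz in the
  form needed for a contracting homotopy: a power of the product of any choice of one variable per
  group is in the ideal, with multihomogeneous cofactors. \<open>range\<close> is what the lower
  bound on \<nu> provides.\<close>

locale koszul = multigraded r n m D for r n m D +
  fixes a :: "nat \<Rightarrow> int" and f :: "nat \<Rightarrow> 'a::comm_ring_1 mpol"
  assumes f_graded: "\<And>i. i < m \<Longrightarrow> f i \<in> graded_part r n (D i)"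
    and D_nonneg: "\<And>i j. i < m \<Longrightarrow> j \<in> {1..r} \<Longrightarrow> 0 \<le> D i j"
    and range: "\<And>i j. i < m \<Longrightarrow> j \<in> {1..r} \<Longrightarrow> - int (n j) \<le> a j + D i j"
    and no_zeros: "\<And>l. (\<And>j. j \<in> {1..r} \<Longrightarrow> l j \<le> n j) \<Longrightarrow>
      \<exists>k g. (\<forall>i<m. g i \<in> graded_part r n (\<lambda>j. int k - D i j)) \<and>
        Poly_Mapping.single (\<Sum>j\<in>{1..r}. Poly_Mapping.single (j, l j) k) 1 = (\<Sum>i<m. f i * g i)"
begin

lemma homog_wedge_f: "homog b k C \<omega> \<Longrightarrow> homog b (Suc k) C (wedge m f \<omega>)"
  using homog_wedge[of f "\<lambda>j. 0" b k C \<omega>] f_graded by simp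

text \<open>
  In positive form degree the multidegrees are so large that no group of variables can occur with
  negative exponents only.
\<close>

lemma group_not_negative:
  assumes "homog a k C \<omega>" "1 \<le> k" "coef \<omega> I \<gamma> \<noteq> 0" "j \<in> {1..r}"
  shows "\<exists>l\<le>n j. 0 \<le> \<gamma> (j, l)"
proof (rule ccontr)
  assume neg: "\<not> (\<exists>l\<le>n j. 0 \<le> \<gamma> (j, l))"
  have I: "I \<subseteq> {..<m}" "card I = k" "\<gamma> \<in> expos C (\<lambda>j. a j + (\<Sum>i\<in>I. D i j))"
    using assms unfolding homog_def by blast+
  then have fin: "finite I" using finite_subset by blast
  obtain i where i: "i \<in> I" using I(2) assms(2) by fastforce
  \<comment> \<open>The n j + 1 negative exponents would sum to at most - n j - 1, whereas an index
    i in I raises the degree to at least - n j.\<close>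
  have "(\<Sum>l\<le>n j. \<gamma> (j, l)) \<le> (\<Sum>l\<le>n j. - 1)" by (rule sum_mono) (use neg in auto)
  moreover have "(\<Sum>l\<le>n j. \<gamma> (j, l)) = a j + (\<Sum>i\<in>I. D i j)"
    using I(3) assms(4) unfolding expos_def by blast
  moreover have "D i j \<le> (\<Sum>i\<in>I. D i j)"
    using i fin I(1) D_nonneg[OF _ assms(4)] by (intro member_le_sum) auto
  moreover have "- int (n j) \<le> a j + D i j" using range i I(1) assms(4) by auto
  ultimately show False by simp
qed

text \<open>If every group has a variable in B, the monomial t of \<open>no_zeros\<close> is a unit,
  and contraction with its cofactors g followed by division by t is a contracting homotopy.\<close>

lemma acyclic:
  assumes l: "\<And>j. j \<in> {1..r} \<Longrightarrow> l j \<le> n j \<and> (j, l j) \<in> B"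
    and AB: "A \<inter> B = {}" and k: "1 \<le> k"
    and \<omega>: "homog a k (A \<union> B) \<omega>" "all_expo (nonneg_on A) (wedge m f \<omega>)"
  shows "\<exists>\<eta>. homog a (k - 1) (A \<union> B) \<eta> \<and> all_expo (nonneg_on A) (\<omega> - wedge m f \<eta>)"
proof -
  obtain q g where g: "\<And>i. i < m \<Longrightarrow> g i \<in> graded_part r n (\<lambda>j. int q - D i j)"
    and e: "Poly_Mapping.single (\<Sum>j\<in>{1..r}. Poly_Mapping.single (j, l j) q) 1 = (\<Sum>i<m. f i * g i)"
    using no_zeros[of l] l by blast
  define t where "t = (\<Sum>j\<in>{1..r}. Poly_Mapping.single (j, l j) q)"
  have t_lookup: "int_expo t v = 0" if "v \<notin> B" for v
    using l that by (auto simp: t_def int_expo_def lookup_sum lookup_single when_def intro!: sum.neutral)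
  have t_nn: "0 \<le> int_expo t v" for v by (simp add: int_expo_def)
  have t_out: "int_expo t v = 0" if "v \<notin> indets r n" for v
    using l that by (auto simp: t_def int_expo_def lookup_sum lookup_single when_def indets_def intro!: sum.neutral)
  have t_deg: "(\<Sum>l'\<le>n j. int_expo t (j, l')) = int q" if j: "j \<in> {1..r}" for j
  proof -
    have "(\<Sum>l'\<le>n j. int_expo t (j, l')) = int (group_degree n t j)"
      by (simp add: group_degree_def int_expo_def)
    also have "group_degree n t j = (\<Sum>i\<in>{1..r}. group_degree n (Poly_Mapping.single (i, l i) q) j)"
      unfolding t_def group_degree_def lookup_sum by (rule sum.swap)
    also have "\<dots> = (\<Sum>i\<in>{1..r}. if i = j then q else 0)"
      by (intro sum.cong refl) (use l in \<open>auto simp: group_degree_single\<close>)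
    finally show ?thesis using j by simp
  qed
  \<comment> \<open>Division by t. It creates poles only at variables of B, and since these are not
    in A, it preserves being zero modulo A.\<close>
  define sh :: "'a form \<Rightarrow> 'a form" where "sh \<omega> = Form (\<lambda>I \<gamma>. coef \<omega> I (\<lambda>v. \<gamma> v + int_expo t v))" for \<omega>
  have coef_sh: "coef (sh \<omega>) I \<gamma> = coef \<omega> I (\<lambda>v. \<gamma> v + int_expo t v)" for \<omega> I \<gamma>
    by (simp add: sh_def)
  have sh_add: "sh (\<omega> + \<omega>') = sh \<omega> + sh \<omega>'" and sh_diff: "sh (\<omega> - \<omega>') = sh \<omega> - sh \<omega>'" for \<omega> \<omega>'
    by (rule form_eqI, simp add: coef_sh)+
  have sh_0: "sh 0 = 0" by (rule form_eqI) (simp add: coef_sh)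
  have sh_sum: "sh (\<Sum>i\<in>S. \<omega> i) = (\<Sum>i\<in>S. sh (\<omega> i))" for S :: "nat set" and \<omega>
    by (induction S rule: infinite_finite_induct) (simp_all add: sh_add sh_0)
  have sh_cre: "sh (cre i \<omega>) = cre i (sh \<omega>)" for i \<omega>
    by (rule form_eqI) (simp add: coef_sh coef_cre)
  have sh_scale: "sh (scale_form P \<omega>) = scale_form P (sh \<omega>)" for P \<omega>
    by (rule form_eqI) (simp add: coef_sh act_def algebra_simps)
  have sh_wedge: "sh (wedge m F \<omega>) = wedge m F (sh \<omega>)" for F \<omega>
    by (simp add: wedge_def sh_sum sh_scale sh_cre)
  have sh_t: "sh (scale_form (Poly_Mapping.single t 1) \<omega>) = \<omega>" for \<omega>
    by (rule form_eqI) (simp add: coef_sh act_single)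
  let ?\<eta> = "sh (contract m g \<omega>)"
  have "wedge m f ?\<eta> = sh (scale_form (\<Sum>i<m. f i * g i) \<omega> - contract m g (wedge m f \<omega>))"
    unfolding sh_wedge[symmetric] wedge_contract[symmetric] by simp
  also have "\<dots> = \<omega> - sh (contract m g (wedge m f \<omega>))"
    unfolding sh_diff e[symmetric] t_def[symmetric] sh_t ..
  finally have diff: "\<omega> - wedge m f ?\<eta> = sh (contract m g (wedge m f \<omega>))" by simp
  have "all_expo (nonneg_on A) (contract m g (wedge m f \<omega>))"
    by (rule all_expo_contract[OF _ \<omega>(2)]) simp
  then have "all_expo (nonneg_on A) (\<omega> - wedge m f ?\<eta>)"
    unfolding diff all_expo_def coef_sh nonneg_on_def using AB t_lookup by fastforce
  moreover have "homog a (k - 1) (A \<union> B) ?\<eta>"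
    unfolding homog_def coef_sh
  proof (intro allI impI)
    fix I \<gamma> assume "coef (contract m g \<omega>) I (\<lambda>v. \<gamma> v + int_expo t v) \<noteq> 0"
    then obtain i s where *: "i < m" "i \<notin> I" "s \<in> Poly_Mapping.keys (g i)"
      "coef \<omega> (insert i I) (\<lambda>v. \<gamma> v + int_expo t v - int_expo s v) \<noteq> 0" by (rule contract_nonzero)
    from *(4) \<omega>(1) have h: "insert i I \<subseteq> {..<m}" "card (insert i I) = k"
      "(\<lambda>v. \<gamma> v + int_expo t v - int_expo s v) \<in> expos (A \<union> B) (\<lambda>j. a j + (\<Sum>i\<in>insert i I. D i j))"
      unfolding homog_def by blast+
    then have fin: "finite I" using finite_subset[of "insert i I"] by auto
    have "s \<in> monomials r n (\<lambda>j. int q - D i j)" using g[OF *(1)] *(3) by (auto simp: graded_part_def)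
    then have "(\<lambda>v. \<gamma> v + int_expo t v) \<in>
        expos (A \<union> B) (\<lambda>j. a j + (\<Sum>i\<in>insert i I. D i j) + (int q - D i j))"
      using expos_shift[of "\<lambda>v. \<gamma> v + int_expo t v"] h(3) by simp
    then have e: "(\<lambda>v. \<gamma> v + int_expo t v) \<in> expos (A \<union> B) (\<lambda>j. a j + (\<Sum>i\<in>I. D i j) + int q)"
      by (rule expos_cong) (use fin *(2) in simp)
    have "\<gamma> \<in> expos (A \<union> B) (\<lambda>j. a j + (\<Sum>i\<in>I. D i j))"
      unfolding expos_def
    proof (intro CollectI conjI allI impI ballI)
      fix v assume "v \<notin> indets r n"
      moreover from this have "\<gamma> v + int_expo t v = 0" using e unfolding expos_def by blast
      ultimately show "\<gamma> v = 0" using t_out by simp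
    next
      fix v assume v: "v \<notin> A \<union> B"
      then have "0 \<le> \<gamma> v + int_expo t v" using e unfolding expos_def by blast
      then show "0 \<le> \<gamma> v" using t_lookup v by simp
    next
      fix j assume j: "j \<in> {1..r}"
      then have "(\<Sum>l\<le>n j. \<gamma> (j, l) + int_expo t (j, l)) = a j + (\<Sum>i\<in>I. D i j) + int q"
        using e unfolding expos_def by blast
      then show "(\<Sum>l\<le>n j. \<gamma> (j, l)) = a j + (\<Sum>i\<in>I. D i j)"
        using t_deg[OF j] by (simp add: sum.distrib)
    qed
    then show "I \<subseteq> {..<m} \<and> card I = k - 1 \<and> \<gamma> \<in> expos (A \<union> B) (\<lambda>j. a j + (\<Sum>i\<in>I. D i j))"
      using h *(2) fin by auto
  qed
  ultimately show ?thesis by blast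
qed

text \<open>Counts the variables that can still be moved into A, in the groups that B misses, before
  each of these groups lacks just one. Every connecting homomorphism in \<open>vanishing\<close>
  uses up one of them and one form degree.\<close>

definition gap :: "(nat \<times> nat) set \<Rightarrow> (nat \<times> nat) set \<Rightarrow> nat" where
  "gap A B = (\<Sum>j\<in>{1..r}. if B \<inter> group j = {} then n j - card (A \<inter> group j) else 0)"

text \<open>Connecting homomorphism of 0 -> M(A, B) -> M(A, B + v) -> M(A + v, B) -> 0, where M(A,
  B) has poles along A and B and is taken modulo regularity in A. A primitive \<eta> with poles at v
  of a form regular at v is a cocycle modulo regularity at v.\<close>

lemma connecting_cocycle:
  assumes "homog a k C \<omega>" "v \<notin> C" "all_expo (nonneg_on A) (\<omega> - wedge m f \<eta>)"
  shows "all_expo (nonneg_on (insert v A)) (wedge m f \<eta>)"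
  unfolding all_expo_def
proof (intro allI impI)
  fix I \<gamma> assume nz: "coef (wedge m f \<eta>) I \<gamma> \<noteq> 0"
  show "nonneg_on (insert v A) \<gamma>"
  proof (cases "coef \<omega> I \<gamma> = 0")
    case True
    then have "coef (\<omega> - wedge m f \<eta>) I \<gamma> \<noteq> 0" using nz by simp
    then show ?thesis using assms(3) unfolding all_expo_def nonneg_on_def by blast
  next
    case False
    then have "0 \<le> \<gamma> v" using assms(1,2) unfolding homog_def expos_def by blast
    then show ?thesis by (auto simp: nonneg_on_def)
  qed
qed

lemma restrict_compl:
  "\<omega> = restrict_expo p \<omega> + restrict_expo (\<lambda>\<gamma>. \<not> p \<gamma>) \<omega>"
  by (rule form_eqI) (simp add: coef_restrict)

text \<open>Long exact sequence for a variable v outside A in a group that B misses. Over M(A, B +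
  v) the cohomology vanishes by induction. Over M(A + v, B) it vanishes one degree lower, because
  \<open>gap\<close> has dropped, or because A and v fill the group. The induction terminates since
  v leaves the complement of A and B in both cases.\<close>

lemma vanishing:
  assumes "A \<inter> B = {}" "A \<union> B \<subseteq> indets r n"
    and "\<And>j. j \<in> {1..r} \<Longrightarrow> card (A \<inter> group j) \<le> n j"
    and "1 \<le> k" "2 + gap A B \<le> k \<or> (\<forall>j\<in>{1..r}. B \<inter> group j \<noteq> {})"
    and "homog a k (A \<union> B) \<omega>" "all_expo (nonneg_on A) (wedge m f \<omega>)"
  shows "\<exists>\<eta>. homog a (k - 1) (A \<union> B) \<eta> \<and> all_expo (nonneg_on A) (\<omega> - wedge m f \<eta>)"
  using assms
proof (induction "card (indets r n - (A \<union> B))" arbitrary: A B \<omega> k rule: less_induct)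
  case less
  show ?case
  proof (cases "\<forall>j\<in>{1..r}. B \<inter> group j \<noteq> {}")
    case True
    then have "\<forall>j\<in>{1..r}. \<exists>l. l \<le> n j \<and> (j, l) \<in> B" by (force simp: group_def)
    then obtain l where "\<And>j. j \<in> {1..r} \<Longrightarrow> l j \<le> n j \<and> (j, l j) \<in> B" by metis
    then show ?thesis using acyclic[of l B A k \<omega>] less.prems by blast
  next
    case False
    then obtain j where j: "j \<in> {1..r}" "B \<inter> group j = {}" by blast
    have k2: "2 + gap A B \<le> k" using less.prems(5) False by blast
    have "A \<inter> group j \<noteq> group j"
      using less.prems(3)[OF j(1)] card_group[of j] by (metis Suc_eq_plus1 not_less_eq_eq order_refl)
    then obtain v where v: "v \<in> group j" "v \<notin> A" by blast
    have vB: "v \<notin> B" using v(1) j(2) by blast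
    have v_indets: "v \<in> indets r n" using v(1) j(1) by (auto simp: group_def indets_def)
    have smaller: "card (indets r n - insert v (A \<union> B)) < card (indets r n - (A \<union> B))"
      using v_indets v(2) vB by (intro psubset_card_mono) auto
    have vj: "v \<notin> group j'" if "j' \<noteq> j" for j' using v(1) that by (auto simp: mem_group)
    have "gap A (insert v B) \<le> gap A B"
      unfolding gap_def by (rule sum_mono) auto
    then have "\<exists>\<eta>. homog a (k - 1) (A \<union> insert v B) \<eta> \<and> all_expo (nonneg_on A) (\<omega> - wedge m f \<eta>)"
      using less.prems v(2) v_indets smaller k2
      by (intro less.hyps) (auto intro: homog_mono)
    then obtain \<eta> where \<eta>: "homog a (k - 1) (insert v (A \<union> B)) \<eta>"
        "all_expo (nonneg_on A) (\<omega> - wedge m f \<eta>)"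
      by auto
    have coc: "all_expo (nonneg_on (insert v A)) (wedge m f \<eta>)"
      using connecting_cocycle[OF less.prems(6)] v(2) vB \<eta>(2) by blast
    \<comment> \<open>\<eta> is changed by a boundary so that its class over M(A + v, B) becomes
      zero on the nose.\<close>
    obtain \<theta> where \<theta>: "homog a (k - 1) (insert v (A \<union> B)) \<theta>" "all_expo (nonneg_on (insert v A)) \<theta>"
        "wedge m f \<theta> = wedge m f \<eta>"
    proof (cases "card (A \<inter> group j) < n j")
      case True
      have "card (insert v A \<inter> group j') \<le> n j'" if "j' \<in> {1..r}" for j'
        using less.prems(3)[OF that] True v vj[of j'] by (cases "j' = j") (auto simp: card_insert_if)
      moreover have "gap (insert v A) B < gap A B"
        unfolding gap_def
      proof (rule sum_strict_mono_ex1)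
        show "\<forall>x\<in>{1..r}. (if B \<inter> group x = {} then n x - card (insert v A \<inter> group x) else 0)
            \<le> (if B \<inter> group x = {} then n x - card (A \<inter> group x) else 0)"
          by (auto intro!: diff_le_mono2 card_mono)
        show "\<exists>x\<in>{1..r}. (if B \<inter> group x = {} then n x - card (insert v A \<inter> group x) else 0)
            < (if B \<inter> group x = {} then n x - card (A \<inter> group x) else 0)"
          using j True v by (intro bexI[of _ j]) (auto simp: card_insert_if)
      qed simp
      ultimately have "\<exists>\<zeta>. homog a (k - 1 - 1) (insert v A \<union> B) \<zeta> \<and>
          all_expo (nonneg_on (insert v A)) (\<eta> - wedge m f \<zeta>)"
        using less.prems v(2) vB v_indets smaller k2 \<eta>(1) coc
        by (intro less.hyps) auto
      then obtain \<zeta> where \<zeta>: "homog a (k - 2) (insert v (A \<union> B)) \<zeta>"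
          "all_expo (nonneg_on (insert v A)) (\<eta> - wedge m f \<zeta>)"
        by (auto simp: diff_diff_eq numeral_2_eq_2)
      have "homog a (k - 1) (insert v (A \<union> B)) (wedge m f \<zeta>)"
        using homog_wedge_f[OF \<zeta>(1)] k2 by (simp add: Suc_diff_Suc numeral_2_eq_2)
      then show ?thesis
        using \<zeta> \<eta>(1) by (intro that[of "\<eta> - wedge m f \<zeta>"]) (auto intro: homog_diff simp: wedge_diff)
    next
      case False
      \<comment> \<open>Now A and v contain a whole group. The form degree k - 1 of \<eta> is
        positive, so every exponent is nonnegative somewhere in that group.\<close>
      then have "card (insert v (A \<inter> group j)) = card (group j)"
        using less.prems(3)[OF j(1)] v(2) by (simp add: card_group)
      then have "insert v (A \<inter> group j) = group j"
        using v(1) by (intro card_subset_eq) auto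
      then have sub: "group j \<subseteq> insert v A" by blast
      have "all_expo (nonneg_on (insert v A)) \<eta>"
        unfolding all_expo_def
      proof (intro allI impI)
        fix I \<gamma> assume "coef \<eta> I \<gamma> \<noteq> 0"
        then obtain l where "l \<le> n j" "0 \<le> \<gamma> (j, l)"
          using group_not_negative[OF \<eta>(1) _ _ j(1)] k2 by fastforce
        then show "nonneg_on (insert v A) \<gamma>"
          using sub by (auto simp: nonneg_on_def group_def)
      qed
      then show ?thesis using \<eta>(1) by (intro that[of \<eta>]) auto
    qed
    let ?p = "\<lambda>\<gamma>. 0 \<le> \<gamma> v"
    have "homog a (k - 1) (A \<union> B) (restrict_expo ?p \<theta>)"
      by (rule homog_restrict_nonneg[OF \<theta>(1)]) auto
    moreover have "all_expo (nonneg_on A) (restrict_expo (\<lambda>\<gamma>. \<not> ?p \<gamma>) \<theta>)"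
      using \<theta>(2) unfolding all_expo_def nonneg_on_def coef_restrict by auto
    then have "all_expo (nonneg_on A) (\<omega> - wedge m f \<eta> + wedge m f (restrict_expo (\<lambda>\<gamma>. \<not> ?p \<gamma>) \<theta>))"
      by (intro all_expo_add \<eta>(2) all_expo_wedge) simp_all
    moreover have "\<omega> - wedge m f \<eta> + wedge m f (restrict_expo (\<lambda>\<gamma>. \<not> ?p \<gamma>) \<theta>) =
        \<omega> - wedge m f (restrict_expo ?p \<theta>)"
      using arg_cong[OF restrict_compl[of \<theta> ?p], of "wedge m f"] \<theta>(3) by (simp add: wedge_add)
    ultimately show ?thesis by auto
  qed
qed

end

section \<open>The order of the cofactors\<close>

lemma sorted_wrt_concat_pairs:
  "sorted_wrt (<) xs \<Longrightarrow> sorted_wrt (<) (concat (map (\<lambda>l::nat. map (Pair l) [0..<g l]) xs))"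
  by (induction xs) (auto simp: sorted_wrt_append sorted_wrt_map)

lemma sorted_cofactor_indices: "sorted_wrt (<) (cofactor_indices r n)"
  unfolding cofactor_indices_def by (rule sorted_wrt_concat_pairs) (simp del: upt_Suc)

lemma distinct_cofactor_indices: "distinct (cofactor_indices r n)"
  using sorted_cofactor_indices strict_sorted_iff by blast

lemma set_cofactor_indices:
  "set (cofactor_indices r n) = (SIGMA l:{1..r}. {..<(if l < r then n l else Suc (n l))})"
  unfolding cofactor_indices_def by (auto split: if_splits)

lemma length_cofactor_indices:
  assumes "1 \<le> r"
  shows "length (cofactor_indices r n) = Suc (sum_dims r n)"
proof -
  have "length (cofactor_indices r n) = card (SIGMA l:{1..r}. {..<(if l < r then n l else Suc (n l))})"
    by (metis distinct_card distinct_cofactor_indices set_cofactor_indices)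
  also have "\<dots> = (\<Sum>l\<in>{1..r}. if l < r then n l else Suc (n l))"
    by (simp add: card_SigmaI)
  also have "\<dots> = (\<Sum>l\<in>{1..r}. n l + (if l = r then 1 else 0))"
    by (rule sum.cong) auto
  finally show ?thesis using assms by (simp add: sum.distrib sum_dims_def)
qed

locale cofactor_chain =
  fixes r :: nat and n :: "nat \<Rightarrow> nat"
  assumes r_pos: "1 \<le> r" and n_pos: "\<And>j. j \<in> {1..r} \<Longrightarrow> 1 \<le> n j"
begin

abbreviation "N \<equiv> sum_dims r n"
abbreviation "cofac \<equiv> cofactor_indices r n"

definition passed :: "nat \<Rightarrow> (nat \<times> nat) set" where "passed c = set (take c cofac)"
text \<open>The value r past the last cofactor makes all groups before r count as finished
  there.\<close>

definition level :: "nat \<Rightarrow> nat" where "level c = (if c \<le> N then fst (cofac ! c) else r)"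
definition later_dims :: "nat \<Rightarrow> nat" where "later_dims j = (\<Sum>i\<in>{j<..r}. n i)"
text \<open>Before group r the last variable of a group has no cofactor of its own but stands in
  front of all cofactors of later groups. Once its group is finished it is therefore inverted, as a
  member of B and never of A.\<close>

definition closed_lasts :: "nat \<Rightarrow> (nat \<times> nat) set" where
  "closed_lasts c = (\<lambda>j. (j, n j)) ` {1..<level c}"

lemma length_cofac [simp]: "length cofac = Suc N"
  by (rule length_cofactor_indices[OF r_pos])

lemma mem_cofac: "x \<in> set cofac \<longleftrightarrow> x \<in> indets r n \<and> (fst x < r \<longrightarrow> snd x \<noteq> n (fst x))"
  by (cases x) (auto simp: set_cofactor_indices indets_def)

lemma cofac_mem: "c \<le> N \<Longrightarrow> cofac ! c \<in> set cofac"
  by (simp add: nth_mem)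

lemma cofac_less: "c < c' \<Longrightarrow> c' \<le> N \<Longrightarrow> cofac ! c < cofac ! c'"
  using sorted_wrt_nth_less[OF sorted_cofactor_indices, of c c' r n] by simp

lemma passed_0 [simp]: "passed 0 = {}" and passed_all: "passed (Suc N) = set cofac"
  by (simp_all add: passed_def)

lemma passed_Suc: "c \<le> N \<Longrightarrow> passed (Suc c) = insert (cofac ! c) (passed c)"
  by (simp add: passed_def take_Suc_conv_app_nth)

lemma finite_passed [simp]: "finite (passed c)"
  by (simp add: passed_def)

lemma card_passed: "c \<le> Suc N \<Longrightarrow> card (passed c) = c"
  unfolding passed_def using distinct_cofactor_indices[of r n]
  by (subst distinct_card) (auto simp: distinct_take)

lemma passed_subset: "passed c \<subseteq> set cofac"
  by (auto simp: passed_def dest: in_set_takeD)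

lemma mem_passed: "c \<le> N \<Longrightarrow> x \<in> passed c \<longleftrightarrow> x \<in> set cofac \<and> x < cofac ! c"
proof -
  assume c: "c \<le> N"
  have "x \<in> passed c \<longleftrightarrow> (\<exists>i<c. x = cofac ! i)"
    using c by (auto simp: passed_def in_set_conv_nth)
  moreover have "x < cofac ! c \<longleftrightarrow> (\<exists>i<c. x = cofac ! i)" if "x \<in> set cofac"
  proof -
    obtain i where i: "i \<le> N" "x = cofac ! i" using \<open>x \<in> set cofac\<close> by (auto simp: in_set_conv_nth less_Suc_eq_le)
    have "i < c" if "x < cofac ! c"
      using that i cofac_less[of c i] c by (cases i c rule: linorder_cases) auto
    then show ?thesis using cofac_less c i by blast
  qed
  moreover have "x \<in> set cofac" if "\<exists>i<c. x = cofac ! i" using that c by (auto intro: cofac_mem)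
  ultimately show ?thesis by blast
qed

lemma cofac_notin_passed: "c \<le> N \<Longrightarrow> cofac ! c \<notin> passed c"
  by (simp add: mem_passed)

lemma level_range: "level c \<in> {1..r}"
  using r_pos cofac_mem[of c] by (auto simp: level_def mem_cofac indets_def)

text \<open>The additional one comes from group r, which contributes cofactors for all of its n r +
  1 variables.\<close>

lemma later_card:
  assumes "j < r"
  shows "card {x \<in> set cofac. j < fst x} = Suc (later_dims j)"
proof -
  have "{x \<in> set cofac. j < fst x} = (SIGMA i:{j<..r}. {..<(if i < r then n i else Suc (n i))})"
    by (auto simp: set_cofactor_indices split: if_splits)
  then have "card {x \<in> set cofac. j < fst x} = (\<Sum>i\<in>{j<..r}. if i < r then n i else Suc (n i))"
    by (simp add: card_SigmaI)
  also have "\<dots> = (\<Sum>i\<in>{j<..r}. n i + (if i = r then 1 else 0))" by (rule sum.cong) auto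
  finally show ?thesis using assms by (simp add: sum.distrib later_dims_def)
qed

lemma later_dims_pos: "j < r \<Longrightarrow> 1 \<le> later_dims j"
  using n_pos[of r] r_pos member_le_sum[of r "{j<..r}" n] by (auto simp: later_dims_def)

lemma passed_group: "c \<le> N \<Longrightarrow> x \<in> passed c \<Longrightarrow> fst x \<le> level c"
  by (auto simp: mem_passed level_def less_prod_def')

text \<open>The cofactors up to c and those of later groups are disjoint. The count guarantees that
  the form degree \<open>Suc N - c\<close> exceeds \<open>gap\<close> by two while earlier groups
  are treated.\<close>

lemma remaining:
  assumes "c \<le> N" "level c < r"
  shows "Suc c + Suc (later_dims (level c)) \<le> Suc N"
proof -
  let ?L = "{x \<in> set cofac. level c < fst x}"
  have "insert (cofac ! c) (passed c) \<union> ?L \<subseteq> set cofac" using passed_subset cofac_mem[OF assms(1)] by auto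
  then have "card (insert (cofac ! c) (passed c) \<union> ?L) \<le> Suc N"
    using card_mono[of "set cofac"] distinct_card[OF distinct_cofactor_indices, of r n] by auto
  moreover have "card (insert (cofac ! c) (passed c) \<union> ?L) = card (insert (cofac ! c) (passed c)) + card ?L"
  proof (rule card_Un_disjoint)
    have le: "fst x \<le> level c" if "x \<in> insert (cofac ! c) (passed c)" for x
      using that passed_group[OF assms(1), of x] assms(1) by (auto simp: level_def)
    show "insert (cofac ! c) (passed c) \<inter> ?L = {}"
    proof (rule equals0I)
      fix x assume "x \<in> insert (cofac ! c) (passed c) \<inter> ?L"
      then have "fst x \<le> level c" "level c < fst x" using le by blast+
      then show False by simp
    qed
  qed auto
  ultimately show ?thesis
    using assms cofac_notin_passed by (simp add: later_card card_passed)
qed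

text \<open>Positivity of the n j enters here: every group has a cofactor, so no group is
  skipped.\<close>

lemma level_mono_Suc:
  assumes "c \<le> N"
  shows "level c \<le> level (Suc c)" "level (Suc c) \<le> Suc (level c)"
proof -
  have le: "level c \<le> r" using level_range[of c] by simp
  show "level c \<le> level (Suc c)"
  proof (cases "Suc c \<le> N")
    case True
    then show ?thesis using cofac_less[of c "Suc c"] assms by (auto simp: level_def less_prod_def')
  qed (use le in \<open>simp add: level_def\<close>)
  show "level (Suc c) \<le> Suc (level c)"
  proof (cases "level c = r")
    case True
    then show ?thesis using level_range[of "Suc c"] by simp
  next
    case False
    then have lt: "level c < r" using le by simp
    let ?x = "(Suc (level c), 0)"
    have x: "?x \<in> set cofac"
      using lt n_pos[of "Suc (level c)"] by (auto simp: mem_cofac indets_def)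
    have "Suc c \<le> N" using remaining[OF assms lt] by simp
    moreover have "?x \<noteq> cofac ! c" using assms by (metis fst_conv level_def n_not_Suc_n)
    then have "?x \<notin> passed (Suc c)"
      using passed_group[OF assms, of ?x] assms by (auto simp: passed_Suc)
    ultimately have "\<not> ?x < cofac ! Suc c" using x mem_passed by blast
    then show ?thesis using \<open>Suc c \<le> N\<close> by (auto simp: level_def less_prod_def' not_less)
  qed
qed

lemma passed_next_level:
  assumes "c \<le> N" "level (Suc c) = Suc (level c)" "t < n (level c)"
  shows "(level c, t) \<in> passed (Suc c)"
proof -
  have lt: "level c < r" using assms(2) level_range[of "Suc c"] by simp
  have "Suc c \<le> N" using remaining[OF assms(1) lt] by simp
  moreover have "(level c, t) \<in> set cofac" using lt assms(3) level_range[of c] by (auto simp: mem_cofac indets_def)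
  moreover have "(level c, t) < cofac ! Suc c" using assms(2) \<open>Suc c \<le> N\<close> by (auto simp: level_def less_prod_def')
  ultimately show ?thesis by (simp add: mem_passed)
qed

lemma closed_lasts_notin: "(closed_lasts c) \<inter> set cofac = {}"
  using level_range[of c] by (auto simp: closed_lasts_def mem_cofac)

lemma closed_lasts_indets: "closed_lasts c \<subseteq> indets r n"
  using level_range[of c] by (auto simp: closed_lasts_def indets_def)

lemma level_0: "level 0 = 1"
proof -
  have x: "(1, 0) \<in> set cofac" using r_pos n_pos[of 1] by (auto simp: mem_cofac indets_def)
  have "\<not> (1, 0) < cofac ! 0" using x mem_passed[of 0 "(1, 0)"] by simp
  then show ?thesis using level_range[of 0] by (auto simp: level_def less_prod_def' not_less)
qed

lemma closed_lasts_0 [simp]: "closed_lasts 0 = {}"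
  by (simp add: closed_lasts_def level_0)

text \<open>
  The monomial in front of the \<open>c\<close>-th cofactor in the nested decomposition, and the Laurent monomial
  that remains after the first \<open>c\<close> cofactors have been divided out of the Sylvester form.
\<close>

definition cofac_expo :: "expo \<Rightarrow> nat \<Rightarrow> expo" where
  "cofac_expo \<alpha> c = Poly_Mapping.single (cofac ! c) (Poly_Mapping.lookup \<alpha> (cofac ! c) + 1) +
     (\<Sum>j\<in>{1..<fst (cofac ! c)}. Poly_Mapping.single (j, n j) (Poly_Mapping.lookup \<alpha> (j, n j) + 1))"

definition chain_expo :: "expo \<Rightarrow> nat \<Rightarrow> nat \<times> nat \<Rightarrow> int" where
  "chain_expo \<alpha> c v =
     (if v \<in> passed c then - int (Poly_Mapping.lookup \<alpha> v) - 1
      else if fst v \<in> {1..<r} \<and> snd v = n (fst v)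
      then (int (Poly_Mapping.lookup \<alpha> v) + 1) *
        (int (later_dims (fst v)) - int (card {x \<in> passed c. fst v < fst x}))
      else 0)"

lemma lookup_cofac_expo:
  assumes "c \<le> N"
  shows "Poly_Mapping.lookup (cofac_expo \<alpha> c) v =
    (if v = cofac ! c \<or> (fst v \<in> {1..<level c} \<and> snd v = n (fst v)) then Poly_Mapping.lookup \<alpha> v + 1 else 0)"
proof -
  have "Poly_Mapping.lookup (\<Sum>j\<in>S. Poly_Mapping.single (j, n j) (Poly_Mapping.lookup \<alpha> (j, n j) + 1)) v =
      (if fst v \<in> S \<and> snd v = n (fst v) then Poly_Mapping.lookup \<alpha> v + 1 else 0)" if "finite S" for S
    using that
  proof induction
    case (insert j S)
    then show ?case by (cases v) (auto simp: lookup_add lookup_single when_def)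
  qed simp
  moreover have "\<not> (fst v \<in> {1..<level c} \<and> snd v = n (fst v))" if "v = cofac ! c"
    using cofac_mem[OF assms] that by (auto simp: level_def assms)
  ultimately show ?thesis
    by (auto simp: cofac_expo_def lookup_add lookup_single when_def level_def assms)
qed

lemma cofac_expo_monomials:
  assumes "c \<le> N"
  shows "cofac_expo \<alpha> c \<in> monomials r n (\<lambda>j. int (group_degree n (cofac_expo \<alpha> c) j))"
proof -
  have "v \<in> indets r n" if "v \<in> Poly_Mapping.keys (cofac_expo \<alpha> c)" for v
  proof -
    have "v = cofac ! c \<or> (fst v \<in> {1..<level c} \<and> snd v = n (fst v))"
      using that lookup_cofac_expo[OF assms, of \<alpha> v] by (metis in_keys_iff)
    then show ?thesis
      using cofac_mem[OF assms] level_range[of c] by (cases v) (auto simp: mem_cofac indets_def)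
  qed
  then show ?thesis by (auto simp: monomials_def)
qed

lemma chain_expo_step:
  assumes "c \<le> N"
  shows "chain_expo \<alpha> c v = chain_expo \<alpha> (Suc c) v + int_expo (cofac_expo \<alpha> c) v"
proof -
  let ?x = "cofac ! c"
  have x: "?x \<in> set cofac" "?x \<notin> passed c" using assms cofac_mem cofac_notin_passed by auto
  have last: "\<not> (fst ?x \<in> {1..<r} \<and> snd ?x = n (fst ?x))" using x(1) by (auto simp: mem_cofac)
  have notlast: "\<not> (fst v \<in> {1..<level c} \<and> snd v = n (fst v))" if "v \<in> set cofac"
    using that level_range[of c] by (auto simp: mem_cofac)
  consider "v = ?x" | "v \<in> passed c" | "v \<noteq> ?x" "v \<notin> passed c" by blast
  then show ?thesis
  proof cases
    case 1
    then show ?thesis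
      using x last assms by (auto simp: chain_expo_def passed_Suc int_expo_def lookup_cofac_expo)
  next
    case 2
    then show ?thesis
      using x notlast passed_subset assms
      by (auto simp: chain_expo_def passed_Suc int_expo_def lookup_cofac_expo)
  next
    case 3
    have "{y \<in> passed (Suc c). fst v < fst y} =
        (if fst v < level c then insert ?x {y \<in> passed c. fst v < fst y} else {y \<in> passed c. fst v < fst y})"
      using assms by (auto simp: passed_Suc level_def)
    then have "card {y \<in> passed (Suc c). fst v < fst y} =
        card {y \<in> passed c. fst v < fst y} + (if fst v < level c then 1 else 0)"
      using x(2) by simp
    moreover have "fst v < r" if "fst v < level c" using that level_range[of c] by simp
    ultimately show ?thesis
      using 3 assms by (auto simp: chain_expo_def passed_Suc int_expo_def lookup_cofac_expo algebra_simps)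
  qed
qed

text \<open>A last variable of a group j before r starts with the exponent (\<alpha> + 1) v_j and
  loses \<alpha> + 1 at each of the v_j + 1 cofactors of later groups. So the front factor of the
  Sylvester form is exactly what makes its exponent end at -\<alpha> - 1, as for the cofactor
  variables.\<close>

lemma chain_expo_last:
  assumes "v \<in> indets r n"
  shows "chain_expo \<alpha> (Suc N) v = - int (Poly_Mapping.lookup \<alpha> v) - 1"
proof (cases "v \<in> set cofac")
  case False
  then have v: "fst v \<in> {1..<r}" "snd v = n (fst v)" using assms by (auto simp: mem_cofac indets_def)
  have "card {x \<in> passed (Suc N). fst v < fst x} = Suc (later_dims (fst v))"
    using v(1) by (simp add: passed_all later_card)
  then show ?thesis using False v by (simp add: chain_expo_def passed_all algebra_simps)
qed (simp add: chain_expo_def passed_all)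

lemma chain_expo_outside:
  assumes "v \<notin> indets r n"
  shows "chain_expo \<alpha> c v = 0"
proof -
  have "v \<notin> passed c" using assms passed_subset mem_cofac by blast
  moreover have "\<not> (fst v \<in> {1..<r} \<and> snd v = n (fst v))"
    using assms by (cases v) (auto simp: indets_def)
  ultimately show ?thesis unfolding chain_expo_def by argo
qed

text \<open>While its group is unfinished, a last variable still has its full starting exponent,
  since no cofactor of a later group has been passed.\<close>

lemma chain_expo_nonneg:
  assumes "c \<le> Suc N" "v \<notin> passed c \<union> closed_lasts c"
  shows "0 \<le> chain_expo \<alpha> c v"
proof (cases "fst v \<in> {1..<r} \<and> snd v = n (fst v)")
  case True
  then have "level c \<le> fst v" using assms(2) by (cases v) (auto simp: closed_lasts_def image_iff)
  then have "c \<le> N" using True by (auto simp: level_def split: if_splits)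
  then have none: "{x \<in> passed c. fst v < fst x} = {}"
    using passed_group \<open>level c \<le> fst v\<close> by fastforce
  show ?thesis using assms(2) True by (simp add: chain_expo_def none)
qed (use assms in \<open>auto simp: chain_expo_def\<close>)

lemma chain_expo_0: "chain_expo \<alpha> 0 v = (if fst v \<in> {1..<r} \<and> snd v = n (fst v)
    then (int (Poly_Mapping.lookup \<alpha> v) + 1) * int (later_dims (fst v)) else 0)"
  by (simp add: chain_expo_def)

end

section \<open>Cocycles of critical degree\<close>

text \<open>The degree of \<alpha> is chosen so that the Laurent monomial with exponents -\<alpha> -
  1 has degree a. If a is \<nu> minus the sum of the d_i, then \<alpha> has degree \<delta> -
  \<nu>.\<close>

locale sylvester_koszul = koszul r n m D a f + cofactor_chain r n
  for r n m D a and f :: "nat \<Rightarrow> 'a::comm_ring_1 mpol" +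
  fixes F :: "expo \<Rightarrow> nat \<Rightarrow> nat \<Rightarrow> 'a mpol"
  assumes F_graded: "\<And>\<alpha> c i. \<alpha> \<in> monomials r n (\<lambda>j. - a j - int (n j) - 1) \<Longrightarrow> c \<le> N \<Longrightarrow> i < m \<Longrightarrow>
      F \<alpha> c i \<in> graded_part r n (\<lambda>j. D i j - int (group_degree n (cofac_expo \<alpha> c) j))"
    and decomp: "\<And>\<alpha> i. \<alpha> \<in> monomials r n (\<lambda>j. - a j - int (n j) - 1) \<Longrightarrow> i < m \<Longrightarrow>
      f i = (\<Sum>c\<le>N. Poly_Mapping.single (cofac_expo \<alpha> c) 1 * F \<alpha> c i)"
begin

definition "alphas = monomials r n (\<lambda>j. - a j - int (n j) - 1)"

definition delta :: "(nat \<times> nat \<Rightarrow> int) \<Rightarrow> 'a laurent" where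
  "delta \<mu> \<gamma> = (if \<gamma> = \<mu> then 1 else 0)"

text \<open>Interpolates between two ends: at c = N + 1 the Laurent monomial with exponents
  -\<alpha> - 1, in form degree zero, and at c = 0 a form without poles whose coefficients are the
  minors of the cofactor matrix times the front monomial.\<close>

definition residual :: "expo \<Rightarrow> nat \<Rightarrow> 'a form" where
  "residual \<alpha> c = wedges m (map (F \<alpha>) [c..<Suc N]) (delta (chain_expo \<alpha> c))"

lemma act_delta: "act (Poly_Mapping.single t 1) (delta \<mu>) = delta (\<lambda>v. \<mu> v + int_expo t v)"
proof
  fix \<gamma>
  have "(\<lambda>v. \<gamma> v - int_expo t v) = \<mu> \<longleftrightarrow> \<gamma> = (\<lambda>v. \<mu> v + int_expo t v)"
    by (auto simp: fun_eq_iff algebra_simps)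
  then show "act (Poly_Mapping.single t 1) (delta \<mu>) \<gamma> = delta (\<lambda>v. \<mu> v + int_expo t v) \<gamma>"
    by (simp add: act_single delta_def)
qed

lemma all_expo_wedges:
  assumes "up_closed p" "p \<mu>"
  shows "all_expo p (wedges m Fs (delta \<mu>))"
proof (induction Fs)
  case Nil
  show ?case using assms(2) by (auto simp: all_expo_def delta_def split: if_splits)
qed (simp add: all_expo_wedge assms(1))

lemma wedge_residual_term:
  assumes "c' \<le> N"
  shows "scale_form (Poly_Mapping.single (cofac_expo \<alpha> c') 1) (wedge m (F \<alpha> c') (residual \<alpha> c)) =
    wedge m (F \<alpha> c') (wedges m (map (F \<alpha>) [c..<Suc N])
      (delta (\<lambda>v. chain_expo \<alpha> c v + int_expo (cofac_expo \<alpha> c') v)))"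
  by (simp only: wedge_scale[symmetric] residual_def scale_wedges act_delta)

lemma wedge_f_residual:
  assumes "\<alpha> \<in> alphas"
  shows "wedge m f (residual \<alpha> c) = (\<Sum>c'\<le>N. wedge m (F \<alpha> c') (wedges m (map (F \<alpha>) [c..<Suc N])
      (delta (\<lambda>v. chain_expo \<alpha> c v + int_expo (cofac_expo \<alpha> c') v))))"
proof -
  have "wedge m f (residual \<alpha> c) = (\<Sum>c'\<le>N. scale_form (Poly_Mapping.single (cofac_expo \<alpha> c') 1)
      (wedge m (F \<alpha> c') (residual \<alpha> c)))"
    by (rule wedge_lincomb) (use decomp assms in \<open>simp add: alphas_def\<close>)
  also have "\<dots> = (\<Sum>c'\<le>N. wedge m (F \<alpha> c') (wedges m (map (F \<alpha>) [c..<Suc N])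
      (delta (\<lambda>v. chain_expo \<alpha> c v + int_expo (cofac_expo \<alpha> c') v))))"
    by (rule sum.cong[OF refl]) (simp only: wedge_residual_term atMost_iff)
  finally show ?thesis .
qed

text \<open>The one-form f is a combination of the columns of cofactors, and each of them already
  occurs in the product.\<close>

lemma wedge_residual_0: "\<alpha> \<in> alphas \<Longrightarrow> wedge m f (residual \<alpha> 0) = 0"
  unfolding wedge_f_residual by (intro sum.neutral ballI wedge_wedges_member) (auto simp del: upt_Suc)

text \<open>The connecting homomorphism takes the residual c + 1 to the residual c. Of the columns
  that make up f, the column c gives the new residual, a later one repeats a factor, and an earlier
  one cancels the pole at its own variable.\<close>

lemma residual_step:
  assumes c: "c \<le> N" and \<alpha>: "\<alpha> \<in> alphas"
  shows "all_expo (nonneg_on (passed c)) (wedge m f (residual \<alpha> (Suc c)) - residual \<alpha> c)"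
proof -
  let ?t = "\<lambda>c'. wedge m (F \<alpha> c') (wedges m (map (F \<alpha>) [Suc c..<Suc N])
      (delta (\<lambda>v. chain_expo \<alpha> (Suc c) v + int_expo (cofac_expo \<alpha> c') v)))"
  have "?t c = residual \<alpha> c"
    unfolding chain_expo_step[OF c, symmetric] residual_def using c
    by (simp add: upt_conv_Cons del: upt_Suc)
  moreover have "all_expo (nonneg_on (passed c)) (?t c')" if c': "c' \<le> N" "c' \<noteq> c" for c'
  proof (cases "c' < c")
    case True
    let ?v = "cofac ! c'"
    have v: "?v \<in> passed c" using True c cofac_less[of c' c] cofac_mem[OF c'(1)] by (simp add: mem_passed)
    then have "?v \<in> passed (Suc c)" using c by (simp add: passed_Suc)
    \<comment> \<open>The exponent -\<alpha> - 1 at the passed variable meets the power \<alpha> + 1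
      in front of its cofactor.\<close>
    then have "0 \<le> chain_expo \<alpha> (Suc c) ?v + int_expo (cofac_expo \<alpha> c') ?v"
      using c' by (simp add: chain_expo_def int_expo_def lookup_cofac_expo)
    then have "nonneg_on (passed c) (\<lambda>v. chain_expo \<alpha> (Suc c) v + int_expo (cofac_expo \<alpha> c') v)"
      using v unfolding nonneg_on_def by blast
    then show ?thesis by (intro all_expo_wedge all_expo_wedges) simp_all
  next
    case False
    then have "F \<alpha> c' \<in> set (map (F \<alpha>) [Suc c..<Suc N])" using c' by (auto simp del: upt_Suc)
    then show ?thesis by (simp only: wedge_wedges_member all_expo_0)
  qed
  ultimately have "all_expo (nonneg_on (passed c)) ((\<Sum>c'\<in>{..N} - {c}. ?t c'))"
    by (intro all_expo_sum) auto
  moreover have "wedge m f (residual \<alpha> (Suc c)) = ?t c + (\<Sum>c'\<in>{..N} - {c}. ?t c')"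
    unfolding wedge_f_residual[OF \<alpha>] using c by (intro sum.remove) auto
  ultimately show ?thesis using \<open>?t c = residual \<alpha> c\<close> by simp
qed

lemma homog_wedges:
  assumes \<alpha>: "\<alpha> \<in> alphas" and "c \<le> Suc N" "\<And>\<gamma>. \<psi> \<gamma> \<noteq> 0 \<Longrightarrow> \<gamma> \<in> expos C b"
  shows "homog (\<lambda>j. b j - (\<Sum>c'\<in>{c..<Suc N}. int (group_degree n (cofac_expo \<alpha> c') j))) (Suc N - c) C
    (wedges m (map (F \<alpha>) [c..<Suc N]) \<psi>)"
  using assms(2)
proof (induction c rule: inc_induct)
  case base
  show ?case using assms(3) by (auto simp: homog_def split: if_splits)
next
  case (step c)
  have "homog (\<lambda>j. b j - (\<Sum>c'\<in>{Suc c..<Suc N}. int (group_degree n (cofac_expo \<alpha> c') j)) -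
      int (group_degree n (cofac_expo \<alpha> c) j)) (Suc (Suc N - Suc c)) C
    (wedge m (F \<alpha> c) (wedges m (map (F \<alpha>) [Suc c..<Suc N]) \<psi>))"
    by (rule homog_wedge[OF _ step.IH]) (use F_graded[of \<alpha> c] \<alpha> step.hyps in \<open>simp add: alphas_def\<close>)
  moreover have "{c..<Suc N} = insert c {Suc c..<Suc N}" using step.hyps by auto
  moreover have "[c..<Suc N] = c # [Suc c..<Suc N]" using step.hyps by (simp add: upt_conv_Cons del: upt_Suc)
  ultimately show ?case using step.hyps by (simp add: algebra_simps Suc_diff_le del: upt_Suc)
qed

text \<open>Each step back multiplies by the monomial in front of a cofactor and adds a column whose
  degree is smaller by just that monomial. Hence all residuals live in the complex with the same
  shift a.\<close>

lemma chain_expo_degree: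
  assumes \<alpha>: "\<alpha> \<in> alphas" and "c \<le> Suc N" "j \<in> {1..r}"
  shows "(\<Sum>l\<le>n j. chain_expo \<alpha> c (j, l)) =
    a j + (\<Sum>c'\<in>{c..<Suc N}. int (group_degree n (cofac_expo \<alpha> c') j))"
  using assms(2)
proof (induction c rule: inc_induct)
  case base
  have "(\<Sum>l\<le>n j. chain_expo \<alpha> (Suc N) (j, l)) = (\<Sum>l\<le>n j. - int (Poly_Mapping.lookup \<alpha> (j, l)) - 1)"
    using assms(3) by (intro sum.cong refl chain_expo_last) (auto simp: indets_def)
  also have "\<dots> = - int (group_degree n \<alpha> j) - int (n j) - 1"
    by (simp add: group_degree_def sum_subtractf sum_negf)
  also have "int (group_degree n \<alpha> j) = - a j - int (n j) - 1"
    using \<alpha> assms(3) by (auto simp: alphas_def monomials_def)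
  finally show ?case by simp
next
  case (step c)
  have "(\<Sum>l\<le>n j. chain_expo \<alpha> c (j, l)) =
      (\<Sum>l\<le>n j. chain_expo \<alpha> (Suc c) (j, l)) + (\<Sum>l\<le>n j. int_expo (cofac_expo \<alpha> c) (j, l))"
    using step.hyps chain_expo_step[of c \<alpha>] by (simp add: sum.distrib)
  moreover have "{c..<Suc N} = insert c {Suc c..<Suc N}" using step.hyps by auto
  ultimately show ?case using step by (simp add: group_degree_def int_expo_def)
qed

lemma homog_residual:
  assumes \<alpha>: "\<alpha> \<in> alphas" and c: "c \<le> Suc N"
  shows "homog a (Suc N - c) (passed c \<union> closed_lasts c) (residual \<alpha> c)"
proof -
  let ?b = "\<lambda>j. a j + (\<Sum>c'\<in>{c..<Suc N}. int (group_degree n (cofac_expo \<alpha> c') j))"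
  have "\<gamma> \<in> expos (passed c \<union> closed_lasts c) ?b" if "delta (chain_expo \<alpha> c) \<gamma> \<noteq> 0" for \<gamma>
  proof -
    have "\<gamma> = chain_expo \<alpha> c" using that by (auto simp: delta_def split: if_splits)
    then show ?thesis
      unfolding expos_def
      using chain_expo_outside chain_expo_nonneg[OF c] chain_expo_degree[OF \<alpha> c] by blast
  qed
  from homog_wedges[OF \<alpha> c this] show ?thesis by (simp add: residual_def del: upt_Suc)
qed

text \<open>The invariant of the descent: modulo a boundary, a combination of residuals and error
  terms \<xi>. The term \<xi> j is regular at the last variable of the finished group j, and is a
  cocycle even without using the variables of that group. At c = 0 the index set of the \<xi> is
  empty. Past the last cofactor a primitive would have negative form degree, hence \<zeta> = 0
  there.\<close>

definition decomposed :: "nat \<Rightarrow> (nat \<times> nat) set \<Rightarrow> 'a form \<Rightarrow> bool" where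
  "decomposed c C \<omega> \<longleftrightarrow> (\<exists>\<zeta> co \<xi>.
     (if c \<le> N then homog a (N - c) C \<zeta> else \<zeta> = 0) \<and>
     (\<forall>j\<in>{1..<level c}. homog a (Suc N - c) C (\<xi> j) \<and> all_expo (\<lambda>\<gamma>. 0 \<le> \<gamma> (j, n j)) (\<xi> j) \<and>
        all_expo (nonneg_on (passed c - group j)) (wedge m f (\<xi> j))) \<and>
     all_expo (nonneg_on (passed c)) (\<omega> - wedge m f \<zeta> -
       (\<Sum>\<alpha>\<in>alphas. scale_form (Poly_Mapping.single 0 (co \<alpha>)) (residual \<alpha> c)) - (\<Sum>j\<in>{1..<level c}. \<xi> j)))"

lemma decomposedE:
  assumes "decomposed c C \<omega>"
  obtains \<zeta> \<xi> co where "if c \<le> N then homog a (N - c) C \<zeta> else \<zeta> = 0"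
    "\<forall>j\<in>{1..<level c}. homog a (Suc N - c) C (\<xi> j) \<and> all_expo (\<lambda>\<gamma>. 0 \<le> \<gamma> (j, n j)) (\<xi> j) \<and>
        all_expo (nonneg_on (passed c - group j)) (wedge m f (\<xi> j))"
    "all_expo (nonneg_on (passed c)) (\<omega> - wedge m f \<zeta> -
       (\<Sum>\<alpha>\<in>alphas. scale_form (Poly_Mapping.single 0 (co \<alpha>)) (residual \<alpha> c)) - (\<Sum>j\<in>{1..<level c}. \<xi> j))"
  using assms unfolding decomposed_def by (elim exE conjE) (rule that)

lemma finite_alphas [simp]: "finite alphas"
  by (simp add: alphas_def)

lemma act_const: "act (Poly_Mapping.single 0 c) \<phi> \<gamma> = c * \<phi> \<gamma>"
  by (simp add: act_single)

lemma residual_last: "coef (residual \<alpha> (Suc N)) I \<gamma> = (if I = {} then delta (chain_expo \<alpha> (Suc N)) \<gamma> else 0)"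
  by (simp add: residual_def)

text \<open>
  In form degree zero a monomial with negative exponents at all cofactor variables is either the
  residual of some \<open>\<alpha>\<close>, or else it is nonnegative at the last variable of some group before the last one.
\<close>

lemma decomposed_last:
  assumes \<omega>: "homog a 0 (passed (Suc N) \<union> closed_lasts (Suc N)) \<omega>"
  shows "decomposed (Suc N) (passed (Suc N) \<union> closed_lasts (Suc N)) \<omega>"
proof -
  let ?C = "passed (Suc N) \<union> closed_lasts (Suc N)"
  let ?neg = "\<lambda>\<gamma>. \<forall>v\<in>set cofac. \<gamma> v < (0::int)"
  \<comment> \<open>Taking the least j with a nonnegative exponent assigns each such monomial to
    exactly one error term.\<close>
  let ?first = "\<lambda>j \<gamma>. 0 \<le> \<gamma> (j, n j) \<and> (\<forall>j'\<in>{1..<j}. \<gamma> (j', n j') < (0::int))"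
  define co where "co \<alpha> = coef \<omega> {} (chain_expo \<alpha> (Suc N))" for \<alpha>
  define \<xi> where "\<xi> j = restrict_expo (\<lambda>\<gamma>. ?neg \<gamma> \<and> ?first j \<gamma>) \<omega>" for j
  have level: "level (Suc N) = r" by (simp add: level_def)
  have zero: "I = {} \<and> \<gamma> \<in> expos ?C a" if "coef \<omega> I \<gamma> \<noteq> 0" for I \<gamma>
  proof -
    have "I \<subseteq> {..<m}" "card I = 0" "\<gamma> \<in> expos ?C (\<lambda>j. a j + (\<Sum>i\<in>I. D i j))"
      using \<omega> that unfolding homog_def by blast+
    moreover from this have "I = {}" using finite_subset by (metis card_0_eq finite_lessThan)
    ultimately show ?thesis by simp
  qed
  have xi: "homog a (Suc N - Suc N) ?C (\<xi> j)" "all_expo (\<lambda>\<gamma>. 0 \<le> \<gamma> (j, n j)) (\<xi> j)" for j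
    using \<omega> by (auto simp: \<xi>_def homog_restrict all_expo_def coef_restrict)
  \<comment> \<open>The differential has form degree one, so it is nonnegative somewhere in group r.
    All variables of that group are passed, and none of them belongs to group j.\<close>
  have xi_closed: "all_expo (nonneg_on (passed (Suc N) - group j)) (wedge m f (\<xi> j))" if j: "j \<in> {1..<r}" for j
    unfolding all_expo_def
  proof (intro allI impI)
    fix I \<gamma> assume "coef (wedge m f (\<xi> j)) I \<gamma> \<noteq> 0"
    moreover have "homog a 1 ?C (wedge m f (\<xi> j))"
      using homog_wedge_f[OF xi(1)[of j]] by simp
    ultimately obtain l where "l \<le> n r" "0 \<le> \<gamma> (r, l)"
      using group_not_negative[of 1 ?C "wedge m f (\<xi> j)" I \<gamma> r] r_pos by auto
    moreover have "(r, l) \<in> passed (Suc N) - group j"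
      using j calculation(1) r_pos by (auto simp: passed_all mem_cofac indets_def mem_group)
    ultimately show "nonneg_on (passed (Suc N) - group j) \<gamma>" unfolding nonneg_on_def by blast
  qed
  have "all_expo (nonneg_on (passed (Suc N))) (\<omega> - wedge m f 0 -
      (\<Sum>\<alpha>\<in>alphas. scale_form (Poly_Mapping.single 0 (co \<alpha>)) (residual \<alpha> (Suc N))) - (\<Sum>j\<in>{1..<r}. \<xi> j))"
    (is "all_expo _ ?\<nu>")
    unfolding all_expo_def
  proof (intro allI impI, rule ccontr)
    fix I \<gamma> assume nz: "coef ?\<nu> I \<gamma> \<noteq> 0" and "\<not> nonneg_on (passed (Suc N)) \<gamma>"
    then have neg: "?neg \<gamma>" by (auto simp: nonneg_on_def passed_all)
    let ?S = "\<Sum>\<alpha>\<in>alphas. if I = {} \<and> \<gamma> = chain_expo \<alpha> (Suc N) then coef \<omega> {} \<gamma> else 0"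
    let ?T = "\<Sum>j\<in>{1..<r}. if ?first j \<gamma> then coef \<omega> I \<gamma> else 0"
    have "(\<Sum>\<alpha>\<in>alphas. coef (scale_form (Poly_Mapping.single 0 (co \<alpha>)) (residual \<alpha> (Suc N))) I \<gamma>) = ?S"
      by (rule sum.cong) (auto simp: act_const residual_last delta_def co_def)
    moreover have "(\<Sum>j\<in>{1..<r}. coef (\<xi> j) I \<gamma>) = ?T"
      using neg by (intro sum.cong) (auto simp: \<xi>_def coef_restrict)
    ultimately have coef_\<nu>: "coef ?\<nu> I \<gamma> = coef \<omega> I \<gamma> - ?S - ?T"
      by (simp add: coef_sum del: coef_scale)
    show False
    proof (cases "coef \<omega> I \<gamma> = 0")
      case True
      have "?S = 0" by (rule sum.neutral) (use True in auto)
      moreover have "?T = 0" using True by (intro sum.neutral) auto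
      ultimately show False using nz coef_\<nu> True by simp
    next
      case False
      then have I: "I = {}" and \<gamma>: "\<gamma> \<in> expos ?C a" using zero by blast+
      have out: "\<gamma> v = 0" if "v \<notin> indets r n" for v using \<gamma> that unfolding expos_def by blast
      show False
      proof (cases "\<forall>j\<in>{1..<r}. \<gamma> (j, n j) < 0")
        case True
        have all_neg: "\<gamma> v < 0" if v: "v \<in> indets r n" for v
        proof (cases "v \<in> set cofac")
          case False
          then have "fst v \<in> {1..<r}" "v = (fst v, n (fst v))"
            using v by (auto simp: mem_cofac indets_def)
          then show ?thesis using True by metis
        qed (use neg in blast)
        \<comment> \<open>All exponents of \<gamma> are negative here, so \<gamma> = -\<alpha> - 1
          can be solved in natural numbers.\<close>
        define \<alpha> :: expo where "\<alpha> = Abs_poly_mapping (\<lambda>v. if v \<in> indets r n then nat (- \<gamma> v - 1) else 0)"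
        have lookup_\<alpha>: "Poly_Mapping.lookup \<alpha> v = (if v \<in> indets r n then nat (- \<gamma> v - 1) else 0)" for v
          unfolding \<alpha>_def
          by (subst lookup_Abs_poly_mapping) (auto intro: finite_subset[OF _ finite_indets[of r n]])
        have "int (group_degree n \<alpha> j) = - a j - int (n j) - 1" if j: "j \<in> {1..r}" for j
        proof -
          have "int (group_degree n \<alpha> j) = (\<Sum>l\<le>n j. - \<gamma> (j, l) - 1)"
            unfolding group_degree_def of_nat_sum
          proof (rule sum.cong[OF refl])
            fix l assume "l \<in> {..n j}"
            then have "(j, l) \<in> indets r n" using j by (simp add: indets_def)
            then show "int (Poly_Mapping.lookup \<alpha> (j, l)) = - \<gamma> (j, l) - 1"
              using all_neg[of "(j, l)"] by (simp add: lookup_\<alpha>)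
          qed
          also have "\<dots> = - (\<Sum>l\<le>n j. \<gamma> (j, l)) - int (n j) - 1" by (simp add: sum_subtractf sum_negf)
          also have "(\<Sum>l\<le>n j. \<gamma> (j, l)) = a j" using \<gamma> j unfolding expos_def by blast
          finally show ?thesis .
        qed
        then have \<alpha>: "\<alpha> \<in> alphas"
          by (auto simp: alphas_def monomials_def in_keys_iff lookup_\<alpha> split: if_splits)
        have eq: "\<gamma> = chain_expo \<beta> (Suc N) \<longleftrightarrow> \<beta> = \<alpha>" if "\<beta> \<in> alphas" for \<beta>
        proof -
          have "\<gamma> = chain_expo \<alpha> (Suc N)"
          proof
            fix v
            show "\<gamma> v = chain_expo \<alpha> (Suc N) v"
            proof (cases "v \<in> indets r n")
              case True
              then show ?thesis using all_neg[OF True] by (simp add: chain_expo_last lookup_\<alpha>)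
            next
              case False
              then show ?thesis using out[OF False] by (simp add: chain_expo_outside)
            qed
          qed
          moreover have "\<beta> = \<alpha>" if e: "chain_expo \<beta> (Suc N) = chain_expo \<alpha> (Suc N)"
          proof (rule poly_mapping_eqI)
            fix v
            show "Poly_Mapping.lookup \<beta> v = Poly_Mapping.lookup \<alpha> v"
            proof (cases "v \<in> indets r n")
              case True
              then show ?thesis using fun_cong[OF e, of v] by (simp add: chain_expo_last)
            next
              case False
              then have "v \<notin> Poly_Mapping.keys \<beta>" "v \<notin> Poly_Mapping.keys \<alpha>"
                using \<open>\<beta> \<in> alphas\<close> \<alpha> unfolding alphas_def monomials_def by blast+
              then show ?thesis by (simp add: in_keys_iff)
            qed
          qed
          ultimately show ?thesis by metis
        qed
        have "?S = (\<Sum>\<beta>\<in>alphas. if \<beta> = \<alpha> then coef \<omega> {} \<gamma> else 0)"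
          by (rule sum.cong[OF refl]) (simp add: I eq)
        then have "?S = coef \<omega> {} \<gamma>" using \<alpha> by simp
        moreover have "?T = 0" using True by (intro sum.neutral) auto
        ultimately show False using nz coef_\<nu> I by simp
      next
        case False
        define j where "j = (LEAST j. j \<in> {1..<r} \<and> 0 \<le> \<gamma> (j, n j))"
        have ex: "\<exists>j. j \<in> {1..<r} \<and> 0 \<le> \<gamma> (j, n j)" using False by (metis not_less)
        have j: "j \<in> {1..<r}" "0 \<le> \<gamma> (j, n j)" using LeastI_ex[OF ex] by (auto simp: j_def)
        have least: "\<gamma> (j', n j') < 0" if "j' \<in> {1..<r}" "j' < j" for j'
          using that not_less_Least[of j' "\<lambda>j. j \<in> {1..<r} \<and> 0 \<le> \<gamma> (j, n j)"] by (auto simp: j_def not_le)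
        have first: "?first i \<gamma> \<longleftrightarrow> i = j" if i: "i \<in> {1..<r}" for i
        proof
          assume f: "?first i \<gamma>"
          show "i = j"
          proof (cases i j rule: linorder_cases)
            case less
            then show ?thesis using least[OF i] f by simp
          next
            case greater
            then have "j \<in> {1..<i}" using j(1) by simp
            then show ?thesis using f j(2) by force
          qed
        next
          assume "i = j"
          then show "?first i \<gamma>" using j least by auto
        qed
        have "?T = (\<Sum>i\<in>{1..<r}. if i = j then coef \<omega> I \<gamma> else 0)"
          by (rule sum.cong[OF refl]) (simp only: first)
        then have "?T = coef \<omega> I \<gamma>" using j(1) by simp
        moreover have "?S = 0"
        proof (rule sum.neutral, intro ballI)
          fix \<alpha>
          have "(j, n j) \<in> indets r n" using j(1) by (auto simp: indets_def)
          then have "\<gamma> \<noteq> chain_expo \<alpha> (Suc N)" using j(2) chain_expo_last[of "(j, n j)" \<alpha>] by auto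
          then show "(if I = {} \<and> \<gamma> = chain_expo \<alpha> (Suc N) then coef \<omega> {} \<gamma> else 0) = 0" by simp
        qed
        ultimately show False using nz coef_\<nu> by simp
      qed
    qed
  qed
  then show ?thesis
    unfolding decomposed_def level
    by (intro exI[of _ 0] exI[of _ co] exI[of _ \<xi>]) (use xi xi_closed in auto)
qed

end

section \<open>Forms without poles and the cocycle of a syzygy\<close>

context multigraded
begin

text \<open>Without poles only finitely many exponents of a given degree exist, so the Laurent
  functions are polynomials again.\<close>

lemma homog_laurent_poly:
  fixes \<omega> :: "'a::comm_ring_1 form"
  assumes "homog b k {} \<omega>"
  shows "\<exists>P\<in>graded_part r n (\<lambda>j. b j + (\<Sum>i\<in>I. D i j)). \<forall>\<gamma>. coef \<omega> I \<gamma> = to_laurent P \<gamma>"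
proof -
  let ?b = "\<lambda>j. b j + (\<Sum>i\<in>I. D i j)"
  define P where "P = (\<Sum>t\<in>monomials r n ?b. Poly_Mapping.single t (coef \<omega> I (int_expo t)))"
  have lookup_P: "Poly_Mapping.lookup P t = (if t \<in> monomials r n ?b then coef \<omega> I (int_expo t) else 0)" for t
    by (auto simp: P_def lookup_sum lookup_single when_def sum.delta)
  have mon: "\<exists>t\<in>monomials r n ?b. \<gamma> = int_expo t" if nz: "coef \<omega> I \<gamma> \<noteq> 0" for \<gamma>
  proof -
    have \<gamma>: "\<gamma> \<in> expos {} ?b" using assms nz unfolding homog_def by blast
    then have out: "\<gamma> v = 0" if "v \<notin> indets r n" for v using that unfolding expos_def by blast
    have nn: "0 \<le> \<gamma> v" for v using \<gamma> unfolding expos_def by blast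
    define t :: expo where "t = Abs_poly_mapping (\<lambda>v. nat (\<gamma> v))"
    have fin: "finite {v. nat (\<gamma> v) \<noteq> 0}"
      by (rule finite_subset[OF _ finite_indets[of r n]]) (use out in force)
    have lookup_t: "Poly_Mapping.lookup t v = nat (\<gamma> v)" for v
      unfolding t_def using fin by (simp add: lookup_Abs_poly_mapping)
    have "Poly_Mapping.keys t \<subseteq> indets r n" using out by (force simp: in_keys_iff lookup_t)
    moreover have "int (group_degree n t j) = ?b j" if "j \<in> {1..r}" for j
    proof -
      have "(\<Sum>l\<le>n j. \<gamma> (j, l)) = ?b j" using \<gamma> that unfolding expos_def by blast
      then show ?thesis using nn by (simp add: group_degree_def lookup_t)
    qed
    ultimately have "t \<in> monomials r n ?b" by (simp add: monomials_def)
    moreover have "\<gamma> = int_expo t" by (rule ext) (simp add: int_expo_def lookup_t nn)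
    ultimately show ?thesis by blast
  qed
  have "coef \<omega> I \<gamma> = to_laurent P \<gamma>" for \<gamma>
  proof (cases "coef \<omega> I \<gamma> = 0")
    case False
    then obtain t where "t \<in> monomials r n ?b" "\<gamma> = int_expo t" using mon by blast
    then show ?thesis by (simp add: lookup_P)
  next
    case True
    show ?thesis
    proof (cases "\<exists>t. \<gamma> = int_expo t")
      case True
      then show ?thesis using \<open>coef \<omega> I \<gamma> = 0\<close> by (auto simp: lookup_P)
    qed (simp add: True to_laurent_outside)
  qed
  moreover have "P \<in> graded_part r n ?b"
    unfolding P_def by (intro graded_part_sum graded_part_single)
  ultimately show ?thesis by blast
qed

text \<open>The contracted volume form has the x i, up to sign, as its coefficients. By
  \<open>wedge_contract\<close> its differential is the sum of the f i times x i, so syzygies become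
  cocycles of form degree m - 1.\<close>

definition contract_top :: "(nat \<Rightarrow> 'a::comm_ring_1 mpol) \<Rightarrow> 'a form" where
  "contract_top x = contract m x (Form (\<lambda>I. if I = {..<m} then to_laurent 1 else (\<lambda>\<gamma>. 0)))"

lemma homog_contract_top:
  fixes x :: "nat \<Rightarrow> 'a::comm_ring_1 mpol"
  assumes "\<And>i. i < m \<Longrightarrow> x i \<in> graded_part r n (\<lambda>j. b j + (\<Sum>i'\<in>{..<m} - {i}. D i' j))"
  shows "homog b (m - 1) {} (contract_top x)"
  unfolding homog_def
proof (intro allI impI)
  fix I \<gamma> assume "coef (contract_top x) I \<gamma> \<noteq> 0"
  then obtain i t where *: "i < m" "i \<notin> I" "t \<in> Poly_Mapping.keys (x i)" "insert i I = {..<m}"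
    "to_laurent (1 :: 'a mpol) (\<lambda>v. \<gamma> v - int_expo t v) \<noteq> 0"
    unfolding contract_top_def by (auto elim!: contract_nonzero split: if_splits)
  then have I: "I = {..<m} - {i}" by auto
  obtain s where s: "(\<lambda>v. \<gamma> v - int_expo t v) = int_expo s" "Poly_Mapping.lookup (1 :: 'a mpol) s \<noteq> 0"
    using *(5) to_laurent_outside by (metis to_laurent_int_expo)
  then have "s = 0" by (auto simp: lookup_one when_def split: if_splits)
  then have "(\<lambda>v. \<gamma> v - int_expo t v) \<in> expos {} (\<lambda>j. 0)"
    using s(1) by (simp add: expos_def)
  then have "\<gamma> \<in> expos {} (\<lambda>j. 0 + (b j + (\<Sum>i'\<in>{..<m} - {i}. D i' j)))"
    by (rule expos_shift) (use assms[OF *(1)] *(3) in \<open>auto simp: graded_part_def\<close>)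
  then show "I \<subseteq> {..<m} \<and> card I = m - 1 \<and> \<gamma> \<in> expos {} (\<lambda>j. b j + (\<Sum>i\<in>I. D i j))"
    using *(1) by (simp add: I)
qed

lemma coef_contract_top:
  fixes x :: "nat \<Rightarrow> 'a::comm_ring_1 mpol"
  assumes "i < m"
  shows "coef (contract_top x) ({..<m} - {i}) \<gamma> = (if odd i then - to_laurent (x i) \<gamma> else to_laurent (x i) \<gamma>)"
proof -
  let ?T = "Form (\<lambda>I. if I = {..<m} then to_laurent (1 :: 'a mpol) else (\<lambda>\<gamma>. 0))"
  have other: "coef (ann i' (scale_form (x i') ?T)) ({..<m} - {i}) \<gamma> = 0" if "i' < m" "i' \<noteq> i" for i'
    using that assms by (auto simp: coef_ann)
  have "coef (contract_top x) ({..<m} - {i}) \<gamma> = (\<Sum>i'<m. coef (ann i' (scale_form (x i') ?T)) ({..<m} - {i}) \<gamma>)"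
    by (simp add: contract_top_def contract_def coef_sum ann_scale)
  also have "\<dots> = (\<Sum>i'<m. if i' = i then coef (ann i (scale_form (x i) ?T)) ({..<m} - {i}) \<gamma> else 0)"
    by (rule sum.cong[OF refl]) (use other in auto)
  also have "\<dots> = coef (ann i (scale_form (x i) ?T)) ({..<m} - {i}) \<gamma>" using assms by simp
  finally show ?thesis
  proof -
    assume e: "coef (contract_top x) ({..<m} - {i}) \<gamma> = coef (ann i (scale_form (x i) ?T)) ({..<m} - {i}) \<gamma>"
    have "{j \<in> {..<m} - {i}. j < i} = {..<i}" using assms by auto
    then have "card {j \<in> {..<m} - {i}. j < i} = i" by simp
    moreover have "insert i ({..<m} - {i}) = {..<m}" using assms by auto
    ultimately show ?thesis unfolding e coef_ann by (simp add: act_to_laurent)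
  qed
qed

lemma wedge_top:
  assumes "homog b m C \<omega>" "\<And>i. i < m \<Longrightarrow> f i \<in> graded_part r n (D i)"
  shows "wedge m f \<omega> = 0"
proof (rule form_eqI)
  fix I \<gamma>
  have "homog b (Suc m) C (wedge m f \<omega>)" using homog_wedge[of f "\<lambda>j. 0" b m C \<omega>] assms by simp
  moreover have "\<not> (I \<subseteq> {..<m} \<and> card I = Suc m)" using card_mono[of "{..<m}" I] by auto
  ultimately show "coef (wedge m f \<omega>) I \<gamma> = coef 0 I \<gamma>" unfolding homog_def by auto
qed

lemma homog_top_form:
  fixes P :: "'a::comm_ring_1 mpol"
  assumes "P \<in> graded_part r n (\<lambda>j. b j + (\<Sum>i<m. D i j))"
  shows "homog b m {} (Form (\<lambda>I. if I = {..<m} then to_laurent P else (\<lambda>\<gamma>. 0)))"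
  unfolding homog_def
proof (intro allI impI)
  fix I \<gamma> assume "coef (Form (\<lambda>I. if I = {..<m} then to_laurent P else (\<lambda>\<gamma>. 0))) I \<gamma> \<noteq> 0"
  then have I: "I = {..<m}" and nz: "to_laurent P \<gamma> \<noteq> 0" by (auto split: if_splits)
  obtain t where t: "\<gamma> = int_expo t" "Poly_Mapping.lookup P t \<noteq> 0"
    using nz to_laurent_outside by (metis to_laurent_int_expo)
  then have "t \<in> monomials r n (\<lambda>j. b j + (\<Sum>i<m. D i j))"
    using assms by (auto simp: graded_part_def in_keys_iff)
  moreover have "(\<lambda>v. \<gamma> v - int_expo t v) \<in> expos {} (\<lambda>j. 0)" by (simp add: t expos_def)
  ultimately have "\<gamma> \<in> expos {} (\<lambda>j. 0 + (b j + (\<Sum>i<m. D i j)))" by (intro expos_shift)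
  then show "I \<subseteq> {..<m} \<and> card I = m \<and> \<gamma> \<in> expos {} (\<lambda>j. b j + (\<Sum>i\<in>I. D i j))"
    by (simp add: I)
qed

lemma wedge_poly:
  fixes \<zeta> :: "'a::comm_ring_1 form"
  assumes "homog b k {} \<zeta>" "I \<subseteq> {..<m}"
  shows "\<exists>h. (\<forall>i\<in>I. h i \<in> graded_part r n (\<lambda>j. b j + (\<Sum>i'\<in>I - {i}. D i' j))) \<and>
    (\<forall>\<gamma>. coef (wedge m f \<zeta>) I \<gamma> = to_laurent (\<Sum>i\<in>I. f i * h i) \<gamma>)"
proof -
  have "\<forall>i. \<exists>P\<in>graded_part r n (\<lambda>j. b j + (\<Sum>i'\<in>I - {i}. D i' j)). \<forall>\<gamma>. coef \<zeta> (I - {i}) \<gamma> = to_laurent P \<gamma>"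
    using homog_laurent_poly[OF assms(1)] by blast
  then have "\<exists>q. \<forall>i. q i \<in> graded_part r n (\<lambda>j. b j + (\<Sum>i'\<in>I - {i}. D i' j)) \<and>
      coef \<zeta> (I - {i}) = to_laurent (q i)"
    by (intro choice) (force intro: ext)
  then obtain q where q: "\<And>i. q i \<in> graded_part r n (\<lambda>j. b j + (\<Sum>i'\<in>I - {i}. D i' j))"
    "\<And>i. coef \<zeta> (I - {i}) = to_laurent (q i)"
    by blast
  define h where "h i = (if odd (card {j\<in>I. j < i}) then - q i else q i)" for i
  have "coef (wedge m f \<zeta>) I \<gamma> = (\<Sum>i\<in>I. to_laurent (f i * h i) \<gamma>)" for \<gamma>
    unfolding coef_wedge[OF assms(2)]
    by (rule sum.cong[OF refl]) (simp add: q(2) h_def act_to_laurent to_laurent_uminus)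
  then show ?thesis
    using q(1) by (intro exI[of _ h]) (auto simp: to_laurent_sum h_def intro: graded_part_uminus)
qed

end

context koszul
begin

text \<open>A top form is a cocycle for degree reasons. With A and B empty, \<open>gap\<close> is
  the sum of the n j, so n + 2 forms are just enough for \<open>vanishing\<close>.\<close>

theorem koszul_top_exact:
  assumes m: "sum_dims r n + 2 \<le> m" and P: "P \<in> graded_part r n (\<lambda>j. a j + (\<Sum>i<m. D i j))"
  shows "\<exists>h. (\<forall>i<m. h i \<in> graded_part r n (\<lambda>j. a j + (\<Sum>i'\<in>{..<m} - {i}. D i' j))) \<and>
    P = (\<Sum>i<m. f i * h i)"
proof -
  let ?\<omega> = "Form (\<lambda>I. if I = {..<m} then to_laurent P else (\<lambda>\<gamma>. 0))"
  have \<omega>: "homog a m {} ?\<omega>" by (rule homog_top_form[OF P])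
  have "gap {} {} = sum_dims r n" by (simp add: gap_def sum_dims_def)
  then have "\<exists>\<eta>. homog a (m - 1) ({} \<union> {}) \<eta> \<and> all_expo (nonneg_on {}) (?\<omega> - wedge m f \<eta>)"
    using \<omega> m wedge_top[OF \<omega> f_graded] by (intro vanishing) auto
  then obtain \<eta> where \<eta>: "homog a (m - 1) {} \<eta>" "all_expo (nonneg_on {}) (?\<omega> - wedge m f \<eta>)" by auto
  obtain h where h: "\<forall>i\<in>{..<m}. h i \<in> graded_part r n (\<lambda>j. a j + (\<Sum>i'\<in>{..<m} - {i}. D i' j))"
      "\<forall>\<gamma>. coef (wedge m f \<eta>) {..<m} \<gamma> = to_laurent (\<Sum>i\<in>{..<m}. f i * h i) \<gamma>"
    using wedge_poly[OF \<eta>(1), of "{..<m}" f] by auto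
  have "coef (?\<omega> - wedge m f \<eta>) {..<m} \<gamma> = 0" for \<gamma>
    using \<eta>(2) unfolding all_expo_def nonneg_on_def by blast
  then have "P = (\<Sum>i<m. f i * h i)" using h(2) by (intro to_laurent_inject) simp
  then show ?thesis using h(1) by auto
qed

end

section \<open>Descent along the cofactors\<close>

context sylvester_koszul
begin

text \<open>When a group is finished, the induction hypothesis inverts its last variable although
  \<eta> is regular there. All its other variables are passed by then, so by
  \<open>group_not_negative\<close> a term with a pole at the last variable is nonnegative at a
  passed one and may be dropped.\<close>

lemma decomposed_project:
  assumes c: "c \<le> N" and lev: "level (Suc c) = Suc (level c)"
    and \<eta>: "homog a (N - c) (passed (Suc c) \<union> closed_lasts c) \<eta>"
    and dec: "decomposed (Suc c) (passed (Suc c) \<union> closed_lasts (Suc c)) \<eta>"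
  shows "decomposed (Suc c) (passed (Suc c) \<union> closed_lasts c) \<eta>"
proof -
  let ?l = "level c" let ?C' = "passed (Suc c) \<union> closed_lasts (Suc c)" let ?C = "passed (Suc c) \<union> closed_lasts c"
  let ?p = "\<lambda>\<gamma>. (0::int) \<le> \<gamma> (?l, n ?l)"
  have lr: "?l < r" using lev level_range[of "Suc c"] by simp
  have l1: "?l \<in> {1..r}" by (rule level_range)
  \<comment> \<open>Keeps the form degree N - c - 1 of \<zeta> positive, as
    \<open>group_not_negative\<close> demands.\<close>
  have rem: "Suc c + 2 \<le> Suc N" using remaining[OF c lr] later_dims_pos[OF lr] by simp
  have C': "?C' = insert (?l, n ?l) ?C"
    using l1 by (auto simp: closed_lasts_def lev atLeastLessThanSuc)
  obtain \<zeta> \<xi> co where \<zeta>0: "if Suc c \<le> N then homog a (N - Suc c) ?C' \<zeta> else \<zeta> = 0"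
    and \<xi>0: "\<forall>j\<in>{1..<level (Suc c)}. homog a (Suc N - Suc c) ?C' (\<xi> j) \<and>
        all_expo (\<lambda>\<gamma>. 0 \<le> \<gamma> (j, n j)) (\<xi> j) \<and>
        all_expo (nonneg_on (passed (Suc c) - group j)) (wedge m f (\<xi> j))"
    and \<nu>0: "all_expo (nonneg_on (passed (Suc c))) (\<eta> - wedge m f \<zeta> -
       (\<Sum>\<alpha>\<in>alphas. scale_form (Poly_Mapping.single 0 (co \<alpha>)) (residual \<alpha> (Suc c))) -
       (\<Sum>j\<in>{1..<level (Suc c)}. \<xi> j))"
    by (rule decomposedE[OF dec])
  have \<zeta>: "homog a (N - Suc c) ?C' \<zeta>" using \<zeta>0 rem by auto
  have \<xi>: "homog a (N - c) ?C' (\<xi> j) \<and> all_expo (\<lambda>\<gamma>. 0 \<le> \<gamma> (j, n j)) (\<xi> j) \<and>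
        all_expo (nonneg_on (passed (Suc c) - group j)) (wedge m f (\<xi> j))" if "j \<in> {1..<Suc ?l}" for j
    using \<xi>0 that unfolding lev diff_Suc_Suc by blast
  note \<nu> = \<nu>0[unfolded lev]
  have neg: "all_expo (nonneg_on (passed (Suc c) - S)) (restrict_expo (\<lambda>\<gamma>. \<not> ?p \<gamma>) \<omega>)"
    if hyp: "homog a k ?C' \<omega>" "1 \<le> k" "S \<inter> group ?l = {}" for k \<omega> S
    unfolding all_expo_def
  proof (intro allI impI)
    fix I \<gamma> assume "coef (restrict_expo (\<lambda>\<gamma>. \<not> ?p \<gamma>) \<omega>) I \<gamma> \<noteq> 0"
    then have "\<not> ?p \<gamma>" "coef \<omega> I \<gamma> \<noteq> 0" by (auto simp: coef_restrict split: if_splits)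
    then obtain t where t: "t \<le> n ?l" "0 \<le> \<gamma> (?l, t)" "t \<noteq> n ?l"
      using group_not_negative[OF hyp(1,2) _ l1] by blast
    then have "(?l, t) \<in> passed (Suc c)" by (intro passed_next_level c lev) simp
    moreover have "(?l, t) \<notin> S" using hyp(3) t(1) by (auto simp: mem_group)
    ultimately show "nonneg_on (passed (Suc c) - S) \<gamma>" using t(2) unfolding nonneg_on_def by blast
  qed
  let ?\<xi> = "\<lambda>j. restrict_expo ?p (\<xi> j)"
  have split: "\<omega> = restrict_expo ?p \<omega> + restrict_expo (\<lambda>\<gamma>. \<not> ?p \<gamma>) \<omega>" for \<omega> :: "'a form"
    by (rule restrict_compl)
  have hr: "homog a k ?C (restrict_expo ?p \<omega>)" if "homog a k ?C' \<omega>" for k \<omega>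
    by (rule homog_restrict_nonneg[OF that]) (auto simp: C')
  \<comment> \<open>The error term of the group just finished is regular at its last variable by
    assumption, so it has no part to drop.\<close>
  have \<xi>_last: "restrict_expo (\<lambda>\<gamma>. \<not> ?p \<gamma>) (\<xi> ?l) = 0"
    using \<xi>[of ?l] l1 by (intro form_eqI) (auto simp: coef_restrict all_expo_def)
  have neg_wedge: "all_expo (nonneg_on (passed (Suc c) - group j)) (wedge m f (restrict_expo (\<lambda>\<gamma>. \<not> ?p \<gamma>) (\<xi> j)))"
    if j: "j \<in> {1..<Suc ?l}" for j
  proof (cases "j = ?l")
    case False
    then have "group j \<inter> group ?l = {}" by (auto simp: group_def)
    then show ?thesis using \<xi>[OF j] rem by (intro all_expo_wedge neg[of "N - c"]) auto
  qed (simp add: \<xi>_last)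
  have "homog a (N - c) ?C (?\<xi> j) \<and> all_expo (\<lambda>\<gamma>. 0 \<le> \<gamma> (j, n j)) (?\<xi> j) \<and>
      all_expo (nonneg_on (passed (Suc c) - group j)) (wedge m f (?\<xi> j))" if j: "j \<in> {1..<Suc ?l}" for j
  proof (intro conjI)
    show "all_expo (\<lambda>\<gamma>. 0 \<le> \<gamma> (j, n j)) (?\<xi> j)" using \<xi>[OF j] by (auto simp: all_expo_def coef_restrict)
    have "wedge m f (?\<xi> j) = wedge m f (\<xi> j) - wedge m f (restrict_expo (\<lambda>\<gamma>. \<not> ?p \<gamma>) (\<xi> j))"
      by (subst (2) split) (simp add: wedge_add)
    then show "all_expo (nonneg_on (passed (Suc c) - group j)) (wedge m f (?\<xi> j))"
      using \<xi>[OF j] neg_wedge[OF j] by (simp add: all_expo_diff)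
  qed (use hr \<xi>[OF j] in blast)
  moreover have "all_expo (nonneg_on (passed (Suc c))) (\<eta> - wedge m f (restrict_expo ?p \<zeta>) -
       (\<Sum>\<alpha>\<in>alphas. scale_form (Poly_Mapping.single 0 (co \<alpha>)) (residual \<alpha> (Suc c))) - (\<Sum>j\<in>{1..<Suc ?l}. ?\<xi> j))"
    (is "all_expo _ ?\<nu>'")
  proof -
    have "wedge m f \<zeta> = wedge m f (restrict_expo ?p \<zeta>) + wedge m f (restrict_expo (\<lambda>\<gamma>. \<not> ?p \<gamma>) \<zeta>)"
      by (subst (1) split) (simp add: wedge_add)
    moreover have "(\<Sum>j\<in>{1..<Suc ?l}. \<xi> j) = (\<Sum>j\<in>{1..<Suc ?l}. ?\<xi> j) +
        (\<Sum>j\<in>{1..<Suc ?l}. restrict_expo (\<lambda>\<gamma>. \<not> ?p \<gamma>) (\<xi> j))"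
      unfolding sum.distrib[symmetric] by (rule sum.cong[OF refl split])
    ultimately have "?\<nu>' = (\<eta> - wedge m f \<zeta> - (\<Sum>\<alpha>\<in>alphas. scale_form (Poly_Mapping.single 0 (co \<alpha>)) (residual \<alpha> (Suc c)))
        - (\<Sum>j\<in>{1..<Suc ?l}. \<xi> j)) + wedge m f (restrict_expo (\<lambda>\<gamma>. \<not> ?p \<gamma>) \<zeta>) +
        (\<Sum>j\<in>{1..<Suc ?l}. restrict_expo (\<lambda>\<gamma>. \<not> ?p \<gamma>) (\<xi> j))"
      by simp
    moreover have "all_expo (nonneg_on (passed (Suc c))) (restrict_expo (\<lambda>\<gamma>. \<not> ?p \<gamma>) \<zeta>)"
      using neg[OF \<zeta>, of "{}"] rem by simp
    moreover have "all_expo (nonneg_on (passed (Suc c))) (restrict_expo (\<lambda>\<gamma>. \<not> ?p \<gamma>) (\<xi> j))"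
      if "j \<in> {1..<Suc ?l}" for j
      using neg[of "N - c" "\<xi> j" "{}"] \<xi>[OF that] rem by simp
    ultimately show ?thesis using \<nu> by (simp only:) (intro all_expo_add all_expo_sum all_expo_wedge; simp)
  qed
  ultimately show ?thesis
    unfolding decomposed_def lev
    using hr[OF \<zeta>] rem
    by (intro exI[of _ "restrict_expo ?p \<zeta>"] exI[of _ co] exI[of _ ?\<xi>]) auto
qed

text \<open>No group is exhausted before the end: up to r - 1 the last variable has no cofactor, and
  in group r the current or a later one is still open.\<close>

lemma passed_group_card:
  assumes "c \<le> N" "j \<in> {1..r}"
  shows "card (passed c \<inter> group j) \<le> n j"
proof -
  obtain x where x: "x \<in> group j" "x \<notin> passed c"
  proof (cases "j < r")
    case True
    then have "(j, n j) \<notin> set cofac" by (simp add: mem_cofac)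
    then have "(j, n j) \<notin> passed c" using passed_subset by blast
    then show ?thesis using that[of "(j, n j)"] by (simp add: mem_group)
  next
    case False
    then have j: "j = r" using assms(2) by simp
    show ?thesis
    proof (cases "level c = r")
      case True
      have "cofac ! c \<in> group r" using cofac_mem[OF assms(1)] True assms(1)
        by (auto simp: mem_group mem_cofac level_def indets_def)
      then show ?thesis using that cofac_notin_passed[OF assms(1)] j by blast
    next
      case False
      then have "level c < r" using level_range[of c] by simp
      then have "(r, 0) \<notin> passed c" using passed_group[OF assms(1), of "(r, 0)"] by auto
      then show ?thesis using that[of "(r, 0)"] j by (simp add: mem_group)
    qed
  qed
  then have "card (passed c \<inter> group j) < card (group j)" by (intro psubset_card_mono) auto
  then show ?thesis by (simp add: card_group)
qed

text \<open>After inverting the next cofactor variable v, \<open>vanishing\<close> gives a primitive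
  \<eta>, which is a cocycle modulo regularity at v. Its decomposition at c + 1 is differentiated:
  the residuals move down by one, \<zeta> disappears because the differential squares to zero, and
  the part of the remainder that is regular at v becomes the new primitive.\<close>

lemma decomposed_step:
  assumes c: "c \<le> N"
    and \<omega>: "homog a (Suc N - c) (passed c \<union> closed_lasts c) \<omega>" "all_expo (nonneg_on (passed c)) (wedge m f \<omega>)"
    and IH: "\<And>\<eta>. homog a (N - c) (passed (Suc c) \<union> closed_lasts (Suc c)) \<eta> \<Longrightarrow>
      all_expo (nonneg_on (passed (Suc c))) (wedge m f \<eta>) \<Longrightarrow>
      decomposed (Suc c) (passed (Suc c) \<union> closed_lasts (Suc c)) \<eta>"
  shows "decomposed c (passed c \<union> closed_lasts c) \<omega>"
proof -
  let ?l = "level c" let ?v = "cofac ! c" let ?A = "passed c" let ?B = "closed_lasts c"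
  have v: "?v \<in> set cofac" "?v \<notin> ?A" "?v \<notin> ?B" "?v \<in> indets r n"
    using cofac_mem[OF c] cofac_notin_passed[OF c] closed_lasts_notin[of c] mem_cofac by blast+
  have vl: "?v \<in> group ?l" using v(4) c by (auto simp: mem_group level_def indets_def)
  have Bmeet: "insert ?v ?B \<inter> group j \<noteq> {}" if "j \<in> {1..?l}" for j
  proof (cases "j = ?l")
    case False
    then have "(j, n j) \<in> ?B \<inter> group j" using that by (auto simp: closed_lasts_def mem_group)
    then show ?thesis by blast
  qed (use vl in blast)
  \<comment> \<open>In group r the set B meets every group. Earlier, only the groups after the
    current one are missed, and their total dimension leaves room for two form degrees by
    \<open>remaining\<close>.\<close>
  have big: "2 + gap ?A (insert ?v ?B) \<le> Suc N - c \<or> (\<forall>j\<in>{1..r}. insert ?v ?B \<inter> group j \<noteq> {})"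
  proof (cases "?l = r")
    case False
    then have lr: "?l < r" using level_range[of c] by simp
    have "gap ?A (insert ?v ?B) \<le> (\<Sum>j\<in>{1..r}. if ?l < j then n j else 0)"
      unfolding gap_def
    proof (rule sum_mono)
      fix j assume "j \<in> {1..r}"
      then show "(if insert ?v ?B \<inter> group j = {} then n j - card (?A \<inter> group j) else 0)
          \<le> (if ?l < j then n j else 0)"
        using Bmeet[of j] by auto
    qed
    also have "\<dots> = (\<Sum>j\<in>{j\<in>{1..r}. ?l < j}. n j)" by (rule sum.inter_filter[symmetric]) simp
    also have "{j\<in>{1..r}. ?l < j} = {?l<..r}" using level_range[of c] by auto
    finally have "gap ?A (insert ?v ?B) \<le> later_dims ?l" by (simp add: later_dims_def)
    then show ?thesis using remaining[OF c lr] by (intro disjI1) arith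
  next
    case True
    then show ?thesis using Bmeet by (intro disjI2 ballI) simp
  qed
  have sub: "?A \<union> insert ?v ?B \<subseteq> indets r n"
    using passed_subset closed_lasts_indets v(4) mem_cofac by blast
  have disj: "?A \<inter> insert ?v ?B = {}" using v(2) closed_lasts_notin passed_subset by blast
  have "\<exists>\<eta>. homog a (Suc N - c - 1) (?A \<union> insert ?v ?B) \<eta> \<and> all_expo (nonneg_on ?A) (\<omega> - wedge m f \<eta>)"
    by (rule vanishing[OF disj sub passed_group_card[OF c]])
       (use c big \<omega> in \<open>auto intro: homog_mono\<close>)
  then obtain \<eta> where \<eta>: "homog a (N - c) (passed (Suc c) \<union> ?B) \<eta>" "all_expo (nonneg_on ?A) (\<omega> - wedge m f \<eta>)"
    using c by (auto simp: passed_Suc)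
  have coc: "all_expo (nonneg_on (passed (Suc c))) (wedge m f \<eta>)"
    using connecting_cocycle[OF \<omega>(1) _ \<eta>(2)] v by (simp add: passed_Suc[OF c])
  have "?B \<subseteq> closed_lasts (Suc c)"
    using level_mono_Suc(1)[OF c] by (auto simp: closed_lasts_def)
  then have "homog a (N - c) (passed (Suc c) \<union> closed_lasts (Suc c)) \<eta>"
    using \<eta>(1) by (rule_tac homog_mono) auto
  then have dec0: "decomposed (Suc c) (passed (Suc c) \<union> closed_lasts (Suc c)) \<eta>" using IH coc by blast
  have dec: "decomposed (Suc c) (passed (Suc c) \<union> ?B) \<eta>"
  proof (cases "level (Suc c) = ?l")
    case True
    then show ?thesis using dec0 by (simp add: closed_lasts_def)
  next
    case False
    then have "level (Suc c) = Suc ?l" using level_mono_Suc[OF c] by simp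
    then show ?thesis using decomposed_project[OF c _ \<eta>(1) dec0] by blast
  qed
  let ?C = "passed (Suc c) \<union> ?B" let ?J = "{1..<level (Suc c)}"
  let ?\<nu> = "\<lambda>\<zeta> co \<xi>. \<eta> - wedge m f \<zeta> -
       (\<Sum>\<alpha>\<in>alphas. scale_form (Poly_Mapping.single 0 (co \<alpha>)) (residual \<alpha> (Suc c))) - (\<Sum>j\<in>?J. \<xi> j)"
  obtain \<zeta> \<xi> co where \<zeta>: "if Suc c \<le> N then homog a (N - Suc c) ?C \<zeta> else \<zeta> = 0"
    and \<xi>0: "\<forall>j\<in>?J. homog a (Suc N - Suc c) ?C (\<xi> j) \<and> all_expo (\<lambda>\<gamma>. 0 \<le> \<gamma> (j, n j)) (\<xi> j) \<and>
        all_expo (nonneg_on (passed (Suc c) - group j)) (wedge m f (\<xi> j))"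
    and \<nu>: "all_expo (nonneg_on (passed (Suc c))) (?\<nu> \<zeta> co \<xi>)"
    by (rule decomposedE[OF dec])
  note \<xi> = bspec[OF \<xi>0[unfolded diff_Suc_Suc]]
  let ?\<nu> = "\<eta> - wedge m f \<zeta> -
       (\<Sum>\<alpha>\<in>alphas. scale_form (Poly_Mapping.single 0 (co \<alpha>)) (residual \<alpha> (Suc c))) - (\<Sum>j\<in>?J. \<xi> j)"
  have h\<zeta>: "homog a (N - c) ?C (wedge m f \<zeta>)"
  proof (cases "Suc c \<le> N")
    case True
    then have "homog a (Suc (N - Suc c)) ?C (wedge m f \<zeta>)" using \<zeta> homog_wedge_f by auto
    then show ?thesis using True by (simp add: Suc_diff_Suc)
  qed (use \<zeta> in simp)
  \<comment> \<open>If the level rises, the residual c + 1 still has no pole at the last variable of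
    the group just finished, since no cofactor of a later group is passed yet.\<close>
  have hres: "homog a (N - c) ?C (residual \<alpha> (Suc c))" if \<alpha>: "\<alpha> \<in> alphas" for \<alpha>
  proof -
    have hc: "homog a (N - c) (passed (Suc c) \<union> closed_lasts (Suc c)) (residual \<alpha> (Suc c))"
      using homog_residual[OF \<alpha>, of "Suc c"] c by simp
    have nn: "0 \<le> chain_expo \<alpha> (Suc c) u" if "u \<notin> ?C" for u
    proof (cases "u \<in> closed_lasts (Suc c)")
      case True
      then obtain x where x: "u = (x, n x)" "1 \<le> x" "x < level (Suc c)" by (auto simp: closed_lasts_def)
      have "\<not> x < level c"
      proof
        assume "x < level c"
        then have "u \<in> closed_lasts c" using x by (auto simp: closed_lasts_def)
        then show False using that by blast
      qed
      then have "x = level c" using x level_mono_Suc[OF c] by simp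
      then have u: "level c = fst u" "u = (level c, n (level c))" "level c < r"
        using x level_range[of "Suc c"] by auto
      have "fst x \<le> fst u" if "x \<in> passed (Suc c)" for x
        using that passed_group[OF c, of x] u(1) c by (auto simp: passed_Suc level_def)
      then have none: "{x \<in> passed (Suc c). fst u < fst x} = {}" by (auto simp only: leD)
      show ?thesis using u(1,3) that level_range[of c] by (auto simp: chain_expo_def none)
    next
      case False
      then show ?thesis using that c by (intro chain_expo_nonneg) auto
    qed
    have "all_expo (\<lambda>\<gamma>. 0 \<le> \<gamma> u) (residual \<alpha> (Suc c))" if "u \<notin> ?C" for u
      unfolding residual_def by (rule all_expo_wedges) (use nn[OF that] in simp_all)
    then have "0 \<le> \<gamma> u" if "coef (residual \<alpha> (Suc c)) I \<gamma> \<noteq> 0" "u \<notin> ?C" for I \<gamma> u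
      using that unfolding all_expo_def by blast
    then show ?thesis using hc unfolding homog_def expos_def by blast
  qed
  have h\<nu>: "homog a (N - c) ?C ?\<nu>"
  proof -
    have "homog a (N - c) ?C (scale_form (Poly_Mapping.single 0 (co \<alpha>)) (residual \<alpha> (Suc c)))" if "\<alpha> \<in> alphas" for \<alpha>
      unfolding homog_def
    proof (intro allI impI)
      fix I \<gamma> assume "coef (scale_form (Poly_Mapping.single 0 (co \<alpha>)) (residual \<alpha> (Suc c))) I \<gamma> \<noteq> 0"
      then have "coef (residual \<alpha> (Suc c)) I \<gamma> \<noteq> 0" by (metis act_const coef_scale mult_zero_right)
      then show "I \<subseteq> {..<m} \<and> card I = N - c \<and> \<gamma> \<in> expos ?C (\<lambda>j. a j + (\<Sum>i\<in>I. D i j))"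
        using hres[OF that] unfolding homog_def by blast
    qed
    then show ?thesis using \<eta>(1) h\<zeta> \<xi> by (intro homog_diff homog_sum) auto
  qed
  let ?p = "\<lambda>\<gamma>. (0::int) \<le> \<gamma> ?v"
  let ?ps = "restrict_expo ?p" and ?ng = "restrict_expo (\<lambda>\<gamma>. \<not> ?p \<gamma>)"
  have ng: "all_expo (nonneg_on (?A - S)) (?ng \<omega>)"
    if "all_expo (nonneg_on (passed (Suc c) - S)) \<omega>" for S and \<omega> :: "'a form"
    using that unfolding all_expo_def coef_restrict nonneg_on_def by (auto simp: passed_Suc[OF c])
  have split: "\<omega> = ?ps \<omega> + ?ng \<omega>" for \<omega> :: "'a form" by (rule restrict_compl)
  have hps: "homog a k (?A \<union> ?B) (?ps \<omega>)" if "homog a k ?C \<omega>" for k \<omega>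
    by (rule homog_restrict_nonneg[OF that]) (auto simp: passed_Suc[OF c])
  \<comment> \<open>New error terms are the parts of the differentials that are regular at v. The
    other parts are zero modulo the passed variables, and so are their differentials, which makes
    the new terms cocycles.\<close>
  let ?\<xi> = "\<lambda>j. ?ps (wedge m f (\<xi> j))"
  have Jsub: "{1..<?l} \<subseteq> ?J" using level_mono_Suc(1)[OF c] by auto
  have new_\<xi>: "homog a (Suc N - c) (?A \<union> ?B) (?\<xi> j) \<and> all_expo (\<lambda>\<gamma>. 0 \<le> \<gamma> (j, n j)) (?\<xi> j) \<and>
      all_expo (nonneg_on (?A - group j)) (wedge m f (?\<xi> j))" if "j \<in> {1..<?l}" for j
  proof (intro conjI)
    have j: "j \<in> ?J" using that Jsub by blast
    have "homog a (Suc (N - c)) ?C (wedge m f (\<xi> j))" using \<xi>[OF j] homog_wedge_f by blast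
    then show "homog a (Suc N - c) (?A \<union> ?B) (?\<xi> j)" using c by (intro hps) (simp add: Suc_diff_le)
    have "all_expo (\<lambda>\<gamma>. 0 \<le> \<gamma> (j, n j)) (wedge m f (\<xi> j))" using \<xi>[OF j] by (intro all_expo_wedge) auto
    then show "all_expo (\<lambda>\<gamma>. 0 \<le> \<gamma> (j, n j)) (?\<xi> j)" by (auto simp: all_expo_def coef_restrict)
    have "wedge m f (wedge m f (\<xi> j)) = wedge m f (?\<xi> j) + wedge m f (?ng (wedge m f (\<xi> j)))"
      by (subst (2) split) (simp add: wedge_add)
    then have "wedge m f (?\<xi> j) = - wedge m f (?ng (wedge m f (\<xi> j)))" by (simp add: eq_neg_iff_add_eq_0)
    then show "all_expo (nonneg_on (?A - group j)) (wedge m f (?\<xi> j))"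
      using ng[of "group j"] \<xi>[OF j] by (simp add: all_expo_uminus all_expo_wedge)
  qed
  \<comment> \<open>Here an error term dies. The variable v lies in the same group j, so being
    closed without the use of group j already means being closed modulo the variables passed before
    v.\<close>
  have last_\<xi>: "all_expo (nonneg_on ?A) (wedge m f (\<xi> j))" if "j \<in> ?J - {1..<?l}" for j
  proof -
    have "j = ?l" using that level_mono_Suc[OF c] by auto
    then have "passed (Suc c) - group j \<subseteq> ?A" using vl by (auto simp: passed_Suc[OF c])
    then show ?thesis using \<xi>[of j] that by (auto intro: all_expo_mono nonneg_on_mono)
  qed
  have expand: "wedge m f \<eta> = wedge m f (?ps ?\<nu>) + wedge m f (?ng ?\<nu>) +
      (\<Sum>\<alpha>\<in>alphas. scale_form (Poly_Mapping.single 0 (co \<alpha>)) (wedge m f (residual \<alpha> (Suc c)))) +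
      (\<Sum>j\<in>?J. wedge m f (\<xi> j))"
  proof -
    have "\<eta> = ?ps ?\<nu> + ?ng ?\<nu> + wedge m f \<zeta> +
        (\<Sum>\<alpha>\<in>alphas. scale_form (Poly_Mapping.single 0 (co \<alpha>)) (residual \<alpha> (Suc c))) + (\<Sum>j\<in>?J. \<xi> j)"
      using split[of ?\<nu>] by (simp add: algebra_simps)
    then have "wedge m f \<eta> = wedge m f (?ps ?\<nu> + ?ng ?\<nu> + wedge m f \<zeta> +
        (\<Sum>\<alpha>\<in>alphas. scale_form (Poly_Mapping.single 0 (co \<alpha>)) (residual \<alpha> (Suc c))) + (\<Sum>j\<in>?J. \<xi> j))"
      by (rule arg_cong)
    then show ?thesis by (simp only: wedge_add wedge_sum wedge_scale wedge_wedge_self add_0_right)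
  qed
  have "(\<Sum>j\<in>?J. wedge m f (\<xi> j)) = (\<Sum>j\<in>?J - {1..<?l}. wedge m f (\<xi> j)) + (\<Sum>j\<in>{1..<?l}. wedge m f (\<xi> j))"
    using Jsub by (intro sum.subset_diff) auto
  moreover have "(\<Sum>j\<in>{1..<?l}. wedge m f (\<xi> j)) = (\<Sum>j\<in>{1..<?l}. ?\<xi> j) + (\<Sum>j\<in>{1..<?l}. ?ng (wedge m f (\<xi> j)))"
    unfolding sum.distrib[symmetric] by (rule sum.cong[OF refl split])
  moreover have "(\<Sum>\<alpha>\<in>alphas. scale_form (Poly_Mapping.single 0 (co \<alpha>)) (wedge m f (residual \<alpha> (Suc c)))) =
      (\<Sum>\<alpha>\<in>alphas. scale_form (Poly_Mapping.single 0 (co \<alpha>)) (wedge m f (residual \<alpha> (Suc c)) - residual \<alpha> c)) +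
      (\<Sum>\<alpha>\<in>alphas. scale_form (Poly_Mapping.single 0 (co \<alpha>)) (residual \<alpha> c))"
    by (simp add: scale_form.scale_right_diff_distrib sum_subtractf)
  ultimately have final: "\<omega> - wedge m f (?ps ?\<nu>) - (\<Sum>\<alpha>\<in>alphas. scale_form (Poly_Mapping.single 0 (co \<alpha>)) (residual \<alpha> c))
      - (\<Sum>j\<in>{1..<?l}. ?\<xi> j) =
      (\<omega> - wedge m f \<eta>) + wedge m f (?ng ?\<nu>) +
      (\<Sum>\<alpha>\<in>alphas. scale_form (Poly_Mapping.single 0 (co \<alpha>)) (wedge m f (residual \<alpha> (Suc c)) - residual \<alpha> c)) +
      (\<Sum>j\<in>?J - {1..<?l}. wedge m f (\<xi> j)) + (\<Sum>j\<in>{1..<?l}. ?ng (wedge m f (\<xi> j)))"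
    unfolding expand by (simp add: algebra_simps)
  have ng_\<nu>: "all_expo (nonneg_on ?A) (?ng ?\<nu>)" using ng[of "{}" ?\<nu>] \<nu> by simp
  have ng_\<xi>: "all_expo (nonneg_on ?A) (?ng (wedge m f (\<xi> j)))" if "j \<in> {1..<?l}" for j
    using ng[of "group j" "wedge m f (\<xi> j)"] \<xi>[of j] that Jsub
    by (auto intro: all_expo_mono nonneg_on_mono)
  have "all_expo (nonneg_on ?A) (\<omega> - wedge m f (?ps ?\<nu>) -
      (\<Sum>\<alpha>\<in>alphas. scale_form (Poly_Mapping.single 0 (co \<alpha>)) (residual \<alpha> c)) - (\<Sum>j\<in>{1..<?l}. ?\<xi> j))"
    unfolding final
    by (intro all_expo_add all_expo_sum \<eta>(2) all_expo_wedge all_expo_scale residual_step[OF c] last_\<xi> ng_\<xi> ng_\<nu>)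
       auto
  then show ?thesis
    unfolding decomposed_def using hps[OF h\<nu>] new_\<xi> c
    by (intro exI[of _ "?ps ?\<nu>"] exI[of _ co] exI[of _ ?\<xi>]) auto
qed

theorem cocycle_decomposed:
  assumes "c \<le> Suc N" "homog a (Suc N - c) (passed c \<union> closed_lasts c) \<omega>"
    "all_expo (nonneg_on (passed c)) (wedge m f \<omega>)"
  shows "decomposed c (passed c \<union> closed_lasts c) \<omega>"
  using assms
proof (induction c arbitrary: \<omega> rule: inc_induct)
  case base
  then show ?case by (intro decomposed_last) simp
next
  case (step c)
  show ?case
  proof (rule decomposed_step)
    show "c \<le> N" using step.hyps by simp
    fix \<eta> assume "homog a (N - c) (passed (Suc c) \<union> closed_lasts (Suc c)) \<eta>"
      "all_expo (nonneg_on (passed (Suc c))) (wedge m f \<eta>)"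
    then show "decomposed (Suc c) (passed (Suc c) \<union> closed_lasts (Suc c)) \<eta>"
      using step.IH[of \<eta>] by simp
  qed (use step.prems in simp_all)
qed

end

section \<open>Sylvester forms as coefficients of the residuals\<close>

context sylvester_koszul
begin

definition front :: "expo \<Rightarrow> expo" where
  "front \<alpha> = (\<Sum>j\<in>{1..<r}. Poly_Mapping.single (j, n j) ((Poly_Mapping.lookup \<alpha> (j, n j) + 1) * later_dims j))"

definition sylv :: "expo \<Rightarrow> 'a mpol" where
  "sylv \<alpha> = Poly_Mapping.single (front \<alpha>) 1 * det (mat (Suc N) (Suc N) (\<lambda>(i, c). F \<alpha> c i))"

lemma lookup_front:
  "Poly_Mapping.lookup (front \<alpha>) v = (if fst v \<in> {1..<r} \<and> snd v = n (fst v)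
    then (Poly_Mapping.lookup \<alpha> v + 1) * later_dims (fst v) else 0)"
proof -
  have "Poly_Mapping.lookup (\<Sum>j\<in>S. Poly_Mapping.single (j, n j)
      ((Poly_Mapping.lookup \<alpha> (j, n j) + 1) * later_dims j)) v =
      (if fst v \<in> S \<and> snd v = n (fst v) then (Poly_Mapping.lookup \<alpha> v + 1) * later_dims (fst v) else 0)"
    if "finite S" for S
    using that
  proof induction
    case (insert j S)
    then show ?case by (cases v) (auto simp: lookup_add lookup_single when_def)
  qed simp
  then show ?thesis by (simp add: front_def)
qed

lemma chain_expo_front: "chain_expo \<alpha> 0 = int_expo (front \<alpha>)"
  by (rule ext) (simp add: chain_expo_0 int_expo_def lookup_front algebra_simps)

text \<open>The first N + 1 indices belong to f_0, ..., f_n; the extra form comes last. The minor on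
  these rows is the determinant in the definition of the Sylvester form.\<close>

lemma coef_residual_0:
  assumes "Suc N \<le> m"
  shows "coef (residual \<alpha> 0) {..<Suc N} \<gamma> = to_laurent (sylv \<alpha>) \<gamma>"
proof -
  let ?Fs = "map (F \<alpha>) [0..<Suc N]"
  have d: "delta (chain_expo \<alpha> 0) = to_laurent (Poly_Mapping.single (front \<alpha>) 1)"
    by (rule ext) (simp add: delta_def chain_expo_front to_laurent_single)
  have M: "mat (card {..<Suc N}) (card {..<Suc N}) (\<lambda>(s, t). (?Fs ! t) (sorted_list_of_set {..<Suc N} ! s)) =
      mat (Suc N) (Suc N) (\<lambda>(i, c). F \<alpha> c i)"
    by (rule eq_matI) (auto simp: lessThan_atLeast0 simp del: upt_Suc)
  have "coef (wedges m ?Fs (delta (chain_expo \<alpha> 0))) {..<Suc N} \<gamma> =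
      act (det (mat (card {..<Suc N}) (card {..<Suc N}) (\<lambda>(s, t). (?Fs ! t) (sorted_list_of_set {..<Suc N} ! s))))
      (delta (chain_expo \<alpha> 0)) \<gamma>"
    by (rule wedges_eq_det) (use assms in auto)
  then show ?thesis
    unfolding M d by (simp add: residual_def d act_to_laurent sylv_def mult.commute del: upt_Suc)
qed

lemma homog_residual_0: "\<alpha> \<in> alphas \<Longrightarrow> homog a (Suc N) {} (residual \<alpha> 0)"
  using homog_residual[of \<alpha> 0] by simp

lemma sylv_graded:
  assumes "Suc N \<le> m" "\<alpha> \<in> alphas"
  shows "sylv \<alpha> \<in> graded_part r n (\<lambda>j. a j + (\<Sum>i<Suc N. D i j))"
proof -
  obtain P where P: "P \<in> graded_part r n (\<lambda>j. a j + (\<Sum>i<Suc N. D i j))"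
    "\<forall>\<gamma>. coef (residual \<alpha> 0) {..<Suc N} \<gamma> = to_laurent P \<gamma>"
    using homog_laurent_poly[OF homog_residual_0[OF assms(2)], of "{..<Suc N}"] by blast
  then have "P = sylv \<alpha>" by (intro to_laurent_inject) (simp add: coef_residual_0[OF assms(1)])
  then show ?thesis using P(1) by simp
qed

text \<open>Read off from \<open>wedge_residual_0\<close> at the full index set: the coefficient
  omitting the last form is the Sylvester form, and the other coefficients serve as cofactors of
  f_0, ..., f_n.\<close>

theorem sylv_annihilated:
  assumes m: "m = Suc (Suc N)" and \<alpha>: "\<alpha> \<in> alphas"
  shows "\<exists>h. (\<forall>i<Suc N. h i \<in> graded_part r n (\<lambda>j. a j + (\<Sum>i'\<in>{..<m} - {i}. D i' j))) \<and>
    f (Suc N) * sylv \<alpha> = (\<Sum>i<Suc N. f i * h i)"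
proof -
  let ?I = "{..<m}"
  have "\<forall>i. \<exists>P. P \<in> graded_part r n (\<lambda>j. a j + (\<Sum>i'\<in>?I - {i}. D i' j)) \<and>
      coef (residual \<alpha> 0) (?I - {i}) = to_laurent P"
    using homog_laurent_poly[OF homog_residual_0[OF \<alpha>]] by (force intro: ext)
  then obtain q where q: "\<And>i. q i \<in> graded_part r n (\<lambda>j. a j + (\<Sum>i'\<in>?I - {i}. D i' j))"
      "\<And>i. coef (residual \<alpha> 0) (?I - {i}) = to_laurent (q i)"
    using choice[of "\<lambda>i P. P \<in> graded_part r n (\<lambda>j. a j + (\<Sum>i'\<in>?I - {i}. D i' j)) \<and>
      coef (residual \<alpha> 0) (?I - {i}) = to_laurent P"] by blast
  define s where "s i = (if odd i then - q i else q i)" for i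
  have below: "{j. j < m \<and> j < i} = {..<i}" if "i < m" for i using that by auto
  have "coef (wedge m f (residual \<alpha> 0)) ?I \<gamma> = (\<Sum>i\<in>?I. to_laurent (f i * s i) \<gamma>)" for \<gamma>
    unfolding coef_wedge[OF order.refl]
    by (rule sum.cong[OF refl]) (simp add: q(2) s_def act_to_laurent to_laurent_uminus below)
  then have "(\<Sum>i<m. f i * s i) = 0"
    by (intro to_laurent_inject) (simp add: to_laurent_sum wedge_residual_0[OF \<alpha>])
  then have zero: "f (Suc N) * s (Suc N) + (\<Sum>i<Suc N. f i * s i) = 0"
    by (simp add: m add.commute)
  have "?I - {Suc N} = {..<Suc N}" using m by auto
  then have "q (Suc N) = sylv \<alpha>"
    using q(2)[of "Suc N"] coef_residual_0[of \<alpha>] m by (intro to_laurent_inject) simp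
  then have "f (Suc N) * sylv \<alpha> = (\<Sum>i<Suc N. f i * (if odd (Suc N) then s i else - s i))"
  proof (cases "odd (Suc N)")
    case True
    then have "s (Suc N) = - sylv \<alpha>" using \<open>q (Suc N) = sylv \<alpha>\<close> by (simp add: s_def)
    then have "f (Suc N) * - sylv \<alpha> + (\<Sum>i<Suc N. f i * s i) = 0" using zero by (simp only:)
    then show ?thesis using True by (simp del: sum.lessThan_Suc)
  next
    case False
    then have "s (Suc N) = sylv \<alpha>" using \<open>q (Suc N) = sylv \<alpha>\<close> by (simp add: s_def)
    then show ?thesis using zero False by (simp add: eq_neg_iff_add_eq_0 sum_negf del: sum.lessThan_Suc)
  qed
  moreover have "(if odd (Suc N) then s i else - s i) \<in> graded_part r n (\<lambda>j. a j + (\<Sum>i'\<in>?I - {i}. D i' j))" for i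
    using q(1)[of i] by (simp add: s_def graded_part_uminus)
  ultimately show ?thesis by (intro exI[of _ "\<lambda>i. if odd (Suc N) then s i else - s i"]) blast
qed

text \<open>Converts the syzygy into a cocycle by \<open>contract_top\<close> and decomposes it at c
  = 0, where nothing is divided out and no error term is left. The coefficient that omits the last
  index is the last entry of the syzygy.\<close>

theorem syzygy_sylv:
  assumes m: "m = Suc (Suc N)"
    and x: "\<And>i. i < m \<Longrightarrow> x i \<in> graded_part r n (\<lambda>j. a j + (\<Sum>i'\<in>{..<m} - {i}. D i' j))"
    and syz: "(\<Sum>i<m. f i * x i) = 0"
  shows "\<exists>co h. (\<forall>i<Suc N. h i \<in> graded_part r n (\<lambda>j. a j + (\<Sum>i'\<in>{..<Suc N} - {i}. D i' j))) \<and>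
    x (Suc N) = (\<Sum>i<Suc N. f i * h i) + (\<Sum>\<alpha>\<in>alphas. Poly_Mapping.single 0 (co \<alpha>) * sylv \<alpha>)"
proof -
  let ?T = "Form (\<lambda>I. if I = {..<m} then to_laurent (1 :: 'a mpol) else (\<lambda>\<gamma>. 0))"
  let ?\<omega> = "contract_top x" and ?I = "{..<Suc N}"
  have h\<omega>: "homog a (Suc N) {} ?\<omega>" using homog_contract_top[of x a] x m by simp
  have "wedge m f ?T = 0"
    by (rule wedge_top[OF homog_top_form f_graded, of 1 "\<lambda>j. - (\<Sum>i<m. D i j)"]) simp_all
  then have "wedge m f ?\<omega> = 0"
    using wedge_contract[of m f x ?T] syz by (simp add: contract_top_def contract_def)
  then have "decomposed 0 (passed 0 \<union> closed_lasts 0) ?\<omega>"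
    using h\<omega> by (intro cocycle_decomposed) simp_all
  then obtain \<zeta> \<xi> co where \<zeta>: "if 0 \<le> N then homog a (N - 0) (passed 0 \<union> closed_lasts 0) \<zeta> else \<zeta> = 0"
    and \<nu>: "all_expo (nonneg_on (passed 0)) (?\<omega> - wedge m f \<zeta> -
       (\<Sum>\<alpha>\<in>alphas. scale_form (Poly_Mapping.single 0 (co \<alpha>)) (residual \<alpha> 0)) - (\<Sum>j\<in>{1..<level 0}. \<xi> j))"
    by (rule decomposedE)
  have \<zeta>: "homog a N {} \<zeta>" using \<zeta> by simp
  obtain h where h: "\<forall>i\<in>?I. h i \<in> graded_part r n (\<lambda>j. a j + (\<Sum>i'\<in>?I - {i}. D i' j))"
      "\<forall>\<gamma>. coef (wedge m f \<zeta>) ?I \<gamma> = to_laurent (\<Sum>i\<in>?I. f i * h i) \<gamma>"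
    using wedge_poly[OF \<zeta>, of ?I f] m by auto
  let ?S = "\<Sum>\<alpha>\<in>alphas. Poly_Mapping.single 0 (co \<alpha>) * sylv \<alpha>"
  have "coef (?\<omega> - wedge m f \<zeta> - (\<Sum>\<alpha>\<in>alphas. scale_form (Poly_Mapping.single 0 (co \<alpha>)) (residual \<alpha> 0))) ?I \<gamma> = 0" for \<gamma>
    using \<nu> unfolding all_expo_def nonneg_on_def by (auto simp: level_0)
  moreover have res: "coef (residual \<alpha> 0) ?I = to_laurent (sylv \<alpha>)" for \<alpha>
    using coef_residual_0[of \<alpha>] m by (intro ext) simp
  ultimately have "coef ?\<omega> ?I \<gamma> = to_laurent ((\<Sum>i<Suc N. f i * h i) + ?S) \<gamma>" for \<gamma>
    using h(2) by (simp add: coef_sum res act_to_laurent to_laurent_sum to_laurent_add diff_eq_eq add.commute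
        del: sum.lessThan_Suc)
  moreover have "?I = {..<m} - {Suc N}" using m by auto
  ultimately have "to_laurent (if odd (Suc N) then - x (Suc N) else x (Suc N)) \<gamma> =
      to_laurent ((\<Sum>i<Suc N. f i * h i) + ?S) \<gamma>" for \<gamma>
    using coef_contract_top[of "Suc N" x \<gamma>] m by (simp add: to_laurent_uminus)
  then have eq: "(if odd (Suc N) then - x (Suc N) else x (Suc N)) = (\<Sum>i<Suc N. f i * h i) + ?S"
    by (rule to_laurent_inject)
  \<comment> \<open>The sign of the last index in \<open>coef_contract_top\<close> is absorbed into
    the cofactors and the scalars.\<close>
  define h' where "h' i = (if odd (Suc N) then - h i else h i)" for i
  define co' where "co' \<alpha> = (if odd (Suc N) then - co \<alpha> else co \<alpha>)" for \<alpha>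
  have "x (Suc N) = (\<Sum>i<Suc N. f i * h' i) + (\<Sum>\<alpha>\<in>alphas. Poly_Mapping.single 0 (co' \<alpha>) * sylv \<alpha>)"
  proof (cases "odd (Suc N)")
    case True
    have "- x (Suc N) = (\<Sum>i<Suc N. f i * h i) + ?S" using eq[unfolded if_P[OF True]] .
    then have "x (Suc N) = - ((\<Sum>i<Suc N. f i * h i) + ?S)" by (simp only: minus_equation_iff[of "x (Suc N)"])
    then show ?thesis using True by (simp add: h'_def co'_def sum_negf single_uminus del: sum.lessThan_Suc)
  next
    case False
    then show ?thesis using eq by (simp add: h'_def co'_def del: sum.lessThan_Suc)
  qed
  moreover have "h' i \<in> graded_part r n (\<lambda>j. a j + (\<Sum>i'\<in>{..<Suc N} - {i}. D i' j))" if "i < Suc N" for i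
    using h(1) that graded_part_uminus[of "h i"] by (simp add: h'_def)
  ultimately show ?thesis by (intro exI[of _ co'] exI[of _ h'] conjI allI impI)
qed

end

section \<open>The Nullstellensatz\<close>

abbreviation ev :: "('v \<Rightarrow> 'k::comm_ring_1) \<Rightarrow> (('v \<Rightarrow>\<^sub>0 nat) \<Rightarrow>\<^sub>0 'k) \<Rightarrow> 'k" where
  "ev \<equiv> evaluate (\<lambda>c. c)"

abbreviation lc :: "'a::zero poly \<Rightarrow> 'a" where
  "lc H \<equiv> poly.coeff H (Polynomial.degree H)"

lemma comm_ring_hom_ev: "comm_ring_hom (ev \<phi>)"
  by (rule comm_ring_hom_eval)

text \<open>Over a finite field, 1 plus the product of all linear factors would have no
  root.\<close>

lemma infinite_alg_closed: "infinite (UNIV :: 'k::alg_closed_field set)"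
proof
  assume fin: "finite (UNIV :: 'k set)"
  define p where "p = (\<Prod>a\<in>(UNIV :: 'k set). [:- a, 1:]) + 1"
  have "Polynomial.degree (\<Prod>a\<in>(UNIV :: 'k set). [:- a, 1:]) = card (UNIV :: 'k set)"
    by (subst degree_prod_eq_sum_degree) auto
  then have "0 < Polynomial.degree (\<Prod>a\<in>(UNIV :: 'k set). [:- a, 1:])" using fin by (simp add: finite_UNIV_card_ge_0)
  then have "Polynomial.degree p > 0" unfolding p_def by (subst degree_add_eq_left) auto
  then obtain x where "poly p x = 0" using alg_closed_imp_poly_has_root by blast
  moreover have "poly p x = 1" using fin by (auto simp: p_def poly_prod)
  ultimately show False by simp
qed

text \<open>The univariate case, one root at a time: each linear factor of G divides one of the
  factors S.\<close>

lemma roots_subset_imp_dvd_power: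
  fixes G S :: "'k::alg_closed_field poly"
  assumes "G \<noteq> 0" "\<And>b. poly G b = 0 \<Longrightarrow> poly S b = 0"
  shows "G dvd S ^ Polynomial.degree G"
  using assms
proof (induction "Polynomial.degree G" arbitrary: G)
  case 0
  then show ?case by (metis degree_eq_zeroE is_unit_pCons_iff pCons_0_0 unit_imp_dvd)
next
  case (Suc k)
  obtain b where b: "poly G b = 0" using alg_closed_imp_poly_has_root[of G] Suc.hyps(2) by auto
  then obtain G' where G': "G = [:- b, 1:] * G'" using poly_eq_0_iff_dvd by blast
  have "G' \<noteq> 0" using G' Suc.prems(1) by auto
  then have deg: "Polynomial.degree G = Suc (Polynomial.degree G')" unfolding G' by (subst degree_mult_eq) auto
  have "poly S x = 0" if "poly G' x = 0" for x using that Suc.prems(2)[of x] by (simp add: G')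
  then have "G' dvd S ^ Polynomial.degree G'" using Suc.hyps deg \<open>G' \<noteq> 0\<close> by auto
  moreover have "[:- b, 1:] dvd S" using Suc.prems(2)[OF b] by (simp add: poly_eq_0_iff_dvd)
  ultimately have "[:- b, 1:] * G' dvd S * S ^ Polynomial.degree G'" by (rule mult_dvd_mono[rotated])
  then have "G dvd S ^ Suc (Polynomial.degree G')" by (simp only: G' power_Suc)
  then show ?case by (simp only: deg)
qed

text \<open>The type has infinitely many indeterminates, so the ring over V is cut out as a set; the
  induction on V in the Nullstellensatz requires it.\<close>

definition polys_in :: "(nat \<times> nat) set \<Rightarrow> 'k::comm_ring_1 mpol set" where
  "polys_in V = {P. \<forall>t\<in>Poly_Mapping.keys P. Poly_Mapping.keys t \<subseteq> V}"

lemma polys_in_single: "Poly_Mapping.keys t \<subseteq> V \<Longrightarrow> Poly_Mapping.single t c \<in> polys_in V"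
  by (simp add: polys_in_def)

lemma polys_in_0 [simp]: "0 \<in> polys_in V" and polys_in_1 [simp]: "1 \<in> polys_in V"
  by (simp_all add: polys_in_def)

lemma polys_in_add: "P \<in> polys_in V \<Longrightarrow> Q \<in> polys_in V \<Longrightarrow> P + Q \<in> polys_in V"
  unfolding polys_in_def using Poly_Mapping.keys_add[of P Q] by blast

lemma polys_in_uminus: "P \<in> polys_in V \<Longrightarrow> - P \<in> polys_in V"
  by (simp add: polys_in_def)

lemma polys_in_diff: "P \<in> polys_in V \<Longrightarrow> Q \<in> polys_in V \<Longrightarrow> P - Q \<in> polys_in V"
  using polys_in_add[OF _ polys_in_uminus, of P V Q] by simp

lemma polys_in_sum: "(\<And>i. i \<in> S \<Longrightarrow> P i \<in> polys_in V) \<Longrightarrow> (\<Sum>i\<in>S. P i) \<in> polys_in V"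
  by (induction S rule: infinite_finite_induct) (auto intro: polys_in_add)

lemma polys_in_mult:
  assumes "P \<in> polys_in V" "Q \<in> polys_in V"
  shows "P * Q \<in> polys_in V"
  unfolding polys_in_def
proof (intro CollectI ballI)
  fix t assume "t \<in> Poly_Mapping.keys (P * Q)"
  then obtain a b where "t = a + b" "a \<in> Poly_Mapping.keys P" "b \<in> Poly_Mapping.keys Q"
    using Poly_Mapping.keys_mult[of P Q] by blast
  then show "Poly_Mapping.keys t \<subseteq> V"
    using assms Poly_Mapping.keys_add[of a b] unfolding polys_in_def by blast
qed

lemma polys_in_power: "P \<in> polys_in V \<Longrightarrow> P ^ k \<in> polys_in V"
  by (induction k) (auto intro: polys_in_mult)

lemma polys_in_mono: "V \<subseteq> Y \<Longrightarrow> polys_in V \<subseteq> polys_in Y"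
  unfolding polys_in_def by blast

lemma ev_polys_in_cong: "P \<in> polys_in V \<Longrightarrow> (\<And>v. v \<in> V \<Longrightarrow> \<phi> v = \<psi> v) \<Longrightarrow> ev \<phi> P = ev \<psi> P"
  by (rule evaluate_cong) (auto simp: polys_in_def)

definition poly_ideal :: "(nat \<times> nat) set \<Rightarrow> 'k::comm_ring_1 mpol set \<Rightarrow> bool" where
  "poly_ideal V J \<longleftrightarrow> J \<subseteq> polys_in V \<and> 0 \<in> J \<and> (\<forall>a\<in>J. \<forall>b\<in>J. a + b \<in> J) \<and>
     (\<forall>a\<in>polys_in V. \<forall>b\<in>J. a * b \<in> J)"

lemma poly_idealD:
  assumes "poly_ideal V J"
  shows "J \<subseteq> polys_in V" "0 \<in> J" "a \<in> J \<Longrightarrow> b \<in> J \<Longrightarrow> a + b \<in> J"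
    "c \<in> polys_in V \<Longrightarrow> b \<in> J \<Longrightarrow> c * b \<in> J"
  using assms unfolding poly_ideal_def by blast+

lemma poly_ideal_diff: "poly_ideal V J \<Longrightarrow> a \<in> J \<Longrightarrow> b \<in> J \<Longrightarrow> a - b \<in> J"
  using poly_idealD(3)[of V J a "- 1 * b"] poly_idealD(4)[of V J "- 1" b] polys_in_uminus[OF polys_in_1] by force

lemma poly_ideal_sum: "poly_ideal V J \<Longrightarrow> (\<And>i. i \<in> S \<Longrightarrow> g i \<in> J) \<Longrightarrow> (\<Sum>i\<in>S. g i) \<in> J"
  by (induction S rule: infinite_finite_induct) (auto intro: poly_idealD)

text \<open>By Zorn, M is maximal among the ideals that avoid all powers of s. If neither a nor b
  were in M, the two enlarged ideals would contain powers of s, and their product would be a power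
  of s in M.\<close>

lemma prime_avoiding:
  fixes s :: "'k::comm_ring_1 mpol"
  assumes J: "poly_ideal V J" and s: "s \<in> polys_in V" "\<And>k. s ^ k \<notin> J"
  obtains M where "poly_ideal V M" "J \<subseteq> M" "\<And>k. s ^ k \<notin> M"
    "\<And>a b. a \<in> polys_in V \<Longrightarrow> b \<in> polys_in V \<Longrightarrow> a * b \<in> M \<Longrightarrow> a \<in> M \<or> b \<in> M"
proof -
  let ?A = "{J'. poly_ideal V J' \<and> J \<subseteq> J' \<and> (\<forall>k. s ^ k \<notin> J')}"
  have "\<exists>M\<in>?A. \<forall>J'\<in>?A. M \<subseteq> J' \<longrightarrow> J' = M"
  proof (rule subset_Zorn_nonempty)
    show "?A \<noteq> {}" using J s(2) by blast
    fix C assume C: "C \<noteq> {}" "subset.chain ?A C"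
    then have CA: "C \<subseteq> ?A" and lin: "\<And>a b. a \<in> C \<Longrightarrow> b \<in> C \<Longrightarrow> a \<subseteq> b \<or> b \<subseteq> a"
      unfolding subset.chain_def by auto
    have "poly_ideal V (\<Union>C)"
      unfolding poly_ideal_def
    proof (intro conjI ballI)
      have "E \<subseteq> polys_in V" if "E \<in> C" for E using that CA poly_idealD(1)[of V E] by blast
      then show "\<Union>C \<subseteq> polys_in V" by blast
      obtain E where "E \<in> C" using C(1) by blast
      then show "0 \<in> \<Union>C" using CA poly_idealD(2)[of V E] by blast
      fix a b assume "a \<in> \<Union>C" "b \<in> \<Union>C"
      then obtain E E' where "a \<in> E" "b \<in> E'" "E \<in> C" "E' \<in> C" by blast
      then obtain E'' where "a \<in> E''" "b \<in> E''" "E'' \<in> C" using lin[of E E'] by blast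
      moreover from this have "a + b \<in> E''" using CA poly_idealD(3)[of V E'' a b] by blast
      ultimately show "a + b \<in> \<Union>C" by blast
    next
      fix a b :: "'k mpol" assume "a \<in> polys_in V" "b \<in> \<Union>C"
      then obtain E where "b \<in> E" "E \<in> C" by blast
      moreover from this have "a * b \<in> E" using CA poly_idealD(4)[of V E a b] \<open>a \<in> polys_in V\<close> by blast
      ultimately show "a * b \<in> \<Union>C" by blast
    qed
    then show "\<Union>C \<in> ?A" using CA C(1) by blast
  qed
  then obtain M where M0: "M \<in> ?A" and max0: "\<forall>J'\<in>?A. M \<subseteq> J' \<longrightarrow> J' = M" by (rule bexE)
  have M: "poly_ideal V M" "J \<subseteq> M" "s ^ k \<notin> M" for k using M0 by simp_all
  have max: "J' = M" if "poly_ideal V J'" "J \<subseteq> J'" "\<And>k. s ^ k \<notin> J'" "M \<subseteq> J'" for J'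
    using bspec[OF max0, of J'] that by simp
  have enlarge: "\<exists>k p c. p \<in> M \<and> c \<in> polys_in V \<and> s ^ k = p + c * a"
    if a: "a \<in> polys_in V" "a \<notin> M" for a
  proof (rule ccontr)
    assume no: "\<nexists>k p c. p \<in> M \<and> c \<in> polys_in V \<and> s ^ k = p + c * a"
    let ?J = "{p + c * a | p c. p \<in> M \<and> c \<in> polys_in V}"
    have "poly_ideal V ?J"
      unfolding poly_ideal_def
    proof (intro conjI ballI)
      show "?J \<subseteq> polys_in V"
        using poly_idealD(1)[OF M(1)] a(1) by (auto intro!: polys_in_add polys_in_mult)
      have "0 = 0 + 0 * a" by simp
      then show "0 \<in> ?J" using poly_idealD(2)[OF M(1)] polys_in_0 by blast
      fix x y assume "x \<in> ?J" "y \<in> ?J"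
      then obtain p c p' c' where "x = p + c * a" "y = p' + c' * a" "p \<in> M" "p' \<in> M" "c \<in> polys_in V" "c' \<in> polys_in V"
        by blast
      moreover from this have "x + y = (p + p') + (c + c') * a" by (simp add: algebra_simps)
      ultimately show "x + y \<in> ?J" using poly_idealD(3)[OF M(1)] polys_in_add by blast
    next
      fix x y :: "'k mpol" assume "x \<in> polys_in V" "y \<in> ?J"
      then obtain p c where "y = p + c * a" "p \<in> M" "c \<in> polys_in V" by blast
      moreover from this have "x * y = x * p + (x * c) * a" by (simp add: algebra_simps)
      ultimately show "x * y \<in> ?J" using \<open>x \<in> polys_in V\<close> poly_idealD(4)[OF M(1)] polys_in_mult by blast
    qed
    moreover have sub: "M \<subseteq> ?J"
    proof
      fix p assume "p \<in> M"
      moreover have "p = p + 0 * a" by simp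
      ultimately show "p \<in> ?J" using polys_in_0 by blast
    qed
    moreover have "s ^ k \<notin> ?J" for k using no by blast
    ultimately have "?J = M" using M(2) by (intro max) auto
    moreover have "a = 0 + 1 * a" by simp
    then have "a \<in> ?J" using poly_idealD(2)[OF M(1)] polys_in_1 by blast
    ultimately show False using a(2) by simp
  qed
  have "a \<in> M \<or> b \<in> M" if ab: "a \<in> polys_in V" "b \<in> polys_in V" "a * b \<in> M" for a b
  proof (rule ccontr)
    assume "\<not> (a \<in> M \<or> b \<in> M)"
    then obtain k p c k' p' c' where *: "p \<in> M" "c \<in> polys_in V" "s ^ k = p + c * a"
      "p' \<in> M" "c' \<in> polys_in V" "s ^ k' = p' + c' * b"
      using enlarge[OF ab(1)] enlarge[OF ab(2)] by blast
    have "s ^ (k + k') = (p' + c' * b) * p + (c * a) * p' + (c * c') * (a * b)"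
      unfolding power_add *(3,6) by (simp add: algebra_simps)
    moreover have "(p' + c' * b) * p \<in> M" "(c * a) * p' \<in> M" "(c * c') * (a * b) \<in> M"
      using * ab poly_idealD(1)[OF M(1)]
      by (auto intro!: poly_idealD(4)[OF M(1)] polys_in_add polys_in_mult simp del: mult.assoc)
    then have "(p' + c' * b) * p + (c * a) * p' + (c * c') * (a * b) \<in> M"
      by (intro poly_idealD(3)[OF M(1)])
    ultimately show False using M(3) by metis
  qed
  then show ?thesis using that M by blast
qed

lemma polys_in_insert_rep:
  assumes "h \<in> polys_in (insert x Y)"
  obtains H where "\<And>i. poly.coeff H i \<in> polys_in Y" "poly H (indet x) = h"
proof -
  have ex: "\<exists>H. (\<forall>i. poly.coeff H i \<in> polys_in Y) \<and> poly H (indet x) = Poly_Mapping.single t c"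
    if t: "Poly_Mapping.keys t \<subseteq> insert x Y" for t and c :: 'a
  proof -
    let ?k = "Poly_Mapping.lookup t x"
    define t' where "t' = Poly_Mapping.update x 0 t"
    have t': "Poly_Mapping.lookup t' v = (if v = x then 0 else Poly_Mapping.lookup t v)" for v
      by (simp add: t'_def lookup_update)
    have sum: "t = t' + Poly_Mapping.single x ?k"
      by (rule poly_mapping_eqI) (simp add: t' lookup_add lookup_single when_def)
    have "indet x ^ k = Poly_Mapping.single (Poly_Mapping.single x k) (1 :: 'a)" for k
      by (induction k) (simp_all add: indet_def mult_single single_add[symmetric] add.commute)
    then have "poly (Polynomial.monom (Poly_Mapping.single t' c) ?k) (indet x) = Poly_Mapping.single t c"
      by (simp add: poly_monom mult_single flip: sum)
    moreover have "Poly_Mapping.keys t' \<subseteq> Y"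
    proof
      fix v assume "v \<in> Poly_Mapping.keys t'"
      then have "v \<noteq> x" "v \<in> Poly_Mapping.keys t" by (auto simp: in_keys_iff t' split: if_splits)
      then show "v \<in> Y" using t by blast
    qed
    ultimately show ?thesis
      by (intro exI[of _ "Polynomial.monom (Poly_Mapping.single t' c) ?k"]) (auto intro: polys_in_single)
  qed
  have "\<exists>H. (\<forall>i. poly.coeff H i \<in> polys_in Y) \<and>
      poly H (indet x) = (\<Sum>t\<in>S. Poly_Mapping.single t (Poly_Mapping.lookup h t))"
    if "finite S" "S \<subseteq> Poly_Mapping.keys h" for S
    using that
  proof induction
    case empty
    show ?case by (intro exI[of _ 0]) simp
  next
    case (insert t S)
    then obtain H where H: "\<forall>i. poly.coeff H i \<in> polys_in Y"
      "poly H (indet x) = (\<Sum>t\<in>S. Poly_Mapping.single t (Poly_Mapping.lookup h t))" by auto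
    obtain H' where H': "\<forall>i. poly.coeff H' i \<in> polys_in Y"
      "poly H' (indet x) = Poly_Mapping.single t (Poly_Mapping.lookup h t)"
      using ex[of t] assms insert.prems unfolding polys_in_def by blast
    show ?case using H H' insert.hyps by (intro exI[of _ "H' + H"]) (auto intro: polys_in_add)
  qed
  from this[of "Poly_Mapping.keys h"] show ?thesis
    using that by (auto simp flip: poly_mapping_sum_singles)
qed

lemma coeffs_in_mult:
  assumes "\<And>i. poly.coeff P i \<in> polys_in Y" "\<And>i. poly.coeff Q i \<in> polys_in Y"
  shows "poly.coeff (P * Q) i \<in> polys_in Y"
  unfolding coeff_mult by (intro polys_in_sum polys_in_mult assms)

lemma coeffs_in_power:
  assumes "\<And>i. poly.coeff P i \<in> polys_in Y"
  shows "poly.coeff (P ^ k) i \<in> polys_in Y"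
proof (induction k arbitrary: i)
  case 0
  show ?case by (cases i) auto
qed (simp add: coeffs_in_mult assms)

text \<open>The leading coefficient of H is no unit, so a power of it is multiplied in; everything
  stays inside the polynomials over Y.\<close>

lemma pseudo_division_in:
  fixes H B :: "'k::idom mpol poly"
  assumes H: "\<And>i. poly.coeff H i \<in> polys_in Y" "0 < Polynomial.degree H" and B: "\<And>i. poly.coeff B i \<in> polys_in Y"
  shows "\<exists>N Q R. (\<forall>i. poly.coeff Q i \<in> polys_in Y) \<and> (\<forall>i. poly.coeff R i \<in> polys_in Y) \<and>
    Polynomial.smult (lc H ^ N) B = Q * H + R \<and> Polynomial.degree R < Polynomial.degree H"
  using B
proof (induction "Polynomial.degree B" arbitrary: B rule: less_induct)
  case less
  show ?case
  proof (cases "Polynomial.degree B < Polynomial.degree H")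
    case True
    then show ?thesis using less.prems by (intro exI[of _ 0] exI[of _ 0] exI[of _ B]) auto
  next
    case False
    let ?M = "Polynomial.monom (lc B) (Polynomial.degree B - Polynomial.degree H)"
    define B' where "B' = Polynomial.smult (lc H) B - ?M * H"
    have M: "poly.coeff ?M i \<in> polys_in Y" for i using less.prems by auto
    have B': "poly.coeff B' i \<in> polys_in Y" for i
      unfolding B'_def coeff_diff coeff_smult by (intro polys_in_diff polys_in_mult coeffs_in_mult M H less.prems)
    have le: "Polynomial.degree B' \<le> Polynomial.degree B"
      unfolding B'_def using False
      by (intro degree_diff_le order.trans[OF degree_smult_le] order.trans[OF degree_mult_le] order.refl)
        (auto intro: order.trans[OF add_right_mono[OF degree_monom_le]])
    have "poly.coeff (?M * H) (Polynomial.degree B) = lc B * lc H"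
      using False coeff_monom_mult[of "lc B" "Polynomial.degree B - Polynomial.degree H" H "Polynomial.degree B"] by simp
    then have top: "poly.coeff B' (Polynomial.degree B) = 0" by (simp add: B'_def mult.commute)
    have "Polynomial.degree B' < Polynomial.degree B"
    proof (rule ccontr)
      assume "\<not> Polynomial.degree B' < Polynomial.degree B"
      then have "Polynomial.degree B' = Polynomial.degree B" using le by simp
      then have "B' = 0" using top leading_coeff_0_iff by metis
      then show False using \<open>Polynomial.degree B' = Polynomial.degree B\<close> False H(2) by simp
    qed
    then obtain N Q R where *: "\<forall>i. poly.coeff Q i \<in> polys_in Y" "\<forall>i. poly.coeff R i \<in> polys_in Y"
      "Polynomial.smult (lc H ^ N) B' = Q * H + R" "Polynomial.degree R < Polynomial.degree H"
      using less.hyps[of B'] B' by blast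
    have "Polynomial.smult (lc H ^ Suc N) B = (Q + Polynomial.smult (lc H ^ N) ?M) * H + R"
      using *(3) unfolding B'_def by (simp add: algebra_simps smult_diff_right smult_smult)
    moreover have "poly.coeff (Q + Polynomial.smult (lc H ^ N) ?M) i \<in> polys_in Y" for i
      unfolding coeff_add coeff_smult using *(1) by (intro polys_in_add polys_in_mult polys_in_power M H(1)) auto
    ultimately show ?thesis using *(2,4) by blast
  qed
qed

lemma degree_map_poly_le:
  assumes "h 0 = 0"
  shows "Polynomial.degree (map_poly h p) \<le> Polynomial.degree p"
  by (rule degree_le) (simp add: coeff_map_poly assms coeff_eq_0)

lemma map_poly_hom:
  assumes "comm_ring_hom h"
  shows "map_poly h (p + q) = map_poly h p + map_poly h q"
    and "map_poly h (p * q) = map_poly h p * map_poly h q"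
    and "map_poly h (Polynomial.smult c p) = Polynomial.smult (h c) (map_poly h p)"
    and "map_poly h (p ^ k) = map_poly h p ^ k"
proof -
  interpret h: comm_ring_hom h by fact
  show "map_poly h (p + q) = map_poly h p + map_poly h q"
    and "map_poly h (Polynomial.smult c p) = Polynomial.smult (h c) (map_poly h p)"
    by (rule poly_eqI, simp add: coeff_map_poly h.hom_add h.hom_mult)+
  have mult: "map_poly h (p * q) = map_poly h p * map_poly h q" for p q
    by (rule poly_eqI) (simp add: coeff_map_poly coeff_mult h.hom_sum h.hom_mult)
  then show "map_poly h (p * q) = map_poly h p * map_poly h q" .
  show "map_poly h (p ^ k) = map_poly h p ^ k"
    by (induction k) (simp_all add: mult)
qed

lemma ev_poly_indet:
  assumes "\<And>i. poly.coeff H i \<in> polys_in Y" "x \<notin> Y"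
  shows "ev (\<phi>(x := b)) (poly H (indet x)) = poly (map_poly (ev \<phi>) H) b"
proof -
  interpret e: comm_ring_hom "ev (\<phi>(x := b))" by (rule comm_ring_hom_ev)
  interpret e': comm_ring_hom "ev \<phi>" by (rule comm_ring_hom_ev)
  have "ev (\<phi>(x := b)) (poly.coeff H i) = ev \<phi> (poly.coeff H i)" for i
    by (rule ev_polys_in_cong[OF assms(1)]) (use assms(2) in auto)
  then have "ev (\<phi>(x := b)) (poly H (indet x)) = (\<Sum>i\<le>Polynomial.degree H. ev \<phi> (poly.coeff H i) * b ^ i)"
    by (simp add: poly_altdef e.hom_sum e.hom_mult e.hom_power)
  also have "\<dots> = (\<Sum>i\<le>Polynomial.degree H. poly.coeff (map_poly (ev \<phi>) H) i * b ^ i)"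
    by (simp add: coeff_map_poly)
  also have "\<dots> = poly (map_poly (ev \<phi>) H) b"
    unfolding poly_altdef
    by (rule sum.mono_neutral_right) (auto simp: coeff_eq_0 degree_map_poly_le)
  finally show ?thesis .
qed

text \<open>Induction on the variables over a prime M that avoids s; the new variable x is
  transcendental or algebraic modulo M. Carrying a polynomial s to be kept nonzero strengthens the
  induction hypothesis: it can preserve the leading coefficients and remainders on which the choice
  of a value for x depends.\<close>

theorem nullstellensatz:
  fixes s :: "'k::alg_closed_field mpol"
  assumes "finite V" "poly_ideal V J" "s \<in> polys_in V" "\<And>k. s ^ k \<notin> J"
  shows "\<exists>\<phi>. (\<forall>P\<in>J. ev \<phi> P = 0) \<and> ev \<phi> s \<noteq> 0"
  using assms
proof (induction V arbitrary: J s rule: finite_induct)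
  case empty
  have const: "\<exists>c. P = Poly_Mapping.single 0 c" if P: "P \<in> polys_in {}" for P :: "'k mpol"
  proof -
    have "t = 0" if "t \<in> Poly_Mapping.keys P" for t
      using P that by (auto simp: polys_in_def)
    then have "P = Poly_Mapping.single 0 (Poly_Mapping.lookup P 0)"
      by (intro poly_mapping_eqI) (auto simp: lookup_single when_def in_keys_iff)
    then show ?thesis by blast
  qed
  have const_ev: "ev \<phi> (Poly_Mapping.single 0 c) = c" for \<phi> and c :: 'k by (simp add: evaluate_single)
  obtain c where c: "s = Poly_Mapping.single 0 c" using const[OF empty.prems(2)] by blast
  have sJ: "s \<notin> J" using empty.prems(3)[of 1] by simp
  then have "c \<noteq> 0" using poly_idealD(2)[OF empty.prems(1)] c by auto
  have "ev undefined P = 0" if P: "P \<in> J" for P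
  proof (rule ccontr)
    assume nz: "ev undefined P \<noteq> 0"
    obtain p where p: "P = Poly_Mapping.single 0 p" using const P poly_idealD(1)[OF empty.prems(1)] by blast
    then have "p \<noteq> 0" using nz const_ev by auto
    then have "s = Poly_Mapping.single 0 (c / p) * P" by (simp add: c p mult_single)
    moreover have "Poly_Mapping.single 0 (c / p) \<in> polys_in {}" by (simp add: polys_in_def)
    ultimately show False using sJ P poly_idealD(4)[OF empty.prems(1)] by metis
  qed
  then show ?case using \<open>c \<noteq> 0\<close> c const_ev by metis
next
  case (insert x Y)
  let ?T = "polys_in Y :: 'k mpol set"
  obtain M where M: "poly_ideal (insert x Y) M" "J \<subseteq> M" "\<And>k. s ^ k \<notin> M"
    and prime: "\<And>a b. a \<in> polys_in (insert x Y) \<Longrightarrow> b \<in> polys_in (insert x Y) \<Longrightarrow> a * b \<in> M \<Longrightarrow> a \<in> M \<or> b \<in> M"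
    using prime_avoiding[OF insert.prems] by metis
  have TX: "?T \<subseteq> polys_in (insert x Y)" by (rule polys_in_mono) auto
  have x_in: "indet x \<in> polys_in (insert x Y)" by (simp add: indet_def polys_in_single)
  have one: "1 \<notin> M" using M(3)[of 0] by simp
  have sM: "s \<notin> M" using M(3)[of 1] by simp
  have J': "poly_ideal Y (M \<inter> ?T)"
    unfolding poly_ideal_def
    using poly_idealD(2,3)[OF M(1)] poly_idealD(4)[OF M(1)] TX polys_in_add polys_in_mult by (auto 0 3)
  have power_notin: "a ^ k \<notin> M \<inter> ?T" if "a \<in> ?T" "a \<notin> M" for a k
  proof (induction k)
    case (Suc k)
    then show ?case
      using prime[of a "a ^ k"] that TX polys_in_power[OF that(1)] polys_in_mult[OF that(1)] by auto
  qed (use one in simp)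
  have poly_in: "poly H (indet x) \<in> polys_in (insert x Y)" if "\<And>i. poly.coeff H i \<in> ?T" for H
    unfolding poly_altdef using that TX x_in by (intro polys_in_sum polys_in_mult polys_in_power) auto
  have poly_M: "poly H (indet x) \<in> M" if "\<And>i. poly.coeff H i \<in> M" for H
    unfolding poly_altdef
  proof (rule poly_ideal_sum[OF M(1)])
    fix i
    have "indet x ^ i * poly.coeff H i \<in> M" using poly_idealD(4)[OF M(1)] polys_in_power[OF x_in] that by blast
    then show "poly.coeff H i * indet x ^ i \<in> M" by (simp add: mult.commute)
  qed
  obtain S where S: "\<And>i. poly.coeff S i \<in> ?T" "poly S (indet x) = s"
    using polys_in_insert_rep[OF insert.prems(2)] by blast
  have hom: "comm_ring_hom (ev \<phi>)" for \<phi> :: "nat \<times> nat \<Rightarrow> 'k" by (rule comm_ring_hom_ev)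
  have vanish: "map_poly (ev \<phi>) R = 0" if "\<And>i. poly.coeff R i \<in> M \<inter> ?T" "\<forall>P\<in>M \<inter> ?T. ev \<phi> P = 0" for \<phi> and R
  proof -
    interpret e: comm_ring_hom "ev \<phi>" by (rule hom)
    show ?thesis by (rule poly_eqI) (use that in \<open>simp add: coeff_map_poly\<close>)
  qed
  show ?case
  proof (cases "\<forall>H. (\<forall>i. poly.coeff H i \<in> ?T) \<longrightarrow> poly H (indet x) \<in> M \<longrightarrow> (\<forall>i. poly.coeff H i \<in> M)")
    case True
    \<comment> \<open>The transcendental case: members of M have all coefficients in M. It suffices
      to keep one coefficient of S nonzero and to choose for x a value that is no root.\<close>
    have "\<exists>i. poly.coeff S i \<notin> M" using poly_M[of S] S(2) sM by auto
    then obtain i where i: "poly.coeff S i \<notin> M" ..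
    obtain \<phi> where \<phi>: "\<forall>P\<in>M \<inter> ?T. ev \<phi> P = 0" "ev \<phi> (poly.coeff S i) \<noteq> 0"
      using insert.IH[OF J' S(1) power_notin[OF S(1) i]] by blast
    interpret e: comm_ring_hom "ev \<phi>" by (rule hom)
    have "poly.coeff (map_poly (ev \<phi>) S) i \<noteq> 0" using \<phi>(2) by (simp add: coeff_map_poly)
    then have nz: "map_poly (ev \<phi>) S \<noteq> 0" by auto
    then obtain b where b: "poly (map_poly (ev \<phi>) S) b \<noteq> 0"
      using poly_roots_finite[OF nz] infinite_alg_closed by (metis (mono_tags, lifting) UNIV_I finite_subset mem_Collect_eq subsetI)
    have "ev (\<phi>(x := b)) P = 0" if P: "P \<in> J" for P
    proof -
      have "P \<in> polys_in (insert x Y)" using P poly_idealD(1)[OF insert.prems(1)] by blast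
      then obtain H where H: "\<And>i. poly.coeff H i \<in> ?T" "poly H (indet x) = P" using polys_in_insert_rep by blast
      then have "poly.coeff H i \<in> M" for i using True P M(2) by blast
      then have "map_poly (ev \<phi>) H = 0" using vanish[OF _ \<phi>(1)] H(1) by blast
      then show ?thesis using ev_poly_indet[OF H(1) insert.hyps(2), of \<phi> b] H(2) by simp
    qed
    then show ?thesis using b ev_poly_indet[OF S(1) insert.hyps(2), of \<phi> b] S(2) by metis
  next
    case False
    \<comment> \<open>The algebraic case: a polynomial of least degree with the property
      \<open>Good\<close> serves as the minimal equation of x modulo M.\<close>
    define Good where "Good H \<longleftrightarrow> (\<forall>i. poly.coeff H i \<in> ?T) \<and> poly H (indet x) \<in> M \<and> (\<exists>i. poly.coeff H i \<notin> M)" for H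
    from False have "\<exists>H. Good H" unfolding Good_def by blast
    then obtain H where H: "Good H" and min: "\<And>H'. Polynomial.degree H' < Polynomial.degree H \<Longrightarrow> \<not> Good H'"
      using exists_least_iff[of "\<lambda>k. \<exists>H. Good H \<and> Polynomial.degree H = k"] by metis
    have HT: "poly.coeff H i \<in> ?T" and HM: "poly H (indet x) \<in> M" for i using H by (auto simp: Good_def)
    let ?c = "lc H"
    have deg: "0 < Polynomial.degree H"
    proof (rule ccontr)
      assume "\<not> 0 < Polynomial.degree H"
      then obtain h where h: "H = [:h:]" using degree_eq_zeroE by blast
      obtain i where "poly.coeff H i \<notin> M" using H by (auto simp: Good_def)
      then show False using HM poly_idealD(2)[OF M(1)] by (cases i) (auto simp: h)
    qed
    have c: "?c \<notin> M"
    proof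
      assume cM: "?c \<in> M"
      define H' where "H' = H - Polynomial.monom ?c (Polynomial.degree H)"
      have coef: "poly.coeff H' i = (if i = Polynomial.degree H then 0 else poly.coeff H i)" for i by (auto simp: H'_def)
      have "Polynomial.degree H' < Polynomial.degree H"
        using deg by (intro degree_lessI) (auto simp: coef coeff_eq_0)
      moreover have "poly (Polynomial.monom ?c (Polynomial.degree H)) (indet x) \<in> M"
        using cM poly_idealD(2)[OF M(1)] by (intro poly_M) auto
      then have "poly H' (indet x) \<in> M" unfolding H'_def poly_diff using HM poly_ideal_diff[OF M(1)] by blast
      moreover obtain i where "poly.coeff H i \<notin> M" using H by (auto simp: Good_def)
      then have "poly.coeff H' i \<notin> M" using cM by (auto simp: coef)
      moreover have "poly.coeff H' i \<in> ?T" for i using HT by (simp add: coef)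
      ultimately show False using min[of H'] unfolding Good_def by blast
    qed
    have small: "poly.coeff R i \<in> M \<inter> ?T" if "\<And>i. poly.coeff R i \<in> ?T" "poly R (indet x) \<in> M" "Polynomial.degree R < Polynomial.degree H" for R i
      using min[OF that(3)] that(1,2) unfolding Good_def by blast
    \<comment> \<open>The exponent is the one from \<open>roots_subset_imp_dvd_power\<close>: if all
      roots of the specialized H were roots of S, then H would divide this power and hence the
      remainder R.\<close>
    obtain k Q R where QR: "\<forall>i. poly.coeff Q i \<in> ?T" "\<forall>i. poly.coeff R i \<in> ?T"
      "Polynomial.smult (?c ^ k) (S ^ Polynomial.degree H) = Q * H + R" "Polynomial.degree R < Polynomial.degree H"
      using pseudo_division_in[OF HT deg, of "S ^ Polynomial.degree H"] coeffs_in_power[OF S(1)] by blast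
    have eq: "?c ^ k * s ^ Polynomial.degree H = poly Q (indet x) * poly H (indet x) + poly R (indet x)"
      using arg_cong[OF QR(3), of "\<lambda>p. poly p (indet x)"] S(2) by (simp add: poly_power)
    have "\<exists>i. poly.coeff R i \<notin> M"
    proof (rule ccontr)
      assume "\<nexists>i. poly.coeff R i \<notin> M"
      then have "poly R (indet x) \<in> M" by (intro poly_M) auto
      then have "?c ^ k * s ^ Polynomial.degree H \<in> M"
        unfolding eq using poly_in[of Q] QR(1) HM by (intro poly_idealD(3,4)[OF M(1)]) auto
      then have "?c ^ k \<in> M \<or> s ^ Polynomial.degree H \<in> M"
        using TX HT insert.prems(2) by (intro prime polys_in_power) auto
      then show False using M(3) power_notin[OF HT c] HT polys_in_power by blast
    qed
    then obtain i where i: "poly.coeff R i \<notin> M" ..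
    \<comment> \<open>Keeping this product nonzero preserves both the degree of H and the
      nonvanishing of R under specialization; R then has too small a degree to be divisible by
      H.\<close>
    let ?t = "?c * poly.coeff R i"
    have t: "?t \<in> ?T" "?t \<notin> M"
      using HT QR(2) c i prime[of ?c "poly.coeff R i"] TX by (auto intro: polys_in_mult)
    obtain \<phi> where \<phi>: "\<forall>P\<in>M \<inter> ?T. ev \<phi> P = 0" "ev \<phi> ?t \<noteq> 0"
      using insert.IH[OF J' t(1) power_notin[OF t]] by blast
    interpret e: comm_ring_hom "ev \<phi>" by (rule hom)
    have \<phi>c: "ev \<phi> ?c \<noteq> 0" "ev \<phi> (poly.coeff R i) \<noteq> 0" using \<phi>(2) by (auto simp: e.hom_mult)
    let ?G = "map_poly (ev \<phi>) H"
    have degG: "Polynomial.degree ?G = Polynomial.degree H" 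
      by (intro antisym degree_map_poly_le le_degree) (use \<phi>c(1) in \<open>simp_all add: coeff_map_poly\<close>)
    then have G0: "?G \<noteq> 0" using deg by auto
    have "\<exists>b. poly ?G b = 0 \<and> poly (map_poly (ev \<phi>) S) b \<noteq> 0"
    proof (rule ccontr)
      assume "\<nexists>b. poly ?G b = 0 \<and> poly (map_poly (ev \<phi>) S) b \<noteq> 0"
      then have "?G dvd map_poly (ev \<phi>) S ^ Polynomial.degree H"
        using roots_subset_imp_dvd_power[OF G0, of "map_poly (ev \<phi>) S"] degG by auto
      moreover have "Polynomial.smult (ev \<phi> ?c ^ k) (map_poly (ev \<phi>) S ^ Polynomial.degree H) = map_poly (ev \<phi>) Q * ?G + map_poly (ev \<phi>) R"
        using arg_cong[OF QR(3), of "map_poly (ev \<phi>)"]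
        by (simp add: map_poly_hom[OF hom] e.hom_power)
      ultimately have "?G dvd map_poly (ev \<phi>) R"
        by (metis dvd_add_right_iff dvd_smult dvd_triv_right)
      moreover have "poly.coeff (map_poly (ev \<phi>) R) i \<noteq> 0" using \<phi>c(2) by (simp add: coeff_map_poly)
      then have "map_poly (ev \<phi>) R \<noteq> 0" by auto
      ultimately have "Polynomial.degree H \<le> Polynomial.degree (map_poly (ev \<phi>) R)" using dvd_imp_degree_le degG by metis
      then show False using QR(4) degree_map_poly_le[of "ev \<phi>" R] by simp
    qed
    then obtain b where b: "poly ?G b = 0" "poly (map_poly (ev \<phi>) S) b \<noteq> 0" by blast
    have "ev (\<phi>(x := b)) P = 0" if P: "P \<in> J" for P
    proof -
      have "P \<in> polys_in (insert x Y)" using P poly_idealD(1)[OF insert.prems(1)] by blast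
      then obtain B where B: "\<And>i. poly.coeff B i \<in> ?T" "poly B (indet x) = P" using polys_in_insert_rep by blast
      obtain k' Q' R' where QR': "\<forall>i. poly.coeff Q' i \<in> ?T" "\<forall>i. poly.coeff R' i \<in> ?T"
        "Polynomial.smult (?c ^ k') B = Q' * H + R'" "Polynomial.degree R' < Polynomial.degree H"
        using pseudo_division_in[OF HT deg, of B] B(1) by blast
      have "poly R' (indet x) = ?c ^ k' * P - poly Q' (indet x) * poly H (indet x)"
        using arg_cong[OF QR'(3), of "\<lambda>p. poly p (indet x)"] B(2) by (simp add: algebra_simps)
      also have "\<dots> \<in> M"
      proof (rule poly_ideal_diff[OF M(1)]; rule poly_idealD(4)[OF M(1)])
        show "?c ^ k' \<in> polys_in (insert x Y)" using TX HT polys_in_power by blast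
        show "poly Q' (indet x) \<in> polys_in (insert x Y)" using poly_in[of Q'] QR'(1) by blast
      qed (use P M(2) HM in auto)
      \<comment> \<open>By minimality of H, a polynomial of smaller degree with value in M has all
        its coefficients in M.\<close>
      finally have "poly.coeff R' i \<in> M \<inter> ?T" for i
        by (intro small[OF _ _ QR'(4)]) (simp_all add: QR'(2))
      then have "map_poly (ev \<phi>) R' = 0" by (intro vanish[OF _ \<phi>(1)])
      then have "Polynomial.smult (ev \<phi> ?c ^ k') (map_poly (ev \<phi>) B) = map_poly (ev \<phi>) Q' * ?G"
        using arg_cong[OF QR'(3), of "map_poly (ev \<phi>)"]
        by (simp add: map_poly_hom[OF hom] e.hom_power)
      then have "poly (Polynomial.smult (ev \<phi> ?c ^ k') (map_poly (ev \<phi>) B)) b = poly (map_poly (ev \<phi>) Q' * ?G) b"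
        by (rule arg_cong)
      then have "ev \<phi> ?c ^ k' * poly (map_poly (ev \<phi>) B) b = 0"
        using b(1) by (simp only: poly_mult poly_smult mult_zero_right)
      then show ?thesis using \<phi>c(1) ev_poly_indet[OF B(1) insert.hyps(2), of \<phi> b] B(2) by simp
    qed
    then show ?thesis using b(2) ev_poly_indet[OF S(1) insert.hyps(2), of \<phi> b] S(2) by metis
  qed
qed

section \<open>From the affine to the multiprojective Nullstellensatz\<close>

definition pad :: "nat \<Rightarrow> (nat \<Rightarrow> nat) \<Rightarrow> (nat \<Rightarrow> nat) \<Rightarrow> (nat \<Rightarrow> nat) \<Rightarrow> expo \<Rightarrow> expo" where
  "pad r n l e t = (\<Sum>j\<in>{1..r}. Poly_Mapping.single (j, l j) (e j - group_degree n t j))"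

definition homogenize :: "nat \<Rightarrow> (nat \<Rightarrow> nat) \<Rightarrow> (nat \<Rightarrow> nat) \<Rightarrow> (nat \<Rightarrow> nat) \<Rightarrow> 'k::comm_ring_1 mpol \<Rightarrow> 'k mpol" where
  "homogenize r n l e P =
     (\<Sum>t\<in>Poly_Mapping.keys P. Poly_Mapping.single (t + pad r n l e t) (Poly_Mapping.lookup P t))"

lemma homogenize_add: "homogenize r n l e (P + Q) = homogenize r n l e P + homogenize r n l e Q"
  unfolding homogenize_def by (rule setsum_keys_plus_distrib) (simp_all add: single_add)

lemma homogenize_single: "homogenize r n l e (Poly_Mapping.single t c) = Poly_Mapping.single (t + pad r n l e t) c"
  by (cases "c = 0") (simp_all add: homogenize_def)

lemma homogenize_0 [simp]: "homogenize r n l e 0 = 0"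
  by (simp add: homogenize_def)

lemma homogenize_sum: "homogenize r n l e (\<Sum>i\<in>S. P i) = (\<Sum>i\<in>S. homogenize r n l e (P i))"
  by (induction S rule: infinite_finite_induct) (simp_all add: homogenize_add)

text \<open>Truncated subtraction satisfies e - (d + g) = (e - d) - g, so no bound on the degree of
  Q is required.\<close>

lemma homogenize_mult:
  fixes P Q :: "'k::comm_ring_1 mpol"
  assumes "P \<in> graded_part r n (\<lambda>j. int (d j))"
  shows "homogenize r n l e (P * Q) = P * homogenize r n l (\<lambda>j. e j - d j) Q"
proof -
  have single: "homogenize r n l e (Poly_Mapping.single u c * Q) =
      Poly_Mapping.single u c * homogenize r n l (\<lambda>j. e j - d j) Q"
    if u: "u \<in> monomials r n (\<lambda>j. int (d j))" for u and c :: 'k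
  proof (induction Q rule: poly_mapping_additive_induct)
    case (single t c')
    have "group_degree n (u + t) j = d j + group_degree n t j" if "j \<in> {1..r}" for j
      using u that by (auto simp: monomials_def group_degree_add)
    then have "pad r n l e (u + t) = pad r n l (\<lambda>j. e j - d j) t"
      unfolding pad_def by (intro sum.cong) (auto simp: diff_diff_left)
    then show ?case by (simp add: mult_single homogenize_single add.assoc)
  qed (simp add: distrib_left homogenize_add)
  have expand: "P * R = (\<Sum>m\<in>Poly_Mapping.keys P. Poly_Mapping.single m (Poly_Mapping.lookup P m) * R)" for R
    unfolding sum_distrib_right[symmetric]
    by (rule arg_cong[of _ _ "\<lambda>x. x * R"], rule poly_mapping_sum_singles)
  have "homogenize r n l e (P * Q) = (\<Sum>m\<in>Poly_Mapping.keys P.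
      Poly_Mapping.single m (Poly_Mapping.lookup P m) * homogenize r n l (\<lambda>j. e j - d j) Q)"
    unfolding expand[of Q] homogenize_sum
    by (intro sum.cong refl single) (use assms in \<open>auto simp: graded_part_def\<close>)
  then show ?thesis by (simp only: expand)
qed

lemma group_degree_sum: "group_degree n (\<Sum>i\<in>S. t i) j = (\<Sum>i\<in>S. group_degree n (t i) j)"
  by (induction S rule: infinite_finite_induct) (simp_all add: group_degree_add)

lemma group_degree_pad:
  assumes "\<And>j. j \<in> {1..r} \<Longrightarrow> l j \<le> n j" "j \<in> {1..r}"
  shows "group_degree n (pad r n l e t) j = e j - group_degree n t j"
proof -
  have "group_degree n (pad r n l e t) j = (\<Sum>i\<in>{1..r}. if i = j then e j - group_degree n t j else 0)"
    unfolding pad_def group_degree_sum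
    by (intro sum.cong refl) (use assms(1) in \<open>auto simp: group_degree_single\<close>)
  then show ?thesis using assms(2) by simp
qed

lemma keys_pad:
  assumes "\<And>j. j \<in> {1..r} \<Longrightarrow> l j \<le> n j"
  shows "Poly_Mapping.keys (pad r n l e t) \<subseteq> indets r n"
proof
  fix v assume "v \<in> Poly_Mapping.keys (pad r n l e t)"
  then have "(\<Sum>j\<in>{1..r}. Poly_Mapping.lookup (Poly_Mapping.single (j, l j) (e j - group_degree n t j)) v) \<noteq> 0"
    by (simp add: pad_def in_keys_iff lookup_sum)
  then obtain j where "j \<in> {1..r}" "Poly_Mapping.lookup (Poly_Mapping.single (j, l j) (e j - group_degree n t j)) v \<noteq> 0"
    by (meson sum.not_neutral_contains_not_neutral)
  then show "v \<in> indets r n" using assms by (auto simp: lookup_single when_def indets_def split: if_splits)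
qed

lemma homogenize_graded:
  assumes "\<And>j. j \<in> {1..r} \<Longrightarrow> l j \<le> n j" "P \<in> polys_in (indets r n)"
    and "\<And>t j. t \<in> Poly_Mapping.keys P \<Longrightarrow> j \<in> {1..r} \<Longrightarrow> group_degree n t j \<le> e j"
  shows "homogenize r n l e P \<in> graded_part r n (\<lambda>j. int (e j))"
  unfolding homogenize_def
proof (intro graded_part_sum graded_part_single)
  fix t assume t: "t \<in> Poly_Mapping.keys P"
  have "Poly_Mapping.keys t \<subseteq> indets r n" using assms(2) t by (auto simp: polys_in_def)
  then have "Poly_Mapping.keys (t + pad r n l e t) \<subseteq> indets r n"
    using keys_pad[of r l n e t, OF assms(1)] Poly_Mapping.keys_add[of t "pad r n l e t"] by blast
  moreover have "group_degree n (t + pad r n l e t) j = e j" if "j \<in> {1..r}" for j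
    using group_degree_pad[OF assms(1) that] assms(3)[OF t that] by (simp add: group_degree_add)
  ultimately show "t + pad r n l e t \<in> monomials r n (\<lambda>j. int (e j))" by (simp add: monomials_def)
qed

text \<open>As long as its degree is below e j, a monomial and its product with the variable
  \<open>(j, l j)\<close> are padded to the same monomial.\<close>

lemma homogenize_dehomogenized:
  fixes h :: "'k::comm_ring_1 mpol"
  assumes l: "\<And>j. j \<in> {1..r} \<Longrightarrow> l j \<le> n j" and j: "j \<in> {1..r}"
    and small: "\<And>t. t \<in> Poly_Mapping.keys h \<Longrightarrow> group_degree n t j < e j"
  shows "homogenize r n l e ((indet (j, l j) - 1) * h) = 0"
proof -
  have single: "homogenize r n l e ((indet (j, l j) - 1) * Poly_Mapping.single t c) = 0"
    if t: "group_degree n t j < e j" for t and c :: 'k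
  proof -
    let ?x = "Poly_Mapping.single (j, l j) (1 :: nat)"
    have gd: "group_degree n (?x + t) i = (if i = j then Suc (group_degree n t i) else group_degree n t i)"
      for i using l[OF j] by (auto simp: group_degree_add group_degree_single)
    have "pad r n l e t = ?x + pad r n l e (?x + t)"
    proof -
      have "pad r n l e t = Poly_Mapping.single (j, l j) (e j - group_degree n t j) +
          (\<Sum>i\<in>{1..r} - {j}. Poly_Mapping.single (i, l i) (e i - group_degree n t i))"
        unfolding pad_def using j by (intro sum.remove) auto
      also have "e j - group_degree n t j = 1 + (e j - group_degree n (?x + t) j)" using t unfolding gd by simp
      also have "(\<Sum>i\<in>{1..r} - {j}. Poly_Mapping.single (i, l i) (e i - group_degree n t i)) =
          (\<Sum>i\<in>{1..r} - {j}. Poly_Mapping.single (i, l i) (e i - group_degree n (?x + t) i))"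
        unfolding gd by (rule sum.cong) auto
      also have "Poly_Mapping.single (j, l j) (1 + (e j - group_degree n (?x + t) j)) =
          ?x + Poly_Mapping.single (j, l j) (e j - group_degree n (?x + t) j)"
        by (rule single_add)
      also note add.assoc
      also have "Poly_Mapping.single (j, l j) (e j - group_degree n (?x + t) j) +
          (\<Sum>i\<in>{1..r} - {j}. Poly_Mapping.single (i, l i) (e i - group_degree n (?x + t) i)) =
          pad r n l e (?x + t)"
        unfolding pad_def using j by (intro sum.remove[symmetric]) auto
      finally show ?thesis by (simp only: add.assoc)
    qed
    then have eq: "(?x + t) + pad r n l e (?x + t) = t + pad r n l e t" by (simp only: add.assoc add.left_commute)
    have "(indet (j, l j) - 1) * Poly_Mapping.single t c =
        Poly_Mapping.single (?x + t) c + Poly_Mapping.single t (- c)"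
      by (simp add: left_diff_distrib indet_def mult_single single_uminus)
    then show ?thesis by (simp only: homogenize_add homogenize_single eq) (simp add: single_uminus)
  qed
  have "(indet (j, l j) - 1) * h =
      (\<Sum>t\<in>Poly_Mapping.keys h. (indet (j, l j) - 1) * Poly_Mapping.single t (Poly_Mapping.lookup h t))"
    unfolding sum_distrib_left[symmetric]
    by (rule arg_cong[of _ _ "\<lambda>x. (indet (j, l j) - 1) * x"], rule poly_mapping_sum_singles)
  then show ?thesis using single small by (simp only: homogenize_sum) (simp add: sum.neutral)
qed

text \<open>Setting one variable of each group to 1 passes to an affine chart, where the f i have no
  common zero. The resulting expression of 1 is homogenized: this turns 1 into the power of the
  chosen variables and kills the multiples of the equations of the chart.\<close>

theorem homogeneous_nullstellensatz:
  fixes f :: "nat \<Rightarrow> 'k::alg_closed_field mpol"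
  assumes f: "\<And>i. i < m \<Longrightarrow> f i \<in> graded_part r n (\<lambda>j. int (d i j))"
    and no_zero: "\<And>q. (\<forall>j\<in>{1..r}. \<exists>l\<le>n j. q (j, l) \<noteq> 0) \<Longrightarrow> \<exists>i<m. ev q (f i) \<noteq> 0"
    and l: "\<And>j. j \<in> {1..r} \<Longrightarrow> l j \<le> n j"
  shows "\<exists>k g. (\<forall>i<m. g i \<in> graded_part r n (\<lambda>j. int k - int (d i j))) \<and>
    Poly_Mapping.single (\<Sum>j\<in>{1..r}. Poly_Mapping.single (j, l j) k) 1 = (\<Sum>i<m. f i * g i)"
proof -
  let ?V = "indets r n"
  define J where "J = {(\<Sum>i<m. f i * g i) + (\<Sum>j\<in>{1..r}. (indet (j, l j) - 1) * h j) | g h.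
      (\<forall>i. g i \<in> polys_in ?V) \<and> (\<forall>j. h j \<in> polys_in ?V)}"
  have JI: "(\<Sum>i<m. f i * g i) + (\<Sum>j\<in>{1..r}. (indet (j, l j) - 1) * h j) \<in> J"
    if "\<And>i. g i \<in> polys_in ?V" "\<And>j. h j \<in> polys_in ?V" for g h
    using that unfolding J_def by blast
  have f_in: "f i \<in> polys_in ?V" if "i < m" for i
    using f[OF that] by (auto simp: graded_part_def polys_in_def monomials_def)
  have x_in: "indet (j, l j) - 1 \<in> polys_in ?V" if "j \<in> {1..r}" for j
    using that l[OF that] by (intro polys_in_diff) (auto simp: indet_def indets_def intro!: polys_in_single)
  have ideal: "poly_ideal ?V J"
    unfolding poly_ideal_def
  proof (intro conjI ballI)
    show "J \<subseteq> polys_in ?V"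
    proof
      fix P assume "P \<in> J"
      then obtain g h where P: "P = (\<Sum>i<m. f i * g i) + (\<Sum>j\<in>{1..r}. (indet (j, l j) - 1) * h j)"
        and gh: "\<And>i. g i \<in> polys_in ?V" "\<And>j. h j \<in> polys_in ?V"
        unfolding J_def by blast
      have "(indet (j, l j) - 1) * h j \<in> polys_in ?V" if "j \<in> {1..r}" for j
        by (rule polys_in_mult[OF x_in[OF that] gh(2)])
      moreover have "f i * g i \<in> polys_in ?V" if "i < m" for i
        by (rule polys_in_mult[OF f_in[OF that] gh(1)])
      ultimately show "P \<in> polys_in ?V" unfolding P by (intro polys_in_add polys_in_sum) (simp_all only: lessThan_iff)
    qed
    show "0 \<in> J" using JI[of "\<lambda>_. 0" "\<lambda>_. 0"] by simp
    fix a b assume "a \<in> J" "b \<in> J"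
    then obtain g h g' h' where gh: "a = (\<Sum>i<m. f i * g i) + (\<Sum>j\<in>{1..r}. (indet (j, l j) - 1) * h j)"
      "b = (\<Sum>i<m. f i * g' i) + (\<Sum>j\<in>{1..r}. (indet (j, l j) - 1) * h' j)"
      "\<And>i. g i \<in> polys_in ?V" "\<And>j. h j \<in> polys_in ?V" "\<And>i. g' i \<in> polys_in ?V" "\<And>j. h' j \<in> polys_in ?V"
      unfolding J_def by blast
    have ab: "a + b = (\<Sum>i<m. f i * (g i + g' i)) + (\<Sum>j\<in>{1..r}. (indet (j, l j) - 1) * (h j + h' j))"
      by (simp add: gh(1,2) distrib_left sum.distrib)
    show "a + b \<in> J" unfolding ab by (intro JI polys_in_add gh(3-))
  next
    fix a b :: "'k mpol" assume a: "a \<in> polys_in ?V" and "b \<in> J"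
    then obtain g h where gh: "b = (\<Sum>i<m. f i * g i) + (\<Sum>j\<in>{1..r}. (indet (j, l j) - 1) * h j)"
      "\<And>i. g i \<in> polys_in ?V" "\<And>j. h j \<in> polys_in ?V"
      unfolding J_def by blast
    have ab: "a * b = (\<Sum>i<m. f i * (a * g i)) + (\<Sum>j\<in>{1..r}. (indet (j, l j) - 1) * (a * h j))"
      by (simp add: gh(1) distrib_left sum_distrib_left mult.left_commute)
    show "a * b \<in> J" unfolding ab by (intro JI polys_in_mult[OF a] gh(2-))
  qed
  have gen_f: "f i \<in> J" if i: "i < m" for i
  proof -
    have "(\<Sum>i'<m. f i' * (if i' = i then 1 else 0)) = (\<Sum>i'<m. if i' = i then f i else 0)"
      by (rule sum.cong) auto
    then have "f i = (\<Sum>i'<m. f i' * (if i' = i then 1 else 0)) + (\<Sum>j\<in>{1..r}. (indet (j, l j) - 1) * 0)"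
      using i by simp
    then show ?thesis using JI[of "\<lambda>i'. if i' = i then 1 else 0" "\<lambda>_. 0"] by simp
  qed
  have gen_x: "indet (j, l j) - 1 \<in> J" if j: "j \<in> {1..r}" for j
  proof -
    have "(\<Sum>j'\<in>{1..r}. (indet (j', l j') - 1) * (if j' = j then 1 else 0)) =
        (\<Sum>j'\<in>{1..r}. if j' = j then indet (j, l j) - (1 :: 'k mpol) else 0)"
      by (rule sum.cong) auto
    then have "indet (j, l j) - 1 = (\<Sum>i<m. f i * 0) +
        (\<Sum>j'\<in>{1..r}. (indet (j', l j') - 1) * (if j' = j then 1 else 0))"
      using j by simp
    then show ?thesis using JI[of "\<lambda>_. 0" "\<lambda>j'. if j' = j then 1 else 0"] by simp
  qed
  have "1 \<in> J"
  proof (rule ccontr)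
    assume "1 \<notin> J"
    then obtain \<phi> where \<phi>: "\<forall>P\<in>J. ev \<phi> P = 0"
      using nullstellensatz[OF finite_indets ideal polys_in_1] by auto
    interpret e: comm_ring_hom "ev \<phi>" by (rule comm_ring_hom_ev)
    have "\<phi> (j, l j) = 1" if "j \<in> {1..r}" for j
      using bspec[OF \<phi> gen_x[OF that]] by (simp add: e.hom_minus)
    then have "\<forall>j\<in>{1..r}. \<exists>l\<le>n j. \<phi> (j, l) \<noteq> 0" using l by (metis one_neq_zero)
    then show False using no_zero \<phi> gen_f by blast
  qed
  then obtain g h where gh: "1 = (\<Sum>i<m. f i * g i) + (\<Sum>j\<in>{1..r}. (indet (j, l j) - 1) * h j)"
      "\<And>i. g i \<in> polys_in ?V" "\<And>j. h j \<in> polys_in ?V"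
    unfolding J_def by blast
  \<comment> \<open>A crude common bound for all degrees that occur. Its successor is used as target
    degree because \<open>homogenize_dehomogenized\<close> demands a strict inequality.\<close>
  define B where "B = (\<Sum>i<m. \<Sum>j\<in>{1..r}. d i j) +
    (\<Sum>i<m. \<Sum>t\<in>Poly_Mapping.keys (g i). \<Sum>j\<in>{1..r}. group_degree n t j) +
    (\<Sum>i\<in>{1..r}. \<Sum>t\<in>Poly_Mapping.keys (h i). \<Sum>j\<in>{1..r}. group_degree n t j)"
  have B1: "d i j + group_degree n t j \<le> B" if "i < m" "j \<in> {1..r}" "t \<in> Poly_Mapping.keys (g i)" for i j t
  proof -
    have "d i j \<le> (\<Sum>i<m. \<Sum>j\<in>{1..r}. d i j)"
      using that by (intro order.trans[OF member_le_sum[of j "{1..r}" "d i"] member_le_sum[of i "{..<m}" "\<lambda>i. \<Sum>j\<in>{1..r}. d i j"]]) auto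
    moreover have "group_degree n t j \<le> (\<Sum>i<m. \<Sum>t\<in>Poly_Mapping.keys (g i). \<Sum>j\<in>{1..r}. group_degree n t j)"
      using that
      by (intro order.trans[OF member_le_sum[of j "{1..r}" "group_degree n t"]
            order.trans[OF member_le_sum[of t "Poly_Mapping.keys (g i)" "\<lambda>t. \<Sum>j\<in>{1..r}. group_degree n t j"]
              member_le_sum[of i "{..<m}" "\<lambda>i. \<Sum>t\<in>Poly_Mapping.keys (g i). \<Sum>j\<in>{1..r}. group_degree n t j"]]]) auto
    ultimately show ?thesis by (simp add: B_def)
  qed
  have B2: "d i j \<le> B" if "i < m" "j \<in> {1..r}" for i j
  proof -
    have "d i j \<le> (\<Sum>i<m. \<Sum>j\<in>{1..r}. d i j)"
      using that by (intro order.trans[OF member_le_sum[of j "{1..r}" "d i"] member_le_sum[of i "{..<m}" "\<lambda>i. \<Sum>j\<in>{1..r}. d i j"]]) auto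
    then show ?thesis by (simp add: B_def)
  qed
  have B3: "group_degree n t j \<le> B" if "i \<in> {1..r}" "j \<in> {1..r}" "t \<in> Poly_Mapping.keys (h i)" for i j t
  proof -
    have "group_degree n t j \<le> (\<Sum>i\<in>{1..r}. \<Sum>t\<in>Poly_Mapping.keys (h i). \<Sum>j\<in>{1..r}. group_degree n t j)"
      using that
      by (intro order.trans[OF member_le_sum[of j "{1..r}" "group_degree n t"]
            order.trans[OF member_le_sum[of t "Poly_Mapping.keys (h i)" "\<lambda>t. \<Sum>j\<in>{1..r}. group_degree n t j"]
              member_le_sum[of i "{1..r}" "\<lambda>i. \<Sum>t\<in>Poly_Mapping.keys (h i). \<Sum>j\<in>{1..r}. group_degree n t j"]]]) auto
    then show ?thesis by (simp add: B_def)
  qed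
  let ?k = "Suc B"
  let ?H = "\<lambda>i. homogenize r n l (\<lambda>j. ?k - d i j) (g i)"
  have "Poly_Mapping.single (\<Sum>j\<in>{1..r}. Poly_Mapping.single (j, l j) ?k) 1 = homogenize r n l (\<lambda>_. ?k) (1 :: 'k mpol)"
    unfolding single_one[symmetric] homogenize_single by (simp add: pad_def del: single_one)
  also have "\<dots> = (\<Sum>i<m. homogenize r n l (\<lambda>_. ?k) (f i * g i)) +
      (\<Sum>j\<in>{1..r}. homogenize r n l (\<lambda>_. ?k) ((indet (j, l j) - 1) * h j))"
    by (subst gh(1)) (simp only: homogenize_add homogenize_sum)
  also have "(\<Sum>j\<in>{1..r}. homogenize r n l (\<lambda>_. ?k) ((indet (j, l j) - 1) * h j)) = 0"
    by (intro sum.neutral ballI homogenize_dehomogenized l) (use B3 in \<open>auto simp: less_Suc_eq_le\<close>)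
  also have "(\<Sum>i<m. homogenize r n l (\<lambda>_. ?k) (f i * g i)) = (\<Sum>i<m. f i * ?H i)"
    by (intro sum.cong refl homogenize_mult f) auto
  finally have eq: "Poly_Mapping.single (\<Sum>j\<in>{1..r}. Poly_Mapping.single (j, l j) ?k) 1 = (\<Sum>i<m. f i * ?H i)" by simp
  have "?H i \<in> graded_part r n (\<lambda>j. int ?k - int (d i j))" if i: "i < m" for i
  proof -
    have "?H i \<in> graded_part r n (\<lambda>j. int (?k - d i j))"
    proof (rule homogenize_graded[OF l gh(2)])
      fix t j assume "t \<in> Poly_Mapping.keys (g i)" "j \<in> {1..r}"
      then have "d i j + group_degree n t j \<le> B" by (intro B1[OF i])
      then show "group_degree n t j \<le> ?k - d i j" by arith
    qed
    moreover have "graded_part r n (\<lambda>j. int (?k - d i j)) = (graded_part r n (\<lambda>j. int ?k - int (d i j)) :: 'k mpol set)"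
      by (rule graded_part_cong) (use B2[OF i] in \<open>auto simp: of_nat_diff le_SucI\<close>)
    ultimately show ?thesis by simp
  qed
  then show ?thesis using eq by (intro exI[of _ ?k] exI[of _ ?H] conjI allI impI)
qed

section \<open>Multiplication by forms that do not vanish on the zero scheme\<close>

context cofactor_chain
begin

text \<open>In each group the degree forces an exponent above that of \<alpha>. The cofactor is
  taken in the first group where this happens at a cofactor variable; in the groups before, it can
  only happen at the last variable. Group r always qualifies because all its variables have
  cofactors.\<close>

lemma cofac_expo_divides:
  assumes t: "t \<in> monomials r n (\<lambda>j. int (e j))" and \<alpha>: "\<And>j. j \<in> {1..r} \<Longrightarrow> group_degree n \<alpha> j < e j"
  shows "\<exists>c\<le>N. \<forall>v. Poly_Mapping.lookup (cofac_expo \<alpha> c) v \<le> Poly_Mapping.lookup t v"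
proof -
  let ?big = "\<lambda>v. Poly_Mapping.lookup \<alpha> v < Poly_Mapping.lookup t v"
  have gd: "group_degree n t j = e j" if "j \<in> {1..r}" for j using t that by (auto simp: monomials_def)
  have some: "\<exists>l\<le>n j. ?big (j, l)" if j: "j \<in> {1..r}" for j
  proof (rule ccontr)
    assume "\<not> (\<exists>l\<le>n j. ?big (j, l))"
    then have "group_degree n t j \<le> group_degree n \<alpha> j"
      unfolding group_degree_def by (intro sum_mono) (auto simp: not_less)
    then show False using gd[OF j] \<alpha>[OF j] by simp
  qed
  let ?P = "\<lambda>j. \<exists>v\<in>set cofac. fst v = j \<and> ?big v"
  obtain l where "l \<le> n r" "?big (r, l)" using some[of r] r_pos by auto
  moreover have "(r, l) \<in> set cofac" using calculation(1) r_pos by (auto simp: mem_cofac indets_def)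
  ultimately have "?P r" by force
  then have P: "?P (LEAST j. ?P j)" by (rule LeastI)
  define j where "j = (LEAST j. ?P j)"
  obtain v where v: "v \<in> set cofac" "fst v = j" "?big v" using P unfolding j_def by blast
  obtain c where c: "c \<le> N" "v = cofac ! c" using v(1) by (auto simp: in_set_conv_nth less_Suc_eq_le)
  have jr: "j \<in> {1..r}" using v(1,2) by (auto simp: mem_cofac indets_def)
  have last: "?big (i, n i)" if i: "i \<in> {1..<j}" for i
  proof -
    have ir: "i \<in> {1..r}" "i < r" using i jr by auto
    obtain l where l: "l \<le> n i" "?big (i, l)" using some[OF ir(1)] by blast
    have "i < (LEAST j. ?P j)" using i unfolding j_def by simp
    then have "\<not> ?P i" by (rule not_less_Least)
    moreover have "?P i" if "(i, l) \<in> set cofac"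
      by (rule bexI[OF _ that]) (use l(2) in simp)
    ultimately have "(i, l) \<notin> set cofac" by blast
    then have "l = n i" using l(1) ir by (auto simp: mem_cofac indets_def)
    then show ?thesis using l(2) by simp
  qed
  have "Poly_Mapping.lookup (cofac_expo \<alpha> c) u \<le> Poly_Mapping.lookup t u" for u
  proof -
    have lev: "level c = j" using c v(2) by (simp add: level_def)
    show ?thesis
      using v(3) c(2) last[of "fst u"] unfolding lookup_cofac_expo[OF c(1)] lev
      by (cases u) (auto simp: Suc_le_eq)
  qed
  then show ?thesis using c(1) by blast
qed

text \<open>The cofactors of the f_i are given, but those of the auxiliary form have to be
  constructed; each monomial is assigned to one divisor.\<close>

lemma decomposition_exists:
  fixes P :: "'a::comm_ring_1 mpol"
  assumes P: "P \<in> graded_part r n (\<lambda>j. int (e j))" and \<alpha>: "\<And>j. j \<in> {1..r} \<Longrightarrow> group_degree n \<alpha> j < e j"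
  shows "\<exists>F. (\<forall>c\<le>N. F c \<in> graded_part r n (\<lambda>j. int (e j) - int (group_degree n (cofac_expo \<alpha> c) j))) \<and>
    P = (\<Sum>c\<le>N. Poly_Mapping.single (cofac_expo \<alpha> c) 1 * F c)"
proof -
  have "\<forall>t\<in>Poly_Mapping.keys P. \<exists>c\<le>N. \<forall>v. Poly_Mapping.lookup (cofac_expo \<alpha> c) v \<le> Poly_Mapping.lookup t v"
    using cofac_expo_divides[OF _ \<alpha>] P by (auto simp: graded_part_def)
  then obtain c where c: "\<And>t. t \<in> Poly_Mapping.keys P \<Longrightarrow> c t \<le> N \<and>
      (\<forall>v. Poly_Mapping.lookup (cofac_expo \<alpha> (c t)) v \<le> Poly_Mapping.lookup t v)"
    by metis
  define q where "q t = t - cofac_expo \<alpha> (c t)" for t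
  have q: "t = cofac_expo \<alpha> (c t) + q t" if "t \<in> Poly_Mapping.keys P" for t
  proof (rule poly_mapping_eqI)
    fix v
    have "Poly_Mapping.lookup (cofac_expo \<alpha> (c t)) v \<le> Poly_Mapping.lookup t v" using c[OF that] by blast
    then show "Poly_Mapping.lookup t v = Poly_Mapping.lookup (cofac_expo \<alpha> (c t) + q t) v"
      by (simp add: q_def lookup_add lookup_minus)
  qed
  define F where "F k = (\<Sum>t\<in>{t\<in>Poly_Mapping.keys P. c t = k}. Poly_Mapping.single (q t) (Poly_Mapping.lookup P t))" for k
  have "F k \<in> graded_part r n (\<lambda>j. int (e j) - int (group_degree n (cofac_expo \<alpha> k) j))" if "k \<le> N" for k
    unfolding F_def
  proof (intro graded_part_sum graded_part_single)
    fix t assume "t \<in> {t\<in>Poly_Mapping.keys P. c t = k}"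
    then have t: "t \<in> Poly_Mapping.keys P" "c t = k" by auto
    have "cofac_expo \<alpha> k + q t \<in> monomials r n (\<lambda>j. int (group_degree n (cofac_expo \<alpha> k) j) +
        (int (e j) - int (group_degree n (cofac_expo \<alpha> k) j)))"
      using q[OF t(1)] t P by (auto simp: graded_part_def)
    then show "q t \<in> monomials r n (\<lambda>j. int (e j) - int (group_degree n (cofac_expo \<alpha> k) j))"
      by (rule group_degree_diff[OF _ cofac_expo_monomials[OF that]])
  qed
  moreover have "P = (\<Sum>k\<le>N. Poly_Mapping.single (cofac_expo \<alpha> k) 1 * F k)"
  proof -
    have "(\<Sum>k\<le>N. Poly_Mapping.single (cofac_expo \<alpha> k) 1 * F k) =
        (\<Sum>k\<le>N. \<Sum>t\<in>{t\<in>Poly_Mapping.keys P. c t = k}. Poly_Mapping.single t (Poly_Mapping.lookup P t))"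
      unfolding F_def sum_distrib_left
    proof (intro sum.cong refl)
      fix k t assume "t \<in> {t\<in>Poly_Mapping.keys P. c t = k}"
      then have "cofac_expo \<alpha> k + q t = t" using q[of t] by auto
      then show "Poly_Mapping.single (cofac_expo \<alpha> k) 1 * Poly_Mapping.single (q t) (Poly_Mapping.lookup P t) =
          Poly_Mapping.single t (Poly_Mapping.lookup P t)"
        by (simp add: mult_single)
    qed
    also have "\<dots> = (\<Sum>t\<in>Poly_Mapping.keys P. Poly_Mapping.single t (Poly_Mapping.lookup P t))"
      by (rule sum.group) (use c in auto)
    finally show ?thesis by (simp flip: poly_mapping_sum_singles)
  qed
  ultimately show ?thesis by blast
qed

end

lemma ev_rescaled:
  fixes P :: "'k::field mpol"
  assumes P: "P \<in> graded_part r n e" and c: "\<And>j l. j \<in> {1..r} \<Longrightarrow> l \<le> n j \<Longrightarrow> q' (j, l) = c j * q (j, l)"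
  shows "ev q' P = (\<Prod>j\<in>{1..r}. c j ^ nat (e j)) * ev q P"
proof -
  have mon: "evaluate_monomial q' t = (\<Prod>j\<in>{1..r}. c j ^ nat (e j)) * evaluate_monomial q t"
    if t: "t \<in> monomials r n e" for t
  proof -
    have sub: "Poly_Mapping.keys t \<subseteq> indets r n" using t by (auto simp: monomials_def)
    have prod: "(\<Prod>v\<in>indets r n. g v) = (\<Prod>j\<in>{1..r}. \<Prod>l\<le>n j. g (j, l))" for g :: "nat \<times> nat \<Rightarrow> 'k"
      unfolding indets_def by (simp add: prod.Sigma)
    have "evaluate_monomial q' t = (\<Prod>j\<in>{1..r}. \<Prod>l\<le>n j. (c j * q (j, l)) ^ Poly_Mapping.lookup t (j, l))"
      unfolding evaluate_monomial_superset[OF finite_indets sub] prod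
      by (intro prod.cong refl) (use c in auto)
    also have "\<dots> = (\<Prod>j\<in>{1..r}. c j ^ nat (e j)) * (\<Prod>j\<in>{1..r}. \<Prod>l\<le>n j. q (j, l) ^ Poly_Mapping.lookup t (j, l))"
      unfolding prod.distrib[symmetric]
    proof (intro prod.cong refl)
      fix j assume j: "j \<in> {1..r}"
      have "int (group_degree n t j) = e j" using t j by (auto simp: monomials_def)
      then have "c j ^ nat (e j) = (\<Prod>l\<le>n j. c j ^ Poly_Mapping.lookup t (j, l))"
        by (metis group_degree_def nat_int power_sum)
      then show "(\<Prod>l\<le>n j. (c j * q (j, l)) ^ Poly_Mapping.lookup t (j, l)) =
          c j ^ nat (e j) * (\<Prod>l\<le>n j. q (j, l) ^ Poly_Mapping.lookup t (j, l))"
        by (simp add: power_mult_distrib prod.distrib)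
    qed
    finally show ?thesis unfolding evaluate_monomial_superset[OF finite_indets sub] prod .
  qed
  have "ev q' P = (\<Sum>t\<in>Poly_Mapping.keys P. Poly_Mapping.lookup P t * evaluate_monomial q' t)"
    by (simp add: evaluate_superset[of "Poly_Mapping.keys P"])
  also have "\<dots> = (\<Sum>t\<in>Poly_Mapping.keys P. (\<Prod>j\<in>{1..r}. c j ^ nat (e j)) * (Poly_Mapping.lookup P t * evaluate_monomial q t))"
    by (intro sum.cong refl) (use P mon in \<open>auto simp: graded_part_def mult.left_commute\<close>)
  finally show ?thesis by (simp add: evaluate_superset[of "Poly_Mapping.keys P" P] sum_distrib_left)
qed

section \<open>The zeros of f and the Koszul complex with one more form\<close>

locale multiprojective = cofactor_chain r n for r n +
  fixes d :: "nat \<Rightarrow> nat \<Rightarrow> nat" and f :: "nat \<Rightarrow> 'k::alg_closed_field mpol"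
  assumes d_pos: "\<And>i j. i \<le> N \<Longrightarrow> j \<in> {1..r} \<Longrightarrow> 1 \<le> d i j"
    and f_deg: "\<And>i. i \<le> N \<Longrightarrow> f i \<in> graded_part r n (idegree d i)"
    and finite_zeros: "finite (zero_points r n f)"
begin

abbreviation "Z \<equiv> zero_points r n f"

text \<open>A chosen representative gives a ring homomorphism. The value itself depends on the
  choice, but the vanishing of a multihomogeneous polynomial does not.\<close>

definition value_at :: "(nat \<times> nat \<Rightarrow> 'k) set \<Rightarrow> 'k mpol \<Rightarrow> 'k" where
  "value_at p = ev (SOME q. q \<in> p)"

lemma rescaling_D:
  "(q, q') \<in> rescaling r n \<Longrightarrow> \<exists>c. \<forall>j\<in>{1..r}. c j \<noteq> 0 \<and> (\<forall>l\<le>n j. q' (j, l) = c j * q (j, l))"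
  unfolding rescaling_def by blast

lemma rescaling_refl: "q \<in> homogeneous_coords r n \<Longrightarrow> (q, q) \<in> rescaling r n"
  unfolding rescaling_def by (auto intro!: exI[of _ "\<lambda>_. 1"])

lemma point_cases:
  assumes "p \<in> multiprojective_space r n"
  obtains q where "q \<in> homogeneous_coords r n" "p = rescaling r n `` {q}" "q \<in> p"
  using assms rescaling_refl unfolding multiprojective_space_def quotient_def by blast

lemma some_in_point: "p \<in> multiprojective_space r n \<Longrightarrow> (SOME q. q \<in> p) \<in> p"
  by (metis point_cases someI_ex)

lemma ev_zero_iff_class:
  assumes p: "p \<in> multiprojective_space r n" and q: "q \<in> p" "q' \<in> p" and P: "P \<in> graded_part r n e"
  shows "ev q P = 0 \<longleftrightarrow> ev q' P = 0"
proof -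
  obtain q0 where q0: "p = rescaling r n `` {q0}" using p by (metis point_cases)
  have *: "ev x P = 0 \<longleftrightarrow> ev q0 P = 0" if "x \<in> p" for x
  proof -
    have "(q0, x) \<in> rescaling r n" using that q0 by blast
    then obtain c where "\<forall>j\<in>{1..r}. c j \<noteq> 0 \<and> (\<forall>l\<le>n j. x (j, l) = c j * q0 (j, l))"
      using rescaling_D by blast
    then show ?thesis using ev_rescaled[OF P, of x c q0] by auto
  qed
  show ?thesis using *[OF q(1)] *[OF q(2)] by simp
qed

lemma nonvanishing_iff:
  assumes "p \<in> multiprojective_space r n" "P \<in> graded_part r n e"
  shows "(\<forall>q\<in>p. ev q P \<noteq> 0) \<longleftrightarrow> value_at p P \<noteq> 0"
  using ev_zero_iff_class[OF assms(1) _ some_in_point[OF assms(1)] assms(2)] some_in_point[OF assms(1)]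
  unfolding value_at_def by blast

lemma zero_point_space: "p \<in> Z \<Longrightarrow> p \<in> multiprojective_space r n"
  by (simp add: zero_points_def)

lemma value_hom: "comm_ring_hom (value_at p)"
  unfolding value_at_def by (rule comm_ring_hom_ev)

lemma value_mult: "value_at p (P * Q) = value_at p P * value_at p Q"
  and value_add: "value_at p (P + Q) = value_at p P + value_at p Q"
  and value_diff: "value_at p (P - Q) = value_at p P - value_at p Q"
  and value_1 [simp]: "value_at p 1 = 1"
  and value_0 [simp]: "value_at p 0 = 0"
  and value_power: "value_at p (P ^ k) = value_at p P ^ k"
  and value_sum: "value_at p (\<Sum>i\<in>S. g i) = (\<Sum>i\<in>S. value_at p (g i))"
  and value_prod: "value_at p (\<Prod>i\<in>S. g i) = (\<Prod>i\<in>S. value_at p (g i))"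
proof -
  interpret e: comm_ring_hom "value_at p" by (rule value_hom)
  show "value_at p (P * Q) = value_at p P * value_at p Q" by (rule e.hom_mult)
  show "value_at p (P + Q) = value_at p P + value_at p Q" by (rule e.hom_add)
  show "value_at p (P - Q) = value_at p P - value_at p Q" by (rule e.hom_minus)
  show "value_at p 1 = 1" "value_at p 0 = 0" by simp_all
  show "value_at p (P ^ k) = value_at p P ^ k" by (rule e.hom_power)
  show "value_at p (\<Sum>i\<in>S. g i) = (\<Sum>i\<in>S. value_at p (g i))" by (rule e.hom_sum)
  show "value_at p (\<Prod>i\<in>S. g i) = (\<Prod>i\<in>S. value_at p (g i))" by (rule e.hom_prod)
qed

lemma coords_zero_point:
  assumes q: "\<forall>j\<in>{1..r}. \<exists>l\<le>n j. q (j, l) \<noteq> 0" and zero: "\<And>i. i \<le> N \<Longrightarrow> ev q (f i) = 0"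
  obtains p where "p \<in> Z" "\<And>P e. P \<in> graded_part r n e \<Longrightarrow> ev q P = 0 \<longleftrightarrow> value_at p P = 0"
proof -
  define q' where "q' = restrict q (indets r n)"
  have q': "q' \<in> homogeneous_coords r n"
    using q by (force simp: homogeneous_coords_def q'_def indets_def)
  define p where "p = rescaling r n `` {q'}"
  have p: "p \<in> multiprojective_space r n" "q' \<in> p"
    using q' rescaling_refl by (auto simp: multiprojective_space_def p_def quotientI)
  have ev: "ev q P = ev q' P" if "P \<in> graded_part r n e" for P e
    by (rule evaluate_cong) (use that in \<open>auto simp: graded_part_def monomials_def q'_def\<close>)
  have val: "ev q P = 0 \<longleftrightarrow> value_at p P = 0" if "P \<in> graded_part r n e" for P e
    unfolding ev[OF that] value_at_def by (rule ev_zero_iff_class[OF p(1) p(2) some_in_point[OF p(1)] that])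
  have "\<forall>x\<in>p. ev x (f i) = 0" if "i \<le> N" for i
    using ev_zero_iff_class[OF p(1) p(2) _ f_deg[OF that]] zero[OF that] ev[OF f_deg[OF that]] by auto
  then have "p \<in> Z" using p(1) by (simp add: zero_points_def)
  then show ?thesis using val that by blast
qed

definition nonvanishing :: "'k mpol \<Rightarrow> bool" where
  "nonvanishing P \<longleftrightarrow> (\<forall>p\<in>Z. value_at p P \<noteq> 0)"

definition ideal_part :: "(nat \<Rightarrow> int) \<Rightarrow> 'k mpol set" where
  "ideal_part \<mu> = {\<Sum>i<Suc N. f i * g i | g. \<forall>i<Suc N. g i \<in> graded_part r n (\<lambda>j. \<mu> j - idegree d i j)}"

lemma ideal_partI:
  "(\<And>i. i < Suc N \<Longrightarrow> g i \<in> graded_part r n (\<lambda>j. \<mu> j - idegree d i j)) \<Longrightarrow> (\<Sum>i<Suc N. f i * g i) \<in> ideal_part \<mu>"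
  unfolding ideal_part_def by blast

lemma ideal_partE:
  assumes "P \<in> ideal_part \<mu>"
  obtains g where "P = (\<Sum>i<Suc N. f i * g i)" "\<And>i. i < Suc N \<Longrightarrow> g i \<in> graded_part r n (\<lambda>j. \<mu> j - idegree d i j)"
  using assms unfolding ideal_part_def by blast

text \<open>The shift of the Koszul complex for which the coefficient omitting the extra form has
  degree \<nu> and the top coefficient has degree \<nu> + e.\<close>

definition offset :: "(nat \<Rightarrow> int) \<Rightarrow> nat \<Rightarrow> int" where
  "offset \<nu> j = \<nu> j - (\<Sum>i<Suc N. idegree d i j)"

definition with_form :: "'k mpol \<Rightarrow> nat \<Rightarrow> 'k mpol" where
  "with_form \<Lambda> i = (if i < Suc N then f i else \<Lambda>)"

definition with_degree :: "(nat \<Rightarrow> nat) \<Rightarrow> nat \<Rightarrow> nat \<Rightarrow> nat" where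
  "with_degree e i = (if i < Suc N then d i else e)"

lemma koszul_with_form:
  assumes \<Lambda>: "\<Lambda> \<in> graded_part r n (\<lambda>j. int (e j))" "nonvanishing \<Lambda>"
    and range: "\<And>i j. i \<le> N \<Longrightarrow> j \<in> {1..r} \<Longrightarrow> - int (n j) \<le> offset \<nu> j + idegree d i j"
    and e: "\<And>j. j \<in> {1..r} \<Longrightarrow> - int (n j) \<le> offset \<nu> j + int (e j)"
  shows "koszul r n (Suc (Suc N)) (\<lambda>i j. int (with_degree e i j)) (offset \<nu>) (with_form \<Lambda>)"
proof
  let ?f = "with_form \<Lambda>" and ?d = "with_degree e"
  show deg: "?f i \<in> graded_part r n (\<lambda>j. int (?d i j))" for i
    using f_deg[of i] \<Lambda>(1) by (simp add: with_form_def with_degree_def idegree_def less_Suc_eq_le)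
  show "0 \<le> int (?d i j)" for i j by simp
  show "- int (n j) \<le> offset \<nu> j + int (?d i j)" if "j \<in> {1..r}" for i j
    using range[of i j] e that by (simp add: with_degree_def idegree_def less_Suc_eq_le)
  show "\<exists>k g. (\<forall>i<Suc (Suc N). g i \<in> graded_part r n (\<lambda>j. int k - int (?d i j))) \<and>
      Poly_Mapping.single (\<Sum>j\<in>{1..r}. Poly_Mapping.single (j, l j) k) 1 = (\<Sum>i<Suc (Suc N). ?f i * g i)"
    if l: "\<And>j. j \<in> {1..r} \<Longrightarrow> l j \<le> n j" for l
  proof (rule homogeneous_nullstellensatz[OF deg _ l])
    fix q :: "nat \<times> nat \<Rightarrow> 'k" assume q: "\<forall>j\<in>{1..r}. \<exists>l\<le>n j. q (j, l) \<noteq> 0"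
    show "\<exists>i<Suc (Suc N). ev q (?f i) \<noteq> 0"
    proof (rule ccontr)
      assume "\<not> ?thesis"
      then have z: "ev q (?f i) = 0" if "i < Suc (Suc N)" for i using that by blast
      have "ev q (f i) = 0" if "i \<le> N" for i using z[of i] that by (simp add: with_form_def)
      then obtain p where "p \<in> Z" "ev q \<Lambda> = 0 \<longleftrightarrow> value_at p \<Lambda> = 0"
        using coords_zero_point[OF q] \<Lambda>(1) by metis
      moreover have "ev q \<Lambda> = 0" using z[of "Suc N"] by (simp add: with_form_def)
      ultimately show False using \<Lambda>(2) by (auto simp: nonvanishing_def)
    qed
  qed
qed

lemma sum_with_degree: "(\<Sum>i<Suc N. int (with_degree e i j)) = (\<Sum>i<Suc N. idegree d i j)"
  by (rule sum.cong) (auto simp: with_degree_def idegree_def)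

lemma sum_with_degree_remove:
  assumes "i < Suc N"
  shows "offset \<nu> j + (\<Sum>i'\<in>{..<Suc N} - {i}. int (with_degree e i' j)) = \<nu> j - idegree d i j"
    and "offset \<nu> j + (\<Sum>i'\<in>{..<Suc (Suc N)} - {i}. int (with_degree e i' j)) = \<nu> j + int (e j) - idegree d i j"
proof -
  have "(\<Sum>i'\<in>{..<Suc N} - {i}. int (with_degree e i' j)) = (\<Sum>i<Suc N. int (with_degree e i j)) - int (with_degree e i j)"
    using assms by (subst sum.remove[of "{..<Suc N}" i]) (simp_all del: sum.lessThan_Suc)
  moreover have "(\<Sum>i'\<in>{..<Suc (Suc N)} - {i}. int (with_degree e i' j)) =
      (\<Sum>i<Suc (Suc N). int (with_degree e i j)) - int (with_degree e i j)"
    using assms by (subst sum.remove[of "{..<Suc (Suc N)}" i]) (simp_all del: sum.lessThan_Suc)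
  moreover have "(\<Sum>i<Suc (Suc N). int (with_degree e i j)) = (\<Sum>i<Suc N. int (with_degree e i j)) + int (e j)"
    by (simp add: with_degree_def)
  moreover have "int (with_degree e i j) = idegree d i j" using assms by (simp add: with_degree_def idegree_def)
  ultimately show "offset \<nu> j + (\<Sum>i'\<in>{..<Suc N} - {i}. int (with_degree e i' j)) = \<nu> j - idegree d i j"
    and "offset \<nu> j + (\<Sum>i'\<in>{..<Suc (Suc N)} - {i}. int (with_degree e i' j)) = \<nu> j + int (e j) - idegree d i j"
    by (simp_all add: offset_def sum_with_degree del: sum.lessThan_Suc)
qed

lemma sum_with_degree_last: "offset \<nu> j + (\<Sum>i'\<in>{..<Suc (Suc N)} - {Suc N}. int (with_degree e i' j)) = \<nu> j"
proof -
  have "{..<Suc (Suc N)} - {Suc N} = {..<Suc N}" by auto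
  then show ?thesis by (simp add: sum_with_degree offset_def del: sum.lessThan_Suc)
qed

text \<open>Exactness at the top: P lies in the ideal of all n + 2 forms, and the cofactor of
  \<Lambda> is the preimage.\<close>

theorem mult_form_surj:
  assumes \<Lambda>: "\<Lambda> \<in> graded_part r n (\<lambda>j. int (e j))" "nonvanishing \<Lambda>"
    and range: "\<And>i j. i \<le> N \<Longrightarrow> j \<in> {1..r} \<Longrightarrow> - int (n j) \<le> offset \<nu> j + idegree d i j"
    and e: "\<And>j. j \<in> {1..r} \<Longrightarrow> - int (n j) \<le> offset \<nu> j + int (e j)"
    and P: "P \<in> graded_part r n (\<lambda>j. \<nu> j + int (e j))"
  shows "\<exists>h\<in>graded_part r n \<nu>. P - \<Lambda> * h \<in> ideal_part (\<lambda>j. \<nu> j + int (e j))"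
proof -
  interpret K: koszul r n "Suc (Suc N)" "\<lambda>i j. int (with_degree e i j)" "offset \<nu>" "with_form \<Lambda>"
    by (rule koszul_with_form[OF \<Lambda> range e])
  have "offset \<nu> j + (\<Sum>i<Suc (Suc N). int (with_degree e i j)) = \<nu> j + int (e j)" for j
    using sum_with_degree[of e j] by (simp add: offset_def with_degree_def)
  then have "P \<in> graded_part r n (\<lambda>j. offset \<nu> j + (\<Sum>i<Suc (Suc N). int (with_degree e i j)))" using P by simp
  then obtain h where h: "\<forall>i<Suc (Suc N). h i \<in> graded_part r n
      (\<lambda>j. offset \<nu> j + (\<Sum>i'\<in>{..<Suc (Suc N)} - {i}. int (with_degree e i' j)))"
    "P = (\<Sum>i<Suc (Suc N). with_form \<Lambda> i * h i)"
    using K.koszul_top_exact by auto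
  have "P - \<Lambda> * h (Suc N) = (\<Sum>i<Suc N. f i * h i)"
    unfolding h(2) by (simp add: with_form_def)
  moreover have "(\<Sum>i<Suc N. f i * h i) \<in> ideal_part (\<lambda>j. \<nu> j + int (e j))"
  proof (rule ideal_partI)
    fix i assume i: "i < Suc N"
    then have "h i \<in> graded_part r n (\<lambda>j. offset \<nu> j + (\<Sum>i'\<in>{..<Suc (Suc N)} - {i}. int (with_degree e i' j)))"
      using h(1) by simp
    then show "h i \<in> graded_part r n (\<lambda>j. \<nu> j + int (e j) - idegree d i j)"
      by (simp only: sum_with_degree_remove[OF i])
  qed
  moreover have "h (Suc N) \<in> graded_part r n \<nu>"
    using h(1)[rule_format, of "Suc N"] unfolding sum_with_degree_last by simp
  ultimately show ?thesis by (intro bexI[of _ "h (Suc N)"]) (simp_all del: sum.lessThan_Suc)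
qed

definition sylvester_span :: "(nat \<Rightarrow> int) \<Rightarrow> (expo \<Rightarrow> nat \<Rightarrow> nat \<Rightarrow> 'k mpol) \<Rightarrow> expo \<Rightarrow> 'k mpol" where
  "sylvester_span \<nu> F \<alpha> = Poly_Mapping.single
     (\<Sum>j\<in>{1..<r}. Poly_Mapping.single (j, n j) ((Poly_Mapping.lookup \<alpha> (j, n j) + 1) * later_dims j)) 1 *
     det (mat (Suc N) (Suc N) (\<lambda>(i, c). F \<alpha> c i))"

text \<open>The relation expressing \<Lambda> * h in the ideal is a syzygy of n + 2 forms with last
  entry h, to which \<open>syzygy_sylv\<close> applies. The second part says that the Sylvester
  forms themselves belong to this kernel.\<close>

theorem mult_form_kernel:
  assumes \<Lambda>: "\<Lambda> \<in> graded_part r n (\<lambda>j. int (e j))" "nonvanishing \<Lambda>"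
    and range: "\<And>i j. i \<le> N \<Longrightarrow> j \<in> {1..r} \<Longrightarrow> - int (n j) \<le> offset \<nu> j + idegree d i j"
    and e: "\<And>j. j \<in> {1..r} \<Longrightarrow> - int (n j) \<le> offset \<nu> j + int (e j)"
    and F_graded: "\<And>\<alpha> c i. \<alpha> \<in> monomials r n (\<lambda>j. - offset \<nu> j - int (n j) - 1) \<Longrightarrow> c \<le> N \<Longrightarrow> i \<le> N \<Longrightarrow>
      F \<alpha> c i \<in> graded_part r n (\<lambda>j. idegree d i j - int (group_degree n (cofac_expo \<alpha> c) j))"
    and decomp: "\<And>\<alpha> i. \<alpha> \<in> monomials r n (\<lambda>j. - offset \<nu> j - int (n j) - 1) \<Longrightarrow> i \<le> N \<Longrightarrow>
      f i = (\<Sum>c\<le>N. Poly_Mapping.single (cofac_expo \<alpha> c) 1 * F \<alpha> c i)"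
  shows "\<And>h. h \<in> graded_part r n \<nu> \<Longrightarrow> \<Lambda> * h \<in> ideal_part (\<lambda>j. \<nu> j + int (e j)) \<Longrightarrow>
      \<exists>co. h - (\<Sum>\<alpha>\<in>monomials r n (\<lambda>j. - offset \<nu> j - int (n j) - 1).
        Poly_Mapping.single 0 (co \<alpha>) * sylvester_span \<nu> F \<alpha>) \<in> ideal_part \<nu>"
    and "\<And>\<alpha>. \<alpha> \<in> monomials r n (\<lambda>j. - offset \<nu> j - int (n j) - 1) \<Longrightarrow>
      sylvester_span \<nu> F \<alpha> \<in> graded_part r n \<nu> \<and> \<Lambda> * sylvester_span \<nu> F \<alpha> \<in> ideal_part (\<lambda>j. \<nu> j + int (e j))"
proof -
  let ?A = "monomials r n (\<lambda>j. - offset \<nu> j - int (n j) - 1)"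
  have "\<exists>G. (\<forall>c\<le>N. G c \<in> graded_part r n (\<lambda>j. int (e j) - int (group_degree n (cofac_expo \<alpha> c) j))) \<and>
      \<Lambda> = (\<Sum>c\<le>N. Poly_Mapping.single (cofac_expo \<alpha> c) 1 * G c)" if \<alpha>: "\<alpha> \<in> ?A" for \<alpha>
  proof (rule decomposition_exists[OF \<Lambda>(1)])
    fix j assume j: "j \<in> {1..r}"
    then have "int (group_degree n \<alpha> j) = - offset \<nu> j - int (n j) - 1" using \<alpha> by (auto simp: monomials_def)
    then show "group_degree n \<alpha> j < e j" using e[OF j] by simp
  qed
  then have "\<forall>\<alpha>\<in>?A. \<exists>G. (\<forall>c\<le>N. G c \<in> graded_part r n (\<lambda>j. int (e j) - int (group_degree n (cofac_expo \<alpha> c) j))) \<and>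
      \<Lambda> = (\<Sum>c\<le>N. Poly_Mapping.single (cofac_expo \<alpha> c) 1 * G c)" by (rule ballI)
  from bchoice[OF this] obtain G where G': "\<forall>\<alpha>\<in>?A. (\<forall>c\<le>N. G \<alpha> c \<in> graded_part r n (\<lambda>j. int (e j) - int (group_degree n (cofac_expo \<alpha> c) j))) \<and>
      \<Lambda> = (\<Sum>c\<le>N. Poly_Mapping.single (cofac_expo \<alpha> c) 1 * G \<alpha> c)" ..
  have G: "\<And>\<alpha> c. \<alpha> \<in> ?A \<Longrightarrow> c \<le> N \<Longrightarrow>
      G \<alpha> c \<in> graded_part r n (\<lambda>j. int (e j) - int (group_degree n (cofac_expo \<alpha> c) j))"
    "\<And>\<alpha>. \<alpha> \<in> ?A \<Longrightarrow> \<Lambda> = (\<Sum>c\<le>N. Poly_Mapping.single (cofac_expo \<alpha> c) 1 * G \<alpha> c)"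
    using G' by simp_all
  define F' where "F' \<alpha> c i = (if i < Suc N then F \<alpha> c i else G \<alpha> c)" for \<alpha> c i
  interpret K: koszul r n "Suc (Suc N)" "\<lambda>i j. int (with_degree e i j)" "offset \<nu>" "with_form \<Lambda>"
    by (rule koszul_with_form[OF \<Lambda> range e])
  interpret S: sylvester_koszul r n "Suc (Suc N)" "\<lambda>i j. int (with_degree e i j)" "offset \<nu>" "with_form \<Lambda>" F'
  proof
    fix \<alpha> c i assume "\<alpha> \<in> ?A" "c \<le> N" "i < Suc (Suc N)"
    then show "F' \<alpha> c i \<in> graded_part r n (\<lambda>j. int (with_degree e i j) - int (group_degree n (cofac_expo \<alpha> c) j))"
      using F_graded[of \<alpha> c i] G(1)[of \<alpha> c]
      by (cases "i < Suc N") (simp_all add: F'_def with_degree_def idegree_def)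
  next
    fix \<alpha> i assume "\<alpha> \<in> ?A" "i < Suc (Suc N)"
    then show "with_form \<Lambda> i = (\<Sum>c\<le>N. Poly_Mapping.single (cofac_expo \<alpha> c) 1 * F' \<alpha> c i)"
      using decomp[of \<alpha> i] G(2)[of \<alpha>]
      by (cases "i < Suc N") (simp_all add: F'_def with_form_def)
  qed
  \<comment> \<open>The minor on the first N + 1 rows contains only cofactors of the f_i, so the
    chosen decomposition of \<Lambda> leaves no trace in the Sylvester forms.\<close>
  have M: "mat (Suc N) (Suc N) (\<lambda>(i, c). F' \<alpha> c i) = mat (Suc N) (Suc N) (\<lambda>(i, c). F \<alpha> c i)" for \<alpha>
    by (rule eq_matI) (auto simp: F'_def)
  have sylv: "S.sylv \<alpha> = sylvester_span \<nu> F \<alpha>" for \<alpha>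
    unfolding S.sylv_def S.front_def sylvester_span_def M ..
  have alphas: "S.alphas = ?A" by (simp add: S.alphas_def)
  have ideal: "(\<Sum>i<Suc N. with_form \<Lambda> i * g i) \<in> ideal_part \<mu>"
    if "\<And>i. i < Suc N \<Longrightarrow> g i \<in> graded_part r n (\<lambda>j. \<mu> j - idegree d i j)" for g \<mu>
  proof -
    have "(\<Sum>i<Suc N. with_form \<Lambda> i * g i) = (\<Sum>i<Suc N. f i * g i)"
      by (rule sum.cong) (auto simp: with_form_def)
    then show ?thesis using ideal_partI[of g \<mu>] that by simp
  qed
  {
    fix h assume h: "h \<in> graded_part r n \<nu>" and "\<Lambda> * h \<in> ideal_part (\<lambda>j. \<nu> j + int (e j))"
    then obtain g where g: "\<Lambda> * h = (\<Sum>i<Suc N. f i * g i)"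
      "\<And>i. i < Suc N \<Longrightarrow> g i \<in> graded_part r n (\<lambda>j. \<nu> j + int (e j) - idegree d i j)"
      by (elim ideal_partE) blast
    define x where "x i = (if i < Suc N then - g i else h)" for i
    have "\<exists>co h'. (\<forall>i<Suc N. h' i \<in> graded_part r n (\<lambda>j. offset \<nu> j + (\<Sum>i'\<in>{..<Suc N} - {i}. int (with_degree e i' j)))) \<and>
      x (Suc N) = (\<Sum>i<Suc N. with_form \<Lambda> i * h' i) + (\<Sum>\<alpha>\<in>S.alphas. Poly_Mapping.single 0 (co \<alpha>) * S.sylv \<alpha>)"
    proof (rule S.syzygy_sylv[OF refl])
      fix i assume "i < Suc (Suc N)"
      then consider "i < Suc N" | "i = Suc N" by linarith
      then show "x i \<in> graded_part r n (\<lambda>j. offset \<nu> j + (\<Sum>i'\<in>{..<Suc (Suc N)} - {i}. int (with_degree e i' j)))"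
      proof cases
        case 1
        then show ?thesis using g(2)[OF 1] unfolding sum_with_degree_remove[OF 1] by (simp add: x_def graded_part_uminus)
      next
        case 2
        then show ?thesis using h unfolding 2 sum_with_degree_last by (simp add: x_def)
      qed
    next
      have "(\<Sum>i<Suc N. with_form \<Lambda> i * x i) = - (\<Sum>i<Suc N. f i * g i)"
        unfolding sum_negf[symmetric] by (rule sum.cong) (auto simp: with_form_def x_def)
      then show "(\<Sum>i<Suc (Suc N). with_form \<Lambda> i * x i) = 0"
        using g(1) by (subst sum.lessThan_Suc) (simp add: with_form_def x_def del: sum.lessThan_Suc)
    qed
    then obtain co h' where h': "\<And>i. i < Suc N \<Longrightarrow> h' i \<in> graded_part r n (\<lambda>j. \<nu> j - idegree d i j)"
      "h = (\<Sum>i<Suc N. with_form \<Lambda> i * h' i) + (\<Sum>\<alpha>\<in>?A. Poly_Mapping.single 0 (co \<alpha>) * sylvester_span \<nu> F \<alpha>)"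
      unfolding sylv alphas using sum_with_degree_remove(1) by (auto simp: x_def)
    then show "\<exists>co. h - (\<Sum>\<alpha>\<in>?A. Poly_Mapping.single 0 (co \<alpha>) * sylvester_span \<nu> F \<alpha>) \<in> ideal_part \<nu>"
      using ideal[of h' \<nu>] by (intro exI[of _ co]) (simp del: sum.lessThan_Suc)
  }
  fix \<alpha> assume \<alpha>: "\<alpha> \<in> ?A"
  have "sylvester_span \<nu> F \<alpha> \<in> graded_part r n (\<lambda>j. offset \<nu> j + (\<Sum>i<Suc N. int (with_degree e i j)))"
    using S.sylv_graded[of \<alpha>] \<alpha> unfolding sylv alphas by simp
  then have "sylvester_span \<nu> F \<alpha> \<in> graded_part r n \<nu>" unfolding sum_with_degree offset_def by simp
  moreover obtain h where h: "\<forall>i<Suc N. h i \<in> graded_part r n (\<lambda>j. offset \<nu> j + (\<Sum>i'\<in>{..<Suc (Suc N)} - {i}. int (with_degree e i' j)))"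
    "\<Lambda> * sylvester_span \<nu> F \<alpha> = (\<Sum>i<Suc N. with_form \<Lambda> i * h i)"
    using S.sylv_annihilated[OF refl, of \<alpha>] \<alpha> unfolding sylv alphas by (auto simp: with_form_def)
  have "h i \<in> graded_part r n (\<lambda>j. \<nu> j + int (e j) - idegree d i j)" if i: "i < Suc N" for i
    using h(1) i unfolding sum_with_degree_remove[OF i, symmetric, of \<nu> _ e] by blast
  then have "\<Lambda> * sylvester_span \<nu> F \<alpha> \<in> ideal_part (\<lambda>j. \<nu> j + int (e j))" unfolding h(2) by (intro ideal)
  ultimately show "sylvester_span \<nu> F \<alpha> \<in> graded_part r n \<nu> \<and> \<Lambda> * sylvester_span \<nu> F \<alpha> \<in> ideal_part (\<lambda>j. \<nu> j + int (e j))"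
    by simp
qed

end

section \<open>Dimensions of quotients\<close>

locale linear_space = vector_space scale for scale :: "'a::field \<Rightarrow> 'b::ab_group_add \<Rightarrow> 'b"
begin

definition fin_gen :: "'b set \<Rightarrow> bool" where
  "fin_gen V \<longleftrightarrow> (\<exists>F. finite F \<and> V \<subseteq> span F)"

text \<open>Stands for the dimension of V / W when W is a subspace of a finitely generated V.
  Quotient maps are replaced by linear maps with conditions on preimages and images of the
  subspaces.\<close>

definition codim :: "'b set \<Rightarrow> 'b set \<Rightarrow> nat" where
  "codim V W = dim V - dim W"

lemma fin_gen_subset: "fin_gen V \<Longrightarrow> W \<subseteq> V \<Longrightarrow> fin_gen W"
  unfolding fin_gen_def by blast

lemma relative_basis:
  assumes V: "fin_gen V" "subspace V" and W: "W \<subseteq> V" "subspace W"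
  obtains C B where "finite C" "finite B" "span C = W" "independent (C \<union> B)" "C \<inter> B = {}"
    "span (C \<union> B) = V" "card C = dim W" "card B + dim W = dim V"
proof -
  obtain F where F: "finite F" "V \<subseteq> span F" using V(1) unfolding fin_gen_def by blast
  obtain C where C: "C \<subseteq> W" "independent C" "W \<subseteq> span C" "card C = dim W" by (rule basis_exists)
  have "C \<subseteq> V" using C(1) W(1) by blast
  then obtain E where E: "C \<subseteq> E" "E \<subseteq> V" "independent E" "V \<subseteq> span E"
    using maximal_independent_subset_extend[OF _ C(2)] by blast
  have fin: "finite E" using independent_span_bound[OF F(1) E(3)] E(2) F(2) by blast
  have "card E = dim V" by (rule basis_card_eq_dim[OF E(2,4,3)])
  moreover have "card E = card C + card (E - C)"
    using card_Un_disjoint[of C "E - C"] fin E(1) finite_subset[OF E(1) fin] by (simp add: Un_absorb1)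
  moreover have "span C = W" by (rule span_subspace[OF C(1,3) W(2)])
  moreover have "span E = V" by (rule span_subspace[OF E(2,4) V(2)])
  moreover have "C \<union> (E - C) = E" using E(1) by blast
  ultimately show ?thesis
    using that[of C "E - C"] fin E(1,3) C(4) finite_subset[OF E(1) fin] by simp
qed

lemma dim_mono:
  assumes "fin_gen V" "subspace V" "W \<subseteq> V" "subspace W"
  shows "dim W \<le> dim V"
  using relative_basis[OF assms] by (metis le_add2)

lemma dim_strict_mono:
  assumes "fin_gen V" "subspace V" "W \<subset> V" "subspace W"
  shows "dim W < dim V"
proof -
  have "W \<subseteq> V" using assms(3) by blast
  then obtain C B where "finite B" "span C = W" "span (C \<union> B) = V" "card B + dim W = dim V"
    using relative_basis[OF assms(1,2) _ assms(4)] by metis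
  moreover from this have "B \<noteq> {}" using assms(3) by auto
  ultimately show ?thesis by (metis add_0 card_gt_0_iff less_add_same_cancel2)
qed

lemma dim_eq_imp_eq:
  assumes "fin_gen V" "subspace V" "W \<subseteq> V" "subspace W" "dim V \<le> dim W"
  shows "W = V"
  using dim_strict_mono[OF assms(1,2) _ assms(4)] assms(3,5) by fastforce

lemma independent_card_le_dim:
  assumes "fin_gen V" "E \<subseteq> V" "independent E"
  shows "card E \<le> dim V"
proof -
  obtain F where F: "finite F" "V \<subseteq> span F" using assms(1) unfolding fin_gen_def by blast
  obtain B where B: "B \<subseteq> V" "independent B" "V \<subseteq> span B" "card B = dim V" by (rule basis_exists)
  have "finite B" using independent_span_bound[OF F(1) B(2)] B(1) F(2) by blast
  then show ?thesis using independent_span_bound[OF _ assms(3), of B] assms(2) B(3,4) by auto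
qed

text \<open>Images of a basis of a complement of W are adjoined one at a time to a basis of W'; a
  dependency would pull back to a dependency of the basis of V.\<close>

lemma codim_le_of_injective:
  assumes V: "fin_gen V" "subspace V" "W \<subseteq> V" "subspace W"
    and V': "fin_gen V'" "subspace V'" "W' \<subseteq> V'" "subspace W'"
    and add: "\<And>x y. \<phi> (x + y) = \<phi> x + \<phi> y" and scl: "\<And>c x. \<phi> (scale c x) = scale c (\<phi> x)"
    and into: "\<And>v. v \<in> V \<Longrightarrow> \<phi> v \<in> V'" and inj: "\<And>v. v \<in> V \<Longrightarrow> \<phi> v \<in> W' \<Longrightarrow> v \<in> W"
  shows "codim V W \<le> codim V' W'"
proof -
  have diff: "\<phi> (x - y) = \<phi> x - \<phi> y" for x y
    using add[of "x - y" y] by (simp add: algebra_simps)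
  obtain C B where B: "finite C" "finite B" "span C = W" "independent (C \<union> B)" "C \<inter> B = {}"
    "span (C \<union> B) = V" "card C = dim W" "card B + dim W = dim V" by (rule relative_basis[OF V])
  obtain C' B' where C': "finite C'" "finite B'" "span C' = W'" "independent (C' \<union> B')" "C' \<inter> B' = {}"
    "span (C' \<union> B') = V'" "card C' = dim W'" "card B' + dim W' = dim V'" by (rule relative_basis[OF V'])
  have indep: "independent (C' \<union> \<phi> ` B0) \<and> card (C' \<union> \<phi> ` B0) = card C' + card B0"
    if "finite B0" "B0 \<subseteq> B" for B0
    using that
  proof (induction B0 rule: finite_induct)
    case empty
    then show ?case using C'(4) independent_mono by auto
  next
    case (insert b B0)
    have new: "\<phi> b \<notin> span (C' \<union> \<phi> ` B0)"
    proof
      assume b: "\<phi> b \<in> span (C' \<union> \<phi> ` B0)"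
      let ?S = "{w + \<phi> x | w x. w \<in> W' \<and> x \<in> span B0}"
      have phi0: "\<phi> 0 = 0" using add[of 0 0] by simp
      have "subspace ?S"
      proof (rule subspaceI)
        show "0 \<in> ?S" using phi0 subspace_0[OF V'(4)] span_zero[of B0] by force
        show "x + y \<in> ?S" if xy: "x \<in> ?S" "y \<in> ?S" for x y
        proof -
          obtain w u w' u' where "x = w + \<phi> u" "y = w' + \<phi> u'" "w \<in> W'" "w' \<in> W'" "u \<in> span B0" "u' \<in> span B0"
            using xy by blast
          then have "x + y = (w + w') + \<phi> (u + u')" "w + w' \<in> W'" "u + u' \<in> span B0"
            using V'(4) by (simp_all add: add subspace_add span_add algebra_simps)
          then show ?thesis by blast
        qed
        show "scale c x \<in> ?S" if xx: "x \<in> ?S" for c x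
        proof -
          obtain w u where "x = w + \<phi> u" "w \<in> W'" "u \<in> span B0" using xx by blast
          then have "scale c x = scale c w + \<phi> (scale c u)" "scale c w \<in> W'" "scale c u \<in> span B0"
            using V'(4) by (simp_all add: scl scale_right_distrib subspace_scale span_scale)
          then show ?thesis by blast
        qed
      qed
      moreover have "C' \<union> \<phi> ` B0 \<subseteq> ?S"
      proof
        fix y assume "y \<in> C' \<union> \<phi> ` B0"
        then consider "y \<in> C'" | x where "x \<in> B0" "y = \<phi> x" by blast
        then show "y \<in> ?S"
        proof cases
          case 1
          then have "y = y + \<phi> 0" "y \<in> W'" using C'(3) by (auto simp: phi0 intro: span_base)
          then show ?thesis using span_zero[of B0] by blast
        next
          case 2
          then have "y = 0 + \<phi> x" "x \<in> span B0" by (auto intro: span_base)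
          then show ?thesis using subspace_0[OF V'(4)] by blast
        qed
      qed
      ultimately have "\<phi> b \<in> ?S" using b span_minimal by blast
      then obtain w x where wx: "\<phi> b = w + \<phi> x" "w \<in> W'" "x \<in> span B0" by blast
      have "x \<in> V" using wx(3) insert.prems B(6) span_mono[of B0 "C \<union> B"] by blast
      moreover have "b \<in> V" using insert.prems B(6) span_base[of b "C \<union> B"] by blast
      moreover have "\<phi> (b - x) \<in> W'" using wx by (simp add: diff)
      ultimately have "b - x \<in> W" using inj V(2) by (blast intro: subspace_diff)
      then have "(b - x) + x \<in> span (C \<union> B0)"
        using wx(3) B(3) by (intro span_add) (use span_mono[of C "C \<union> B0"] span_mono[of B0 "C \<union> B0"] in blast)+
      moreover have "C \<union> B0 \<subseteq> (C \<union> B) - {b}" using insert B(5) by blast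
      ultimately have "b \<in> span ((C \<union> B) - {b})" using span_mono by (metis diff_add_cancel subsetD)
      moreover have "b \<in> C \<union> B" using insert.prems by blast
      ultimately show False using B(4) unfolding dependent_def by blast
    qed
    have IH: "independent (C' \<union> \<phi> ` B0)" "card (C' \<union> \<phi> ` B0) = card C' + card B0" using insert by auto
    have eq: "C' \<union> \<phi> ` insert b B0 = insert (\<phi> b) (C' \<union> \<phi> ` B0)" by blast
    have "\<phi> b \<notin> C' \<union> \<phi> ` B0" by (rule contra_subsetD[OF span_superset new])
    then show ?case unfolding eq using independent_insertI[OF new IH(1)] IH(2) insert C'(1) by simp
  qed
  have "C' \<union> \<phi> ` B \<subseteq> V'"
    using C'(6) span_base[of _ "C' \<union> B'"] into B(6) span_base[of _ "C \<union> B"] by blast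
  then have "card C' + card B \<le> dim V'"
    using independent_card_le_dim[OF V'(1)] indep[OF B(2) subset_refl] by metis
  then show ?thesis using B(8) C'(7) unfolding codim_def by linarith
qed

lemma codim_le_of_surjective:
  assumes V: "fin_gen V" "subspace V" "W \<subseteq> V" "subspace W"
    and V': "fin_gen V'" "subspace V'" "W' \<subseteq> V'" "subspace W'"
    and add: "\<And>x y. \<phi> (x + y) = \<phi> x + \<phi> y" and scl: "\<And>c x. \<phi> (scale c x) = scale c (\<phi> x)"
    and into: "\<And>v. v \<in> W \<Longrightarrow> \<phi> v \<in> W'" and surj: "\<And>y. y \<in> V' \<Longrightarrow> \<exists>v\<in>V. y - \<phi> v \<in> W'"
  shows "codim V' W' \<le> codim V W"
proof -
  obtain C B where B: "finite C" "finite B" "span C = W" "independent (C \<union> B)" "C \<inter> B = {}"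
    "span (C \<union> B) = V" "card C = dim W" "card B + dim W = dim V" by (rule relative_basis[OF V])
  obtain C' B' where C': "finite C'" "finite B'" "span C' = W'" "independent (C' \<union> B')" "C' \<inter> B' = {}"
    "span (C' \<union> B') = V'" "card C' = dim W'" "card B' + dim W' = dim V'" by (rule relative_basis[OF V'])
  let ?S = "span (C' \<union> \<phi> ` B)"
  have W'S: "W' \<subseteq> ?S" unfolding C'(3)[symmetric] by (rule span_mono) blast
  have phi0: "\<phi> 0 = 0" using add[of 0 0] by simp
  have "\<phi> v \<in> ?S" if "v \<in> V" for v
  proof -
    have "subspace {v. \<phi> v \<in> ?S}"
      by (rule subspaceI) (auto simp: phi0 add scl span_zero span_add span_scale)
    moreover have "C \<union> B \<subseteq> {v. \<phi> v \<in> ?S}"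
      using into B(3) W'S span_base[of _ C] span_base[of _ "C' \<union> \<phi> ` B"] by blast
    ultimately show ?thesis using that B(6) span_minimal by blast
  qed
  note image = this
  have "y \<in> ?S" if y: "y \<in> V'" for y
  proof -
    obtain v where v: "v \<in> V" "y - \<phi> v \<in> W'" using surj[OF y] by blast
    have "(y - \<phi> v) + \<phi> v \<in> ?S" by (rule span_add) (use v image W'S in blast)+
    then show ?thesis by simp
  qed
  then have "dim V' \<le> card (C' \<union> \<phi> ` B)" by (intro dim_le_card) (use C'(1) B(2) in auto)
  also have "\<dots> \<le> card C' + card B"
    using card_Un_le[of C' "\<phi> ` B"] card_image_le[OF B(2), of \<phi>] by linarith
  finally show ?thesis using B(8) C'(7) unfolding codim_def by linarith
qed

lemma codim_transitive:
  assumes "fin_gen V" "subspace V" "T \<subseteq> V" "subspace T" "W \<subseteq> T" "subspace W"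
  shows "codim V W = codim V T + codim T W"
  using dim_mono[OF assms(1-4)] dim_mono[OF fin_gen_subset[OF assms(1,3)] assms(4-6)]
  unfolding codim_def by linarith

text \<open>The second isomorphism theorem identifies T / (T \<inter> U) with V / U, since T and U
  together generate V.\<close>

lemma codim_Int:
  assumes V: "fin_gen V" "subspace V" and T: "T \<subseteq> V" "subspace T" and U: "U \<subseteq> V" "subspace U"
    and sum: "\<And>v. v \<in> V \<Longrightarrow> \<exists>t\<in>T. v - t \<in> U"
  shows "codim V (T \<inter> U) = codim V T + codim V U"
proof -
  have TU: "T \<inter> U \<subseteq> T" "subspace (T \<inter> U)" using T U by (auto simp: subspace_inter)
  have fT: "fin_gen T" using fin_gen_subset[OF V(1) T(1)] .
  have "codim T (T \<inter> U) \<le> codim V U"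
    by (rule codim_le_of_injective[OF fT T(2) TU V U, of "\<lambda>x. x"]) (use T in auto)
  moreover have "codim V U \<le> codim T (T \<inter> U)"
    by (rule codim_le_of_surjective[OF fT T(2) TU V U, of "\<lambda>x. x"]) (use sum in auto)
  ultimately show ?thesis using codim_transitive[OF V T TU] by simp
qed

text \<open>Otherwise W enlarged by the vectors one after another would grow strictly more often
  than the codimension permits. The leading coefficient of the dependency is 1, on which the
  nonvanishing of the multiplier in \<open>local_parts_comaximal\<close> relies.\<close>

lemma dependent_modulo:
  assumes V: "fin_gen V" "subspace V" and W: "W \<subseteq> V" "subspace W"
    and w: "\<And>i. w i \<in> V"
  shows "\<exists>i\<le>codim V W. \<exists>c. w i - (\<Sum>j<i. scale (c j) (w j)) \<in> W"
proof (rule ccontr)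
  assume neg: "\<not> ?thesis"
  define U where "U i = {x + (\<Sum>j<i. scale (c j) (w j)) | x c. x \<in> W}" for i :: nat
  have sub: "subspace (U i)" for i
  proof (rule subspaceI)
    show "0 \<in> U i" unfolding U_def
      using subspace_0[OF W(2)] by (intro CollectI exI[of _ 0] exI[of _ "\<lambda>_. 0"]) simp
    fix a b assume "a \<in> U i" "b \<in> U i"
    then obtain x c y e where "a = x + (\<Sum>j<i. scale (c j) (w j))" "b = y + (\<Sum>j<i. scale (e j) (w j))" "x \<in> W" "y \<in> W"
      unfolding U_def by blast
    then have "a + b = (x + y) + (\<Sum>j<i. scale (c j + e j) (w j))" "x + y \<in> W"
      using W(2) by (simp_all add: scale_left_distrib sum.distrib subspace_add algebra_simps)
    then show "a + b \<in> U i" unfolding U_def by (intro CollectI exI[of _ "x + y"] exI[of _ "\<lambda>j. c j + e j"]) simp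
  next
    fix k a assume "a \<in> U i"
    then obtain x c where "a = x + (\<Sum>j<i. scale (c j) (w j))" "x \<in> W" unfolding U_def by blast
    then have "scale k a = scale k x + (\<Sum>j<i. scale (k * c j) (w j))" "scale k x \<in> W"
      using W(2) by (simp_all add: scale_right_distrib scale_sum_right subspace_scale)
    then show "scale k a \<in> U i" unfolding U_def by (intro CollectI exI[of _ "scale k x"] exI[of _ "\<lambda>j. k * c j"]) simp
  qed
  have UV: "U i \<subseteq> V" for i
    unfolding U_def using W(1) w V(2) by (auto intro!: subspace_add subspace_sum subspace_scale)
  have less: "U i \<subset> U (Suc i)" if i: "i \<le> codim V W" for i
  proof -
    have "U i \<subseteq> U (Suc i)"
    proof
      fix a assume "a \<in> U i"
      then obtain x c where "a = x + (\<Sum>j<i. scale (c j) (w j))" "x \<in> W" unfolding U_def by blast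
      then have "a = x + (\<Sum>j<Suc i. scale ((c(i := 0)) j) (w j))" by simp
      then show "a \<in> U (Suc i)" unfolding U_def using \<open>x \<in> W\<close> by blast
    qed
    moreover have "w i = 0 + (\<Sum>j<Suc i. scale (if j = i then 1 else 0) (w j))" by simp
    then have "w i \<in> U (Suc i)" unfolding U_def
      using subspace_0[OF W(2)] by (intro CollectI exI[of _ 0] exI[of _ "\<lambda>j. if j = i then 1 else 0"]) simp
    moreover have "w i \<notin> U i"
    proof
      assume "w i \<in> U i"
      then obtain x c where "w i = x + (\<Sum>j<i. scale (c j) (w j))" "x \<in> W" unfolding U_def by blast
      then have "w i - (\<Sum>j<i. scale (c j) (w j)) \<in> W" by (simp add: add_diff_cancel_right')
      then show False using neg i by blast
    qed
    ultimately show ?thesis by blast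
  qed
  have "dim W + i \<le> dim (U i)" if "i \<le> Suc (codim V W)" for i
    using that
  proof (induction i)
    case 0
    have "U 0 = W" unfolding U_def by auto
    then show ?case by simp
  next
    case (Suc i)
    have "dim (U i) < dim (U (Suc i))"
      by (rule dim_strict_mono[OF fin_gen_subset[OF V(1) UV] sub less sub]) (use Suc in simp)
    then show ?case using Suc by simp
  qed
  from this[OF order_refl] show False
    using dim_mono[OF V UV sub, of "Suc (codim V W)"] unfolding codim_def by linarith
qed

end

interpretation mpol: linear_space "\<lambda>(c::'k::field) (P::'k mpol). Poly_Mapping.single 0 c * P"
  by unfold_locales (simp_all add: algebra_simps mult_single single_add flip: mult.assoc)

lemma graded_part_scale: "P \<in> graded_part r n a \<Longrightarrow> Poly_Mapping.single 0 c * P \<in> graded_part r n a"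
  for P :: "'a::comm_ring_1 mpol"
proof -
  assume "P \<in> graded_part r n a"
  moreover have "Poly_Mapping.single 0 c \<in> graded_part r n (\<lambda>j. 0)"
    by (rule graded_part_single) (simp add: monomials_def)
  ultimately show ?thesis using graded_part_mult[of "Poly_Mapping.single 0 c" r n "\<lambda>j. 0" P a] by simp
qed

lemma subspace_graded_part: "mpol.subspace (graded_part r n a)"
  by (rule mpol.subspaceI) (auto intro: graded_part_add graded_part_scale)

lemma graded_part_subset_span:
  "graded_part r n a \<subseteq> mpol.span ((\<lambda>m. Poly_Mapping.single m 1) ` monomials r n a)"
proof
  fix P :: "'a::field mpol" assume P: "P \<in> graded_part r n a"
  have "P = (\<Sum>m\<in>Poly_Mapping.keys P. Poly_Mapping.single 0 (Poly_Mapping.lookup P m) * Poly_Mapping.single m 1)"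
    by (simp add: mult_single flip: poly_mapping_sum_singles)
  also have "\<dots> \<in> mpol.span ((\<lambda>m. Poly_Mapping.single m 1) ` monomials r n a)"
    by (intro mpol.span_sum mpol.span_scale mpol.span_base) (use P in \<open>auto simp: graded_part_def\<close>)
  finally show "P \<in> mpol.span ((\<lambda>m. Poly_Mapping.single m 1) ` monomials r n a)" .
qed

lemma fin_gen_graded_part: "mpol.fin_gen (graded_part r n a)"
  unfolding mpol.fin_gen_def
  by (intro exI[of _ "(\<lambda>m. Poly_Mapping.single m 1) ` monomials r n a"] conjI graded_part_subset_span) simp

section \<open>Forms separating the points\<close>

context multiprojective
begin

lemma equiv_rescaling: "equiv (homogeneous_coords r n) (rescaling r n :: ((nat \<times> nat \<Rightarrow> 'k) \<times> _) set)"
proof (rule equivI)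
  show "rescaling r n \<subseteq> homogeneous_coords r n \<times> homogeneous_coords r n" by (auto simp: rescaling_def)
  show "refl_on (homogeneous_coords r n) (rescaling r n)" by (auto simp: refl_on_def rescaling_refl)
  show "sym (rescaling r n :: ((nat \<times> nat \<Rightarrow> 'k) \<times> _) set)"
  proof (rule symI)
    fix p q :: "nat \<times> nat \<Rightarrow> 'k" assume pq: "(p, q) \<in> rescaling r n"
    then obtain c where c: "\<forall>j\<in>{1..r}. c j \<noteq> 0 \<and> (\<forall>l\<le>n j. q (j, l) = c j * p (j, l))" using rescaling_D by blast
    have "\<forall>j\<in>{1..r}. inverse (c j) \<noteq> 0 \<and> (\<forall>l\<le>n j. p (j, l) = inverse (c j) * q (j, l))" using c by simp
    then show "(q, p) \<in> rescaling r n" using pq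
      unfolding rescaling_def mem_Collect_eq case_prod_conv by (intro conjI exI[of _ "\<lambda>j. inverse (c j)"]) auto
  qed
  show "trans (rescaling r n :: ((nat \<times> nat \<Rightarrow> 'k) \<times> _) set)"
  proof (rule transI)
    fix p q s :: "nat \<times> nat \<Rightarrow> 'k" assume pq: "(p, q) \<in> rescaling r n" "(q, s) \<in> rescaling r n"
    obtain c where c: "\<forall>j\<in>{1..r}. c j \<noteq> 0 \<and> (\<forall>l\<le>n j. q (j, l) = c j * p (j, l))" using rescaling_D[OF pq(1)] by blast
    obtain b where b: "\<forall>j\<in>{1..r}. b j \<noteq> 0 \<and> (\<forall>l\<le>n j. s (j, l) = b j * q (j, l))" using rescaling_D[OF pq(2)] by blast
    have "\<forall>j\<in>{1..r}. b j * c j \<noteq> 0 \<and> (\<forall>l\<le>n j. s (j, l) = (b j * c j) * p (j, l))" using b c by simp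
    then show "(p, s) \<in> rescaling r n" using pq
      unfolding rescaling_def mem_Collect_eq case_prod_conv by (intro conjI exI[of _ "\<lambda>j. b j * c j"]) auto
  qed
qed

lemma point_subset: "p \<in> multiprojective_space r n \<Longrightarrow> p \<subseteq> homogeneous_coords r n"
  unfolding multiprojective_space_def quotient_def rescaling_def by blast

lemma point_coords_nonzero:
  assumes "p \<in> Z" "j \<in> {1..r}"
  shows "\<exists>l\<le>n j. (SOME q. q \<in> p) (j, l) \<noteq> 0"
  using some_in_point[OF zero_point_space[OF assms(1)]] point_subset[OF zero_point_space[OF assms(1)]] assms(2)
  unfolding homogeneous_coords_def by blast

lemma value_indet: "value_at p (indet v) = (SOME q. q \<in> p) v"
  by (simp add: value_at_def)

lemma value_single_0: "value_at p (Poly_Mapping.single 0 c) = c"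
  by (simp add: value_at_def evaluate_single)

text \<open>With coefficients 1, t, t^2, ... the value at each zero is a nonzero polynomial in t, so
  only finitely many t are excluded, while the field is infinite.\<close>

lemma linear_form_exists:
  assumes j: "j \<in> {1..r}"
  shows "\<exists>L\<in>graded_part r n (\<lambda>i. if i = j then 1 else 0). nonvanishing L"
proof -
  define A where "A p = (\<Sum>l\<le>n j. Polynomial.monom ((SOME q. q \<in> p) (j, l)) l)" for p :: "(nat \<times> nat \<Rightarrow> 'k) set"
  have co: "poly.coeff (A p) l = (SOME q. q \<in> p) (j, l)" if "l \<le> n j" for p l
    using that by (simp add: A_def coeff_sum)
  have "A p \<noteq> 0" if "p \<in> Z" for p
    using point_coords_nonzero[OF that j] co[of _ p] by (metis Polynomial.coeff_0)
  then have "finite (\<Union>p\<in>Z. {t. poly (A p) t = 0})"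
    using finite_zeros poly_roots_finite by blast
  then obtain t where t: "\<And>p. p \<in> Z \<Longrightarrow> poly (A p) t \<noteq> 0"
    using ex_new_if_finite[OF infinite_alg_closed] by blast
  define L where "L = (\<Sum>l\<le>n j. Poly_Mapping.single 0 (t ^ l) * indet (j, l) :: 'k mpol)"
  have "L \<in> graded_part r n (\<lambda>i. if i = j then 1 else 0)"
    unfolding L_def by (intro graded_part_sum graded_part_scale graded_part_indet) (use j in \<open>auto simp: indets_def\<close>)
  moreover have "value_at p L = poly (A p) t" for p
    by (simp add: L_def A_def value_sum value_mult value_indet value_single_0 poly_sum poly_monom mult.commute)
  ultimately show ?thesis using t unfolding nonvanishing_def by (intro bexI[of _ L]) auto
qed

definition linear_form :: "nat \<Rightarrow> 'k mpol" where
  "linear_form j = (SOME L. L \<in> graded_part r n (\<lambda>i. if i = j then 1 else 0) \<and> nonvanishing L)"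

lemma linear_form:
  assumes "j \<in> {1..r}"
  shows "linear_form j \<in> graded_part r n (\<lambda>i. if i = j then 1 else 0)" "nonvanishing (linear_form j)"
  using someI_ex[OF linear_form_exists[OF assms, unfolded Bex_def]] unfolding linear_form_def by blast+

text \<open>Serves as the auxiliary \<Lambda>, and also as a filler that raises degrees without
  creating zeros on \<open>Z\<close>.\<close>

definition ell :: "(nat \<Rightarrow> nat) \<Rightarrow> 'k mpol" where
  "ell e = (\<Prod>j\<in>{1..r}. linear_form j ^ e j)"

lemma ell_graded: "ell e \<in> graded_part r n (\<lambda>j. int (e j))"
proof -
  have "ell e \<in> graded_part r n (\<lambda>j. \<Sum>i\<in>{1..r}. int (e i) * (if j = i then 1 else 0))"
    unfolding ell_def by (intro graded_part_prod graded_part_power linear_form)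
  also have "graded_part r n (\<lambda>j. \<Sum>i\<in>{1..r}. int (e i) * (if j = i then 1 else 0)) = (graded_part r n (\<lambda>j. int (e j)) :: 'k mpol set)"
    by (rule graded_part_cong) (auto simp: if_distrib sum.delta' cong: if_cong)
  finally show ?thesis .
qed

lemma ell_nonvanishing: "nonvanishing (ell e)"
  using linear_form(2) unfolding nonvanishing_def ell_def by (simp add: value_prod value_power)

lemma value_ell: "p \<in> Z \<Longrightarrow> value_at p (ell e) \<noteq> 0"
  using ell_nonvanishing by (simp add: nonvanishing_def)

text \<open>The candidates are the 2 by 2 minors formed with the coordinates of q. If all of them
  vanished at p, the coordinates would be proportional in every group and the points equal.\<close>

lemma separating_linear_form:
  assumes pq: "p \<in> Z" "q \<in> Z" "p \<noteq> q"
  shows "\<exists>j\<in>{1..r}. \<exists>D\<in>graded_part r n (\<lambda>i. if i = j then 1 else 0). value_at p D \<noteq> 0 \<and> value_at q D = 0"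
proof (rule ccontr)
  assume neg: "\<not> ?thesis"
  let ?P = "SOME x. x \<in> p" and ?Q = "SOME x. x \<in> q"
  have cross: "?P (j, l) * ?Q (j, l') = ?P (j, l') * ?Q (j, l)" if j: "j \<in> {1..r}" "l \<le> n j" "l' \<le> n j" for j l l'
  proof -
    let ?D = "Poly_Mapping.single 0 (?Q (j, l')) * indet (j, l) - Poly_Mapping.single 0 (?Q (j, l)) * indet (j, l') :: 'k mpol"
    have "?D \<in> graded_part r n (\<lambda>i. if i = j then 1 else 0)"
      by (intro graded_part_diff graded_part_scale graded_part_indet) (use j in \<open>auto simp: indets_def\<close>)
    moreover have "value_at q ?D = 0" by (simp add: value_diff value_mult value_indet value_single_0)
    ultimately have "value_at p ?D = 0" using neg j(1) by blast
    then show ?thesis by (simp add: value_diff value_mult value_indet value_single_0 mult.commute)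
  qed
  have sp: "p \<in> multiprojective_space r n" "q \<in> multiprojective_space r n" using pq zero_point_space by auto
  have mem: "?P \<in> p" "?Q \<in> q" using sp some_in_point by auto
  have co: "?P \<in> homogeneous_coords r n" "?Q \<in> homogeneous_coords r n" using mem sp point_subset by blast+
  have "\<exists>c. c \<noteq> 0 \<and> (\<forall>l\<le>n j. ?P (j, l) = c * ?Q (j, l))" if j: "j \<in> {1..r}" for j
  proof -
    obtain l' where l': "l' \<le> n j" "?Q (j, l') \<noteq> 0" using point_coords_nonzero[OF pq(2) j] by blast
    obtain l where l: "l \<le> n j" "?P (j, l) \<noteq> 0" using point_coords_nonzero[OF pq(1) j] by blast
    have eq: "?P (j, i) = ?P (j, l') / ?Q (j, l') * ?Q (j, i)" if "i \<le> n j" for i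
      using cross[OF j that l'(1)] l'(2) by (simp add: field_simps)
    moreover have "?P (j, l') / ?Q (j, l') \<noteq> 0" using eq[OF l(1)] l(2) by auto
    ultimately show ?thesis by blast
  qed
  then obtain c where "\<forall>j\<in>{1..r}. c j \<noteq> 0 \<and> (\<forall>l\<le>n j. ?P (j, l) = c j * ?Q (j, l))" by metis
  then have "(?Q, ?P) \<in> rescaling r n"
    unfolding rescaling_def mem_Collect_eq case_prod_conv using co by blast
  then have "q = p"
    using quotient_eqI[OF equiv_rescaling _ _ mem(2,1)] sp unfolding multiprojective_space_def by blast
  then show False using pq(3) by simp
qed

text \<open>Padding with \<open>ell\<close> makes the degree the same for all pairs of points, so
  that products and sums over points are multihomogeneous.\<close>

lemma separating_form:
  assumes pq: "p \<in> Z" "q \<in> Z" "p \<noteq> q"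
  shows "\<exists>D\<in>graded_part r n (\<lambda>i. 1). value_at p D \<noteq> 0 \<and> value_at q D = 0"
proof -
  obtain j D where j: "j \<in> {1..r}" and D: "D \<in> graded_part r n (\<lambda>i. if i = j then 1 else 0)"
    "value_at p D \<noteq> 0" "value_at q D = 0" using separating_linear_form[OF assms] by blast
  let ?e = "\<lambda>i. if i = j then 0 else (1::nat)"
  have "D * ell ?e \<in> graded_part r n (\<lambda>i. (if i = j then 1 else 0) + int (?e i))"
    by (rule graded_part_mult[OF D(1) ell_graded])
  also have "graded_part r n (\<lambda>i. (if i = j then 1 else 0) + int (?e i)) = (graded_part r n (\<lambda>i. 1) :: 'k mpol set)"
    by (rule graded_part_cong) auto
  finally show ?thesis using D(2,3) value_ell[OF pq(1)] by (intro bexI[of _ "D * ell ?e"]) (simp_all add: value_mult)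
qed

lemma separating_family:
  "\<exists>c s. \<forall>p\<in>Z. s p \<in> graded_part r n (\<lambda>i. int c) \<and> value_at p (s p) \<noteq> 0 \<and> (\<forall>q\<in>Z - {p}. value_at q (s p) = 0)"
proof -
  have "\<forall>x\<in>{(p, q). p \<in> Z \<and> q \<in> Z \<and> p \<noteq> q}. \<exists>D. D \<in> graded_part r n (\<lambda>i. 1) \<and> value_at (fst x) D \<noteq> 0 \<and> value_at (snd x) D = 0"
    using separating_form by fastforce
  from bchoice[OF this] obtain D where D: "\<And>p q. p \<in> Z \<Longrightarrow> q \<in> Z \<Longrightarrow> p \<noteq> q \<Longrightarrow>
      D (p, q) \<in> graded_part r n (\<lambda>i. 1) \<and> value_at p (D (p, q)) \<noteq> 0 \<and> value_at q (D (p, q)) = 0"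
    by force
  define s where "s p = (\<Prod>q\<in>Z - {p}. D (p, q))" for p
  have "s p \<in> graded_part r n (\<lambda>i. int (card Z - 1))" if p: "p \<in> Z" for p
  proof -
    have "s p \<in> graded_part r n (\<lambda>i. \<Sum>q\<in>Z - {p}. 1)"
      unfolding s_def by (intro graded_part_prod) (use D p in auto)
    then show ?thesis using p finite_zeros by simp
  qed
  moreover have "value_at p (s p) \<noteq> 0" if "p \<in> Z" for p
    using D[OF that] finite_zeros by (auto simp: s_def value_prod)
  moreover have "value_at q (s p) = 0" if "p \<in> Z" "q \<in> Z - {p}" for p q
    using D[of p q] that finite_zeros by (auto simp: s_def value_prod intro!: bexI[of _ q])
  ultimately show ?thesis by blast
qed

end

section \<open>The local components of the quotient\<close>

lemma graded_part_nonzero: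
  assumes "P \<in> graded_part r n e" "P \<noteq> 0" "j \<in> {1..r}"
  shows "0 \<le> e j"
proof -
  obtain m where "m \<in> Poly_Mapping.keys P" using assms(2) by fastforce
  then have "int (group_degree n m j) = e j" using assms(1,3) by (auto simp: graded_part_def monomials_def)
  then show ?thesis by linarith
qed

context multiprojective
begin

lemma ideal_part_cong: "(\<And>j. j \<in> {1..r} \<Longrightarrow> \<mu> j = \<mu>' j) \<Longrightarrow> ideal_part \<mu> = ideal_part \<mu>'"
proof -
  assume eq: "\<And>j. j \<in> {1..r} \<Longrightarrow> \<mu> j = \<mu>' j"
  have "graded_part r n (\<lambda>j. \<mu> j - idegree d i j) = (graded_part r n (\<lambda>j. \<mu>' j - idegree d i j) :: 'k mpol set)" for i
    by (rule graded_part_cong) (simp add: eq)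
  then show ?thesis unfolding ideal_part_def by simp
qed

lemma ideal_part_subset: "ideal_part \<mu> \<subseteq> graded_part r n \<mu>"
proof
  fix x assume "x \<in> ideal_part \<mu>"
  then obtain g where g: "x = (\<Sum>i<Suc N. f i * g i)" "\<forall>i<Suc N. g i \<in> graded_part r n (\<lambda>j. \<mu> j - idegree d i j)"
    unfolding ideal_part_def by blast
  show "x \<in> graded_part r n \<mu>" unfolding g(1)
  proof (rule graded_part_sum)
    fix i assume "i \<in> {..<Suc N}"
    then show "f i * g i \<in> graded_part r n \<mu>"
      using graded_part_mult[OF f_deg g(2)[rule_format], of i i] by (simp add: less_Suc_eq_le)
  qed
qed

lemma ideal_part_mult:
  assumes "P \<in> graded_part r n a" "x \<in> ideal_part \<mu>"
  shows "P * x \<in> ideal_part (\<lambda>j. \<mu> j + a j)"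
proof -
  obtain g where g: "x = (\<Sum>i<Suc N. f i * g i)" "\<forall>i<Suc N. g i \<in> graded_part r n (\<lambda>j. \<mu> j - idegree d i j)"
    using assms(2) unfolding ideal_part_def by blast
  have "P * x = (\<Sum>i<Suc N. f i * (P * g i))" unfolding g(1) sum_distrib_left by (simp add: mult.left_commute)
  also have "\<dots> \<in> ideal_part (\<lambda>j. \<mu> j + a j)"
  proof (rule ideal_partI)
    fix i assume "i < Suc N"
    then show "P * g i \<in> graded_part r n (\<lambda>j. \<mu> j + a j - idegree d i j)"
      using graded_part_mult[OF assms(1) g(2)[rule_format], of i] by (simp add: algebra_simps)
  qed
  finally show ?thesis .
qed

lemma ideal_part_0: "0 \<in> ideal_part \<mu>"
  using ideal_partI[of "\<lambda>_. 0" \<mu>] by simp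

lemma ideal_part_add: "x \<in> ideal_part \<mu> \<Longrightarrow> y \<in> ideal_part \<mu> \<Longrightarrow> x + y \<in> ideal_part \<mu>"
proof -
  assume "x \<in> ideal_part \<mu>" "y \<in> ideal_part \<mu>"
  then obtain g h where g: "x = (\<Sum>i<Suc N. f i * g i)" "\<forall>i<Suc N. g i \<in> graded_part r n (\<lambda>j. \<mu> j - idegree d i j)"
    and h: "y = (\<Sum>i<Suc N. f i * h i)" "\<forall>i<Suc N. h i \<in> graded_part r n (\<lambda>j. \<mu> j - idegree d i j)"
    unfolding ideal_part_def by blast
  have "x + y = (\<Sum>i<Suc N. f i * (g i + h i))" unfolding g(1) h(1) by (simp add: distrib_left sum.distrib)
  also have "\<dots> \<in> ideal_part \<mu>" by (rule ideal_partI) (use g(2) h(2) graded_part_add in blast)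
  finally show ?thesis .
qed

lemma ideal_part_sum: "(\<And>i. i \<in> S \<Longrightarrow> x i \<in> ideal_part \<mu>) \<Longrightarrow> (\<Sum>i\<in>S. x i) \<in> ideal_part \<mu>"
  by (induction S rule: infinite_finite_induct) (auto intro: ideal_part_0 ideal_part_add)

lemma ideal_part_scale: "x \<in> ideal_part \<mu> \<Longrightarrow> Poly_Mapping.single 0 c * x \<in> ideal_part \<mu>"
proof -
  assume "x \<in> ideal_part \<mu>"
  moreover have "Poly_Mapping.single 0 c \<in> graded_part r n (\<lambda>j. 0)"
    by (rule graded_part_single) (simp add: monomials_def)
  ultimately show ?thesis using ideal_part_mult[of "Poly_Mapping.single 0 c" "\<lambda>j. 0" x \<mu>] by simp
qed

lemma subspace_ideal_part: "mpol.subspace (ideal_part \<mu>)"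
  by (rule mpol.subspaceI) (auto intro: ideal_part_0 ideal_part_add ideal_part_scale)

lemma f_in_ideal_part: "i \<le> N \<Longrightarrow> f i \<in> ideal_part (idegree d i)"
proof -
  assume i: "i \<le> N"
  have "f i = (\<Sum>k<Suc N. f k * (if k = i then 1 else 0))"
    using i by (simp add: if_distrib sum.delta' cong: if_cong del: sum.lessThan_Suc)
  also have "\<dots> \<in> ideal_part (idegree d i)"
    by (rule ideal_partI) auto
  finally show ?thesis .
qed

text \<open>In these degrees the \<alpha> would have negative degree, so no Sylvester forms exist
  and every form without zeros on \<open>Z\<close> acts bijectively modulo the ideal.\<close>

definition large :: "(nat \<Rightarrow> int) \<Rightarrow> bool" where
  "large \<mu> \<longleftrightarrow> (\<forall>j\<in>{1..r}. 0 \<le> offset \<mu> j)"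

lemma large_nonneg: "large \<mu> \<Longrightarrow> j \<in> {1..r} \<Longrightarrow> 0 \<le> \<mu> j"
proof -
  assume "large \<mu>" "j \<in> {1..r}"
  moreover have "0 \<le> (\<Sum>i<Suc N. idegree d i j)" by (intro sum_nonneg) (simp add: idegree_def)
  ultimately show ?thesis by (force simp: large_def offset_def)
qed

lemma mult_form_surj_large:
  assumes "\<Lambda> \<in> graded_part r n (\<lambda>j. int (e j))" "nonvanishing \<Lambda>" "large \<mu>"
    and "P \<in> graded_part r n (\<lambda>j. \<mu> j + int (e j))"
  shows "\<exists>h\<in>graded_part r n \<mu>. P - \<Lambda> * h \<in> ideal_part (\<lambda>j. \<mu> j + int (e j))"
  by (rule mult_form_surj[OF assms(1,2) _ _ assms(4)]) (use assms(3) in \<open>force simp: large_def idegree_def\<close>)+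

lemma mult_form_cancel_large:
  assumes "\<Lambda> \<in> graded_part r n (\<lambda>j. int (e j))" "nonvanishing \<Lambda>" "large \<mu>"
    and "h \<in> graded_part r n \<mu>" "\<Lambda> * h \<in> ideal_part (\<lambda>j. \<mu> j + int (e j))"
  shows "h \<in> ideal_part \<mu>"
proof -
  have empty: "monomials r n (\<lambda>j. - offset \<mu> j - int (n j) - 1) = {}"
  proof -
    have 1: "1 \<in> {1..r}" using r_pos by simp
    then have "0 \<le> offset \<mu> 1" using assms(3) unfolding large_def by blast
    then have "- offset \<mu> 1 - int (n 1) - 1 < 0" by linarith
    with 1 show ?thesis unfolding monomials_def by (smt (verit, best) Collect_empty_eq of_nat_0_le_iff)
  qed
  have "\<exists>co. h - (\<Sum>\<alpha>\<in>monomials r n (\<lambda>j. - offset \<mu> j - int (n j) - 1).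
      Poly_Mapping.single 0 (co \<alpha>) * sylvester_span \<mu> (\<lambda>_ _ _. 0) \<alpha>) \<in> ideal_part \<mu>"
    by (rule mult_form_kernel(1)[OF assms(1,2) _ _ _ _ assms(4,5)])
      (use assms(3) in \<open>force simp: large_def idegree_def empty\<close>)+
  then show ?thesis unfolding empty by simp
qed

text \<open>The part of degree \<open>\<mu>\<close> of the primary component of the ideal at the point \<open>p\<close>.\<close>

definition local_part :: "(nat \<times> nat \<Rightarrow> 'k) set \<Rightarrow> (nat \<Rightarrow> int) \<Rightarrow> 'k mpol set" where
  "local_part p \<mu> = {g\<in>graded_part r n \<mu>.
     \<exists>e. \<exists>u\<in>graded_part r n e. value_at p u \<noteq> 0 \<and> u * g \<in> ideal_part (\<lambda>j. \<mu> j + e j)}"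

lemma local_partI:
  "g \<in> graded_part r n \<mu> \<Longrightarrow> u \<in> graded_part r n e \<Longrightarrow> value_at p u \<noteq> 0 \<Longrightarrow> u * g \<in> ideal_part (\<lambda>j. \<mu> j + e j) \<Longrightarrow>
    g \<in> local_part p \<mu>"
  unfolding local_part_def by blast

lemma local_partE:
  assumes "g \<in> local_part p \<mu>"
  obtains e u where "g \<in> graded_part r n \<mu>" "u \<in> graded_part r n e" "value_at p u \<noteq> 0" "u * g \<in> ideal_part (\<lambda>j. \<mu> j + e j)"
  using assms unfolding local_part_def by blast

lemma local_part_subset: "local_part p \<mu> \<subseteq> graded_part r n \<mu>"
  unfolding local_part_def by blast

lemma ideal_part_subset_local: "ideal_part \<mu> \<subseteq> local_part p \<mu>"
proof
  fix g assume g: "g \<in> ideal_part \<mu>"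
  then show "g \<in> local_part p \<mu>"
    using ideal_part_subset by (intro local_partI[of g \<mu> 1 "\<lambda>_. 0"]) auto
qed

lemma local_part_mult:
  assumes "P \<in> graded_part r n a" "g \<in> local_part p \<mu>"
  shows "P * g \<in> local_part p (\<lambda>j. \<mu> j + a j)"
  using assms(2)
proof (rule local_partE)
  fix e u assume u: "g \<in> graded_part r n \<mu>" "u \<in> graded_part r n e" "value_at p u \<noteq> 0" "u * g \<in> ideal_part (\<lambda>j. \<mu> j + e j)"
  show ?thesis
  proof (rule local_partI[OF _ u(2,3)])
    show "P * g \<in> graded_part r n (\<lambda>j. \<mu> j + a j)"
      using graded_part_mult[OF u(1) assms(1)] by (simp add: mult.commute)
    show "u * (P * g) \<in> ideal_part (\<lambda>j. \<mu> j + a j + e j)"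
      using ideal_part_mult[OF assms(1) u(4)] by (simp add: algebra_simps)
  qed
qed

lemma local_part_add:
  assumes "g \<in> local_part p \<mu>" "h \<in> local_part p \<mu>"
  shows "g + h \<in> local_part p \<mu>"
proof -
  obtain e u where u: "g \<in> graded_part r n \<mu>" "u \<in> graded_part r n e" "value_at p u \<noteq> 0" "u * g \<in> ideal_part (\<lambda>j. \<mu> j + e j)"
    using assms(1) by (rule local_partE)
  obtain a v where v: "h \<in> graded_part r n \<mu>" "v \<in> graded_part r n a" "value_at p v \<noteq> 0" "v * h \<in> ideal_part (\<lambda>j. \<mu> j + a j)"
    using assms(2) by (rule local_partE)
  show ?thesis
  proof (rule local_partI[OF graded_part_add[OF u(1) v(1)] graded_part_mult[OF u(2) v(2)]])
    show "value_at p (u * v) \<noteq> 0" using u(3) v(3) by (simp add: value_mult)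
    have "v * (u * g) \<in> ideal_part (\<lambda>j. \<mu> j + (e j + a j))" "u * (v * h) \<in> ideal_part (\<lambda>j. \<mu> j + (e j + a j))"
      using ideal_part_mult[OF v(2) u(4)] ideal_part_mult[OF u(2) v(4)] by (simp_all add: algebra_simps)
    from ideal_part_add[OF this] show "u * v * (g + h) \<in> ideal_part (\<lambda>j. \<mu> j + (e j + a j))" by (simp add: algebra_simps)
  qed
qed

lemma local_part_0: "0 \<in> local_part p \<mu>"
  using ideal_part_0 ideal_part_subset_local by blast

lemma local_part_scale: "g \<in> local_part p \<mu> \<Longrightarrow> Poly_Mapping.single 0 c * g \<in> local_part p \<mu>"
proof -
  assume "g \<in> local_part p \<mu>"
  moreover have "Poly_Mapping.single 0 c \<in> graded_part r n (\<lambda>j. 0)"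
    by (rule graded_part_single) (simp add: monomials_def)
  ultimately show ?thesis using local_part_mult[of "Poly_Mapping.single 0 c" "\<lambda>j. 0" g p \<mu>] by simp
qed

lemma subspace_local_part: "mpol.subspace (local_part p \<mu>)"
  by (rule mpol.subspaceI) (auto intro: local_part_0 local_part_add local_part_scale)

lemma local_part_cancel:
  assumes "v \<in> graded_part r n e" "value_at p v \<noteq> 0" "g \<in> graded_part r n \<mu>" "v * g \<in> local_part p (\<lambda>j. \<mu> j + e j)"
  shows "g \<in> local_part p \<mu>"
  using assms(4)
proof (rule local_partE)
  fix a u assume u: "u \<in> graded_part r n a" "value_at p u \<noteq> 0" "u * (v * g) \<in> ideal_part (\<lambda>j. \<mu> j + e j + a j)"
  show ?thesis
    by (rule local_partI[OF assms(3) graded_part_mult[OF u(1) assms(1)]])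
      (use u(2,3) assms(2) in \<open>simp_all add: value_mult algebra_simps\<close>)
qed

text \<open>The multiplier is padded to a degree with equal entries, so that the multipliers for
  different points can be brought to one common degree.\<close>

lemma local_part_level:
  assumes p: "p \<in> Z" and g: "g \<in> local_part p \<mu>"
  shows "\<exists>k. \<exists>u\<in>graded_part r n (\<lambda>_. int k). value_at p u \<noteq> 0 \<and> u * g \<in> ideal_part (\<lambda>j. \<mu> j + int k)"
  using g
proof (rule local_partE)
  fix e u assume u: "u \<in> graded_part r n e" "value_at p u \<noteq> 0" "u * g \<in> ideal_part (\<lambda>j. \<mu> j + e j)"
  have "u \<noteq> 0" using u(2) value_0 by metis
  then have nonneg: "0 \<le> e j" if "j \<in> {1..r}" for j by (rule graded_part_nonzero[OF u(1) _ that])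
  define k where "k = (\<Sum>j\<in>{1..r}. nat (e j))"
  have le: "e j \<le> int k" if "j \<in> {1..r}" for j
  proof -
    have "nat (e j) \<le> k" unfolding k_def by (rule member_le_sum[OF that]) simp_all
    then show ?thesis by linarith
  qed
  define \<theta> where "\<theta> = ell (\<lambda>j. k - nat (e j))"
  have eq: "e j + int (k - nat (e j)) = int k" if "j \<in> {1..r}" for j
    using le[OF that] nonneg[OF that] by (simp add: of_nat_diff nat_le_iff)
  have "u * \<theta> \<in> graded_part r n (\<lambda>j. e j + int (k - nat (e j)))"
    unfolding \<theta>_def by (rule graded_part_mult[OF u(1) ell_graded])
  also have "graded_part r n (\<lambda>j. e j + int (k - nat (e j))) = (graded_part r n (\<lambda>_. int k) :: 'k mpol set)"
    by (rule graded_part_cong) (rule eq)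
  finally have 1: "u * \<theta> \<in> graded_part r n (\<lambda>_. int k)" .
  have "\<theta> * (u * g) \<in> ideal_part (\<lambda>j. \<mu> j + e j + int (k - nat (e j)))"
    unfolding \<theta>_def by (rule ideal_part_mult[OF ell_graded u(3)])
  also have "ideal_part (\<lambda>j. \<mu> j + e j + int (k - nat (e j))) = ideal_part (\<lambda>j. \<mu> j + int k)"
    by (rule ideal_part_cong) (use eq in \<open>simp add: add.assoc\<close>)
  finally have 2: "(u * \<theta>) * g \<in> ideal_part (\<lambda>j. \<mu> j + int k)" by (simp add: ac_simps)
  have "value_at p (u * \<theta>) \<noteq> 0" using u(2) value_ell[OF p] by (simp add: value_mult \<theta>_def)
  then show ?thesis using 1 2 by blast
qed

text \<open>The multipliers at the single points are added with weights that vanish at all other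
  points. The sum has no zero on \<open>Z\<close> and still takes g into the ideal, so it can be
  cancelled in a large degree.\<close>

lemma local_parts_Int:
  assumes \<mu>: "large \<mu>" and g: "g \<in> graded_part r n \<mu>" "\<And>p. p \<in> Z \<Longrightarrow> g \<in> local_part p \<mu>"
  shows "g \<in> ideal_part \<mu>"
proof -
  have "\<forall>p\<in>Z. \<exists>ku. snd ku \<in> graded_part r n (\<lambda>_. int (fst ku)) \<and> value_at p (snd ku) \<noteq> 0 \<and>
      snd ku * g \<in> ideal_part (\<lambda>j. \<mu> j + int (fst ku))"
  proof
    fix p assume p: "p \<in> Z"
    obtain k u where "u \<in> graded_part r n (\<lambda>_. int k)" "value_at p u \<noteq> 0" "u * g \<in> ideal_part (\<lambda>j. \<mu> j + int k)"
      using local_part_level[OF p g(2)[OF p]] by blast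
    then show "\<exists>ku. snd ku \<in> graded_part r n (\<lambda>_. int (fst ku)) \<and> value_at p (snd ku) \<noteq> 0 \<and>
        snd ku * g \<in> ideal_part (\<lambda>j. \<mu> j + int (fst ku))"
      by (intro exI[of _ "(k, u)"]) simp
  qed
  from bchoice[OF this] obtain ku where ku: "\<And>p. p \<in> Z \<Longrightarrow> snd (ku p) \<in> graded_part r n (\<lambda>_. int (fst (ku p)))"
    "\<And>p. p \<in> Z \<Longrightarrow> value_at p (snd (ku p)) \<noteq> 0"
    "\<And>p. p \<in> Z \<Longrightarrow> snd (ku p) * g \<in> ideal_part (\<lambda>j. \<mu> j + int (fst (ku p)))" by blast
  obtain c s where sep: "\<forall>p\<in>Z. s p \<in> graded_part r n (\<lambda>i. int c) \<and> value_at p (s p) \<noteq> 0 \<and> (\<forall>q\<in>Z - {p}. value_at q (s p) = 0)"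
    using separating_family by (elim exE)
  have s: "\<And>p. p \<in> Z \<Longrightarrow> s p \<in> graded_part r n (\<lambda>i. int c)" "\<And>p. p \<in> Z \<Longrightarrow> value_at p (s p) \<noteq> 0"
    "\<And>p q. p \<in> Z \<Longrightarrow> q \<in> Z - {p} \<Longrightarrow> value_at q (s p) = 0"
    using sep by simp_all
  define M where "M = (\<Sum>p\<in>Z. fst (ku p))"
  have le: "fst (ku p) \<le> M" if "p \<in> Z" for p
    unfolding M_def by (rule member_le_sum[OF that]) (simp_all add: finite_zeros)
  define W where "W p = s p * ell (\<lambda>_. M - fst (ku p))" for p
  have W: "W p \<in> graded_part r n (\<lambda>_. int (c + (M - fst (ku p))))" if "p \<in> Z" for p
    using graded_part_mult[OF s(1)[OF that] ell_graded, of "\<lambda>_. M - fst (ku p)"] by (simp add: W_def)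
  define \<Lambda> where "\<Lambda> = (\<Sum>p\<in>Z. W p * snd (ku p))"
  have "\<Lambda> \<in> graded_part r n (\<lambda>_. int (c + M))"
    unfolding \<Lambda>_def
  proof (rule graded_part_sum)
    fix p assume p: "p \<in> Z"
    show "W p * snd (ku p) \<in> graded_part r n (\<lambda>_. int (c + M))"
      using graded_part_mult[OF W[OF p] ku(1)[OF p]] le[OF p] by (simp add: of_nat_diff)
  qed
  moreover have "nonvanishing \<Lambda>"
    unfolding nonvanishing_def
  proof
    fix q assume q: "q \<in> Z"
    have "value_at q (W p * snd (ku p)) = 0" if "p \<in> Z - {q}" for p
      using s(3)[of p q] that q by (auto simp: W_def value_mult)
    then have "(\<Sum>p\<in>Z - {q}. value_at q (W p * snd (ku p))) = 0" by (intro sum.neutral) blast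
    then have "value_at q \<Lambda> = value_at q (W q * snd (ku q))"
      unfolding \<Lambda>_def value_sum sum.remove[OF finite_zeros q, of "\<lambda>p. value_at q (W p * snd (ku p))"] by simp
    then show "value_at q \<Lambda> \<noteq> 0" using s(2)[OF q] ku(2)[OF q] value_ell[OF q] by (simp add: W_def value_mult)
  qed
  moreover have "\<Lambda> * g \<in> ideal_part (\<lambda>j. \<mu> j + int (c + M))"
    unfolding \<Lambda>_def sum_distrib_right
  proof (rule ideal_part_sum)
    fix p assume p: "p \<in> Z"
    show "W p * snd (ku p) * g \<in> ideal_part (\<lambda>j. \<mu> j + int (c + M))"
      using ideal_part_mult[OF W[OF p] ku(3)[OF p]] le[OF p] by (simp add: of_nat_diff mult.assoc algebra_simps)
  qed
  ultimately show ?thesis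
    using mult_form_cancel_large[of \<Lambda> "\<lambda>_. c + M"] \<mu> g(1) by simp
qed

lemma codim_ideal_part_shift:
  assumes "large \<mu>"
  shows "mpol.codim (graded_part r n (\<lambda>j. \<mu> j + int (e j))) (ideal_part (\<lambda>j. \<mu> j + int (e j)))
    \<le> mpol.codim (graded_part r n \<mu>) (ideal_part \<mu>)"
proof (rule mpol.codim_le_of_surjective[where \<phi> = "\<lambda>x. ell e * x",
    OF fin_gen_graded_part subspace_graded_part ideal_part_subset subspace_ideal_part
       fin_gen_graded_part subspace_graded_part ideal_part_subset subspace_ideal_part])
  show "ell e * v \<in> ideal_part (\<lambda>j. \<mu> j + int (e j))" if "v \<in> ideal_part \<mu>" for v
    by (rule ideal_part_mult[OF ell_graded that])
  show "\<exists>v\<in>graded_part r n \<mu>. y - ell e * v \<in> ideal_part (\<lambda>j. \<mu> j + int (e j))"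
    if "y \<in> graded_part r n (\<lambda>j. \<mu> j + int (e j))" for y
    by (rule mult_form_surj_large[OF ell_graded ell_nonvanishing assms that])
qed (simp_all add: algebra_simps)

text \<open>The form t is nonzero at p and zero at the other points. The products of g with powers
  of t, padded to a common degree, become dependent modulo the ideal; this yields K and a form v,
  nonzero away from p, such that v * t ^ K * g is in the ideal. Hence multiples of v * g belong to
  the component at p, and multiples of t ^ K * g to the other components.\<close>

lemma local_parts_comaximal:
  assumes \<mu>: "large \<mu>" and p: "p \<in> Z" and g: "g \<in> graded_part r n \<mu>"
  shows "\<exists>a\<in>local_part p \<mu>. \<forall>q\<in>Z - {p}. g - a \<in> local_part q \<mu>"
proof -
  obtain c s where sep: "\<forall>p\<in>Z. s p \<in> graded_part r n (\<lambda>i. int c) \<and> value_at p (s p) \<noteq> 0 \<and> (\<forall>q\<in>Z - {p}. value_at q (s p) = 0)"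
    using separating_family by (elim exE)
  have s: "\<And>p. p \<in> Z \<Longrightarrow> s p \<in> graded_part r n (\<lambda>i. int c)" "\<And>p. p \<in> Z \<Longrightarrow> value_at p (s p) \<noteq> 0"
    "\<And>p q. p \<in> Z \<Longrightarrow> q \<in> Z - {p} \<Longrightarrow> value_at q (s p) = 0"
    using sep by simp_all
  define D where "D = mpol.codim (graded_part r n \<mu>) (ideal_part \<mu>)"
  let ?V = "graded_part r n (\<lambda>j. \<mu> j + int (c * D))" and ?W = "ideal_part (\<lambda>j. \<mu> j + int (c * D))"
  define t where "t = s p"
  have tk: "t ^ k \<in> graded_part r n (\<lambda>_. int (c * k))" for k
    using graded_part_power[OF s(1)[OF p], of k] by (simp add: t_def mult.commute)
  have ellk: "ell (\<lambda>_. c * k) \<in> graded_part r n (\<lambda>_. int (c * k))" for k by (rule ell_graded)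
  \<comment> \<open>There are D + 1 such forms, one more than the codimension in the higher degree
    allows to be independent. The value 0 beyond D is a default, as the index found is at most
    D.\<close>
  define w where "w i = (if i \<le> D then t ^ (D - i) * ell (\<lambda>_. c * i) * g else 0)" for i
  have "w i \<in> ?V" for i
  proof (cases "i \<le> D")
    case True
    then have "int (c * (D - i)) + int (c * i) = int (c * D)"
      by (metis add_mult_distrib2 le_add_diff_inverse2 of_nat_add)
    then show ?thesis
      using graded_part_mult[OF graded_part_mult[OF tk ellk] g, of "D - i" i] True by (simp add: w_def add.commute)
  qed (simp add: w_def)
  then obtain i cc where i: "i \<le> mpol.codim ?V ?W"
    and cc: "w i - (\<Sum>j<i. Poly_Mapping.single 0 (cc j) * w j) \<in> ?W"
    using mpol.dependent_modulo[OF fin_gen_graded_part subspace_graded_part ideal_part_subset subspace_ideal_part, of w] by blast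
  have iD: "i \<le> D" using i codim_ideal_part_shift[OF \<mu>, of "\<lambda>_. c * D"] by (simp add: D_def)
  define K where "K = D - i"
  have D: "D = K + i" using iD by (simp add: K_def)
  \<comment> \<open>The dependency with t ^ K divided out. All terms but the first contain t, so
    away from p the value is that of the first.\<close>
  define v where "v = ell (\<lambda>_. c * i) - (\<Sum>j<i. Poly_Mapping.single 0 (cc j) * (t ^ (i - j) * ell (\<lambda>_. c * j)))"
  have v: "v \<in> graded_part r n (\<lambda>_. int (c * i))"
    unfolding v_def
  proof (intro graded_part_diff ellk graded_part_sum graded_part_scale)
    fix j assume "j \<in> {..<i}"
    then have "int (c * (i - j)) + int (c * j) = int (c * i)"
      by (metis add_mult_distrib2 le_add_diff_inverse2 lessThan_iff less_imp_le of_nat_add)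
    then show "t ^ (i - j) * ell (\<lambda>_. c * j) \<in> graded_part r n (\<lambda>_. int (c * i))"
      using graded_part_mult[OF tk ellk, of "i - j" j] by simp
  qed
  have v_val: "value_at q v \<noteq> 0" if "q \<in> Z - {p}" for q
  proof -
    have "value_at q t = 0" using s(3)[OF p that] by (simp add: t_def)
    then have "value_at q (\<Sum>j<i. Poly_Mapping.single 0 (cc j) * (t ^ (i - j) * ell (\<lambda>_. c * j))) = 0"
      unfolding value_sum by (intro sum.neutral) (auto simp: value_mult value_power)
    then show ?thesis using value_ell[of q] that by (simp add: v_def value_diff)
  qed
  have vtg: "v * t ^ K * g \<in> ?W"
  proof -
    have "w j = t ^ K * (t ^ (i - j) * ell (\<lambda>_. c * j)) * g" if "j < i" for j
    proof -
      have "D - j = K + (i - j)" using that D by simp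
      then have "t ^ (D - j) = t ^ K * t ^ (i - j)" by (simp only: power_add)
      then show ?thesis using that iD by (simp add: w_def mult.assoc)
    qed
    then have "(\<Sum>j<i. Poly_Mapping.single 0 (cc j) * w j) =
        (\<Sum>j<i. Poly_Mapping.single 0 (cc j) * (t ^ (i - j) * ell (\<lambda>_. c * j))) * (t ^ K * g)"
      unfolding sum_distrib_right by (intro sum.cong) (simp_all add: ac_simps)
    moreover have "w i = ell (\<lambda>_. c * i) * (t ^ K * g)" using iD by (simp add: w_def K_def ac_simps)
    ultimately have "w i - (\<Sum>j<i. Poly_Mapping.single 0 (cc j) * w j) = v * t ^ K * g"
      by (simp add: v_def left_diff_distrib mult.assoc)
    then show ?thesis using cc by simp
  qed
  \<comment> \<open>On \<open>Z\<close>, x vanishes exactly at p and y exactly off p. So v * x and t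
    ^ K * y have no common zero there and their sum vanishes nowhere.\<close>
  define x where "x = (\<Sum>q\<in>Z - {p}. s q) * ell (\<lambda>_. c * K)"
  define y where "y = s p * ell (\<lambda>_. c * i)"
  have x: "x \<in> graded_part r n (\<lambda>_. int (c + c * K))"
    using graded_part_mult[OF graded_part_sum ellk, of "Z - {p}" s "\<lambda>_. int c" K] s(1) by (simp add: x_def)
  have y: "y \<in> graded_part r n (\<lambda>_. int (c + c * i))"
    using graded_part_mult[OF s(1)[OF p] ellk, of i] by (simp add: y_def)
  define \<Lambda> where "\<Lambda> = v * x + t ^ K * y"
  have vx: "v * x \<in> graded_part r n (\<lambda>_. int (c + c * D))"
    using graded_part_mult[OF v x] by (simp add: D algebra_simps)
  have ty: "t ^ K * y \<in> graded_part r n (\<lambda>_. int (c + c * D))"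
    using graded_part_mult[OF tk y, of K] by (simp add: D algebra_simps)
  have \<Lambda>: "\<Lambda> \<in> graded_part r n (\<lambda>_. int (c + c * D))"
    unfolding \<Lambda>_def by (rule graded_part_add[OF vx ty])
  have \<Lambda>_nv: "value_at q \<Lambda> \<noteq> 0" if q: "q \<in> Z" for q
  proof (cases "q = p")
    case True
    have "value_at p (s q') = 0" if "q' \<in> Z - {p}" for q' using s(3)[of q' p] that p by auto
    then have "value_at p x = 0" by (simp add: x_def value_mult value_sum sum.neutral)
    then show ?thesis using True s(2)[OF p] value_ell[OF p]
      by (simp add: \<Lambda>_def y_def t_def value_add value_mult value_power)
  next
    case False
    then have q': "q \<in> Z - {p}" using q by simp
    have "value_at q (\<Sum>q'\<in>Z - {p}. s q') = value_at q (s q)"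
      unfolding value_sum using s(3) q finite_zeros
      by (subst sum.remove[OF _ q']) (auto intro!: sum.neutral)
    then have "value_at q x \<noteq> 0" using s(2)[OF q] value_ell[OF q] by (simp add: x_def value_mult)
    moreover have "value_at q y = 0" using s(3)[OF p q'] by (simp add: y_def value_mult)
    ultimately show ?thesis using v_val[OF q'] by (simp add: \<Lambda>_def value_add value_mult)
  qed
  have vxg: "v * x * g \<in> local_part p (\<lambda>j. \<mu> j + int (c + c * D))"
  proof (rule local_partI[OF _ tk[of K]])
    show "v * x * g \<in> graded_part r n (\<lambda>j. \<mu> j + int (c + c * D))"
      using graded_part_mult[OF vx g] by (simp add: algebra_simps)
    show "value_at p (t ^ K) \<noteq> 0" using s(2)[OF p] by (simp add: t_def value_power)
    show "t ^ K * (v * x * g) \<in> ideal_part (\<lambda>j. \<mu> j + int (c + c * D) + int (c * K))"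
      using ideal_part_mult[OF x vtg] by (simp add: algebra_simps)
  qed
  have tyg: "t ^ K * y * g \<in> local_part q (\<lambda>j. \<mu> j + int (c + c * D))" if q: "q \<in> Z - {p}" for q
  proof (rule local_partI[OF _ v v_val[OF q]])
    show "t ^ K * y * g \<in> graded_part r n (\<lambda>j. \<mu> j + int (c + c * D))"
      using graded_part_mult[OF ty g] by (simp add: algebra_simps)
    show "v * (t ^ K * y * g) \<in> ideal_part (\<lambda>j. \<mu> j + int (c + c * D) + int (c * i))"
      using ideal_part_mult[OF y vtg] by (simp add: algebra_simps)
  qed
  have "v * x * g \<in> graded_part r n (\<lambda>j. \<mu> j + int (c + c * D))" using vxg local_part_subset by blast
  \<comment> \<open>Division by \<Lambda> modulo the ideal turns the two summands of \<Lambda> * g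
    into the two summands of g.\<close>
  then obtain a where a: "a \<in> graded_part r n \<mu>" "v * x * g - \<Lambda> * a \<in> ideal_part (\<lambda>j. \<mu> j + int (c + c * D))"
    using mult_form_surj_large[of \<Lambda> "\<lambda>_. c + c * D" \<mu>] \<Lambda> \<Lambda>_nv \<mu> unfolding nonvanishing_def by blast
  have "\<Lambda> * a = v * x * g - (v * x * g - \<Lambda> * a)" by simp
  also have "\<dots> \<in> local_part p (\<lambda>j. \<mu> j + int (c + c * D))"
    using mpol.subspace_diff[OF subspace_local_part vxg] a(2) ideal_part_subset_local by blast
  finally have "a \<in> local_part p \<mu>" using local_part_cancel[OF \<Lambda> \<Lambda>_nv[OF p] a(1)] by simp
  moreover have "g - a \<in> local_part q \<mu>" if q: "q \<in> Z - {p}" for q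
  proof -
    have "\<Lambda> * (g - a) = (v * x * g - \<Lambda> * a) + t ^ K * y * g" by (simp add: \<Lambda>_def algebra_simps)
    also have "\<dots> \<in> local_part q (\<lambda>j. \<mu> j + int (c + c * D))"
      using local_part_add[OF _ tyg[OF q]] a(2) ideal_part_subset_local by blast
    finally show ?thesis using local_part_cancel[OF \<Lambda> \<Lambda>_nv graded_part_diff[OF g a(1)]] q by simp
  qed
  ultimately show ?thesis by blast
qed

text \<open>The Chinese remainder theorem: adding one point at a time, comaximality makes
  codimensions additive, and the intersection of all components is the ideal.\<close>

theorem codim_ideal_part:
  assumes \<mu>: "large \<mu>"
  shows "mpol.codim (graded_part r n \<mu>) (ideal_part \<mu>) = (\<Sum>p\<in>Z. mpol.codim (graded_part r n \<mu>) (local_part p \<mu>))"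
proof -
  let ?V = "graded_part r n \<mu> :: 'k mpol set"
  let ?T = "\<lambda>S. {g\<in>?V. \<forall>p\<in>S. g \<in> local_part p \<mu>}"
  have "mpol.codim ?V (?T S) = (\<Sum>p\<in>S. mpol.codim ?V (local_part p \<mu>))" if "finite S" "S \<subseteq> Z" for S
    using that
  proof (induction S rule: finite_induct)
    case empty
    then show ?case by (simp add: mpol.codim_def)
  next
    case (insert p S)
    have sub: "mpol.subspace (?T S)"
      by (rule mpol.subspaceI) (auto intro: graded_part_add graded_part_scale local_part_0 local_part_add local_part_scale)
    have eq: "?T (insert p S) = local_part p \<mu> \<inter> ?T S" using local_part_subset by blast
    have "mpol.codim ?V (local_part p \<mu> \<inter> ?T S) = mpol.codim ?V (local_part p \<mu>) + mpol.codim ?V (?T S)"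
    proof (rule mpol.codim_Int[OF fin_gen_graded_part subspace_graded_part local_part_subset subspace_local_part _ sub])
      show "?T S \<subseteq> ?V" by blast
      fix g assume g: "g \<in> ?V"
      have p: "p \<in> Z" "S \<subseteq> Z - {p}" using insert by auto
      obtain a where a: "a \<in> local_part p \<mu>" "\<forall>q\<in>Z - {p}. g - a \<in> local_part q \<mu>"
        using local_parts_comaximal[OF \<mu> p(1) g] by blast
      have "g - a \<in> ?V" using graded_part_diff[OF g subsetD[OF local_part_subset a(1)]] .
      then have "g - a \<in> ?T S" using a(2) subsetD[OF p(2)] by simp
      then show "\<exists>a\<in>local_part p \<mu>. g - a \<in> ?T S" using a(1) by blast
    qed
    then show ?case unfolding eq using insert by simp
  qed
  from this[OF finite_zeros subset_refl] have "mpol.codim ?V (?T Z) = (\<Sum>p\<in>Z. mpol.codim ?V (local_part p \<mu>))" .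
  moreover have "?T Z = ideal_part \<mu>"
    using local_parts_Int[OF \<mu>] ideal_part_subset ideal_part_subset_local by blast
  ultimately show ?thesis by simp
qed

lemma codim_local_part_shift:
  assumes "large \<mu>"
  shows "mpol.codim (graded_part r n (\<lambda>j. \<mu> j + int (e j))) (local_part p (\<lambda>j. \<mu> j + int (e j)))
    \<le> mpol.codim (graded_part r n \<mu>) (local_part p \<mu>)"
proof (rule mpol.codim_le_of_surjective[where \<phi> = "\<lambda>x. ell e * x",
    OF fin_gen_graded_part subspace_graded_part local_part_subset subspace_local_part
       fin_gen_graded_part subspace_graded_part local_part_subset subspace_local_part])
  show "ell e * v \<in> local_part p (\<lambda>j. \<mu> j + int (e j))" if "v \<in> local_part p \<mu>" for v
    by (rule local_part_mult[OF ell_graded that])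
  show "\<exists>v\<in>graded_part r n \<mu>. y - ell e * v \<in> local_part p (\<lambda>j. \<mu> j + int (e j))"
    if "y \<in> graded_part r n (\<lambda>j. \<mu> j + int (e j))" for y
    using mult_form_surj_large[OF ell_graded ell_nonvanishing assms that] ideal_part_subset_local by blast
qed (simp_all add: algebra_simps)

text \<open>Multiplication by \<open>h\<close> is injective between quotients of the same dimension, hence bijective.\<close>

lemma mult_form_surj_local:
  assumes \<mu>: "large \<mu>" and h: "h \<in> graded_part r n (\<lambda>j. int (e j))" "value_at p h \<noteq> 0"
    and P: "P \<in> graded_part r n (\<lambda>j. \<mu> j + int (e j))"
  shows "\<exists>G\<in>graded_part r n \<mu>. P - h * G \<in> local_part p (\<lambda>j. \<mu> j + int (e j))"
proof -
  let ?V = "graded_part r n (\<lambda>j. \<mu> j + int (e j)) :: 'k mpol set" and ?T = "local_part p (\<lambda>j. \<mu> j + int (e j))"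
  define U where "U = {x\<in>?V. \<exists>G\<in>graded_part r n \<mu>. x - h * G \<in> ?T}"
  have UI: "x \<in> U" if "x \<in> ?V" "G \<in> graded_part r n \<mu>" "x - h * G \<in> ?T" for x G
    using that unfolding U_def by blast
  have hG: "h * G \<in> ?V" if "G \<in> graded_part r n \<mu>" for G
    using graded_part_mult[OF h(1) that] by (simp add: add.commute)
  have subU: "mpol.subspace U"
  proof (rule mpol.subspaceI)
    show "0 \<in> U" by (rule UI[of _ 0]) (simp_all add: local_part_0)
    show "x + y \<in> U" if xy: "x \<in> U" "y \<in> U" for x y
    proof -
      obtain G H where G: "x \<in> ?V" "G \<in> graded_part r n \<mu>" "x - h * G \<in> ?T"
        and H: "y \<in> ?V" "H \<in> graded_part r n \<mu>" "y - h * H \<in> ?T" using xy unfolding U_def by blast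
      have "x + y - h * (G + H) = (x - h * G) + (y - h * H)" by (simp add: algebra_simps)
      then have "x + y - h * (G + H) \<in> ?T" using local_part_add[OF G(3) H(3)] by metis
      then show ?thesis by (rule UI[OF graded_part_add[OF G(1) H(1)] graded_part_add[OF G(2) H(2)]])
    qed
    show "Poly_Mapping.single 0 c * x \<in> U" if x: "x \<in> U" for c x
    proof -
      obtain G where G: "x \<in> ?V" "G \<in> graded_part r n \<mu>" "x - h * G \<in> ?T" using x unfolding U_def by blast
      have "Poly_Mapping.single 0 c * x - h * (Poly_Mapping.single 0 c * G) = Poly_Mapping.single 0 c * (x - h * G)"
        by (simp add: algebra_simps)
      then have "Poly_Mapping.single 0 c * x - h * (Poly_Mapping.single 0 c * G) \<in> ?T"
        using local_part_scale[OF G(3), of c] by metis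
      then show ?thesis by (rule UI[OF graded_part_scale[OF G(1)] graded_part_scale[OF G(2)]])
    qed
  qed
  have UV: "U \<subseteq> ?V" unfolding U_def by blast
  have TU: "?T \<subseteq> U"
  proof
    fix x assume x: "x \<in> ?T"
    then show "x \<in> U" by (intro UI[of x 0]) (use local_part_subset in auto)
  qed
  have fU: "mpol.fin_gen U" using mpol.fin_gen_subset[OF fin_gen_graded_part UV] .
  have "mpol.codim (graded_part r n \<mu>) (local_part p \<mu>) \<le> mpol.codim U ?T"
  proof (rule mpol.codim_le_of_injective[where \<phi> = "\<lambda>x. h * x",
      OF fin_gen_graded_part subspace_graded_part local_part_subset subspace_local_part fU subU TU subspace_local_part])
    show "h * G \<in> U" if "G \<in> graded_part r n \<mu>" for G
      by (rule UI[OF hG[OF that] that]) (simp add: local_part_0)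
    show "G \<in> local_part p \<mu>" if "G \<in> graded_part r n \<mu>" "h * G \<in> ?T" for G
      by (rule local_part_cancel[OF h that])
  qed (simp_all add: algebra_simps)
  then have "mpol.codim ?V ?T \<le> mpol.codim U ?T" using codim_local_part_shift[OF \<mu>, of e p] by linarith
  moreover have "mpol.dim ?T \<le> mpol.dim U" by (rule mpol.dim_mono[OF fU subU TU subspace_local_part])
  ultimately have "mpol.dim ?V \<le> mpol.dim U" unfolding mpol.codim_def by linarith
  then have "U = ?V" by (rule mpol.dim_eq_imp_eq[OF fin_gen_graded_part subspace_graded_part UV subU])
  then show ?thesis using P unfolding U_def by blast
qed

end

section \<open>Lengths of the local rings\<close>

text \<open>Chains of ideals of the quotient correspond to chains of ideals that contain I, so no
  element of the quotient ring has to be handled later.\<close>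

lemma ring_length_quotient:
  assumes R: "ring R" and a: "ideal I R"
    and upper: "\<And>k J. (\<And>i. i \<le> k \<Longrightarrow> ideal (J i) R \<and> I \<subseteq> J i) \<Longrightarrow> (\<And>i. i < k \<Longrightarrow> J i \<subset> J (Suc i)) \<Longrightarrow> k \<le> D"
    and lower: "\<And>i. i \<le> D \<Longrightarrow> ideal (J i) R \<and> I \<subseteq> J i" "\<And>i. i < D \<Longrightarrow> J i \<subset> J (Suc i)"
  shows "ring_length (R Quot I) = enat D"
proof -
  interpret ring R by fact
  let ?q = "\<lambda>J. a_r_coset R I ` J"
  let ?A = "{J. ideal J R \<and> I \<subseteq> J}" and ?B = "{J. ideal J (R Quot I)}"
  have bij: "bij_betw ?q ?A ?B" by (rule quot_ideal_correspondence[OF a])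
  have Union_image: "\<Union> (?q J) = J" if "J \<in> ?A" for J
    using ideal_incl_iff[OF a, of J] that by auto
  show ?thesis
    unfolding ring_length_def
  proof (rule antisym)
    show "(SUP k\<in>{k. \<exists>J. (\<forall>i\<le>k. ideal (J i) (R Quot I)) \<and> (\<forall>i<k. J i \<subset> J (Suc i))}. enat k) \<le> enat D"
    proof (rule SUP_least)
      fix k assume "k \<in> {k. \<exists>J. (\<forall>i\<le>k. ideal (J i) (R Quot I)) \<and> (\<forall>i<k. J i \<subset> J (Suc i))}"
      then obtain J where J: "\<And>i. i \<le> k \<Longrightarrow> J i \<in> ?B" "\<And>i. i < k \<Longrightarrow> J i \<subset> J (Suc i)" by blast
      define H where "H i = \<Union> (J i)" for i
      have H: "H i \<in> ?A \<and> ?q (H i) = J i" if "i \<le> k" for i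
      proof -
        have "J i \<in> ?q ` ?A" using J(1)[OF that] bij by (simp add: bij_betw_def)
        then obtain Y where "Y \<in> ?A" "J i = ?q Y" by blast
        then show ?thesis using Union_image[of Y] by (simp add: H_def)
      qed
      have "H i \<subset> H (Suc i)" if "i < k" for i
      proof -
        have "H i \<subseteq> H (Suc i)" using J(2)[OF that] unfolding H_def by blast
        moreover have "H i \<noteq> H (Suc i)" using H[of i] H[of "Suc i"] J(2)[OF that] that
          by (metis Suc_leI less_imp_le psubset_eq)
        ultimately show ?thesis by blast
      qed
      then have "k \<le> D" using H by (intro upper[of k H]) auto
      then show "enat k \<le> enat D" by simp
    qed
    have "ideal (?q (J i)) (R Quot I)" if "i \<le> D" for i
      using bij lower(1)[OF that] unfolding bij_betw_def by blast
    moreover have "?q (J i) \<subset> ?q (J (Suc i))" if "i < D" for i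
    proof -
      have "J i \<in> ?A" "J (Suc i) \<in> ?A" using lower(1)[of i] lower(1)[of "Suc i"] that by auto
      then have "?q (J i) = ?q (J (Suc i)) \<Longrightarrow> J i = J (Suc i)"
        by (intro inj_onD[OF bij_betw_imp_inj_on[OF bij]])
      then have "?q (J i) \<noteq> ?q (J (Suc i))" using lower(2)[OF that] by auto
      then show ?thesis using lower(2)[OF that] by blast
    qed
    ultimately show "enat D \<le> (SUP k\<in>{k. \<exists>J. (\<forall>i\<le>k. ideal (J i) (R Quot I)) \<and> (\<forall>i<k. J i \<subset> J (Suc i))}. enat k)"
      by (intro SUP_upper CollectI exI[of _ "\<lambda>i. ?q (J i)"]) blast
  qed
qed

context multiprojective
begin

section \<open>The local ring at a zero as a ring of fractions\<close>

abbreviation "local_ring \<equiv> multiprojective_local_ring r n"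

lemma local_ring_simps [simp]:
  "x \<otimes>\<^bsub>local_ring p\<^esub> y = x * y" "x \<oplus>\<^bsub>local_ring p\<^esub> y = x + y" "\<one>\<^bsub>local_ring p\<^esub> = 1" "\<zero>\<^bsub>local_ring p\<^esub> = 0"
  by (simp_all add: multiprojective_local_ring_def)

lemma nonzero_of_value: "value_at p h \<noteq> 0 \<Longrightarrow> h \<noteq> 0"
  by auto

lemma local_ring_carrier:
  assumes "p \<in> Z"
  shows "x \<in> carrier (local_ring p) \<longleftrightarrow>
    (\<exists>g h e. x = Fract g h \<and> g \<in> graded_part r n e \<and> h \<in> graded_part r n e \<and> value_at p h \<noteq> 0)"
  using nonvanishing_iff[OF zero_point_space[OF assms]] unfolding multiprojective_local_ring_def
  by (simp add: conj_ac) blast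

lemma local_ring_carrierI:
  "p \<in> Z \<Longrightarrow> g \<in> graded_part r n e \<Longrightarrow> h \<in> graded_part r n e \<Longrightarrow> value_at p h \<noteq> 0 \<Longrightarrow> Fract g h \<in> carrier (local_ring p)"
  using local_ring_carrier by blast

lemma local_ring_carrierE:
  assumes "p \<in> Z" "x \<in> carrier (local_ring p)"
  obtains g h e where "x = Fract g h" "g \<in> graded_part r n e" "h \<in> graded_part r n e" "value_at p h \<noteq> 0"
  using assms local_ring_carrier by blast

lemma local_ring_closed:
  assumes p: "p \<in> Z" and xy: "x \<in> carrier (local_ring p)" "y \<in> carrier (local_ring p)"
  shows "x + y \<in> carrier (local_ring p)" "x * y \<in> carrier (local_ring p)" "- x \<in> carrier (local_ring p)"
proof -
  obtain g h e where x: "x = Fract g h" "g \<in> graded_part r n e" "h \<in> graded_part r n e" "value_at p h \<noteq> 0"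
    by (rule local_ring_carrierE[OF p xy(1)])
  obtain g' h' e' where y: "y = Fract g' h'" "g' \<in> graded_part r n e'" "h' \<in> graded_part r n e'" "value_at p h' \<noteq> 0"
    by (rule local_ring_carrierE[OF p xy(2)])
  have nz: "h \<noteq> 0" "h' \<noteq> 0" using x(4) y(4) nonzero_of_value by blast+
  have hh: "h * h' \<in> graded_part r n (\<lambda>j. e j + e' j)" "value_at p (h * h') \<noteq> 0"
    using graded_part_mult[OF x(3) y(3)] x(4) y(4) by (simp_all add: value_mult)
  have "g * h' + g' * h \<in> graded_part r n (\<lambda>j. e j + e' j)"
    using graded_part_add[OF graded_part_mult[OF x(2) y(3)] graded_part_mult[OF x(3) y(2)]] by (simp add: mult.commute)
  from local_ring_carrierI[OF p this hh] show "x + y \<in> carrier (local_ring p)"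
    using nz by (simp add: x(1) y(1))
  show "x * y \<in> carrier (local_ring p)"
    using local_ring_carrierI[OF p graded_part_mult[OF x(2) y(2)] hh] by (simp add: x(1) y(1))
  show "- x \<in> carrier (local_ring p)"
    using local_ring_carrierI[OF p graded_part_uminus[OF x(2)] x(3,4)] by (simp add: x(1))
qed

lemma local_ring_const: "p \<in> Z \<Longrightarrow> Fract (Poly_Mapping.single 0 c) 1 \<in> carrier (local_ring p)"
  by (rule local_ring_carrierI[of _ _ "\<lambda>_. 0"]) (auto intro!: graded_part_single simp: monomials_def)

lemma local_ring_0_1: "p \<in> Z \<Longrightarrow> 0 \<in> carrier (local_ring p)" "p \<in> Z \<Longrightarrow> 1 \<in> carrier (local_ring p)"
  using local_ring_const[of p 0] local_ring_const[of p 1] by (simp_all add: Zero_fract_def One_fract_def)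

lemma cring_local_ring:
  assumes p: "p \<in> Z"
  shows "cring (local_ring p)"
proof (rule cringI)
  show "abelian_group (local_ring p)"
  proof (rule abelian_groupI)
    fix x assume "x \<in> carrier (local_ring p)"
    then show "\<exists>y\<in>carrier (local_ring p). y \<oplus>\<^bsub>local_ring p\<^esub> x = \<zero>\<^bsub>local_ring p\<^esub>"
      using local_ring_closed(3)[OF p, of x x] by (intro bexI[of _ "- x"]) simp_all
  qed (use local_ring_closed[OF p] local_ring_0_1[OF p] in \<open>simp_all add: algebra_simps\<close>)
  show "Group.comm_monoid (local_ring p)"
    by (rule comm_monoidI) (use local_ring_closed[OF p] local_ring_0_1[OF p] in \<open>simp_all add: algebra_simps\<close>)
qed (simp add: algebra_simps)

lemma local_ring_idealI:
  assumes p: "p \<in> Z" and J: "J \<subseteq> carrier (local_ring p)" "0 \<in> J" "\<And>x y. x \<in> J \<Longrightarrow> y \<in> J \<Longrightarrow> x + y \<in> J"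
    "\<And>x y. x \<in> J \<Longrightarrow> y \<in> carrier (local_ring p) \<Longrightarrow> y * x \<in> J"
  shows "ideal J (local_ring p)"
proof -
  interpret cring "local_ring p" by (rule cring_local_ring[OF p])
  have neg: "- x \<in> J" if "x \<in> J" for x
    using J(4)[OF that local_ring_closed(3)[OF p local_ring_0_1(2)[OF p] local_ring_0_1(2)[OF p]]] by simp
  have inv: "\<ominus>\<^bsub>local_ring p\<^esub> x = - x" if "x \<in> carrier (local_ring p)" for x
    by (rule minus_equality) (use local_ring_closed(3)[OF p] that in auto)
  have "subgroup J (add_monoid (local_ring p))"
  proof (rule add.subgroupI)
    show "\<ominus>\<^bsub>local_ring p\<^esub> x \<in> J" if "x \<in> J" for x using neg[OF that] inv that J(1) by auto
  qed (use J in auto)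
  then show ?thesis
    by (rule idealI[OF ring_axioms]) (use J(4) in \<open>auto simp: mult.commute\<close>)
qed

lemma local_ring_idealD:
  assumes "ideal J (local_ring p)"
  shows "J \<subseteq> carrier (local_ring p)" "0 \<in> J" "\<And>x y. x \<in> J \<Longrightarrow> y \<in> J \<Longrightarrow> x + y \<in> J"
    "\<And>x y. x \<in> J \<Longrightarrow> y \<in> carrier (local_ring p) \<Longrightarrow> y * x \<in> J"
proof -
  interpret ideal J "local_ring p" by fact
  show "J \<subseteq> carrier (local_ring p)" "0 \<in> J" using a_subset additive_subgroup.zero_closed[OF is_additive_subgroup] by auto
  show "x + y \<in> J" if "x \<in> J" "y \<in> J" for x y using additive_subgroup.a_closed[OF is_additive_subgroup that] by simp
  show "y * x \<in> J" if "x \<in> J" "y \<in> carrier (local_ring p)" for x y using I_l_closed[OF that] by simp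
qed

lemma local_ring_ideal_diff:
  assumes p: "p \<in> Z" and J: "ideal J (local_ring p)" and xy: "x \<in> J" "y \<in> J"
  shows "x - y \<in> J"
proof -
  have "- 1 \<in> carrier (local_ring p)" using local_ring_closed(3)[OF p] local_ring_0_1[OF p] by blast
  then have "- 1 * y \<in> J" by (rule local_ring_idealD(4)[OF J xy(2)])
  then show ?thesis using local_ring_idealD(3)[OF J xy(1)] by fastforce
qed

text \<open>Since \<open>local_part\<close> already allows for multipliers that do not vanish at p,
  single fractions describe the whole ideal of the subscheme and no sums of fractions
  appear.\<close>

definition scheme_ideal :: "(nat \<times> nat \<Rightarrow> 'k) set \<Rightarrow> 'k mpol fract set" where
  "scheme_ideal p = {Fract g h | g h e. g \<in> local_part p e \<and> h \<in> graded_part r n e \<and> value_at p h \<noteq> 0}"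

lemma scheme_idealI:
  "g \<in> local_part p e \<Longrightarrow> h \<in> graded_part r n e \<Longrightarrow> value_at p h \<noteq> 0 \<Longrightarrow> Fract g h \<in> scheme_ideal p"
  unfolding scheme_ideal_def by blast

lemma scheme_idealE:
  assumes "x \<in> scheme_ideal p"
  obtains g h e where "x = Fract g h" "g \<in> local_part p e" "h \<in> graded_part r n e" "value_at p h \<noteq> 0"
  using assms unfolding scheme_ideal_def by blast

lemma ideal_scheme_ideal:
  assumes p: "p \<in> Z"
  shows "ideal (scheme_ideal p) (local_ring p)"
proof (rule local_ring_idealI[OF p])
  show "scheme_ideal p \<subseteq> carrier (local_ring p)"
  proof
    fix x assume "x \<in> scheme_ideal p"
    then show "x \<in> carrier (local_ring p)"
      by (rule scheme_idealE) (use local_part_subset local_ring_carrierI[OF p] in blast)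
  qed
  show "0 \<in> scheme_ideal p"
    using scheme_idealI[OF local_part_0 graded_part_1, of p] by (simp add: Zero_fract_def)
  show "x + y \<in> scheme_ideal p" if xy: "x \<in> scheme_ideal p" "y \<in> scheme_ideal p" for x y
  proof -
    obtain g h e where x: "x = Fract g h" "g \<in> local_part p e" "h \<in> graded_part r n e" "value_at p h \<noteq> 0"
      by (rule scheme_idealE[OF xy(1)])
    obtain g' h' e' where y: "y = Fract g' h'" "g' \<in> local_part p e'" "h' \<in> graded_part r n e'" "value_at p h' \<noteq> 0"
      by (rule scheme_idealE[OF xy(2)])
    have nz: "h \<noteq> 0" "h' \<noteq> 0" using x(4) y(4) nonzero_of_value by blast+
    have "h' * g \<in> local_part p (\<lambda>j. e j + e' j)" "h * g' \<in> local_part p (\<lambda>j. e j + e' j)"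
      using local_part_mult[OF y(3) x(2)] local_part_mult[OF x(3) y(2)] by (simp_all add: add.commute)
    then have "h' * g + h * g' \<in> local_part p (\<lambda>j. e j + e' j)" by (rule local_part_add)
    then have "Fract (h' * g + h * g') (h * h') \<in> scheme_ideal p"
      by (rule scheme_idealI[OF _ graded_part_mult[OF x(3) y(3)]]) (use x(4) y(4) in \<open>simp add: value_mult\<close>)
    then show ?thesis using nz by (simp add: x(1) y(1) mult.commute)
  qed
  show "y * x \<in> scheme_ideal p" if xy: "x \<in> scheme_ideal p" "y \<in> carrier (local_ring p)" for x y
  proof -
    obtain g h e where x: "x = Fract g h" "g \<in> local_part p e" "h \<in> graded_part r n e" "value_at p h \<noteq> 0"
      by (rule scheme_idealE[OF xy(1)])
    obtain g' h' e' where y: "y = Fract g' h'" "g' \<in> graded_part r n e'" "h' \<in> graded_part r n e'" "value_at p h' \<noteq> 0"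
      by (rule local_ring_carrierE[OF p xy(2)])
    have "Fract (g' * g) (h' * h) \<in> scheme_ideal p"
    proof (rule scheme_idealI[OF local_part_mult[OF y(2) x(2)]])
      show "h' * h \<in> graded_part r n (\<lambda>j. e j + e' j)" using graded_part_mult[OF y(3) x(3)] by (simp add: add.commute)
    qed (use x(4) y(4) in \<open>simp add: value_mult\<close>)
    then show ?thesis by (simp add: x(1) y(1))
  qed
qed

text \<open>A fraction g / h is expanded by a multiplier u that takes g into the ideal. Each f i
  becomes a generator of the local ideal after division by \<open>ell (d i)\<close>, a form of the
  same degree that is nonzero at p.\<close>

lemma genideal_eq_scheme_ideal:
  assumes p: "p \<in> Z"
  shows "genideal (local_ring p) {Fract (f i) h | i h. i \<le> N \<and> h \<in> graded_part r n (idegree d i) \<and> (\<forall>q\<in>p. ev q h \<noteq> 0)}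
    = scheme_ideal p" (is "genideal _ ?S = _")
proof -
  interpret cring "local_ring p" by (rule cring_local_ring[OF p])
  have S: "Fract (f i) h \<in> ?S" if "i \<le> N" "h \<in> graded_part r n (idegree d i)" "value_at p h \<noteq> 0" for i h
    using that nonvanishing_iff[OF zero_point_space[OF p] that(2)] by blast
  have SE: "\<exists>i h. x = Fract (f i) h \<and> i \<le> N \<and> h \<in> graded_part r n (idegree d i) \<and> value_at p h \<noteq> 0" if "x \<in> ?S" for x
    using that nonvanishing_iff[OF zero_point_space[OF p]] by blast
  have sub: "?S \<subseteq> scheme_ideal p"
  proof
    fix x assume "x \<in> ?S"
    then obtain i h where "x = Fract (f i) h" "i \<le> N" "h \<in> graded_part r n (idegree d i)" "value_at p h \<noteq> 0"
      using SE by blast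
    then show "x \<in> scheme_ideal p"
      using scheme_idealI[of "f i" p "idegree d i" h] f_in_ideal_part[of i] ideal_part_subset_local by blast
  qed
  then have Sc: "?S \<subseteq> carrier (local_ring p)" using local_ring_idealD(1)[OF ideal_scheme_ideal[OF p]] by blast
  note gen = genideal_ideal[OF Sc]
  have "scheme_ideal p \<subseteq> genideal (local_ring p) ?S"
  proof
    fix x assume "x \<in> scheme_ideal p"
    then obtain g h e where x: "x = Fract g h" "g \<in> local_part p e" "h \<in> graded_part r n e" "value_at p h \<noteq> 0"
      by (rule scheme_idealE)
    obtain a u where u: "u \<in> graded_part r n a" "value_at p u \<noteq> 0" "u * g \<in> ideal_part (\<lambda>j. e j + a j)"
      using x(2) by (rule local_partE)
    obtain b where b: "u * g = (\<Sum>i<Suc N. f i * b i)" "\<And>i. i < Suc N \<Longrightarrow> b i \<in> graded_part r n (\<lambda>j. e j + a j - idegree d i j)"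
      using u(3) unfolding ideal_part_def by blast
    have nz: "u * h \<noteq> 0" "value_at p (u * h) \<noteq> 0" using u(2) x(4) nonzero_of_value by (auto simp: value_mult)
    have uh: "u * h \<in> graded_part r n (\<lambda>j. e j + a j)" using graded_part_mult[OF u(1) x(3)] by (simp add: add.commute)
    have summand: "Fract (f i * b i) (u * h) \<in> genideal (local_ring p) ?S" if i: "i < Suc N" for i
    proof -
      have l: "ell (d i) \<in> graded_part r n (idegree d i)" using ell_graded[of "d i"] by (simp add: idegree_def)
      have lz: "value_at p (ell (d i)) \<noteq> 0" by (rule value_ell[OF p])
      have "Fract (f i) (ell (d i)) \<in> genideal (local_ring p) ?S"
        using genideal_self[OF Sc] S[OF _ l lz] i by (meson less_Suc_eq_le subsetD)
      moreover have "Fract (ell (d i) * b i) (u * h) \<in> carrier (local_ring p)"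
        using graded_part_mult[OF l b(2)[OF i]] by (intro local_ring_carrierI[OF p _ uh nz(2)]) simp
      ultimately have "Fract (ell (d i) * b i) (u * h) * Fract (f i) (ell (d i)) \<in> genideal (local_ring p) ?S"
        by (rule local_ring_idealD(4)[OF gen])
      moreover have "Fract (ell (d i) * b i) (u * h) * Fract (f i) (ell (d i)) = Fract (f i * b i) (u * h)"
        using nonzero_of_value[OF lz] nz(1) by (simp add: eq_fract ac_simps)
      ultimately show ?thesis by simp
    qed
    have "Fract (\<Sum>i<m. f i * b i) (u * h) \<in> genideal (local_ring p) ?S" if "m \<le> Suc N" for m
      using that
    proof (induction m)
      case 0
      then show ?case using local_ring_idealD(2)[OF gen] nz(1) by (simp add: fract_collapse)
    next
      case (Suc m)
      have "Fract (\<Sum>i<Suc m. f i * b i) (u * h) = Fract (\<Sum>i<m. f i * b i) (u * h) + Fract (f m * b m) (u * h)"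
        using nz(1) by (simp add: eq_fract algebra_simps)
      then show ?case using local_ring_idealD(3)[OF gen] Suc summand[of m] by simp
    qed
    from this[OF order_refl] have "Fract (u * g) (u * h) \<in> genideal (local_ring p) ?S" using b(1) by simp
    moreover have "Fract (u * g) (u * h) = x" using nz(1) by (simp add: x(1) eq_fract)
    ultimately show "x \<in> genideal (local_ring p) ?S" by simp
  qed
  then show ?thesis using genideal_minimal[OF ideal_scheme_ideal[OF p] sub] by blast
qed

lemma chain_dim:
  assumes "\<And>i. i < k \<Longrightarrow> S i < S (Suc i)"
  shows "S 0 + k \<le> (S k :: nat)"
  using assms by (induction k) (auto simp: Suc_le_eq intro: le_less_trans)

text \<open>Ideals above the scheme ideal embed strictly monotonically into subspaces between
  \<open>local_part\<close> and the graded part, which bounds every chain. Conversely, an ideal can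
  be enlarged so that the dimension rises by at most one: the maximal ideal kills a simple quotient,
  and the residue field is the base field. Repeating this gives a chain of full length.\<close>

theorem ring_length_local_ring:
  assumes p: "p \<in> Z" and \<mu>: "large \<mu>"
  shows "ring_length (subscheme_local_ring r n d f p) = enat (mpol.codim (graded_part r n \<mu>) (local_part p \<mu>))"
proof -
  let ?L = "local_ring p" and ?a = "scheme_ideal p" and ?V = "graded_part r n \<mu> :: 'k mpol set"
  \<comment> \<open>A fixed denominator of degree \<mu> that is nonzero at p; it identifies forms of
    degree \<mu> with local functions.\<close>
  define \<theta> where "\<theta> = ell (\<lambda>j. nat (\<mu> j))"
  have "\<theta> \<in> graded_part r n (\<lambda>j. int (nat (\<mu> j)))" unfolding \<theta>_def by (rule ell_graded)
  also have "graded_part r n (\<lambda>j. int (nat (\<mu> j))) = ?V"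
    by (rule graded_part_cong) (use large_nonneg[OF \<mu>] in simp)
  finally have \<theta>: "\<theta> \<in> ?V" .
  have \<theta>v: "value_at p \<theta> \<noteq> 0" unfolding \<theta>_def by (rule value_ell[OF p])
  have \<theta>0: "\<theta> \<noteq> 0" by (rule nonzero_of_value[OF \<theta>v])
  define S where "S J = {G\<in>?V. Fract G \<theta> \<in> J}" for J
  have frac: "Fract G \<theta> \<in> carrier ?L" if "G \<in> ?V" for G by (rule local_ring_carrierI[OF p that \<theta> \<theta>v])
  have frac_add: "Fract (G + H) \<theta> = Fract G \<theta> + Fract H \<theta>" for G H
    using \<theta>0 by (simp add: eq_fract algebra_simps)
  have frac_diff: "Fract (G - H) \<theta> = Fract G \<theta> - Fract H \<theta>" for G H
    using frac_add[of "G - H" H] by (simp only: diff_add_cancel add_diff_cancel_right')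
  have frac_scale: "Fract (Poly_Mapping.single 0 c * G) \<theta> = Fract (Poly_Mapping.single 0 c) 1 * Fract G \<theta>" for c G
    by simp
  have aI: "ideal ?a ?L" by (rule ideal_scheme_ideal[OF p])
  have subS: "mpol.subspace (S J)" if J: "ideal J ?L" for J
  proof (rule mpol.subspaceI)
    show "0 \<in> S J" using local_ring_idealD(2)[OF J] \<theta>0 by (simp add: S_def fract_collapse)
    show "G + H \<in> S J" if "G \<in> S J" "H \<in> S J" for G H
      using that local_ring_idealD(3)[OF J] by (auto simp: S_def frac_add intro: graded_part_add)
    show "Poly_Mapping.single 0 c * G \<in> S J" if "G \<in> S J" for c G
      using that local_ring_idealD(4)[OF J _ local_ring_const[OF p, of c]] graded_part_scale[of G r n \<mu> c]
      unfolding S_def frac_scale mem_Collect_eq by blast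
  qed
  have SV: "S J \<subseteq> ?V" for J unfolding S_def by blast
  have Sa: "S ?a = local_part p \<mu>"
  proof (intro equalityI subsetI)
    fix G assume "G \<in> S ?a"
    then have G: "G \<in> ?V" "Fract G \<theta> \<in> ?a" by (auto simp: S_def)
    obtain g h e where x: "Fract G \<theta> = Fract g h" "g \<in> local_part p e" "h \<in> graded_part r n e" "value_at p h \<noteq> 0"
      by (rule scheme_idealE[OF G(2)])
    have "h * G = \<theta> * g" using x(1) \<theta>0 nonzero_of_value[OF x(4)] by (simp add: eq_fract mult.commute)
    also have "\<dots> \<in> local_part p (\<lambda>j. \<mu> j + e j)" using local_part_mult[OF \<theta> x(2)] by (simp add: add.commute)
    finally show "G \<in> local_part p \<mu>" by (rule local_part_cancel[OF x(3,4) G(1)])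
  next
    fix G assume "G \<in> local_part p \<mu>"
    then show "G \<in> S ?a" using scheme_idealI[OF _ \<theta> \<theta>v] local_part_subset unfolding S_def by blast
  qed
  \<comment> \<open>Every local function has denominator \<theta> up to the scheme ideal. Its own
    denominator may vanish at other zeros, so \<open>mult_form_surj_local\<close> is needed here and
    not \<open>mult_form_surj_large\<close>.\<close>
  have rep: "\<exists>G\<in>?V. x - Fract G \<theta> \<in> ?a" if xL: "x \<in> carrier ?L" for x
  proof -
    obtain g h e where x: "x = Fract g h" "g \<in> graded_part r n e" "h \<in> graded_part r n e" "value_at p h \<noteq> 0"
      by (rule local_ring_carrierE[OF p xL])
    have h0: "h \<noteq> 0" by (rule nonzero_of_value[OF x(4)])
    have "graded_part r n e = (graded_part r n (\<lambda>j. int (nat (e j))) :: 'k mpol set)"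
      by (rule graded_part_cong) (use graded_part_nonzero[OF x(3) h0] in simp)
    then have gh: "g \<in> graded_part r n (\<lambda>j. int (nat (e j)))" "h \<in> graded_part r n (\<lambda>j. int (nat (e j)))"
      using x(2,3) by auto
    obtain G where G: "G \<in> ?V" "\<theta> * g - h * G \<in> local_part p (\<lambda>j. \<mu> j + int (nat (e j)))"
      using mult_form_surj_local[OF \<mu> gh(2) x(4) graded_part_mult[OF \<theta> gh(1)]] by blast
    have "Fract (\<theta> * g - h * G) (\<theta> * h) \<in> ?a"
      by (rule scheme_idealI[OF G(2) graded_part_mult[OF \<theta> gh(2)]]) (use x(4) \<theta>v in \<open>simp add: value_mult\<close>)
    moreover have "Fract (\<theta> * g - h * G) (\<theta> * h) = x - Fract G \<theta>"
      using h0 \<theta>0 by (simp add: x(1) eq_fract algebra_simps)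
    ultimately show ?thesis using G(1) by auto
  qed
  have S_eq: "J \<subseteq> J'" if J: "ideal J ?L" "?a \<subseteq> J" "ideal J' ?L" "?a \<subseteq> J'" "S J \<subseteq> S J'" for J J'
  proof
    fix x assume x: "x \<in> J"
    then obtain G where G: "G \<in> ?V" "x - Fract G \<theta> \<in> ?a" using rep local_ring_idealD(1)[OF J(1)] by blast
    have "x - (x - Fract G \<theta>) \<in> J" by (rule local_ring_ideal_diff[OF p J(1) x]) (use G(2) J(2) in blast)
    then have "G \<in> S J'" using G(1) J(5) by (auto simp: S_def)
    then have "(x - Fract G \<theta>) + Fract G \<theta> \<in> J'"
      by (intro local_ring_idealD(3)[OF J(3)]) (use G(2) J(4) in \<open>auto simp: S_def\<close>)
    then show "x \<in> J'" by simp
  qed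
  have fV: "mpol.fin_gen ?V" and sV: "mpol.subspace ?V" by (rule fin_gen_graded_part subspace_graded_part)+
  have strict: "mpol.dim (S J) < mpol.dim (S J')"
    if J: "ideal J ?L" "?a \<subseteq> J" "ideal J' ?L" "?a \<subseteq> J'" "J \<subset> J'" for J J'
  proof (rule mpol.dim_strict_mono[OF mpol.fin_gen_subset[OF fV SV] subS[OF J(3)] _ subS[OF J(1)]])
    have "S J \<subseteq> S J'" using J(5) unfolding S_def by blast
    moreover have "\<not> S J' \<subseteq> S J" using S_eq[OF J(3,4,1,2)] J(5) by blast
    ultimately show "S J \<subset> S J'" by blast
  qed
  have L_ideal: "ideal (carrier ?L) ?L"
    by (rule local_ring_idealI[OF p]) (use local_ring_closed[OF p] local_ring_0_1[OF p] in auto)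
  have SL: "S (carrier ?L) = ?V" using frac unfolding S_def by blast
  \<comment> \<open>Least dimension of the associated subspace replaces minimality of the ideal; by
    \<open>strict\<close>, nothing lies strictly between J and J'.\<close>
  have succ: "\<exists>J'. ideal J' ?L \<and> J \<subset> J' \<and> mpol.dim (S J') \<le> Suc (mpol.dim (S J))"
    if J: "ideal J ?L" "?a \<subseteq> J" "J \<noteq> carrier ?L" for J
  proof -
    have "ideal (carrier ?L) ?L \<and> J \<subset> carrier ?L" using L_ideal J(3) local_ring_idealD(1)[OF J(1)] by blast
    then obtain J' where J': "ideal J' ?L \<and> J \<subset> J'"
      and min: "\<And>Y. ideal Y ?L \<and> J \<subset> Y \<Longrightarrow> mpol.dim (S J') \<le> mpol.dim (S Y)"
      using ex_has_least_nat[of "\<lambda>Y. ideal Y ?L \<and> J \<subset> Y" "carrier ?L" "\<lambda>Y. mpol.dim (S Y)"] by blast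
    then obtain o1 where o1: "o1 \<in> J'" "o1 \<notin> J" by blast
    have J'I: "ideal J' ?L" "J \<subset> J'" "?a \<subseteq> J'" using J' J(2) by auto
    have oL: "o1 \<in> carrier ?L" using o1 local_ring_idealD(1)[OF J'I(1)] by blast
    have gen: "\<exists>j\<in>J. \<exists>l\<in>carrier ?L. x = j + b * o1 * l" if b: "b \<in> carrier ?L" "b * o1 \<notin> J" "x \<in> J'" for b x
    proof -
      define X1 where "X1 = {j + b * o1 * l | j l. j \<in> J \<and> l \<in> carrier ?L}"
      have bo: "b * o1 \<in> carrier ?L" using local_ring_closed(2)[OF p b(1) oL] .
      have bJ: "b * o1 \<in> J'" using local_ring_idealD(4)[OF J'I(1) o1(1) b(1)] .
      have X1: "ideal X1 ?L"
      proof (rule local_ring_idealI[OF p])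
        show "X1 \<subseteq> carrier ?L"
        proof
          fix x assume "x \<in> X1"
          then obtain j l where x: "x = j + b * o1 * l" "j \<in> J" "l \<in> carrier ?L" unfolding X1_def by blast
          have "j \<in> carrier ?L" using x(2) local_ring_idealD(1)[OF J(1)] by blast
          then show "x \<in> carrier ?L"
            unfolding x(1) by (intro local_ring_closed(1)[OF p] local_ring_closed(2)[OF p bo x(3)])
        qed
        have "0 = 0 + b * o1 * 0" by simp
        then show "0 \<in> X1" unfolding X1_def using local_ring_idealD(2)[OF J(1)] local_ring_0_1(1)[OF p] by blast
        show "x + y \<in> X1" if xy: "x \<in> X1" "y \<in> X1" for x y
        proof -
          obtain j l j' l' where "x = j + b * o1 * l" "y = j' + b * o1 * l'" "j \<in> J" "j' \<in> J" "l \<in> carrier ?L" "l' \<in> carrier ?L"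
            using xy unfolding X1_def by blast
          moreover from this have "x + y = (j + j') + b * o1 * (l + l')" by (simp add: algebra_simps)
          ultimately show ?thesis unfolding X1_def
            using local_ring_idealD(3)[OF J(1), of j j'] local_ring_closed(1)[OF p, of l l'] by blast
        qed
        show "y * x \<in> X1" if xy: "x \<in> X1" "y \<in> carrier ?L" for x y
        proof -
          obtain j l where "x = j + b * o1 * l" "j \<in> J" "l \<in> carrier ?L" using xy(1) unfolding X1_def by blast
          moreover from this have "y * x = y * j + b * o1 * (y * l)" by (simp add: algebra_simps)
          ultimately show ?thesis unfolding X1_def
            using local_ring_idealD(4)[OF J(1), of j y] local_ring_closed(2)[OF p xy(2), of l] xy(2) by blast
        qed
      qed
      have JX: "J \<subseteq> X1"
      proof
        fix j assume "j \<in> J"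
        moreover have "j = j + b * o1 * 0" by simp
        ultimately show "j \<in> X1" unfolding X1_def using local_ring_0_1(1)[OF p] by blast
      qed
      have "b * o1 = 0 + b * o1 * 1" by simp
      then have "b * o1 \<in> X1" unfolding X1_def using local_ring_idealD(2)[OF J(1)] local_ring_0_1(2)[OF p] by blast
      then have JX': "J \<subset> X1" using JX b(2) by blast
      have XJ: "X1 \<subseteq> J'"
      proof
        fix x assume "x \<in> X1"
        then obtain j l where x: "x = j + l * (b * o1)" "j \<in> J" "l \<in> carrier ?L" unfolding X1_def by (auto simp: mult.commute)
        show "x \<in> J'" unfolding x(1)
          by (rule local_ring_idealD(3)[OF J'I(1) _ local_ring_idealD(4)[OF J'I(1) bJ x(3)]]) (use x(2) J'I(2) in blast)
      qed
      have "mpol.dim (S J') \<le> mpol.dim (S X1)" by (rule min) (use X1 JX' in blast)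
      moreover have "?a \<subseteq> X1" using J(2) JX by (rule subset_trans)
      ultimately have "\<not> X1 \<subset> J'" using strict[OF X1 _ J'I(1,3)] by fastforce
      then have "X1 = J'" using XJ by blast
      then show ?thesis using b(3) unfolding X1_def by blast
    qed
    \<comment> \<open>Nakayama by hand: if y * o1 still generated J' over J with y in the maximal
      ideal, then o1 = j + y * o1 * l, and the unit 1 - y * l would put o1 into J.\<close>
    have mo: "y * o1 \<in> J" if y: "y = Fract g h" "g \<in> graded_part r n e" "h \<in> graded_part r n e" "value_at p h \<noteq> 0" "value_at p g = 0"
      for y g h e
    proof (rule ccontr)
      assume no: "y * o1 \<notin> J"
      have "y \<in> carrier ?L" using local_ring_carrierI[OF p y(2,3,4)] y(1) by simp
      then obtain j l where jl: "j \<in> J" "l \<in> carrier ?L" "o1 = j + y * o1 * l" using gen[OF _ no o1(1)] by blast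
      obtain g' h' e' where l: "l = Fract g' h'" "g' \<in> graded_part r n e'" "h' \<in> graded_part r n e'" "value_at p h' \<noteq> 0"
        by (rule local_ring_carrierE[OF p jl(2)])
      have nz: "h \<noteq> 0" "h' \<noteq> 0" using y(4) l(4) nonzero_of_value by blast+
      let ?w = "h * h' - g * g'"
      have w: "?w \<in> graded_part r n (\<lambda>j. e j + e' j)" "value_at p ?w \<noteq> 0"
        using graded_part_diff[OF graded_part_mult[OF y(3) l(3)] graded_part_mult[OF y(2) l(2)]] y(4,5) l(4)
        by (simp_all add: value_diff value_mult)
      have c: "Fract (h * h') ?w \<in> carrier ?L" by (rule local_ring_carrierI[OF p graded_part_mult[OF y(3) l(3)] w])
      have "1 - y * l = Fract ?w (h * h')" using nz by (simp add: y(1) l(1) One_fract_def eq_fract algebra_simps)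
      moreover have "Fract (h * h') ?w * Fract ?w (h * h') = 1"
        using nz nonzero_of_value[OF w(2)] by (simp add: One_fract_def eq_fract algebra_simps)
      ultimately have "Fract (h * h') ?w * (1 - y * l) = 1" by simp
      moreover have "j = (1 - y * l) * o1" using jl(3) by (simp add: algebra_simps)
      ultimately have "o1 = Fract (h * h') ?w * j" by (simp flip: mult.assoc)
      then show False using local_ring_idealD(4)[OF J(1) jl(1) c] o1(2) by simp
    qed
    obtain G0 where G0: "G0 \<in> ?V" "o1 - Fract G0 \<theta> \<in> ?a" using rep[OF oL] by blast
    \<comment> \<open>The factor l is split into its value at p and an element of the maximal ideal;
      the latter takes o1 into J, so one scalar multiple of G0 suffices.\<close>
    have key: "\<exists>c. G - Poly_Mapping.single 0 c * G0 \<in> S J" if G: "G \<in> S J'" for G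
    proof -
      have G': "G \<in> ?V" "Fract G \<theta> \<in> J'" using G by (auto simp: S_def)
      have "1 * o1 \<notin> J" using o1(2) by simp
      then obtain j l where jl: "j \<in> J" "l \<in> carrier ?L" "Fract G \<theta> = j + 1 * o1 * l"
        using gen[OF local_ring_0_1(2)[OF p] _ G'(2)] by blast
      obtain g h e where l: "l = Fract g h" "g \<in> graded_part r n e" "h \<in> graded_part r n e" "value_at p h \<noteq> 0"
        by (rule local_ring_carrierE[OF p jl(2)])
      define c where "c = value_at p g / value_at p h"
      define l' where "l' = Fract (g - Poly_Mapping.single 0 c * h) h"
      have h0: "h \<noteq> 0" by (rule nonzero_of_value[OF l(4)])
      have "l' * o1 \<in> J"
        by (rule mo[OF l'_def graded_part_diff[OF l(2) graded_part_scale[OF l(3)]] l(3,4)])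
          (use l(4) in \<open>simp add: value_diff value_mult value_single_0 c_def\<close>)
      moreover have "l = Fract (Poly_Mapping.single 0 c) 1 + l'"
        using h0 by (simp add: l(1) l'_def eq_fract algebra_simps)
      moreover have "Fract (Poly_Mapping.single 0 c) 1 * (o1 - Fract G0 \<theta>) \<in> J"
        using local_ring_idealD(4)[OF aI G0(2) local_ring_const[OF p]] J(2) by blast
      ultimately have "j + l' * o1 + Fract (Poly_Mapping.single 0 c) 1 * (o1 - Fract G0 \<theta>) \<in> J"
        "l = Fract (Poly_Mapping.single 0 c) 1 + l'"
        using local_ring_idealD(3)[OF J(1)] jl(1) by blast+
      moreover from this(2) have "j + l' * o1 + Fract (Poly_Mapping.single 0 c) 1 * (o1 - Fract G0 \<theta>) =
          Fract G \<theta> - Fract (Poly_Mapping.single 0 c) 1 * Fract G0 \<theta>"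
        unfolding jl(3) by (simp only: algebra_simps mult_1_left)
      moreover have "Fract (G - Poly_Mapping.single 0 c * G0) \<theta> = Fract G \<theta> - Fract (Poly_Mapping.single 0 c) 1 * Fract G0 \<theta>"
        unfolding frac_diff frac_scale ..
      ultimately have "Fract (G - Poly_Mapping.single 0 c * G0) \<theta> \<in> J" by (simp only:)
      then show ?thesis using graded_part_diff[OF G'(1) graded_part_scale[OF G0(1)]] unfolding S_def by blast
    qed
    obtain C B where C: "finite C" "mpol.span C = S J" "card C = mpol.dim (S J)"
      using mpol.relative_basis[OF fV sV SV subS[OF J(1)]] by metis
    have "S J' \<subseteq> mpol.span (insert G0 C)"
      using key unfolding mpol.span_insert C(2) by blast
    then have "mpol.dim (S J') \<le> card (insert G0 C)" using C(1) by (intro mpol.dim_le_card) auto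
    also have "\<dots> \<le> Suc (mpol.dim (S J))" using C(1,3) by (simp add: card_insert_if)
    finally show ?thesis using J' by blast
  qed
  let ?D = "mpol.codim ?V (local_part p \<mu>)"
  have dimT: "mpol.dim (local_part p \<mu>) \<le> mpol.dim ?V"
    by (rule mpol.dim_mono[OF fV sV local_part_subset subspace_local_part])
  have chain: "\<exists>J. (\<forall>i\<le>k. ideal (J i) ?L \<and> ?a \<subseteq> J i) \<and> (\<forall>i<k. J i \<subset> J (Suc i)) \<and>
      mpol.dim (S (J k)) \<le> mpol.dim (local_part p \<mu>) + k" if "k \<le> ?D" for k
    using that
  proof (induction k)
    case 0
    show ?case by (rule exI[of _ "\<lambda>_. ?a"]) (simp add: aI Sa)
  next
    case (Suc k)
    then have "k \<le> ?D" by simp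
    from Suc.IH[OF this] obtain J where "(\<forall>i\<le>k. ideal (J i) ?L \<and> ?a \<subseteq> J i) \<and> (\<forall>i<k. J i \<subset> J (Suc i)) \<and>
      mpol.dim (S (J k)) \<le> mpol.dim (local_part p \<mu>) + k" by (elim exE)
    then have J: "\<And>i. i \<le> k \<Longrightarrow> ideal (J i) ?L \<and> ?a \<subseteq> J i" "\<And>i. i < k \<Longrightarrow> J i \<subset> J (Suc i)"
      "mpol.dim (S (J k)) \<le> mpol.dim (local_part p \<mu>) + k" by blast+
    have "mpol.dim (S (J k)) < mpol.dim ?V" using J(3) Suc.prems unfolding mpol.codim_def by linarith
    then have "J k \<noteq> carrier ?L" using SL by (metis nat_neq_iff)
    then obtain J' where J': "ideal J' ?L" "J k \<subset> J'" "mpol.dim (S J') \<le> Suc (mpol.dim (S (J k)))"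
      using succ[of "J k"] J(1)[of k] by blast
    define J2 where "J2 i = (if i \<le> k then J i else J')" for i
    have "ideal (J2 i) ?L \<and> ?a \<subseteq> J2 i" for i
      using J(1)[of i] J(1)[of k] J'(1,2) unfolding J2_def by auto
    moreover have "J2 i \<subset> J2 (Suc i)" if "i < Suc k" for i
      using J(2)[of i] J'(2) that unfolding J2_def by (auto simp: less_Suc_eq)
    moreover have "mpol.dim (S (J2 (Suc k))) \<le> mpol.dim (local_part p \<mu>) + Suc k"
      using J'(3) J(3) by (simp add: J2_def)
    ultimately show ?case by blast
  qed
  from chain[OF order_refl] obtain J where "(\<forall>i\<le>?D. ideal (J i) ?L \<and> ?a \<subseteq> J i) \<and> (\<forall>i<?D. J i \<subset> J (Suc i)) \<and>
      mpol.dim (S (J ?D)) \<le> mpol.dim (local_part p \<mu>) + ?D" by (elim exE)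
  then have J: "\<And>i. i \<le> ?D \<Longrightarrow> ideal (J i) ?L \<and> ?a \<subseteq> J i" "\<And>i. i < ?D \<Longrightarrow> J i \<subset> J (Suc i)" by blast+
  have "ring_length (?L Quot ?a) = enat ?D"
  proof (rule ring_length_quotient[OF cring.axioms(1)[OF cring_local_ring[OF p]] aI])
    show "i \<le> ?D \<Longrightarrow> ideal (J i) ?L \<and> ?a \<subseteq> J i" "i < ?D \<Longrightarrow> J i \<subset> J (Suc i)" for i
      by (rule J, assumption)+
  next
    fix k J assume J: "\<And>i. i \<le> k \<Longrightarrow> ideal (J i) ?L \<and> ?a \<subseteq> J i" "\<And>i. i < k \<Longrightarrow> J i \<subset> J (Suc i)"
    have "mpol.dim (S (J 0)) + k \<le> mpol.dim (S (J k))"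
      by (rule chain_dim, rule strict) (use J in auto)
    moreover have "mpol.dim (S (J k)) \<le> mpol.dim ?V"
      by (rule mpol.dim_mono[OF fV sV SV subS]) (use J(1) in blast)
    moreover have "mpol.dim (local_part p \<mu>) \<le> mpol.dim (S (J 0))"
      using J(1)[of 0] unfolding Sa[symmetric]
      by (intro mpol.dim_mono[OF mpol.fin_gen_subset[OF fV SV] subS _ subS[OF aI]]) (auto simp: S_def)
    ultimately show "k \<le> ?D" unfolding mpol.codim_def by linarith
  qed
  then show ?thesis unfolding subscheme_local_ring_def genideal_eq_scheme_ideal[OF p] .
qed

end

section \<open>The corank of a matrix of coordinate vectors\<close>

context
  fixes W :: "'k::field vec set" and N :: nat
  assumes W: "W \<subseteq> carrier_vec N" "0\<^sub>v N \<in> W" "\<And>x y. x \<in> W \<Longrightarrow> y \<in> W \<Longrightarrow> x + y \<in> W"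
    "\<And>c x. x \<in> W \<Longrightarrow> c \<cdot>\<^sub>v x \<in> W"
begin

abbreviation "vecs \<equiv> module_vec TYPE('k) N"
abbreviation "quot \<equiv> quotient_module vecs W"
abbreviation "coset x \<equiv> a_r_coset vecs W x"

lemma coset_eq: "coset x = {h + x | h. h \<in> W}"
  by (auto simp: a_r_coset_def' module_vec_simps)

lemma uminus_in_W: "x \<in> W \<Longrightarrow> - x \<in> W"
proof -
  have "- x = - 1 \<cdot>\<^sub>v x" by (rule eq_vecI) auto
  then show "x \<in> W \<Longrightarrow> - x \<in> W" using W(4)[of x "- 1"] by simp
qed

lemma coset_absorb:
  assumes h: "h \<in> W" and z: "z \<in> carrier_vec N"
  shows "coset (h + z) = coset z"
proof -
  have hc: "h \<in> carrier_vec N" using W(1) h by blast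
  have "\<exists>k\<in>W. g + (h + z) = k + z" if g: "g \<in> W" for g
  proof (intro bexI)
    show "g + (h + z) = (g + h) + z" using assoc_add_vec[of g N h z] g W(1) hc z by (simp add: subsetD)
    show "g + h \<in> W" by (rule W(3)[OF g h])
  qed
  moreover have "\<exists>k\<in>W. g + z = k + (h + z)" if g: "g \<in> W" for g
  proof (intro bexI)
    have gc: "g \<in> carrier_vec N" using g W(1) by blast
    show "g + z = (g + - h) + (h + z)" using gc hc z by (intro eq_vecI) auto
    show "g + - h \<in> W" by (rule W(3)[OF g uminus_in_W[OF h]])
  qed
  ultimately show ?thesis unfolding coset_eq by blast
qed

lemma coset_0: "coset (0\<^sub>v N) = W"
  unfolding coset_eq using W(1) by (auto simp: subsetD) (metis right_zero_vec subsetD)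

lemma coset_eq_W: "x \<in> carrier_vec N \<Longrightarrow> coset x = W \<Longrightarrow> x \<in> W"
  unfolding coset_eq using W(2) by (metis (mono_tags, lifting) left_zero_vec mem_Collect_eq)

lemma quot_carrier: "carrier quot = coset ` carrier_vec N"
  by (auto simp: quotient_module_def A_RCOSETS_def' module_vec_simps)

lemma quot_add: "x \<in> carrier_vec N \<Longrightarrow> y \<in> carrier_vec N \<Longrightarrow> coset x \<oplus>\<^bsub>quot\<^esub> coset y = coset (x + y)"
proof -
  assume x: "x \<in> carrier_vec N" and y: "y \<in> carrier_vec N"
  have "(h + x) + (g + y) = (h + g) + (x + y)" if "h \<in> W" "g \<in> W" for h g
  proof -
    have "h \<in> carrier_vec N" "g \<in> carrier_vec N" using that W(1) by auto
    then show ?thesis using x y by (intro eq_vecI) auto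
  qed
  then have "set_add vecs (coset x) (coset y) = {(h + g) + (x + y) | h g. h \<in> W \<and> g \<in> W}"
    unfolding coset_eq set_add_def' by (auto simp: module_vec_simps) metis+
  also have "\<dots> = coset (x + y)"
  proof -
    have "\<exists>h g. k + (x + y) = (h + g) + (x + y) \<and> h \<in> W \<and> g \<in> W" if "k \<in> W" for k
      using that W(1,2) by (intro exI[of _ k] exI[of _ "0\<^sub>v N"]) auto
    then show ?thesis unfolding coset_eq using W(3) by blast
  qed
  finally show ?thesis by (simp add: quotient_module_def)
qed

lemma quot_smult: "x \<in> carrier_vec N \<Longrightarrow> c \<odot>\<^bsub>quot\<^esub> coset x = coset (c \<cdot>\<^sub>v x)"
proof -
  assume x: "x \<in> carrier_vec N"
  have "coset (c \<cdot>\<^sub>v y) = coset (c \<cdot>\<^sub>v x)" if y: "y \<in> coset x" for y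
  proof -
    obtain h where h: "h \<in> W" "y = h + x" using y unfolding coset_eq by blast
    have "c \<cdot>\<^sub>v y = c \<cdot>\<^sub>v h + c \<cdot>\<^sub>v x" unfolding h(2) using h(1) W(1) x by (intro smult_add_distrib_vec) auto
    then show ?thesis using coset_absorb[OF W(4)[OF h(1)], of "c \<cdot>\<^sub>v x" c] x by simp
  qed
  moreover have "coset x \<noteq> {}" unfolding coset_eq using W(2) by blast
  ultimately have "(\<Union>y\<in>coset x. coset (c \<cdot>\<^sub>v y)) = coset (c \<cdot>\<^sub>v x)" by auto
  then show ?thesis by (simp add: quotient_module_def module_vec_simps)
qed

lemma quot_zero: "\<zero>\<^bsub>quot\<^esub> = coset (0\<^sub>v N)"
  unfolding coset_0 by (simp add: quotient_module_def)

lemma vectorspace_quot: "vectorspace class_ring quot"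
proof -
  have ab: "abelian_group quot"
  proof (rule abelian_groupI)
    fix x assume "x \<in> carrier quot"
    then obtain u where u: "u \<in> carrier_vec N" "x = coset u" unfolding quot_carrier by blast
    have "- u + u = 0\<^sub>v N" using u(1) by (intro eq_vecI) auto
    then have "coset (- u) \<oplus>\<^bsub>quot\<^esub> x = \<zero>\<^bsub>quot\<^esub>" unfolding u(2) quot_zero using quot_add[of "- u" u] u(1) by simp
    then show "\<exists>y\<in>carrier quot. y \<oplus>\<^bsub>quot\<^esub> x = \<zero>\<^bsub>quot\<^esub>" 
      by (rule bexI) (use u(1) in \<open>simp add: quot_carrier\<close>)
  next
    fix x y z assume "x \<in> carrier quot" "y \<in> carrier quot" "z \<in> carrier quot"
    then obtain u v w where "x = coset u" "y = coset v" "z = coset w" "u \<in> carrier_vec N" "v \<in> carrier_vec N" "w \<in> carrier_vec N"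
      unfolding quot_carrier by blast
    then show "x \<oplus>\<^bsub>quot\<^esub> y \<oplus>\<^bsub>quot\<^esub> z = x \<oplus>\<^bsub>quot\<^esub> (y \<oplus>\<^bsub>quot\<^esub> z)"
      by (simp add: quot_add assoc_add_vec[of _ N])
  qed (auto simp: quot_carrier quot_zero quot_add comm_add_vec[of _ N])
  have "Module.module class_ring quot"
  proof (rule moduleI[OF _ ab])
    show "cring (class_ring :: 'k ring)" using class_field[where 'a='k] unfolding field_def domain_def by blast
  next
    fix a b x assume "x \<in> carrier quot"
    then obtain u where u: "u \<in> carrier_vec N" "x = coset u" unfolding quot_carrier by blast
    show "(a \<oplus>\<^bsub>class_ring\<^esub> b) \<odot>\<^bsub>quot\<^esub> x = a \<odot>\<^bsub>quot\<^esub> x \<oplus>\<^bsub>quot\<^esub> b \<odot>\<^bsub>quot\<^esub> x"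
      using u by (simp add: quot_smult quot_add class_ring_simps add_smult_distrib_vec)
    show "(a \<otimes>\<^bsub>class_ring\<^esub> b) \<odot>\<^bsub>quot\<^esub> x = a \<odot>\<^bsub>quot\<^esub> (b \<odot>\<^bsub>quot\<^esub> x)"
      using u by (simp add: quot_smult class_ring_simps smult_smult_assoc)
    show "a \<odot>\<^bsub>quot\<^esub> x \<in> carrier quot" using u by (auto simp: quot_smult quot_carrier)
    show "\<one>\<^bsub>class_ring\<^esub> \<odot>\<^bsub>quot\<^esub> x = x" using u by (simp add: quot_smult class_ring_simps)
  next
    fix a x y assume "x \<in> carrier quot" "y \<in> carrier quot"
    then obtain u v where "x = coset u" "y = coset v" "u \<in> carrier_vec N" "v \<in> carrier_vec N"
      unfolding quot_carrier by blast
    then show "a \<odot>\<^bsub>quot\<^esub> (x \<oplus>\<^bsub>quot\<^esub> y) = a \<odot>\<^bsub>quot\<^esub> x \<oplus>\<^bsub>quot\<^esub> a \<odot>\<^bsub>quot\<^esub> y"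
      by (simp add: quot_smult quot_add smult_add_distrib_vec[of _ N])
  qed
  then show ?thesis by (intro vectorspace.intro class_field)
qed

text \<open>The columns of S represent a basis of the quotient. The linear isomorphism from the
  coordinate space carries the unit vectors to a basis of cosets.\<close>

lemma dim_quot:
  assumes S: "S \<in> carrier_mat N c"
    and gen: "\<And>y. y \<in> carrier_vec N \<Longrightarrow> \<exists>x\<in>carrier_vec c. \<exists>h\<in>W. y = h + S *\<^sub>v x"
    and inj: "\<And>x. x \<in> carrier_vec c \<Longrightarrow> S *\<^sub>v x \<in> W \<Longrightarrow> x = 0\<^sub>v c"
  shows "vectorspace.dim class_ring quot = c"
proof -
  interpret Q: vectorspace class_ring quot by (rule vectorspace_quot)
  interpret V: vec_space "TYPE('k)" c .
  let ?T = "\<lambda>x. coset (S *\<^sub>v x)"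
  have Sx: "S *\<^sub>v x \<in> carrier_vec N" if "x \<in> carrier_vec c" for x using S that by simp
  have "?T \<in> module_hom class_ring (module_vec TYPE('k) c) quot"
    unfolding module_hom_def
    using S Sx by (auto simp: quot_carrier module_vec_simps quot_add quot_smult mult_add_distrib_mat_vec mult_mat_vec)
  then interpret T: linear_map class_ring "module_vec TYPE('k) c" quot ?T
    by unfold_locales
  have surj: "?T ` carrier (module_vec TYPE('k) c) = carrier quot"
  proof (intro equalityI subsetI)
    fix y assume "y \<in> ?T ` carrier (module_vec TYPE('k) c)"
    then show "y \<in> carrier quot" using Sx by (auto simp: quot_carrier module_vec_simps)
  next
    fix y assume "y \<in> carrier quot"
    then obtain u where u: "u \<in> carrier_vec N" "y = coset u" unfolding quot_carrier by blast
    then obtain x h where x: "x \<in> carrier_vec c" "h \<in> W" "u = h + S *\<^sub>v x" using gen by blast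
    then have "y = ?T x" using coset_absorb[OF x(2) Sx[OF x(1)]] u(2) by simp
    then show "y \<in> ?T ` carrier (module_vec TYPE('k) c)" using x(1) by (auto simp: module_vec_simps)
  qed
  have injT: "inj_on ?T (carrier (module_vec TYPE('k) c))"
  proof (rule inj_onI)
    fix x y assume xy: "x \<in> carrier (module_vec TYPE('k) c)" "y \<in> carrier (module_vec TYPE('k) c)" "?T x = ?T y"
    then have c: "x \<in> carrier_vec c" "y \<in> carrier_vec c" by (auto simp: module_vec_simps)
    have "coset (S *\<^sub>v (x - y)) = ?T x \<oplus>\<^bsub>quot\<^esub> coset (- (S *\<^sub>v y))"
    proof -
      have "S *\<^sub>v (x - y) = S *\<^sub>v x + - (S *\<^sub>v y)"
        unfolding mult_minus_distrib_mat_vec[OF S c] using Sx[OF c(1)] Sx[OF c(2)] by (intro eq_vecI) auto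
      then show ?thesis using quot_add[OF Sx[OF c(1)], of "- (S *\<^sub>v y)"] Sx[OF c(2)] by simp
    qed
    also have "\<dots> = coset (S *\<^sub>v y + - (S *\<^sub>v y))" unfolding xy(3) using quot_add[OF Sx[OF c(2)], of "- (S *\<^sub>v y)"] Sx[OF c(2)] by simp
    also have "S *\<^sub>v y + - (S *\<^sub>v y) = 0\<^sub>v N" using Sx[OF c(2)] by (intro eq_vecI) auto
    finally have "S *\<^sub>v (x - y) \<in> W" using coset_eq_W[OF Sx, of "x - y"] c coset_0 by simp
    then have "x - y = 0\<^sub>v c" using inj c by simp
    then have "(x - y) $ i = 0" if "i < c" for i using that by simp
    then show "x = y" using c by (intro eq_vecI) (auto simp: carrier_vecD)
  qed
  have basis: "Q.basis (?T ` set (unit_vecs c))"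
    by (rule T.linear_inj_image_is_basis[OF injT surj V.unit_vecs_basis V.fin_dim])
  have "inj_on ?T (set (unit_vecs c))"
    by (rule inj_on_subset[OF injT]) (auto simp: module_vec_simps unit_vecs_def)
  then have "card (?T ` set (unit_vecs c)) = c"
    by (simp add: card_image distinct_card[OF V.unit_vecs_distinct])
  then show ?thesis using Q.dim_basis[OF _ basis] by simp
qed

end

lemma lookup_scale: "Poly_Mapping.lookup (Poly_Mapping.single 0 c * P) m = c * Poly_Mapping.lookup P m"
  for P :: "('b::cancel_comm_monoid_add \<Rightarrow>\<^sub>0 'a::comm_ring_1)"
proof (induction P rule: poly_mapping_additive_induct)
  case (single t b)
  then show ?case by (simp add: mult_single lookup_single when_def)
next
  case (add P R)
  then show ?case by (simp add: distrib_left lookup_add)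
qed

section \<open>Coordinate vectors and spans of polynomials\<close>

definition combination :: "'k::field mpol list \<Rightarrow> 'k vec \<Rightarrow> 'k mpol" where
  "combination Ps z = (\<Sum>k<length Ps. Poly_Mapping.single 0 (z $ k) * Ps ! k)"

lemma combination_add:
  "z \<in> carrier_vec (length Ps) \<Longrightarrow> y \<in> carrier_vec (length Ps) \<Longrightarrow> combination Ps (z + y) = combination Ps z + combination Ps y"
  unfolding combination_def sum.distrib[symmetric] by (intro sum.cong refl) (simp add: single_add distrib_right)

lemma combination_smult:
  "z \<in> carrier_vec (length Ps) \<Longrightarrow> combination Ps (c \<cdot>\<^sub>v z) = Poly_Mapping.single 0 c * combination Ps z"
  by (simp add: combination_def sum_distrib_left mult_single flip: mult.assoc)

lemma combination_0: "combination Ps (0\<^sub>v (length Ps)) = 0"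
  by (simp add: combination_def)

lemma combination_unit: "k < length Ps \<Longrightarrow> combination Ps (unit_vec (length Ps) k) = Ps ! k"
proof -
  assume k: "k < length Ps"
  have "combination Ps (unit_vec (length Ps) k) = (\<Sum>i<length Ps. if i = k then Ps ! i else 0)"
    unfolding combination_def by (intro sum.cong) (auto simp: k)
  then show ?thesis using k by simp
qed

lemma combination_in_span: "z \<in> carrier_vec (length Ps) \<Longrightarrow> combination Ps z \<in> mpol.span (set Ps)"
  unfolding combination_def by (intro mpol.span_sum mpol.span_scale mpol.span_base) auto

lemma span_set_eq: "mpol.span (set Ps) = combination Ps ` carrier_vec (length Ps)"
proof
  have "mpol.subspace (combination Ps ` carrier_vec (length Ps))"
  proof (rule mpol.subspaceI)
    show "0 \<in> combination Ps ` carrier_vec (length Ps)" using combination_0 by (metis imageI zero_carrier_vec)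
    show "x + y \<in> combination Ps ` carrier_vec (length Ps)"
      if xy: "x \<in> combination Ps ` carrier_vec (length Ps)" "y \<in> combination Ps ` carrier_vec (length Ps)" for x y
    proof -
      obtain u v where "u \<in> carrier_vec (length Ps)" "v \<in> carrier_vec (length Ps)" "x = combination Ps u" "y = combination Ps v"
        using xy by blast
      then show ?thesis using combination_add[of u Ps v] by (intro image_eqI[of _ _ "u + v"]) auto
    qed
    show "Poly_Mapping.single 0 c * x \<in> combination Ps ` carrier_vec (length Ps)"
      if x: "x \<in> combination Ps ` carrier_vec (length Ps)" for c x
    proof -
      obtain u where "u \<in> carrier_vec (length Ps)" "x = combination Ps u" using x by blast
      then show ?thesis using combination_smult[of u Ps c] by (intro image_eqI[of _ _ "c \<cdot>\<^sub>v u"]) auto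
    qed
  qed
  moreover have "set Ps \<subseteq> combination Ps ` carrier_vec (length Ps)"
  proof
    fix P assume "P \<in> set Ps"
    then obtain k where "k < length Ps" "P = Ps ! k" by (metis in_set_conv_nth)
    then show "P \<in> combination Ps ` carrier_vec (length Ps)"
      using combination_unit[of k Ps] by (intro image_eqI[of _ _ "unit_vec (length Ps) k"]) auto
  qed
  ultimately show "mpol.span (set Ps) \<subseteq> combination Ps ` carrier_vec (length Ps)" by (rule mpol.span_minimal[rotated])
qed (use combination_in_span in blast)

lemma set_monomial_list: "set (monomial_list r n \<nu>) = monomials r n \<nu>"
  and distinct_monomial_list: "distinct (monomial_list r n \<nu>)"
  by (simp_all add: monomial_list_def)

lemma dim_coordinates [simp]: "dim_vec (coordinates r n \<nu> P) = length (monomial_list r n \<nu>)"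
  by (simp add: coordinates_def)

lemma coordinates_carrier: "coordinates r n \<nu> P \<in> carrier_vec (length (monomial_list r n \<nu>))"
  by (simp add: carrier_vecI)

lemma index_coordinates:
  "i < length (monomial_list r n \<nu>) \<Longrightarrow> coordinates r n \<nu> P $ i = Poly_Mapping.lookup P (monomial_list r n \<nu> ! i)"
  by (simp add: coordinates_def vec_of_list_index)

lemma coordinates_add: "coordinates r n \<nu> (P + Q) = coordinates r n \<nu> P + coordinates r n \<nu> Q"
  by (rule eq_vecI) (simp_all add: index_coordinates lookup_add)

lemma coordinates_scale: "coordinates r n \<nu> (Poly_Mapping.single 0 c * P) = c \<cdot>\<^sub>v coordinates r n \<nu> P"
  for P :: "'a::comm_ring_1 mpol"
  by (rule eq_vecI) (simp_all add: index_coordinates lookup_scale)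

lemma coordinates_0: "coordinates r n \<nu> 0 = 0\<^sub>v (length (monomial_list r n \<nu>))"
  by (rule eq_vecI) (simp_all add: index_coordinates)

lemma coordinates_eqD:
  assumes "P \<in> graded_part r n \<nu>" "Q \<in> graded_part r n \<nu>" "coordinates r n \<nu> P = coordinates r n \<nu> Q"
  shows "P = Q"
proof (rule poly_mapping_eqI)
  fix m
  show "Poly_Mapping.lookup P m = Poly_Mapping.lookup Q m"
  proof (cases "m \<in> monomials r n \<nu>")
    case True
    then obtain i where "i < length (monomial_list r n \<nu>)" "m = monomial_list r n \<nu> ! i"
      by (metis in_set_conv_nth set_monomial_list)
    then show ?thesis using assms(3) index_coordinates by metis
  next
    case False
    then have "m \<notin> Poly_Mapping.keys P" "m \<notin> Poly_Mapping.keys Q" using assms(1,2) by (auto simp: graded_part_def)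
    then show ?thesis by (simp add: in_keys_iff)
  qed
qed

lemma coordinates_surj:
  fixes y :: "'a::comm_ring_1 vec"
  assumes y: "y \<in> carrier_vec (length (monomial_list r n \<nu>))"
  shows "\<exists>P\<in>graded_part r n \<nu>. coordinates r n \<nu> P = y"
proof (rule bexI)
  let ?l = "monomial_list r n \<nu>"
  let ?P = "\<Sum>i<length ?l. Poly_Mapping.single (?l ! i) (y $ i)"
  show "?P \<in> graded_part r n \<nu>"
    by (intro graded_part_sum graded_part_single) (use nth_mem[of _ ?l] in \<open>auto simp: set_monomial_list\<close>)
  show "coordinates r n \<nu> ?P = y"
  proof (rule eq_vecI)
    fix i assume "i < dim_vec y"
    then have i: "i < length ?l" using y by simp
    have "(\<Sum>k<length ?l. Poly_Mapping.lookup (Poly_Mapping.single (?l ! k) (y $ k)) (?l ! i)) = (\<Sum>k<length ?l. if k = i then y $ k else 0)"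
      by (intro sum.cong) (use i distinct_monomial_list in \<open>auto simp: lookup_single when_def nth_eq_iff_index_eq\<close>)
    then show "coordinates r n \<nu> ?P $ i = y $ i" using i by (simp add: index_coordinates lookup_sum)
  qed (use y in simp)
qed

lemma coordinates_combination:
  assumes z: "z \<in> carrier_vec (length Ps)"
  shows "mat_of_cols (length (monomial_list r n \<nu>)) (map (coordinates r n \<nu>) Ps) *\<^sub>v z = coordinates r n \<nu> (combination Ps z)"
proof (rule eq_vecI)
  fix i assume "i < dim_vec (coordinates r n \<nu> (combination Ps z))"
  then have i: "i < length (monomial_list r n \<nu>)" by simp
  show "(mat_of_cols (length (monomial_list r n \<nu>)) (map (coordinates r n \<nu>) Ps) *\<^sub>v z) $ i = coordinates r n \<nu> (combination Ps z) $ i"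
    using i z
    by (simp add: index_coordinates combination_def lookup_sum lookup_scale scalar_prod_def mat_of_cols_index atLeast0LessThan)
      (intro sum.cong refl mult.commute)
qed simp

text \<open>A basis of a complement of the span, written in coordinates, supplies the matrix S for
  \<open>dim_quot\<close>.\<close>

theorem corank_coordinates:
  fixes Ps :: "'k::field mpol list"
  assumes Ps: "set Ps \<subseteq> graded_part r n \<nu>"
  shows "corank (mat_of_cols (length (monomial_list r n \<nu>)) (map (coordinates r n \<nu>) Ps)) =
    mpol.codim (graded_part r n \<nu>) (mpol.span (set Ps))"
proof -
  let ?N = "length (monomial_list r n \<nu>)" and ?co = "coordinates r n \<nu> :: 'k mpol \<Rightarrow> _" and ?V = "graded_part r n \<nu> :: 'k mpol set"
  have spV: "mpol.span (set Ps) \<subseteq> ?V" by (rule mpol.span_minimal[OF Ps subspace_graded_part])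
  obtain C B where B: "finite C" "finite B" "mpol.span C = mpol.span (set Ps)" "mpol.independent (C \<union> B)" "C \<inter> B = {}"
    "mpol.span (C \<union> B) = ?V" "card C = mpol.dim (mpol.span (set Ps))" "card B + mpol.dim (mpol.span (set Ps)) = mpol.dim ?V"
    by (rule mpol.relative_basis[OF fin_gen_graded_part subspace_graded_part spV mpol.subspace_span])
  obtain Es where Es: "set Es = B" "distinct Es" using finite_distinct_list[OF B(2)] by blast
  have len: "length Es = card B" using distinct_card[OF Es(2)] Es(1) by simp
  have BV: "mpol.span B \<subseteq> ?V" unfolding B(6)[symmetric] by (rule mpol.span_mono) simp
  let ?A = "mat_of_cols ?N (map ?co Ps)" and ?S = "mat_of_cols ?N (map ?co Es)"
  define W where "W = ?co ` mpol.span (set Ps)"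
  have range: "{?A *\<^sub>v x | x. x \<in> carrier_vec (dim_col ?A)} = W"
  proof -
    have "{?A *\<^sub>v x | x. x \<in> carrier_vec (dim_col ?A)} = (\<lambda>x. ?A *\<^sub>v x) ` carrier_vec (length Ps)" by auto
    then show ?thesis
      unfolding W_def span_set_eq image_image using coordinates_combination[of _ Ps r n \<nu>] by (simp cong: image_cong)
  qed
  have "vectorspace.dim class_ring (quotient_module (module_vec TYPE('k) ?N) W) = length Es"
  proof (rule dim_quot)
    show "W \<subseteq> carrier_vec ?N" unfolding W_def using coordinates_carrier by blast
    show "0\<^sub>v ?N \<in> W" unfolding W_def coordinates_0[symmetric] using mpol.span_zero by blast
    show "x + y \<in> W" if "x \<in> W" "y \<in> W" for x y
      using that mpol.span_add unfolding W_def by (force simp flip: coordinates_add)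
    show "c \<cdot>\<^sub>v x \<in> W" if "x \<in> W" for c x
      using that mpol.span_scale unfolding W_def by (force simp flip: coordinates_scale)
    show "?S \<in> carrier_mat ?N (length Es)" by (simp add: carrier_matI)
  next
    fix y :: "'k vec" assume "y \<in> carrier_vec ?N"
    then obtain P where P: "P \<in> ?V" "?co P = y" using coordinates_surj by blast
    then obtain w b where wb: "P = w + b" "w \<in> mpol.span C" "b \<in> mpol.span B" unfolding B(6)[symmetric] mpol.span_Un by blast
    then obtain x where x: "x \<in> carrier_vec (length Es)" "b = combination Es x" unfolding Es(1)[symmetric] span_set_eq by blast
    have "y = ?co w + ?S *\<^sub>v x" using P(2) wb(1) x coordinates_combination[OF x(1)] by (simp add: coordinates_add)
    then show "\<exists>x\<in>carrier_vec (length Es). \<exists>h\<in>W. y = h + ?S *\<^sub>v x" using x(1) wb(2) unfolding B(3) W_def by blast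
  next
    fix x :: "'k vec" assume x: "x \<in> carrier_vec (length Es)" and "?S *\<^sub>v x \<in> W"
    then obtain w where w: "w \<in> mpol.span C" "?co (combination Es x) = ?co w"
      unfolding W_def B(3) coordinates_combination[OF x] by blast
    have "combination Es x = w"
      by (rule coordinates_eqD[OF _ _ w(2)]) (use combination_in_span[OF x] Es(1) BV w(1) B(3) spV in blast)+
    \<comment> \<open>A nonzero coefficient would express a complement basis vector through the
      other basis vectors.\<close>
    have "x $ k = 0" if k: "k < length Es" for k
    proof (rule ccontr)
      assume nz: "x $ k \<noteq> 0"
      have "combination Es x = Poly_Mapping.single 0 (x $ k) * Es ! k + (\<Sum>i\<in>{..<length Es} - {k}. Poly_Mapping.single 0 (x $ i) * Es ! i)"
        unfolding combination_def using k by (subst sum.remove[of _ k]) auto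
      then have "Poly_Mapping.single 0 (x $ k) * Es ! k = w - (\<Sum>i\<in>{..<length Es} - {k}. Poly_Mapping.single 0 (x $ i) * Es ! i)"
        using \<open>combination Es x = w\<close> by (simp add: algebra_simps)
      moreover have "C \<subseteq> C \<union> B - {Es ! k}" using nth_mem[OF k] Es(1) B(5) by blast
      then have "w \<in> mpol.span (C \<union> B - {Es ! k})" using w(1) mpol.span_mono by blast
      moreover have "(\<Sum>i\<in>{..<length Es} - {k}. Poly_Mapping.single 0 (x $ i) * Es ! i) \<in> mpol.span (C \<union> B - {Es ! k})"
        by (intro mpol.span_sum mpol.span_scale mpol.span_base) (use k Es in \<open>auto simp: nth_eq_iff_index_eq\<close>)
      ultimately have "Poly_Mapping.single 0 (x $ k) * Es ! k \<in> mpol.span (C \<union> B - {Es ! k})"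
        by (simp add: mpol.span_diff)
      from mpol.span_scale[OF this, of "inverse (x $ k)"]
      have "Es ! k \<in> mpol.span (C \<union> B - {Es ! k})" using nz by (simp add: mult_single flip: mult.assoc)
      then show False using B(4) nth_mem[OF k] Es(1) unfolding mpol.dependent_def by blast
    qed
    then show "x = 0\<^sub>v (length Es)" using x by (intro eq_vecI) auto
  qed
  then show ?thesis
    unfolding corank_def cokernel_def range mpol.codim_def using len B(8) by simp
qed

section \<open>Extension of scalars\<close>

lemma independent_monomials: "mpol.independent ((\<lambda>m. Poly_Mapping.single m 1 :: 'k::field mpol) ` M)"
  unfolding mpol.dependent_def
proof clarify
  fix m assume m: "m \<in> M"
    and s: "Poly_Mapping.single m 1 \<in> mpol.span ((\<lambda>m. Poly_Mapping.single m 1 :: 'k mpol) ` M - {Poly_Mapping.single m 1})"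
  let ?U = "{P :: 'k mpol. Poly_Mapping.lookup P m = 0}"
  have "mpol.subspace ?U" by (rule mpol.subspaceI) (auto simp: lookup_add lookup_scale)
  moreover have "(\<lambda>m. Poly_Mapping.single m 1 :: 'k mpol) ` M - {Poly_Mapping.single m 1} \<subseteq> ?U"
    by (auto simp: lookup_single when_def)
  ultimately have "(Poly_Mapping.single m 1 :: 'k mpol) \<in> ?U" using s mpol.span_minimal by blast
  then show False by simp
qed

lemma dim_graded_part: "mpol.dim (graded_part r n \<nu> :: 'k::field mpol set) = card (monomials r n \<nu>)"
proof (rule mpol.dim_unique[OF _ graded_part_subset_span independent_monomials])
  show "card ((\<lambda>m. Poly_Mapping.single m (1::'k)) ` monomials r n \<nu>) = card (monomials r n \<nu>)"
    by (rule card_image, rule inj_onI) (metis lookup_single_eq lookup_single_not_eq zero_neq_one)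
qed (auto intro: graded_part_single)

lemma lookup_map: "h 0 = 0 \<Longrightarrow> Poly_Mapping.lookup (Poly_Mapping.map h P) m = h (Poly_Mapping.lookup P m)"
  by (simp add: map.rep_eq when_def)

lemma map_single: "h 0 = 0 \<Longrightarrow> Poly_Mapping.map h (Poly_Mapping.single m c) = Poly_Mapping.single m (h c)"
  by (rule poly_mapping_eqI) (simp add: lookup_map lookup_single when_def)

lemma comm_ring_hom_map:
  fixes h :: "'a::comm_ring_1 \<Rightarrow> 'b::comm_ring_1"
  assumes "comm_ring_hom h"
  shows "comm_ring_hom (Poly_Mapping.map h :: 'a mpol \<Rightarrow> 'b mpol)"
proof -
  interpret h: comm_ring_hom h by fact
  let ?H = "Poly_Mapping.map h :: 'a mpol \<Rightarrow> 'b mpol"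
  have add: "?H (P + Q) = ?H P + ?H Q" for P Q
    by (rule poly_mapping_eqI) (simp add: lookup_map lookup_add h.hom_add)
  have mult: "?H (P * Q) = ?H P * ?H Q" for P Q
  proof (induction P rule: poly_mapping_additive_induct)
    case (single m c)
    show ?case
    proof (induction Q rule: poly_mapping_additive_induct)
      case (single m' c')
      then show ?case by (simp add: mult_single map_single h.hom_mult)
    next
      case (add Q R)
      then show ?case by (simp add: distrib_left \<open>\<And>P Q. ?H (P + Q) = ?H P + ?H Q\<close>)
    qed
  next
    case (add P R)
    then show ?case by (simp add: distrib_right \<open>\<And>P Q. ?H (P + Q) = ?H P + ?H Q\<close>)
  qed
  have "?H 1 = 1" unfolding single_one[symmetric] by (simp add: map_single del: single_one)
  moreover have "?H 0 = 0" by (rule poly_mapping_eqI) (simp add: lookup_map)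
  ultimately show ?thesis by unfold_locales (simp_all add: add mult)
qed

lemma comm_ring_hom_to_ac: "comm_ring_hom to_ac"
  by unfold_locales simp_all

lemma comm_ring_hom_extend: "comm_ring_hom extend_to_closure"
  unfolding extend_to_closure_def by (rule comm_ring_hom_map[OF comm_ring_hom_to_ac])

lemma lookup_extend: "Poly_Mapping.lookup (extend_to_closure P) m = to_ac (Poly_Mapping.lookup P m)"
  by (simp add: extend_to_closure_def lookup_map)

lemma extend_single: "extend_to_closure (Poly_Mapping.single m c) = Poly_Mapping.single m (to_ac c)"
  by (simp add: extend_to_closure_def map_single)

lemma
  fixes P Q :: "'a::field mpol"
  shows extend_0: "extend_to_closure (0 :: 'a mpol) = 0"
  and extend_add: "extend_to_closure (P + Q) = extend_to_closure P + extend_to_closure Q"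
  and extend_mult: "extend_to_closure (P * Q) = extend_to_closure P * extend_to_closure Q"
proof -
  interpret comm_ring_hom "extend_to_closure :: 'a mpol \<Rightarrow> _" by (rule comm_ring_hom_extend)
  show "extend_to_closure (0 :: 'a mpol) = 0" by simp
  show "extend_to_closure (P + Q) = extend_to_closure P + extend_to_closure Q" by (rule hom_add)
  show "extend_to_closure (P * Q) = extend_to_closure P * extend_to_closure Q" by (rule hom_mult)
qed

lemma inj_extend: "inj extend_to_closure"
  by (rule injI, rule poly_mapping_eqI) (metis lookup_extend to_ac_eq_iff)

lemma extend_graded: "P \<in> graded_part r n \<nu> \<Longrightarrow> extend_to_closure P \<in> graded_part r n \<nu>"
  unfolding graded_part_def by (auto simp: in_keys_iff lookup_extend subset_iff)

lemma extend_span: "P \<in> mpol.span S \<Longrightarrow> extend_to_closure P \<in> mpol.span (extend_to_closure ` S)"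
proof -
  have "mpol.subspace {P. extend_to_closure P \<in> mpol.span (extend_to_closure ` S)}"
    by (rule mpol.subspaceI)
      (auto simp: extend_0 extend_add extend_mult extend_single intro: mpol.span_zero mpol.span_add mpol.span_scale)
  moreover have "S \<subseteq> {P. extend_to_closure P \<in> mpol.span (extend_to_closure ` S)}" by (auto intro: mpol.span_base)
  ultimately show "P \<in> mpol.span S \<Longrightarrow> ?thesis" using mpol.span_minimal by blast
qed

text \<open>A basis of the graded part adapted to S still generates all monomials over the closure
  and has as many elements as there are monomials. So it stays independent, and with it the part
  that spans S.\<close>

theorem codim_extend:
  fixes S :: "'k::field mpol set"
  assumes S: "S \<subseteq> graded_part r n \<nu>"
  shows "mpol.codim (graded_part r n \<nu>) (mpol.span (extend_to_closure ` S)) = mpol.codim (graded_part r n \<nu>) (mpol.span S)"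
proof -
  let ?V = "graded_part r n \<nu> :: 'k mpol set" and ?V' = "graded_part r n \<nu> :: 'k alg_closure mpol set"
  have spV: "mpol.span S \<subseteq> ?V" by (rule mpol.span_minimal[OF S subspace_graded_part])
  obtain C B where B: "finite C" "finite B" "mpol.span C = mpol.span S" "mpol.independent (C \<union> B)" "C \<inter> B = {}"
    "mpol.span (C \<union> B) = ?V" "card C = mpol.dim (mpol.span S)" "card B + mpol.dim (mpol.span S) = mpol.dim ?V"
    by (rule mpol.relative_basis[OF fin_gen_graded_part subspace_graded_part spV mpol.subspace_span])
  let ?E = "extend_to_closure ` (C \<union> B)"
  have sub: "?E \<subseteq> ?V'" using B(6) mpol.span_superset[of "C \<union> B"] extend_graded by blast
  have "Poly_Mapping.single m 1 \<in> mpol.span ?E" if "m \<in> monomials r n \<nu>" for m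
  proof -
    have "Poly_Mapping.single m 1 \<in> mpol.span (C \<union> B)" unfolding B(6) by (rule graded_part_single[OF that])
    from extend_span[OF this] show ?thesis by (simp add: extend_single)
  qed
  then have "mpol.span ((\<lambda>m. Poly_Mapping.single m 1) ` monomials r n \<nu>) \<subseteq> mpol.span ?E"
    by (intro mpol.span_minimal[OF _ mpol.subspace_span]) blast
  then have span: "?V' \<subseteq> mpol.span ?E" using graded_part_subset_span by (rule subset_trans[rotated])
  have "card ?E = card (C \<union> B)" by (rule card_image) (rule inj_on_subset[OF inj_extend subset_UNIV])
  also have "\<dots> = mpol.dim ?V" using mpol.dim_eq_card_independent[OF B(4)] unfolding B(6)[symmetric] by simp
  finally have card: "card ?E = mpol.dim ?V'" by (simp add: dim_graded_part)
  obtain E0 where E0: "E0 \<subseteq> ?E" "mpol.independent E0" "?E \<subseteq> mpol.span E0"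
    using mpol.maximal_independent_subset[of ?E] by blast
  have "?V' \<subseteq> mpol.span E0" using span mpol.span_minimal[OF E0(3) mpol.subspace_span] by blast
  then have "card E0 = mpol.dim ?V'" by (intro mpol.basis_card_eq_dim[OF _ _ E0(2)]) (use E0(1) sub in blast)+
  then have "E0 = ?E" using card E0(1) B(1,2) by (intro card_subset_eq) auto
  then have "mpol.independent (extend_to_closure ` C)" using E0(2) mpol.independent_mono by (metis image_mono sup_ge1)
  then have "mpol.dim (mpol.span (extend_to_closure ` C)) = card (extend_to_closure ` C)"
    by (simp add: mpol.dim_eq_card_independent)
  also have "\<dots> = card C" by (rule card_image) (rule inj_on_subset[OF inj_extend subset_UNIV])
  finally have "mpol.dim (mpol.span (extend_to_closure ` C)) = mpol.dim (mpol.span S)" using B(7) by simp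
  moreover have "mpol.span (extend_to_closure ` C) = mpol.span (extend_to_closure ` S)"
  proof (rule antisym; rule mpol.span_minimal[OF _ mpol.subspace_span]; rule image_subsetI)
    fix P assume "P \<in> C"
    then have "P \<in> mpol.span S" using B(3) mpol.span_superset by blast
    then show "extend_to_closure P \<in> mpol.span (extend_to_closure ` S)" by (rule extend_span)
  next
    fix P assume "P \<in> S"
    then have "P \<in> mpol.span C" unfolding B(3) by (rule mpol.span_base)
    then show "extend_to_closure P \<in> mpol.span (extend_to_closure ` C)" by (rule extend_span)
  qed
  ultimately show ?thesis by (simp add: mpol.codim_def dim_graded_part)
qed

section \<open>Specialization of the Sylvester forms\<close>

context cofactor_chain
begin

text \<open>Each descent into the next group multiplies all remaining terms by a power of the last
  variable; these powers collect to the monomial in front of the cofactor.\<close>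

lemma nested_sum_flatten:
  fixes G :: "nat \<Rightarrow> nat \<Rightarrow> 'a::comm_ring_1 mpol"
  assumes "1 \<le> l" "l \<le> r"
  shows "nested_sum r n \<alpha> G l = (\<Sum>v\<in>{v\<in>set cofac. l \<le> fst v}.
    Poly_Mapping.single (Poly_Mapping.single v (Poly_Mapping.lookup \<alpha> v + 1) +
      (\<Sum>j\<in>{l..<fst v}. Poly_Mapping.single (j, n j) (Poly_Mapping.lookup \<alpha> (j, n j) + 1))) 1 * G (fst v) (snd v))"
  using assms(2,1)
proof (induction l rule: inc_induct)
  have indet_power: "indet v ^ k = (Poly_Mapping.single (Poly_Mapping.single v k) 1 :: 'a mpol)" for v k
    by (induction k) (simp_all add: indet_def mult_single single_add[symmetric] flip: single_one)
  {
    case base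
    have set: "{v\<in>set cofac. r \<le> fst v} = Pair r ` {..n r}"
      using r_pos by (auto simp: mem_cofac indets_def)
    show ?case
      unfolding set
      by (subst nested_sum.simps, simp only: indet_power less_irrefl if_False, simp add: sum.reindex inj_on_def)
  next
    case (step l)
    let ?t = "\<lambda>l v. Poly_Mapping.single (Poly_Mapping.single v (Poly_Mapping.lookup \<alpha> v + 1) +
      (\<Sum>j\<in>{l..<fst v}. Poly_Mapping.single (j, n j) (Poly_Mapping.lookup \<alpha> (j, n j) + 1))) (1::'a) * G (fst v) (snd v)"
    have set: "{v\<in>set cofac. l \<le> fst v} = Pair l ` {..<n l} \<union> {v\<in>set cofac. Suc l \<le> fst v}"
    proof -
      have "{v\<in>set cofac. fst v = l} = Pair l ` {..<n l}"
        using step.prems step.hyps by (auto simp: mem_cofac indets_def image_iff)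
      moreover have "{v\<in>set cofac. l \<le> fst v} = {v\<in>set cofac. fst v = l} \<union> {v\<in>set cofac. Suc l \<le> fst v}"
        by auto
      ultimately show ?thesis by simp
    qed
    have t: "?t l v = indet (l, n l) ^ (Poly_Mapping.lookup \<alpha> (l, n l) + 1) * ?t (Suc l) v" if "Suc l \<le> fst v" for v
    proof -
      have "{l..<fst v} = insert l {Suc l..<fst v}" using that by auto
      then have "(\<Sum>j\<in>{l..<fst v}. Poly_Mapping.single (j, n j) (Poly_Mapping.lookup \<alpha> (j, n j) + 1)) =
          Poly_Mapping.single (l, n l) (Poly_Mapping.lookup \<alpha> (l, n l) + 1) +
          (\<Sum>j\<in>{Suc l..<fst v}. Poly_Mapping.single (j, n j) (Poly_Mapping.lookup \<alpha> (j, n j) + 1))" by simp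
      then show ?thesis
        unfolding indet_power by (simp only: mult.assoc[symmetric] mult_single mult_1_left) (simp add: ac_simps)
    qed
    have "nested_sum r n \<alpha> G l = (\<Sum>j<n l. ?t l (l, j)) +
        indet (l, n l) ^ (Poly_Mapping.lookup \<alpha> (l, n l) + 1) * (\<Sum>v\<in>{v\<in>set cofac. Suc l \<le> fst v}. ?t (Suc l) v)"
    proof -
      have "indet (l, j) ^ (Poly_Mapping.lookup \<alpha> (l, j) + 1) * G l j = ?t l (l, j)" for j
        by (simp only: indet_power) simp
      moreover have "nested_sum r n \<alpha> G (Suc l) = (\<Sum>v\<in>{v\<in>set cofac. Suc l \<le> fst v}. ?t (Suc l) v)"
        by (rule step.IH) simp
      ultimately show ?thesis by (subst nested_sum.simps) (simp only: step.hyps if_True)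
    qed
    also have "(\<Sum>j<n l. ?t l (l, j)) = (\<Sum>v\<in>Pair l ` {..<n l}. ?t l v)"
      by (simp add: sum.reindex inj_on_def)
    also have "indet (l, n l) ^ (Poly_Mapping.lookup \<alpha> (l, n l) + 1) * (\<Sum>v\<in>{v\<in>set cofac. Suc l \<le> fst v}. ?t (Suc l) v) =
        (\<Sum>v\<in>{v\<in>set cofac. Suc l \<le> fst v}. ?t l v)"
      unfolding sum_distrib_left by (rule sum.cong[OF refl]) (use t in auto)
    also have "(\<Sum>v\<in>Pair l ` {..<n l}. ?t l v) + (\<Sum>v\<in>{v\<in>set cofac. Suc l \<le> fst v}. ?t l v) = (\<Sum>v\<in>{v\<in>set cofac. l \<le> fst v}. ?t l v)"
      unfolding set by (rule sum.union_disjoint[symmetric]) auto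
    finally show ?case .
  }
qed

lemma nested_sum_cofactors:
  fixes G :: "nat \<Rightarrow> nat \<Rightarrow> 'a::comm_ring_1 mpol"
  shows "nested_sum r n \<alpha> G 1 =
    (\<Sum>c\<le>N. Poly_Mapping.single (cofac_expo \<alpha> c) 1 * G (fst (cofac ! c)) (snd (cofac ! c)))"
proof -
  have "{v\<in>set cofac. 1 \<le> fst v} = set cofac" by (auto simp: mem_cofac indets_def)
  also have "\<dots> = (!) cofac ` {..N}" by (auto simp: set_conv_nth less_Suc_eq_le)
  finally have "{v\<in>set cofac. 1 \<le> fst v} = (!) cofac ` {..N}" .
  moreover have "inj_on ((!) cofac) {..N}"
    by (rule inj_onI) (metis atMost_iff cofac_less less_irrefl linorder_neqE_nat)
  ultimately show ?thesis
    using r_pos by (simp add: nested_sum_flatten sum.reindex cofac_expo_def)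
qed

text \<open>
  A monomial of degree \<open>e\<close> that only the \<open>c\<close>-th product in the decomposition can contain: in the group
  of the \<open>c\<close>-th cofactor it is a pure power, in the groups before it a pure power of the last indeterminate.
\<close>

lemma exclusive_monomial:
  assumes c: "c \<le> N"
  shows "\<exists>m\<in>monomials r n (\<lambda>j. int (e j)). \<forall>\<alpha>. \<forall>c'\<le>N. \<forall>t. m = cofac_expo \<alpha> c' + t \<longrightarrow> c' = c"
proof -
  define v where "v = cofac ! c"
  have v: "v \<in> set cofac" "v \<in> indets r n" "fst v < r \<Longrightarrow> snd v \<noteq> n (fst v)"
    using cofac_mem[OF c] mem_cofac[of v] by (auto simp: v_def)
  define s where "s j = (if j < fst v then n j else if j = fst v then snd v else 0)" for j
  have s: "s j \<le> n j" if "j \<in> {1..r}" for j using v(2) by (auto simp: s_def indets_def)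
  define m where "m = (\<Sum>j\<in>{1..r}. Poly_Mapping.single (j, s j) (e j))"
  have look: "Poly_Mapping.lookup m (j, l) = (if j \<in> {1..r} \<and> l = s j then e j else 0)" for j l
  proof -
    have "Poly_Mapping.lookup m (j, l) = (\<Sum>i\<in>{1..r}. if i = j then (if l = s j then e j else 0) else 0)"
      unfolding m_def lookup_sum by (intro sum.cong) (auto simp: lookup_single when_def)
    then show ?thesis by simp
  qed
  have "m \<in> monomials r n (\<lambda>j. int (e j))"
    unfolding monomials_def
  proof (intro CollectI conjI ballI)
    show "Poly_Mapping.keys m \<subseteq> indets r n"
      using s by (auto simp: in_keys_iff look indets_def split: if_splits)
    fix j assume j: "j \<in> {1..r}"
    then show "int (group_degree n m j) = int (e j)" using s[OF j] by (simp add: group_degree_def look)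
  qed
  moreover have "c' = c" if c': "c' \<le> N" and eq: "m = cofac_expo \<alpha> c' + t" for \<alpha> c' t
  proof -
    let ?v = "cofac ! c'"
    have pos: "w = (fst w, s (fst w))" if "0 < Poly_Mapping.lookup (cofac_expo \<alpha> c') w" for w
    proof -
      have "0 < Poly_Mapping.lookup m w" using that by (simp add: eq lookup_add)
      then show ?thesis by (cases w) (auto simp: look split: if_splits)
    qed
    have lev: "level c' = fst ?v" using c' by (simp add: level_def)
    have v': "?v \<in> indets r n" "fst ?v < r \<Longrightarrow> snd ?v \<noteq> n (fst ?v)"
      using cofac_mem[OF c'] mem_cofac[of ?v] by auto
    have sv: "snd ?v = s (fst ?v)"
      using pos[of ?v] by (simp add: lookup_cofac_expo[OF c'] prod_eq_iff)
    have last: "n i = s i" if "i \<in> {1..<fst ?v}" for i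
      using pos[of "(i, n i)"] that by (simp add: lookup_cofac_expo[OF c'] lev)
    consider "fst ?v < fst v" | "fst v < fst ?v" | "fst ?v = fst v" by linarith
    then have "?v = v"
    proof cases
      case 1
      moreover have "fst v \<le> r" using v(2) by (auto simp: indets_def)
      ultimately show ?thesis using sv v'(2) by (simp add: s_def)
    next
      case 2
      have "1 \<le> fst v" "fst ?v \<le> r" using v(2) v'(1) by (auto simp: indets_def)
      then show ?thesis using last[of "fst v"] v(3) 2 by (simp add: s_def)
    next
      case 3
      then show ?thesis using sv by (simp add: s_def prod_eq_iff)
    qed
    then show ?thesis unfolding v_def using c c' by (metis cofac_less less_irrefl linorder_neqE_nat)
  qed
  ultimately show ?thesis by blast
qed

end

lemma lookup_generic_poly:
  "Poly_Mapping.lookup (generic_poly r n d i) m =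
    (if m \<in> monomials r n (idegree d i) then Poly_Mapping.single (Poly_Mapping.single (i, m) 1) 1 else 0)"
  unfolding generic_poly_def lookup_sum by (simp add: lookup_single when_def sum.delta')

context cofactor_chain
begin

text \<open>
  A multihomogeneous cofactor of a wrong degree would have to vanish in the right degree, but
  the coefficient of the exclusive monomial in the generic polynomial is not zero.
\<close>

lemma generic_cofactor_graded:
  assumes dec: "sylvester_decomposition r n d \<alpha> i G" and c: "c \<le> N"
  shows "G (fst (cofac ! c)) (snd (cofac ! c)) \<in>
    graded_part r n (\<lambda>j. idegree d i j - int (group_degree n (cofac_expo \<alpha> c) j))"
proof -
  let ?G = "\<lambda>c. G (fst (cofac ! c)) (snd (cofac ! c))"
  obtain e where e: "?G c \<in> graded_part r n e"
    using dec cofac_mem[OF c] unfolding sylvester_decomposition_def by (cases "cofac ! c") force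
  obtain m where m: "m \<in> monomials r n (\<lambda>j. int (d i j))"
    "\<And>c' t. c' \<le> N \<Longrightarrow> m = cofac_expo \<alpha> c' + t \<Longrightarrow> c' = c"
    using exclusive_monomial[OF c, of "d i"] by blast
  have sum: "generic_poly r n d i = (\<Sum>c\<le>N. Poly_Mapping.single (cofac_expo \<alpha> c) 1 * ?G c)"
    using dec unfolding sylvester_decomposition_def nested_sum_cofactors by blast
  have "m \<in> Poly_Mapping.keys (generic_poly r n d i)"
    using m(1) by (simp add: in_keys_iff lookup_generic_poly idegree_def)
  then obtain c' where c': "c' \<le> N" "m \<in> Poly_Mapping.keys (Poly_Mapping.single (cofac_expo \<alpha> c') 1 * ?G c')"
    unfolding sum using keys_sum[of "\<lambda>c. Poly_Mapping.single (cofac_expo \<alpha> c) 1 * ?G c" "{..N}"] by blast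
  then obtain s t where st: "s \<in> Poly_Mapping.keys (Poly_Mapping.single (cofac_expo \<alpha> c') (1 :: coeff_poly))"
    "t \<in> Poly_Mapping.keys (?G c')" "m = s + t"
    using keys_mult by blast
  have s: "s = cofac_expo \<alpha> c'" using st(1) by (simp split: if_splits)
  have cc: "c' = c" using m(2)[OF c'(1)] st(3) s by blast
  have t: "t \<in> monomials r n e" using st(2) e cc by (auto simp: graded_part_def)
  have "e j = idegree d i j - int (group_degree n (cofac_expo \<alpha> c) j)" if j: "j \<in> {1..r}" for j
  proof -
    have "int (group_degree n m j) = int (d i j)" "int (group_degree n t j) = e j"
      using m(1) t j by (auto simp: monomials_def)
    then show ?thesis unfolding st(3) s cc by (simp add: group_degree_add idegree_def)
  qed
  then have "graded_part r n e = (graded_part r n (\<lambda>j. idegree d i j - int (group_degree n (cofac_expo \<alpha> c) j)) :: coeff_poly mpol set)"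
    by (rule graded_part_cong)
  then show ?thesis using e by simp
qed

end

lemma graded_part_map:
  assumes "h 0 = 0" "P \<in> graded_part r n e"
  shows "Poly_Mapping.map h P \<in> graded_part r n e"
proof -
  have "Poly_Mapping.keys (Poly_Mapping.map h P) \<subseteq> Poly_Mapping.keys P"
    using assms(1) by (auto simp: in_keys_iff lookup_map)
  then show ?thesis using assms(2) unfolding graded_part_def by blast
qed

lemma comm_ring_hom_specialize: "comm_ring_hom (specialize f)"
  unfolding specialize_def by (rule comm_ring_hom_evaluate) (unfold_locales, simp_all)

lemma map_generic_poly:
  assumes "f i \<in> graded_part r n (idegree d i)"
  shows "Poly_Mapping.map (specialize f) (generic_poly r n d i) = f i"
proof (rule poly_mapping_eqI)
  fix m
  interpret comm_ring_hom "specialize f" by (rule comm_ring_hom_specialize)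
  have "Poly_Mapping.lookup (f i) m = 0" if "m \<notin> monomials r n (idegree d i)"
    using that assms by (auto simp: graded_part_def in_keys_iff subset_iff)
  moreover have "specialize f (Poly_Mapping.single (Poly_Mapping.single (i, m) 1) 1) = Poly_Mapping.lookup (f i) m"
    by (simp add: specialize_def evaluate_single)
  ultimately show "Poly_Mapping.lookup (Poly_Mapping.map (specialize f) (generic_poly r n d i)) m = Poly_Mapping.lookup (f i) m"
    by (simp add: lookup_map lookup_generic_poly)
qed

lemma map_map_compose:
  "h 0 = 0 \<Longrightarrow> g 0 = 0 \<Longrightarrow> Poly_Mapping.map g (Poly_Mapping.map h P) = Poly_Mapping.map (\<lambda>c. g (h c)) P"
  by (rule poly_mapping_eqI) (simp add: lookup_map)

lemma map_mat_mat_of_cols_coordinates: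
  assumes "h 0 = 0"
  shows "map_mat h (mat_of_cols (length (monomial_list r n \<nu>)) (map (coordinates r n \<nu>) Ps)) =
    mat_of_cols (length (monomial_list r n \<nu>)) (map (coordinates r n \<nu>) (map (Poly_Mapping.map h) Ps))"
  by (rule eq_matI) (simp_all add: mat_of_cols_index index_coordinates lookup_map assms)

section \<open>The corank of the elimination matrix\<close>

context multiprojective
begin

theorem codim_elimination:
  assumes range: "\<And>i j. i \<le> N \<Longrightarrow> j \<in> {1..r} \<Longrightarrow> - int (n j) \<le> offset \<nu> j + idegree d i j"
    and F_graded: "\<And>\<alpha> c i. \<alpha> \<in> monomials r n (\<lambda>j. - offset \<nu> j - int (n j) - 1) \<Longrightarrow> c \<le> N \<Longrightarrow> i \<le> N \<Longrightarrow>
      F \<alpha> c i \<in> graded_part r n (\<lambda>j. idegree d i j - int (group_degree n (cofac_expo \<alpha> c) j))"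
    and decomp: "\<And>\<alpha> i. \<alpha> \<in> monomials r n (\<lambda>j. - offset \<nu> j - int (n j) - 1) \<Longrightarrow> i \<le> N \<Longrightarrow>
      f i = (\<Sum>c\<le>N. Poly_Mapping.single (cofac_expo \<alpha> c) 1 * F \<alpha> c i)"
  shows "ideal_part \<nu> \<union> sylvester_span \<nu> F ` monomials r n (\<lambda>j. - offset \<nu> j - int (n j) - 1) \<subseteq> graded_part r n \<nu>"
    and "enat (mpol.codim (graded_part r n \<nu>)
      (mpol.span (ideal_part \<nu> \<union> sylvester_span \<nu> F ` monomials r n (\<lambda>j. - offset \<nu> j - int (n j) - 1)))) =
    (\<Sum>p\<in>Z. ring_length (subscheme_local_ring r n d f p))"
proof -
  let ?A = "monomials r n (\<lambda>j. - offset \<nu> j - int (n j) - 1)"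
  let ?W = "mpol.span (ideal_part \<nu> \<union> sylvester_span \<nu> F ` ?A)"
  \<comment> \<open>The least shift that makes \<nu> + e large. Multiplication by
    \<open>ell e\<close> then bounds the codimension from both sides.\<close>
  define e where "e j = nat (- offset \<nu> j)" for j
  let ?\<mu> = "\<lambda>j. \<nu> j + int (e j)"
  have \<mu>: "large ?\<mu>" by (auto simp: large_def offset_def e_def)
  have e: "- int (n j) \<le> offset \<nu> j + int (e j)" for j by (simp add: e_def)
  have ker1: "\<exists>co. h - (\<Sum>\<alpha>\<in>?A. Poly_Mapping.single 0 (co \<alpha>) * sylvester_span \<nu> F \<alpha>) \<in> ideal_part \<nu>"
    if "h \<in> graded_part r n \<nu>" "ell e * h \<in> ideal_part ?\<mu>" for h
    by (rule mult_form_kernel(1)[OF ell_graded ell_nonvanishing range e F_graded decomp that])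
  have ker2: "sylvester_span \<nu> F \<alpha> \<in> graded_part r n \<nu> \<and> ell e * sylvester_span \<nu> F \<alpha> \<in> ideal_part ?\<mu>"
    if "\<alpha> \<in> ?A" for \<alpha>
    by (rule mult_form_kernel(2)[OF ell_graded ell_nonvanishing range e F_graded decomp that])
  have gen: "ideal_part \<nu> \<union> sylvester_span \<nu> F ` ?A \<subseteq> {h\<in>graded_part r n \<nu>. ell e * h \<in> ideal_part ?\<mu>}"
  proof (intro Un_least subsetI)
    show "h \<in> {h\<in>graded_part r n \<nu>. ell e * h \<in> ideal_part ?\<mu>}" if "h \<in> ideal_part \<nu>" for h
      using that ideal_part_subset ideal_part_mult[OF ell_graded that] by blast
    show "h \<in> {h\<in>graded_part r n \<nu>. ell e * h \<in> ideal_part ?\<mu>}" if "h \<in> sylvester_span \<nu> F ` ?A" for h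
      using that ker2 by blast
  qed
  have "mpol.subspace {h\<in>graded_part r n \<nu>. ell e * h \<in> ideal_part ?\<mu>}"
  proof (rule mpol.subspaceI)
    show "Poly_Mapping.single 0 c * x \<in> {h\<in>graded_part r n \<nu>. ell e * h \<in> ideal_part ?\<mu>}"
      if "x \<in> {h\<in>graded_part r n \<nu>. ell e * h \<in> ideal_part ?\<mu>}" for c x
      using that ideal_part_scale[of "ell e * x" ?\<mu> c] by (simp add: graded_part_scale mult.left_commute)
  qed (auto simp: distrib_left intro: ideal_part_0 ideal_part_add graded_part_add)
  then have W: "?W \<subseteq> {h\<in>graded_part r n \<nu>. ell e * h \<in> ideal_part ?\<mu>}" by (rule mpol.span_minimal[OF gen])
  then have WV: "?W \<subseteq> graded_part r n \<nu>" by blast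
  have "mpol.codim (graded_part r n \<nu>) ?W \<le> mpol.codim (graded_part r n ?\<mu>) (ideal_part ?\<mu>)"
  proof (rule mpol.codim_le_of_injective[where \<phi> = "\<lambda>x. ell e * x",
      OF fin_gen_graded_part subspace_graded_part WV mpol.subspace_span
        fin_gen_graded_part subspace_graded_part ideal_part_subset subspace_ideal_part])
    show "ell e * h \<in> graded_part r n ?\<mu>" if "h \<in> graded_part r n \<nu>" for h
      using graded_part_mult[OF ell_graded that, of e] by (simp add: add.commute)
    show "h \<in> ?W" if h: "h \<in> graded_part r n \<nu>" "ell e * h \<in> ideal_part ?\<mu>" for h
    proof -
      obtain co where co: "h - (\<Sum>\<alpha>\<in>?A. Poly_Mapping.single 0 (co \<alpha>) * sylvester_span \<nu> F \<alpha>) \<in> ideal_part \<nu>"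
        using ker1[OF h] by blast
      have "(\<Sum>\<alpha>\<in>?A. Poly_Mapping.single 0 (co \<alpha>) * sylvester_span \<nu> F \<alpha>) \<in> ?W"
        by (intro mpol.span_sum mpol.span_scale mpol.span_base) blast
      moreover have "h - (\<Sum>\<alpha>\<in>?A. Poly_Mapping.single 0 (co \<alpha>) * sylvester_span \<nu> F \<alpha>) \<in> ?W"
        by (rule mpol.span_base[OF UnI1[OF co]])
      ultimately show ?thesis using mpol.span_add by fastforce
    qed
  qed (simp_all add: algebra_simps)
  moreover have "mpol.codim (graded_part r n ?\<mu>) (ideal_part ?\<mu>) \<le> mpol.codim (graded_part r n \<nu>) ?W"
  proof (rule mpol.codim_le_of_surjective[where \<phi> = "\<lambda>x. ell e * x",
      OF fin_gen_graded_part subspace_graded_part WV mpol.subspace_span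
        fin_gen_graded_part subspace_graded_part ideal_part_subset subspace_ideal_part])
    show "ell e * h \<in> ideal_part ?\<mu>" if "h \<in> ?W" for h using that W by blast
    show "\<exists>h\<in>graded_part r n \<nu>. y - ell e * h \<in> ideal_part ?\<mu>" if "y \<in> graded_part r n ?\<mu>" for y
      by (rule mult_form_surj[OF ell_graded ell_nonvanishing range e that])
  qed (simp_all add: algebra_simps)
  ultimately have "mpol.codim (graded_part r n \<nu>) ?W = (\<Sum>p\<in>Z. mpol.codim (graded_part r n ?\<mu>) (local_part p ?\<mu>))"
    using codim_ideal_part[OF \<mu>] by linarith
  moreover have "(\<Sum>p\<in>Z. ring_length (subscheme_local_ring r n d f p)) =
      (\<Sum>p\<in>Z. enat (mpol.codim (graded_part r n ?\<mu>) (local_part p ?\<mu>)))"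
    by (intro sum.cong refl ring_length_local_ring \<mu>)
  moreover have "(\<Sum>p\<in>Z. enat (g p)) = enat (\<Sum>p\<in>Z. g p)" for g
    by (simp flip: of_nat_eq_enat)
  ultimately show "enat (mpol.codim (graded_part r n \<nu>) ?W) = (\<Sum>p\<in>Z. ring_length (subscheme_local_ring r n d f p))"
    by simp
  show "ideal_part \<nu> \<union> sylvester_span \<nu> F ` ?A \<subseteq> graded_part r n \<nu>" using gen by blast
qed

lemma span_macaulay:
  "mpol.span (\<Union>i\<in>{..<Suc N}. (\<lambda>m. Poly_Mapping.single m 1 * f i) ` monomials r n (\<lambda>j. \<nu> j - idegree d i j)) = ideal_part \<nu>"
  (is "mpol.span ?S = _")
proof
  have "Poly_Mapping.single m 1 * f i \<in> ideal_part \<nu>" if "i < Suc N" "m \<in> monomials r n (\<lambda>j. \<nu> j - idegree d i j)" for i m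
    using ideal_part_mult[OF graded_part_single[OF that(2)] f_in_ideal_part, of i 1] that(1) by (simp add: less_Suc_eq_le)
  then show "mpol.span ?S \<subseteq> ideal_part \<nu>" by (intro mpol.span_minimal[OF _ subspace_ideal_part]) blast
  show "ideal_part \<nu> \<subseteq> mpol.span ?S"
  proof
    fix x assume "x \<in> ideal_part \<nu>"
    then obtain g where g: "x = (\<Sum>i<Suc N. f i * g i)" "\<forall>i<Suc N. g i \<in> graded_part r n (\<lambda>j. \<nu> j - idegree d i j)"
      unfolding ideal_part_def by blast
    have "f i * g i \<in> mpol.span ?S" if i: "i < Suc N" for i
    proof -
      have "f i * g i = (\<Sum>m\<in>Poly_Mapping.keys (g i). Poly_Mapping.single 0 (Poly_Mapping.lookup (g i) m) * (Poly_Mapping.single m 1 * f i))"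
      proof -
        have "g i = (\<Sum>m\<in>Poly_Mapping.keys (g i). Poly_Mapping.single 0 (Poly_Mapping.lookup (g i) m) * Poly_Mapping.single m 1)"
          by (simp add: mult_single flip: poly_mapping_sum_singles)
        then have "g i * f i = (\<Sum>m\<in>Poly_Mapping.keys (g i). Poly_Mapping.single 0 (Poly_Mapping.lookup (g i) m) * Poly_Mapping.single m 1) * f i"
          by (rule arg_cong)
        then show ?thesis by (simp add: sum_distrib_right mult.assoc mult.commute[of "f i"])
      qed
      also have "\<dots> \<in> mpol.span ?S"
      proof (intro mpol.span_sum mpol.span_scale mpol.span_base)
        fix m assume "m \<in> Poly_Mapping.keys (g i)"
        then have "m \<in> monomials r n (\<lambda>j. \<nu> j - idegree d i j)" using g(2) i by (auto simp: graded_part_def)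
        then show "Poly_Mapping.single m 1 * f i \<in> ?S" using i by blast
      qed
      finally show ?thesis .
    qed
    then show "x \<in> mpol.span ?S" unfolding g(1) by (intro mpol.span_sum) simp
  qed
qed

end

lemma prod_indet_power:
  "(\<Prod>i\<in>S. indet (v i) ^ k i) = (Poly_Mapping.single (\<Sum>i\<in>S. Poly_Mapping.single (v i) (k i)) 1 :: 'a::comm_ring_1 mpol)"
proof -
  have "indet w ^ l = (Poly_Mapping.single (Poly_Mapping.single w l) 1 :: 'a mpol)" for w l
    by (induction l) (simp_all add: indet_def mult_single single_add[symmetric] flip: single_one)
  then show ?thesis
    by (induction S rule: infinite_finite_induct) (simp_all add: mult_single)
qed

lemma map_sylvester_form:
  fixes h :: "'a::comm_ring_1 \<Rightarrow> 'b::comm_ring_1"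
  assumes "comm_ring_hom h"
  shows "Poly_Mapping.map h (sylvester_form r n \<alpha> G) =
    Poly_Mapping.single (\<Sum>j\<in>{1..<r}. Poly_Mapping.single (j, n j)
      ((Poly_Mapping.lookup \<alpha> (j, n j) + 1) * (\<Sum>i\<in>{j<..r}. n i))) 1 *
    det (mat (Suc (sum_dims r n)) (Suc (sum_dims r n))
      (\<lambda>(i, c). Poly_Mapping.map h (G i (fst (cofactor_indices r n ! c)) (snd (cofactor_indices r n ! c)))))"
proof -
  interpret h: comm_ring_hom h by fact
  interpret H: comm_ring_hom "Poly_Mapping.map h :: 'a mpol \<Rightarrow> 'b mpol" by (rule comm_ring_hom_map[OF assms])
  have "map_mat (Poly_Mapping.map h) (sylvester_matrix r n G) =
      mat (Suc (sum_dims r n)) (Suc (sum_dims r n))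
        (\<lambda>(i, c). Poly_Mapping.map h (G i (fst (cofactor_indices r n ! c)) (snd (cofactor_indices r n ! c))))"
    by (rule eq_matI) (simp_all add: sylvester_matrix_def split_beta)
  then show ?thesis
    unfolding sylvester_form_def prod_indet_power H.hom_mult H.hom_det[symmetric] by (simp add: map_single)
qed

lemma extend_graded_iff: "extend_to_closure P \<in> graded_part r n \<nu> \<longleftrightarrow> P \<in> graded_part r n \<nu>"
proof -
  have "Poly_Mapping.keys (extend_to_closure P) = Poly_Mapping.keys P"
    by (auto simp: in_keys_iff lookup_extend)
  then show ?thesis by (simp add: graded_part_def)
qed

theorem proposition5p4:
  fixes r :: nat and n :: "nat \<Rightarrow> nat" and d :: "nat \<Rightarrow> nat \<Rightarrow> nat"
    and f :: "nat \<Rightarrow> 'k::field mpol" and \<kappa> :: nat and \<nu> :: "nat \<Rightarrow> int"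
    and G :: "expo \<Rightarrow> nat \<Rightarrow> nat \<Rightarrow> nat \<Rightarrow> coeff_poly mpol"
  assumes "r \<ge> 1"
    and "\<forall>j\<in>{1..r}. n j \<ge> 1"
    and "\<forall>i\<le>sum_dims r n. \<forall>j\<in>{1..r}. d i j \<ge> 1"
    and "\<forall>\<alpha>. Poly_Mapping.keys \<alpha> \<subseteq> indets r n \<and>
              (\<forall>j\<in>{1..r}. int (group_degree n \<alpha> j) < min_degree r n d j) \<longrightarrow>
            (\<forall>i\<le>sum_dims r n. sylvester_decomposition r n d \<alpha> i (G \<alpha> i))"
    and "\<forall>i\<le>sum_dims r n. f i \<in> graded_part r n (idegree d i)"
    and "defines_finite_subscheme_of_degree r n d (\<lambda>i. extend_to_closure (f i)) \<kappa>"
    and "\<forall>j\<in>{1..r}. \<nu> j \<ge> crit_degree r n d j - (min_degree r n d j - 1)"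
  shows "corank (map_mat (specialize f) (elimination_matrix r n d G \<nu>)) = \<kappa>"
proof -
  let ?f = "\<lambda>i. extend_to_closure (f i)"
  have fin: "finite (zero_points r n ?f)"
    and \<kappa>: "(\<Sum>p\<in>zero_points r n ?f. ring_length (subscheme_local_ring r n d ?f p)) = enat \<kappa>"
    using assms(6) unfolding defines_finite_subscheme_of_degree_def by blast+
  interpret multiprojective r n d ?f
  proof
    show "1 \<le> r" by (rule assms(1))
    show "1 \<le> n j" if "j \<in> {1..r}" for j using assms(2) that by blast
    show "1 \<le> d i j" if "i \<le> sum_dims r n" "j \<in> {1..r}" for i j using assms(3) that by blast
    show "?f i \<in> graded_part r n (idegree d i)" if "i \<le> sum_dims r n" for i
      using assms(5) that by (simp add: extend_graded_iff)
    show "finite (zero_points r n ?f)" by (rule fin)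
  qed
  define A where "A = monomials r n (\<lambda>j. crit_degree r n d j - \<nu> j)"
  have A: "monomials r n (\<lambda>j. - offset \<nu> j - int (n j) - 1) = A"
  proof -
    have "(\<lambda>j. - offset \<nu> j - int (n j) - 1) = (\<lambda>j. crit_degree r n d j - \<nu> j)"
      by (rule ext) (simp add: offset_def crit_degree_def lessThan_Suc_atMost del: sum.lessThan_Suc)
    then show ?thesis by (simp add: A_def)
  qed
  \<comment> \<open>By definition of \<delta>, \<open>offset \<nu> j\<close> equals \<nu> j -
    \<delta> j - n j - 1, so the assumed lower bound on \<nu> is exactly this inequality for the
    minimal degree.\<close>
  have range: "- int (n j) \<le> offset \<nu> j + idegree d i j" if "i \<le> N" "j \<in> {1..r}" for i j
  proof -
    have "min_degree r n d j \<le> idegree d i j" unfolding min_degree_def by (rule Min_le) (use that in auto)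
    moreover have "crit_degree r n d j - (min_degree r n d j - 1) \<le> \<nu> j" using assms(7) that(2) by blast
    ultimately show ?thesis
      by (simp add: offset_def crit_degree_def lessThan_Suc_atMost del: sum.lessThan_Suc)
  qed
  have dec: "sylvester_decomposition r n d \<alpha> i (G \<alpha> i)" if \<alpha>: "\<alpha> \<in> A" and i: "i \<le> N" for \<alpha> i
  proof -
    \<comment> \<open>The degree \<delta> - \<nu> of \<alpha> is at most the minimal degree minus 1,
      which is where the decompositions are assumed to exist.\<close>
    have "int (group_degree n \<alpha> j) < min_degree r n d j" if j: "j \<in> {1..r}" for j
    proof -
      have "int (group_degree n \<alpha> j) = crit_degree r n d j - \<nu> j" using \<alpha> j by (auto simp: A_def monomials_def)
      then show ?thesis using assms(7) j by force
    qed
    moreover have "Poly_Mapping.keys \<alpha> \<subseteq> indets r n" using \<alpha> by (simp add: A_def monomials_def)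
    ultimately show ?thesis using assms(4) i by blast
  qed
  \<comment> \<open>Specialization followed by the embedding into the closure. It carries the given
    generic decompositions to decompositions of the f_i over the closure, of the degrees found in
    the generic situation.\<close>
  define h where "h c = to_ac (specialize f c)" for c
  interpret sp: comm_ring_hom "specialize f" by (rule comm_ring_hom_specialize)
  interpret h: comm_ring_hom h
    by unfold_locales (simp_all add: h_def sp.hom_add sp.hom_mult)
  interpret H: comm_ring_hom "Poly_Mapping.map h :: coeff_poly mpol \<Rightarrow> 'k alg_closure mpol" by (rule comm_ring_hom_map) unfold_locales
  have ext: "extend_to_closure (Poly_Mapping.map (specialize f) P) = Poly_Mapping.map h P" for P
    unfolding extend_to_closure_def h_def by (rule map_map_compose) simp_all
  have generic: "Poly_Mapping.map h (generic_poly r n d i) = ?f i" if "i \<le> N" for i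
    unfolding ext[symmetric] using map_generic_poly[of f i r n d] assms(5) that by simp
  define F where "F \<alpha> c i = Poly_Mapping.map h (G \<alpha> i (fst (cofac ! c)) (snd (cofac ! c)))" for \<alpha> c i
  have F_graded: "F \<alpha> c i \<in> graded_part r n (\<lambda>j. idegree d i j - int (group_degree n (cofac_expo \<alpha> c) j))"
    if "\<alpha> \<in> A" "c \<le> N" "i \<le> N" for \<alpha> c i
    unfolding F_def
    by (rule graded_part_map[where h = h], rule h.hom_zero, rule generic_cofactor_graded[OF dec[OF that(1,3)] that(2)])
  have decomp: "?f i = (\<Sum>c\<le>N. Poly_Mapping.single (cofac_expo \<alpha> c) 1 * F \<alpha> c i)" if "\<alpha> \<in> A" "i \<le> N" for \<alpha> i
  proof -
    have "generic_poly r n d i = (\<Sum>c\<le>N. Poly_Mapping.single (cofac_expo \<alpha> c) 1 * G \<alpha> i (fst (cofac ! c)) (snd (cofac ! c)))"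
      using dec[OF that] unfolding sylvester_decomposition_def nested_sum_cofactors by blast
    then have "Poly_Mapping.map h (generic_poly r n d i) = (\<Sum>c\<le>N. Poly_Mapping.single (cofac_expo \<alpha> c) 1 * F \<alpha> c i)"
      by (simp only: H.hom_sum H.hom_mult map_single h.hom_zero h.hom_one F_def)
    then show ?thesis using generic[OF that(2)] by simp
  qed
  have sylv: "Poly_Mapping.map h (sylvester_form r n \<alpha> (G \<alpha>)) = sylvester_span \<nu> F \<alpha>" for \<alpha>
    unfolding map_sylvester_form[OF h.comm_ring_hom_axioms] sylvester_span_def later_dims_def F_def ..
  define cols where "cols = macaulay_columns r n d \<nu> @ sylvester_columns r n d G \<nu>"
  \<comment> \<open>If \<nu> exceeds \<delta> in some group, \<alpha> would need a negative degree
    there. The Macaulay matrix is then the hybrid one without Sylvester columns, and both cases are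
    treated as one.\<close>
  have "sylvester_columns r n d G \<nu> = []" if not_le: "\<not> (\<forall>j\<in>{1..r}. \<nu> j \<le> crit_degree r n d j)"
  proof -
    have "A = {}" using not_le unfolding A_def monomials_def by force
    then show ?thesis by (simp add: sylvester_columns_def monomial_list_def A_def)
  qed
  then have elim: "elimination_matrix r n d G \<nu> =
      mat_of_cols (length (monomial_list r n \<nu>)) (map (coordinates r n \<nu>) cols)"
    by (auto simp: elimination_matrix_def matrix_H_def matrix_M_def cols_def)
  define Ps where "Ps = map (Poly_Mapping.map (specialize f)) cols"
  let ?M = "\<Union>i\<in>{..<Suc N}. (\<lambda>m. Poly_Mapping.single m 1 * ?f i) ` monomials r n (\<lambda>j. \<nu> j - idegree d i j)"
  have "Poly_Mapping.map h ` set (macaulay_columns r n d \<nu>) = ?M"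
  proof -
    have col: "Poly_Mapping.map h (Poly_Mapping.single m 1 * generic_poly r n d i) = Poly_Mapping.single m 1 * ?f i"
      if "i < Suc N" for i m
      using generic[of i] that by (simp add: H.hom_mult map_single)
    show ?thesis
      unfolding macaulay_columns_def
      by (simp add: image_UN image_image set_monomial_list atLeast0LessThan del: upt_Suc)
        (intro SUP_cong image_cong refl col, simp)
  qed
  moreover have "Poly_Mapping.map h ` set (sylvester_columns r n d G \<nu>) = sylvester_span \<nu> F ` A"
    by (simp add: sylvester_columns_def set_monomial_list image_image sylv A_def)
  ultimately have img: "extend_to_closure ` set Ps = ?M \<union> sylvester_span \<nu> F ` A"
    by (simp only: Ps_def set_map image_image ext cols_def set_append image_Un)
  have M: "?M \<subseteq> ideal_part \<nu>" using mpol.span_superset[of ?M] unfolding span_macaulay .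
  note elimination = codim_elimination[of \<nu> F, unfolded A, OF range F_graded decomp]
  have "extend_to_closure ` set Ps \<subseteq> graded_part r n \<nu>" unfolding img using elimination(1) M by blast
  then have Ps: "set Ps \<subseteq> graded_part r n \<nu>" using extend_graded_iff by blast
  have "corank (map_mat (specialize f) (elimination_matrix r n d G \<nu>)) = mpol.codim (graded_part r n \<nu>) (mpol.span (set Ps))"
    unfolding elim map_mat_mat_of_cols_coordinates[where h = "specialize f", OF sp.hom_zero] Ps_def[symmetric] by (rule corank_coordinates[OF Ps])
  also have "\<dots> = mpol.codim (graded_part r n \<nu>) (mpol.span (extend_to_closure ` set Ps))"
    by (rule codim_extend[OF Ps, symmetric])
  also have "mpol.span (extend_to_closure ` set Ps) = mpol.span (ideal_part \<nu> \<union> sylvester_span \<nu> F ` A)"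
    unfolding img span_macaulay[symmetric] mpol.span_Un mpol.span_span ..
  finally show ?thesis using elimination(2) \<kappa> by simp
qed

end
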